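(* Let $k$ be a perfect field of characteristic different from $3$, let $K$ be a function field over $k$, let $K'$ be a quadratic extension of $K$ whose function field is of genus zero, and let $T$ be a set of places of $K$. Then there exists a cubic extension $L$ of $K$ such that $K'$ is the purely cubic closure of $L/K$ and such that $L/K$ is fully (i.e. triply) ramified at exactly the places in $T$ if and only if every place in $T$ splits in the quadratic extension $K'/K$.
   Context: A cubic extension of $K$ is a separable field extension $L/K$ of degree three that is geometric, i.e. not of the form $K\ell$ with $\ell$ a degree-three extension of $k$. A cubic extension $L/K$ is purely cubic if it admits a generator whose minimal polynomial over $K$ is of the form $X^3-\beta$. The purely cubic closure of a cubic extension $L/K$ is the smallest extension $K'$ of $K$ such that $LK'/K'$ is purely cubic (it exists, is unique, and $[K':K]\le 2$).
   Formalization: The set T of places is required to be finite and nonempty: for T empty, or T infinite with all places split, every place in T splits but no such cubic extension L exists, so the statement as worded fails. *)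

theory Defs
  imports "HOL-Algebra.Algebra"
begin

text \<open>
  Every field in sight is a subfield of one ambient field \<open>R\<close>, later an algebraic closure of the
  base function field; composites are then subfields generated by unions, and "extension field"
  means larger subfield of \<open>R\<close>. In the definitions, \<open>k\<close> is always the base field and \<open>F\<close> a
  function field over \<open>k\<close>.
\<close>

text \<open>As for the type class constant \<open>CHAR\<close>: characteristic zero is \<open>Gcd {0} = 0\<close>.\<close>

definition characteristic :: "('a, 'b) ring_scheme \<Rightarrow> nat" where
  "characteristic R = Gcd {n::nat. [n] \<cdot>\<^bsub>R\<^esub> \<one>\<^bsub>R\<^esub> = \<zero>\<^bsub>R\<^esub>}"

definition perfect_field :: "('a, 'b) ring_scheme \<Rightarrow> bool" where
  "perfect_field R \<longleftrightarrow> field R \<and>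
     (characteristic R = 0 \<or>
      (\<forall>x \<in> carrier R. \<exists>y \<in> carrier R. y [^]\<^bsub>R\<^esub> characteristic R = x))"

context ring
begin

subsection \<open>Field extensions\<close>

definition field_extension :: "'a set \<Rightarrow> 'a set \<Rightarrow> bool" where
  "field_extension K L \<longleftrightarrow> subfield K R \<and> subfield L R \<and> K \<subseteq> L"

definition composite :: "'a set \<Rightarrow> 'a set \<Rightarrow> 'a set" where
  "composite L F = generate_field R (L \<union> F)"

text \<open>Multiplicities of roots are taken in \<open>R\<close>, so this is separability only when \<open>R\<close> is
  algebraically closed (or at least contains a normal closure of \<open>L\<close>).\<close>

definition separable_extension :: "'a set \<Rightarrow> 'a set \<Rightarrow> bool" where
  "separable_extension K L \<longleftrightarrow> field_extension K L \<and>
     (\<forall>x \<in> L. (algebraic over K) x \<and> (\<forall>a \<in> carrier R. alg_mult (Irr K x) a \<le> 1))"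

definition function_field :: "'a set \<Rightarrow> 'a set \<Rightarrow> bool" where
  "function_field k F \<longleftrightarrow> field_extension k F \<and>
     (\<exists>x \<in> F. (transcendental over k) x \<and>
              finite_dimension (generate_field R (insert x k)) F)"

definition constant_field :: "'a set \<Rightarrow> 'a set \<Rightarrow> 'a set" where
  "constant_field k F = {x \<in> F. (algebraic over k) x}"


subsection \<open>Cubic extensions\<close>

definition cubic_extension :: "'a set \<Rightarrow> 'a set \<Rightarrow> 'a set \<Rightarrow> bool" where
  "cubic_extension k K L \<longleftrightarrow> separable_extension K L \<and> dimension 3 K L \<and>
     (\<nexists>l. field_extension k l \<and> dimension 3 k l \<and> L = composite K l)"

text \<open>Polynomials are coefficient lists, leading coefficient first, so the list below is
  \<open>X\<^sup>3 - \<beta>\<close>.\<close>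

definition purely_cubic :: "'a set \<Rightarrow> 'a set \<Rightarrow> 'a set \<Rightarrow> bool" where
  "purely_cubic k K L \<longleftrightarrow> cubic_extension k K L \<and>
     (\<exists>y \<in> L. \<exists>\<beta> \<in> K. L = generate_field R (insert y K) \<and> Irr K y = [\<one>, \<zero>, \<zero>, \<ominus> \<beta>])"

text \<open>Whether \<open>LF/F\<close> is geometric refers to the constants of \<open>F\<close>, which may be more than \<open>k\<close>.\<close>

definition makes_purely_cubic :: "'a set \<Rightarrow> 'a set \<Rightarrow> 'a set \<Rightarrow> 'a set \<Rightarrow> bool" where
  "makes_purely_cubic k K L F \<longleftrightarrow> field_extension K F \<and>
     purely_cubic (constant_field k F) F (composite L F)"

definition purely_cubic_closure :: "'a set \<Rightarrow> 'a set \<Rightarrow> 'a set \<Rightarrow> 'a set \<Rightarrow> bool" where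
  "purely_cubic_closure k K L K' \<longleftrightarrow> makes_purely_cubic k K L K' \<and>
     (\<forall>F. makes_purely_cubic k K L F \<longrightarrow> K' \<subseteq> F)"


subsection \<open>Places and ramification\<close>

definition valuation_ring :: "'a set \<Rightarrow> 'a set \<Rightarrow> 'a set \<Rightarrow> bool" where
  "valuation_ring k F V \<longleftrightarrow> subring V R \<and> k \<subset> V \<and> V \<subset> F \<and> (\<forall>x \<in> F - {\<zero>}. x \<in> V \<or> inv x \<in> V)"

text \<open>A place is the maximal ideal of a valuation ring; the ring is recovered by
  \<open>place_ring\<close>.\<close>

definition places :: "'a set \<Rightarrow> 'a set \<Rightarrow> 'a set set" where
  "places k F = {V - Units (R\<lparr>carrier := V\<rparr>) | V. valuation_ring k F V}"

definition place_ring :: "'a set \<Rightarrow> 'a set \<Rightarrow> 'a set" where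
  "place_ring F P = {x \<in> F. x \<noteq> \<zero> \<longrightarrow> inv x \<notin> P}"

definition uniformizer :: "'a set \<Rightarrow> 'a set \<Rightarrow> 'a \<Rightarrow> bool" where
  "uniformizer F P t \<longleftrightarrow> t \<in> P \<and> P = {t \<otimes> z | z. z \<in> place_ring F P}"

text \<open>Only meaningful for \<open>x \<noteq> \<zero>\<close>.\<close>

definition place_val :: "'a set \<Rightarrow> 'a set \<Rightarrow> 'a \<Rightarrow> int" where
  "place_val F P x = (THE n. \<exists>t u. uniformizer F P t \<and>
     u \<in> Units (R\<lparr>carrier := place_ring F P\<rparr>) \<and> x = t [^] n \<otimes> u)"

definition places_over :: "'a set \<Rightarrow> 'a set \<Rightarrow> 'a set \<Rightarrow> 'a set set" where
  "places_over k L P = {Q \<in> places k L. P \<subseteq> Q}"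

definition ramification_index :: "'a set \<Rightarrow> 'a set \<Rightarrow> 'a set \<Rightarrow> 'a set \<Rightarrow> nat" where
  "ramification_index K L P Q =
     (THE e. \<forall>x \<in> K - {\<zero>}. place_val L Q x = int e * place_val K P x)"

definition fully_ramified :: "'a set \<Rightarrow> 'a set \<Rightarrow> 'a set \<Rightarrow> 'a set \<Rightarrow> bool" where
  "fully_ramified k K L P \<longleftrightarrow>
     (\<exists>Q \<in> places_over k L P. ramification_index K L P Q = (dim over K) L)"

definition splits :: "'a set \<Rightarrow> 'a set \<Rightarrow> 'a set \<Rightarrow> 'a set \<Rightarrow> bool" where
  "splits k K L P \<longleftrightarrow> card (places_over k L P) = (dim over K) L"


subsection \<open>Divisors and the genus\<close>

text \<open>Degrees and dimensions are over the full constant field of \<open>F\<close>, not over \<open>k\<close>.\<close>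

definition place_degree :: "'a set \<Rightarrow> 'a set \<Rightarrow> 'a set \<Rightarrow> nat" where
  "place_degree k F P =
     (let V = R\<lparr>carrier := place_ring F P\<rparr>
      in (ring.dim (V Quot P) over ((\<lambda>c. P +>\<^bsub>V\<^esub> c) ` constant_field k F)) (carrier (V Quot P)))"

definition divisors :: "'a set \<Rightarrow> 'a set \<Rightarrow> ('a set \<Rightarrow> int) set" where
  "divisors k F = {A. finite {P. A P \<noteq> 0} \<and> {P. A P \<noteq> 0} \<subseteq> places k F}"

definition divisor_degree :: "'a set \<Rightarrow> 'a set \<Rightarrow> ('a set \<Rightarrow> int) \<Rightarrow> int" where
  "divisor_degree k F A = (\<Sum>P | A P \<noteq> 0. A P * int (place_degree k F P))"

definition riemann_roch_space :: "'a set \<Rightarrow> 'a set \<Rightarrow> ('a set \<Rightarrow> int) \<Rightarrow> 'a set" where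
  "riemann_roch_space k F A =
     {x \<in> F. x \<noteq> \<zero> \<longrightarrow> (\<forall>P \<in> places k F. place_val F P x \<ge> - A P)}"

definition divisor_dim :: "'a set \<Rightarrow> 'a set \<Rightarrow> ('a set \<Rightarrow> int) \<Rightarrow> nat" where
  "divisor_dim k F A = (dim over (constant_field k F)) (riemann_roch_space k F A)"

text \<open>The genus is the maximum of \<open>deg A - \<ell>(A) + 1\<close> over all divisors \<open>A\<close>.\<close>

definition has_genus :: "'a set \<Rightarrow> 'a set \<Rightarrow> int \<Rightarrow> bool" where
  "has_genus k F g \<longleftrightarrow>
     (\<exists>A \<in> divisors k F. divisor_degree k F A - int (divisor_dim k F A) + 1 = g) \<and>
     (\<forall>A \<in> divisors k F. divisor_degree k F A - int (divisor_dim k F A) + 1 \<le> g)"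

end

end

theory Submission
  imports Defs "HOL-Decision_Procs.Algebra_Aux"
begin

text \<open>
Let \<open>\<sigma>\<close> be the conjugation of \<open>K'/K\<close>. If \<open>r \<in> K'\<close> has norm 1 and is not a cube, and \<open>u\<^sup>3 = r\<close>, then
\<open>u + 1/u\<close> generates a cubic extension \<open>L/K\<close> with \<open>L K' = K'(u)\<close>, and \<open>L/K\<close> is fully ramified exactly below
the places of \<open>K'\<close> at which the value of \<open>r\<close> is prime to 3.

Conversely, if \<open>K'\<close> is the purely cubic closure of \<open>L/K\<close>, then \<open>L K' = K'(w)\<close> with \<open>w\<^sup>3 = \<beta>\<close>, and extending
\<open>\<sigma>\<close> to \<open>L K'\<close> with \<open>L\<close> fixed shows \<open>\<sigma> \<beta> \<in> \<beta>\<^sup>\<plusminus>\<^sup>1 K'\<^sup>*\<^sup>3\<close>. The sign is \<open>-1\<close>, since otherwise \<open>L/K\<close> would be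
purely cubic already. A place of \<open>K'\<close> fixed by \<open>\<sigma>\<close> therefore has \<open>3 | v(\<beta>)\<close>, so it is not fully ramified.

If the places in \<open>T\<close> split, choose one place \<open>Q\<close> above each. In genus zero a degree-zero divisor is
principal, so \<open>\<Sum> (Q - \<sigma> Q)\<close> is the divisor of some \<open>f\<close>, and \<open>r = f / \<sigma> f\<close> has norm 1 and value \<open>\<plusminus>2\<close> at the
chosen places and their conjugates, and value 0 elsewhere.
\<close>

text \<open>No roots of unity and no Galois theory of \<open>L K'\<close> are used. If
  \<open>w\<close> is a cube root of a non-cube and 3 is nonzero, then an element of the field
  generated by \<open>w\<close> whose cube lies below is a base element times 1, \<open>w\<close> or
  \<open>w^2\<close>; this gives the dichotomy for the conjugate of \<beta> and also the minimality
  of \<open>K'\<close>. Conjugation extends to \<open>L K'\<close> at no cost, because one generator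
  \<open>c\<close> with one quadratic equation serves over every larger base field not containing
  it. In characteristic 2 the extension \<open>K'/K\<close> may be inseparable with trivial
  conjugation; the converse has to exclude this separately. Principality needs no degree formula for
  principal divisors: genus zero yields a function with poles bounded by a divisor opposite to its
  conjugate, its norm then has no poles, hence is constant, and every bound is attained. Cubic
  includes geometric, also over the constants of \<open>K'\<close>; this is read off from a fully
  ramified place, since a constant extension of degree three is unramified. Passing from
  \<open>f\<close> to \<open>r\<close> doubles the values, which is harmless because 2 is prime to
  3.\<close>

context field
begin

subsection \<open>Normalising fractions in fields\<close>

text \<open>The rules pull subtractions outward and finally transpose them to the other side of an
  equation. An identity of ring expressions thereby becomes an equation between sums of products,
  which the distributive and AC rules of \<open>ring_norm\<close> decide.\<close>

lemma move_minus:
  assumes "x \<in> carrier R" "y \<in> carrier R" "z \<in> carrier R"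
  shows "x \<oplus> (y \<ominus> z) = (x \<oplus> y) \<ominus> z" "(x \<ominus> y) \<oplus> z = (x \<oplus> z) \<ominus> y"
    "(x \<ominus> y) \<ominus> z = x \<ominus> (y \<oplus> z)" "x \<ominus> (y \<ominus> z) = (x \<oplus> z) \<ominus> y"
    "x \<oplus> \<ominus> y = x \<ominus> y" "\<ominus> x \<oplus> y = y \<ominus> x" "x \<ominus> \<ominus> y = x \<oplus> y"
    "\<ominus> x \<ominus> y = \<ominus> (x \<oplus> y)" "\<ominus> (x \<ominus> y) = y \<ominus> x"
    "(x \<ominus> y) \<otimes> z = (x \<otimes> z) \<ominus> (y \<otimes> z)" "z \<otimes> (x \<ominus> y) = (z \<otimes> x) \<ominus> (z \<otimes> y)"
    "\<ominus> x \<otimes> y = \<ominus> (x \<otimes> y)" "x \<otimes> \<ominus> y = \<ominus> (x \<otimes> y)"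
    "(x \<ominus> y = z) = (x = z \<oplus> y)" "(z = x \<ominus> y) = (z \<oplus> y = x)"
    "(\<ominus> x = z) = (\<zero> = z \<oplus> x)" "(z = \<ominus> x) = (z \<oplus> x = \<zero>)"
    "\<zero> \<ominus> x = \<ominus> x" "x \<ominus> \<zero> = x" "x \<ominus> x = \<zero>"
proof -
  show e: "(x \<ominus> y = z) = (x = z \<oplus> y)"
    using assms by (metis a_minus_def a_assoc a_inv_closed minus_closed l_neg r_neg r_zero)
  then show "(z = x \<ominus> y) = (z \<oplus> y = x)" by auto
  show "(\<ominus> x = z) = (\<zero> = z \<oplus> x)" "(z = \<ominus> x) = (z \<oplus> x = \<zero>)"
    using assms by (metis minus_equality l_neg)+
qed (use assms in \<open>simp_all add: a_minus_def minus_add a_ac l_distr r_distr l_minus r_minus r_neg\<close>)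

lemma integer_numerals: "\<guillemotleft>2\<guillemotright> = \<one> \<oplus> \<one>" "\<guillemotleft>3\<guillemotright> = \<one> \<oplus> (\<one> \<oplus> \<one>)"
  "\<guillemotleft>6\<guillemotright> = \<one> \<oplus> (\<one> \<oplus> (\<one> \<oplus> (\<one> \<oplus> (\<one> \<oplus> \<one>))))"
  by (simp_all add: of_integer_def eval_nat_numeral a_assoc)

lemma nat_pow_numerals:
  assumes "x \<in> carrier R"
  shows "x [^] (2::nat) = x \<otimes> x" "x [^] (3::nat) = x \<otimes> (x \<otimes> x)"
  using assms by (simp_all add: eval_nat_numeral m_assoc)

lemmas ring_norm = move_minus l_distr r_distr a_ac m_ac integer_numerals
  nat_pow_numerals

text \<open>Fractions are moved to the outside of an expression and then multiplied across the
  equation. Each rule demands a nonzero denominator, which is why later proofs often name a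
  denominator by a local constant known to be nonzero before they normalise.\<close>

lemma move_denominator:
  assumes "x \<in> carrier R" "y \<in> carrier R" "y \<noteq> \<zero>" "z \<in> carrier R"
  shows "(x \<oslash> y) \<otimes> z = (x \<otimes> z) \<oslash> y" "z \<otimes> (x \<oslash> y) = (z \<otimes> x) \<oslash> y"
    "(x \<oslash> y) \<oplus> z = (x \<oplus> z \<otimes> y) \<oslash> y" "z \<oplus> (x \<oslash> y) = (z \<otimes> y \<oplus> x) \<oslash> y"
    "(x \<oslash> y) \<ominus> z = (x \<ominus> z \<otimes> y) \<oslash> y" "z \<ominus> (x \<oslash> y) = (z \<otimes> y \<ominus> x) \<oslash> y"
    "\<ominus> (x \<oslash> y) = (\<ominus> x) \<oslash> y" "inv y = \<one> \<oslash> y"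
    "(x \<oslash> y = z) = (x = z \<otimes> y)" "(z = x \<oslash> y) = (z \<otimes> y = x)"
proof -
  have i: "inv y \<in> carrier R" "y \<otimes> inv y = \<one>" "inv y \<otimes> y = \<one>"
    using assms field_Units by auto
  have c: "z \<otimes> y \<otimes> inv y = z" "x \<otimes> inv y \<otimes> y = x"
    using assms i by (simp_all add: m_assoc)
  show e: "(x \<oslash> y = z) = (x = z \<otimes> y)"
    using c assms(3) by (auto simp: m_div_def)
  then show "(z = x \<oslash> y) = (z \<otimes> y = x)" by auto
  show "(x \<oslash> y) \<otimes> z = (x \<otimes> z) \<oslash> y" "z \<otimes> (x \<oslash> y) = (z \<otimes> x) \<oslash> y"
    "\<ominus> (x \<oslash> y) = (\<ominus> x) \<oslash> y" "inv y = \<one> \<oslash> y"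
    using assms i(1) by (simp_all add: m_div_def m_ac l_minus r_minus)
  show "(x \<oslash> y) \<oplus> z = (x \<oplus> z \<otimes> y) \<oslash> y" "z \<oplus> (x \<oslash> y) = (z \<otimes> y \<oplus> x) \<oslash> y"
    "(x \<oslash> y) \<ominus> z = (x \<ominus> z \<otimes> y) \<oslash> y" "z \<ominus> (x \<oslash> y) = (z \<otimes> y \<ominus> x) \<oslash> y"
    using assms i(1) c(1) by (simp_all add: m_div_def l_distr a_minus_def l_minus)
qed

lemma divide_divide:
  assumes "x \<in> carrier R" "y \<in> carrier R" "y \<noteq> \<zero>" "z \<in> carrier R" "z \<noteq> \<zero>"
  shows "(x \<oslash> y) \<oslash> z = x \<oslash> (y \<otimes> z)" "x \<oslash> (y \<oslash> z) = (x \<otimes> z) \<oslash> y"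
  using assms field_Units integral_iff[of y z] integral_iff[of y "inv z"] nonzero_imp_inverse_nonzero[of z]
  by (simp_all add: m_div_def nonzero_inverse_mult_distrib nonzero_inverse_inverse_eq m_ac)

lemmas field_norm = move_denominator divide_divide integral_iff ring_norm

subsection \<open>Subfields and small extensions\<close>

lemma subfield_closed:
  assumes "subfield F R"
  shows "\<zero> \<in> F" "\<one> \<in> F"
    "\<And>x y. x \<in> F \<Longrightarrow> y \<in> F \<Longrightarrow> x \<oplus> y \<in> F"
    "\<And>x y. x \<in> F \<Longrightarrow> y \<in> F \<Longrightarrow> x \<otimes> y \<in> F"
    "\<And>x y. x \<in> F \<Longrightarrow> y \<in> F \<Longrightarrow> x \<ominus> y \<in> F"
    "\<And>x. x \<in> F \<Longrightarrow> \<ominus> x \<in> F"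
    "\<And>x y. x \<in> F \<Longrightarrow> y \<in> F \<Longrightarrow> x \<oslash> y \<in> F"
    "\<And>x. x \<in> F \<Longrightarrow> x \<noteq> \<zero> \<Longrightarrow> inv x \<in> F"
    "\<And>x n. x \<in> F \<Longrightarrow> x [^] (n::nat) \<in> F"
    "\<And>x. x \<in> F \<Longrightarrow> x \<in> carrier R"
proof -
  note sr = subringE[OF subfieldE(1)[OF assms]]
  show "\<zero> \<in> F" "\<one> \<in> F" "\<And>x y. x \<in> F \<Longrightarrow> y \<in> F \<Longrightarrow> x \<oplus> y \<in> F"
    "\<And>x y. x \<in> F \<Longrightarrow> y \<in> F \<Longrightarrow> x \<otimes> y \<in> F" "\<And>x. x \<in> F \<Longrightarrow> \<ominus> x \<in> F"
    using sr(2,3,5-7) by blast+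
  show "\<And>x y. x \<in> F \<Longrightarrow> y \<in> F \<Longrightarrow> x \<ominus> y \<in> F"
    using sr by (auto simp: a_minus_def)
  show i: "inv x \<in> F" if "x \<in> F" "x \<noteq> \<zero>" for x
    using subfield_m_inv(1)[OF assms, of x] that by auto
  show "\<And>x y. x \<in> F \<Longrightarrow> y \<in> F \<Longrightarrow> x \<oslash> y \<in> F"
    using sr i by (auto simp: m_div_def)
  show "x [^] (n::nat) \<in> F" if "x \<in> F" for x n
    using that by (induction n) (use sr in auto)
  show "\<And>x. x \<in> F \<Longrightarrow> x \<in> carrier R"
    using sr(1) by blast
qed

lemma subfieldI_closed:
  assumes "F \<subseteq> carrier R" "\<one> \<in> F" "\<And>x y. x \<in> F \<Longrightarrow> y \<in> F \<Longrightarrow> x \<ominus> y \<in> F"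
    "\<And>x y. x \<in> F \<Longrightarrow> y \<in> F \<Longrightarrow> x \<otimes> y \<in> F" "\<And>x. x \<in> F \<Longrightarrow> x \<noteq> \<zero> \<Longrightarrow> inv x \<in> F"
  shows "subfield F R"
proof -
  have z: "\<zero> \<in> F"
    using assms(3)[OF assms(2) assms(2)] by (simp add: r_neg a_minus_def)
  have n: "\<ominus> x \<in> F" if "x \<in> F" for x
    using assms(3)[OF z that] assms(1) that by (auto simp: subset_eq)
  have a: "x \<oplus> y \<in> F" if "x \<in> F" "y \<in> F" for x y
    using assms(3)[OF that(1) n[OF that(2)]] assms(1) that by (auto simp: a_minus_def subset_eq)
  have "subring F R"
    by (rule subringI) (use assms n a in auto)
  then show ?thesis
    by (rule subfieldI') (use assms in auto)
qed

text \<open>The intermediate field is a \<open>K\<close>-subspace of \<open>L\<close>, hence finite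
  over \<open>K\<close>, and a \<open>K\<close>-basis of \<open>L\<close> spans \<open>L\<close>
  over \<open>M\<close>. The tower law then compares the dimensions.\<close>

lemma dimension_over_intermediate:
  assumes "subfield K R" "subfield M R" "subfield L R" "K \<subseteq> M" "M \<subseteq> L" "dimension n K L"
  obtains i j where "dimension i K M" "dimension j M L" "i * j = n"
proof -
  have "subalgebra K M R"
    using assms subfield_closed[OF assms(2)]
    by (intro subalgebra.intro subgroup.intro subalgebra_axioms.intro)
      (auto simp: subset_eq simp flip: a_inv_def)
  then have "finite_dimension K M"
    using subalbegra_incl_imp_finite_dimension[OF assms(1) finite_dimensionI[OF assms(6)]] assms(5)
    by blast
  then obtain i where i: "dimension i K M"
    by (auto elim: finite_dimensionE')
  obtain Us where Us: "set Us \<subseteq> carrier R" "Span K Us = L"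
    using exists_base[OF assms(1,6)] by blast
  have "Span M Us = L"
  proof
    have "subalgebra M L R"
      using assms subfield_closed[OF assms(3)]
      by (intro subalgebra.intro subgroup.intro subalgebra_axioms.intro)
        (auto simp: subset_eq simp flip: a_inv_def)
    moreover have "set Us \<subseteq> L"
      using Span_base_incl[OF assms(1) Us(1)] Us(2) by simp
    ultimately show "Span M Us \<subseteq> L"
      using subalgebra_Span_incl[OF assms(2)] by blast
    have "subalgebra K (Span M Us) R"
      using Span_is_subalgebra[OF assms(2) Us(1)] assms(4)
      by (auto simp: subalgebra_def subalgebra_axioms_def)
    then show "L \<subseteq> Span M Us"
      using subalgebra_Span_incl[OF assms(1) _ Span_base_incl[OF assms(2) Us(1)]] Us(2) by blast
  qed
  then have "finite_dimension M L"
    using Span_finite_dimension[OF assms(2) Us(1)] by simp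
  then obtain j where j: "dimension j M L"
    by (auto elim: finite_dimensionE')
  have "i * j = n"
    using dimension_is_inj[OF assms(1) telescopic_base[OF assms(1,2) i j] assms(6)] .
  with i j that show thesis by blast
qed

lemma dimension_one_imp_eq:
  assumes "subfield K R" "subfield M R" "K \<subseteq> M" "dimension 1 K M"
  shows "M = K"
proof -
  have "independent K [\<one>]"
    by (rule li_Cons) auto
  then have "Span K [\<one>] = M" "Span K [\<one>] = K"
    using independent_length_eq_dimension[OF assms(1,4), of "[\<one>]"]
      independent_length_eq_dimension[OF assms(1) dimension_one[OF assms(1)], of "[\<one>]"]
      subfield_closed[OF assms(1)] assms(3) by auto
  then show ?thesis by simp
qed

lemma prime_dimension_intermediate:
  assumes "subfield K R" "subfield M R" "subfield L R" "K \<subseteq> M" "M \<subseteq> L"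
    and "dimension n K L" "Factorial_Ring.prime n"
  shows "M = K \<or> M = L"
proof -
  obtain i j where ij: "dimension i K M" "dimension j M L" "i * j = n"
    using dimension_over_intermediate[OF assms(1-6)] .
  then have "i = 1 \<or> j = 1"
    using assms(7) prime_product by metis
  then show ?thesis
    using dimension_one_imp_eq[OF assms(1,2,4)] dimension_one_imp_eq[OF assms(2,3,5)] ij by auto
qed

text \<open>Linear independence of 1, \<open>y\<close>, \<open>y^2\<close>, spelled out in
  coefficients instead of through \<open>independent\<close>. In this form it passes to smaller
  fields at once, and a relation can be used by reading off a single coefficient.\<close>

definition indep3 :: "'a set \<Rightarrow> 'a \<Rightarrow> bool" where
  "indep3 K y \<longleftrightarrow> (\<forall>a\<in>K. \<forall>b\<in>K. \<forall>c\<in>K. a \<oplus> b \<otimes> y \<oplus> c \<otimes> (y \<otimes> y) = \<zero> \<longrightarrow> a = \<zero> \<and> b = \<zero> \<and> c = \<zero>)"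

lemma indep3D:
  assumes "indep3 K y" "a \<in> K" "b \<in> K" "c \<in> K" "a \<oplus> b \<otimes> y \<oplus> c \<otimes> (y \<otimes> y) = \<zero>"
  shows "a = \<zero>" "b = \<zero>" "c = \<zero>"
  using assms unfolding indep3_def by blast+

lemma indep3_mono: "indep3 M y \<Longrightarrow> K \<subseteq> M \<Longrightarrow> indep3 K y"
  unfolding indep3_def by blast

lemma exp_base_3: "y \<in> carrier R \<Longrightarrow> exp_base y 3 = [y \<otimes> y, y, \<one>]"
  by (simp add: exp_base_def numeral_3_eq_3)

lemma Span_exp_base_3:
  assumes "subfield K R" "y \<in> carrier R"
  shows "Span K (exp_base y 3) = {a \<oplus> b \<otimes> y \<oplus> c \<otimes> (y \<otimes> y) | a b c. a \<in> K \<and> b \<in> K \<and> c \<in> K}"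
    (is "?A = ?B")
proof -
  have l3: "length Ks = 3 \<Longrightarrow> \<exists>c b a. Ks = [c, b, a]" for Ks :: "'a list"
    by (auto simp: numeral_3_eq_3 length_Suc_conv)
  have "c \<otimes> (y \<otimes> y) \<oplus> (b \<otimes> y \<oplus> (a \<otimes> \<one> \<oplus> \<zero>)) = a \<oplus> b \<otimes> y \<oplus> c \<otimes> (y \<otimes> y)"
    if "a \<in> K" "b \<in> K" "c \<in> K" for a b c
  proof -
    have "a \<in> carrier R" "b \<in> carrier R" "c \<in> carrier R"
      using that subfield_closed(10)[OF assms(1)] by auto
    with assms(2) show ?thesis by (simp add: ring_norm)
  qed
  note eq = this
  have s: "set [y \<otimes> y, y, \<one>] \<subseteq> carrier R"
    using assms(2) by auto
  show ?thesis
  proof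
    show "?A \<subseteq> ?B"
    proof
      fix x assume "x \<in> ?A"
      then obtain Ks where Ks: "set Ks \<subseteq> K" "length Ks = 3" "x = combine Ks [y \<otimes> y, y, \<one>]"
        using Span_mem_iff_length_version[OF assms(1) s] exp_base_3[OF assms(2)] by auto
      then obtain c b a where k: "Ks = [c, b, a]" using l3 by blast
      with Ks have "x = c \<otimes> (y \<otimes> y) \<oplus> (b \<otimes> y \<oplus> (a \<otimes> \<one> \<oplus> \<zero>))" "a \<in> K" "b \<in> K" "c \<in> K"
        by auto
      with eq show "x \<in> ?B" by blast
    qed
    show "?B \<subseteq> ?A"
    proof
      fix x assume "x \<in> ?B"
      then obtain a b c where x: "x = a \<oplus> b \<otimes> y \<oplus> c \<otimes> (y \<otimes> y)" and abc: "a \<in> K" "b \<in> K" "c \<in> K"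
        by blast
      then have "x = combine [c, b, a] [y \<otimes> y, y, \<one>]"
        using eq[OF abc] by simp
      then show "x \<in> ?A"
        unfolding exp_base_3[OF assms(2)] Span_mem_iff_length_version[OF assms(1) s]
        using abc by (intro exI[of _ "[c, b, a]"]) simp
    qed
  qed
qed

lemma independent_exp_base_3_iff:
  assumes "subfield K R" "y \<in> carrier R"
  shows "independent K (exp_base y 3) \<longleftrightarrow> indep3 K y"
proof
  have eq: "c \<otimes> (y \<otimes> y) \<oplus> (b \<otimes> y \<oplus> (a \<otimes> \<one> \<oplus> \<zero>)) = a \<oplus> b \<otimes> y \<oplus> c \<otimes> (y \<otimes> y)"
    if "a \<in> K" "b \<in> K" "c \<in> K" for a b c
  proof -
    have "a \<in> carrier R" "b \<in> carrier R" "c \<in> carrier R"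
      using that subfield_closed(10)[OF assms(1)] by auto
    with assms(2) show ?thesis by (simp add: ring_norm)
  qed
  assume i: "independent K (exp_base y 3)"
  show "indep3 K y"
    unfolding indep3_def
  proof (intro ballI impI)
    fix a b c assume k: "a \<in> K" "b \<in> K" "c \<in> K" "a \<oplus> b \<otimes> y \<oplus> c \<otimes> (y \<otimes> y) = \<zero>"
    then have "combine [c, b, a] [y \<otimes> y, y, \<one>] = \<zero>"
      using eq[of a b c] by simp
    then have "set (take 3 [c, b, a]) \<subseteq> {\<zero>}"
      using independent_imp_trivial_combine[OF assms(1) i, of "[c, b, a]"] k(1-3)
      unfolding exp_base_3[OF assms(2)] by auto
    then show "a = \<zero> \<and> b = \<zero> \<and> c = \<zero>" by simp
  qed
next
  assume i: "indep3 K y"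
  have "\<one> \<noteq> \<zero>" by simp
  note cl = subfield_closed[OF assms(1)]
  have 1: "independent K [\<one>]"
    by (rule li_Cons) auto
  have 2: "y \<notin> Span K [\<one>]"
  proof
    assume "y \<in> Span K [\<one>]"
    then obtain Ks where Ks: "set Ks \<subseteq> K" "length Ks = 1" "y = combine Ks [\<one>]"
      using Span_mem_iff_length_version[OF assms(1), of "[\<one>]"] by auto
    then obtain a where "Ks = [a]" by (auto simp: length_Suc_conv)
    with Ks have a: "a \<in> K" "y = a" using cl by auto
    then have "\<ominus> a \<oplus> \<one> \<otimes> y \<oplus> \<zero> \<otimes> (y \<otimes> y) = \<zero>" using assms(2) by (simp add: l_neg)
    from indep3D(2)[OF i _ _ _ this] a cl show False by simp
  qed
  have 3: "y \<otimes> y \<notin> Span K [y, \<one>]"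
  proof
    assume "y \<otimes> y \<in> Span K [y, \<one>]"
    then obtain Ks where Ks: "set Ks \<subseteq> K" "length Ks = 2" "y \<otimes> y = combine Ks [y, \<one>]"
      using Span_mem_iff_length_version[OF assms(1), of "[y, \<one>]"] assms(2) by auto
    then obtain b a where "Ks = [b, a]" by (auto simp: length_Suc_conv numeral_2_eq_2)
    with Ks have a: "a \<in> K" "b \<in> K" "y \<otimes> y = b \<otimes> y \<oplus> a" using cl by auto
    then have ac: "a \<in> carrier R" "b \<in> carrier R" using cl by auto
    have "\<ominus> a \<oplus> (\<ominus> b) \<otimes> y \<oplus> \<one> \<otimes> (y \<otimes> y) = \<zero>"
      using ac assms(2) by (simp add: ring_norm a(3))
    from indep3D(3)[OF i _ _ _ this] a cl show False by simp
  qed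
  show "independent K (exp_base y 3)"
    unfolding exp_base_3[OF assms(2)]
    by (intro li_Cons 2 3 1) (use assms(2) in auto)
qed

text \<open>Three is prime, so no field lies strictly between \<open>K\<close> and \<open>L\<close>:
  an element outside \<open>K\<close> already generates \<open>L\<close>, and its first three powers
  form a basis.\<close>

lemma dimension_3_basis:
  assumes "subfield K R" "subfield L R" "K \<subseteq> L" "dimension 3 K L" "y \<in> L" "y \<notin> K"
  shows "indep3 K y"
    and "x \<in> L \<Longrightarrow> \<exists>a\<in>K. \<exists>b\<in>K. \<exists>c\<in>K. x = a \<oplus> b \<otimes> y \<oplus> c \<otimes> (y \<otimes> y)"
    and "degree (Irr K y) = 3" and "L = generate_field R (insert y K)" and "(algebraic over K) y"
proof -
  have yc: "y \<in> carrier R"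
    using assms subfield_closed(10) by blast
  have alg: "(algebraic over K) y"
    using finite_dimension_imp_algebraic[OF assms(1) subfieldE(1)[OF assms(2)] finite_dimensionI[OF assms(4)] assms(5)] .
  then show "(algebraic over K) y" .
  let ?E = "simple_extension K y"
  have E: "subfield ?E R"
    using simple_extension_is_subfield[OF assms(1) yc] alg by blast
  have "?E \<subseteq> L"
    using simple_extension_minimal[OF subfieldE(1)[OF assms(1)] yc] subfieldE(1)[OF assms(2)] assms(3,5)
    by blast
  moreover have KE: "K \<subseteq> ?E" "y \<in> ?E"
    using simple_extension_incl[OF subfieldE(3)[OF assms(1)] yc]
      simple_extension_mem[OF subfieldE(1)[OF assms(1)] yc] by auto
  ultimately have EL: "?E = L"
    using prime_dimension_intermediate[OF assms(1) E assms(2) _ _ assms(4)] assms(6) by auto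
  show L: "L = generate_field R (insert y K)"
  proof (rule generate_fieldI)
    show "insert y K \<subseteq> carrier R" "insert y K \<subseteq> L"
      using yc subfieldE(3)[OF assms(1)] assms by auto
    show "subfield L R" by fact
    fix M assume "subfield M R" "insert y K \<subseteq> M"
    then have "?E \<subseteq> M"
      using simple_extension_minimal[OF subfieldE(1)[OF assms(1)] yc] subfieldE(1)[of M R] by blast
    then show "L \<subseteq> M" using EL by simp
  qed
  have "dimension (degree (Irr K y)) K L"
    using dimension_simple_extension[OF assms(1) yc alg] EL by simp
  then show d: "degree (Irr K y) = 3"
    using dimension_is_inj[OF assms(1) _ assms(4)] by blast
  have ind: "independent K (exp_base y 3)"
    using exp_base_independent[OF assms(1) yc alg] d by simp
  then show "indep3 K y"
    using independent_exp_base_3_iff[OF assms(1) yc] by blast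
  have "Span K (exp_base y 3) = L"
    using Span_exp_base[OF assms(1) yc alg] d EL by simp
  then show "\<exists>a\<in>K. \<exists>b\<in>K. \<exists>c\<in>K. x = a \<oplus> b \<otimes> y \<oplus> c \<otimes> (y \<otimes> y)" if "x \<in> L"
    using Span_exp_base_3[OF assms(1) yc] that by blast
qed

lemma eval_monic_3:
  assumes "y \<in> carrier R" "a \<in> carrier R" "b \<in> carrier R" "c \<in> carrier R"
  shows "eval [\<one>, c, b, a] y = y \<otimes> y \<otimes> y \<oplus> c \<otimes> (y \<otimes> y) \<oplus> b \<otimes> y \<oplus> a"
proof -
  have "eval [\<one>, c, b, a] y = \<one> \<otimes> y [^] (3::nat) \<oplus> (c \<otimes> y [^] (2::nat) \<oplus> (b \<otimes> y [^] (1::nat) \<oplus> (a \<otimes> y [^] (0::nat) \<oplus> \<zero>)))"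
    by (simp add: numeral_3_eq_3 numeral_2_eq_2)
  also have "\<dots> = y \<otimes> y \<otimes> y \<oplus> c \<otimes> (y \<otimes> y) \<oplus> b \<otimes> y \<oplus> a"
    using assms by (simp add: ring_norm)
  finally show ?thesis .
qed

text \<open>The cubic relation bounds the degree of the minimal polynomial by 3 from above, the
  independence of 1, \<open>y\<close>, \<open>y^2\<close> bounds it from below.\<close>

lemma dimension_3I:
  assumes "subfield K R" "y \<in> carrier R" "indep3 K y"
    and "a \<in> K" "b \<in> K" "c \<in> K" "y \<otimes> y \<otimes> y = a \<oplus> b \<otimes> y \<oplus> c \<otimes> (y \<otimes> y)"
  shows "dimension 3 K (generate_field R (insert y K))"
proof -
  note cl = subfield_closed[OF assms(1)]
  have ac: "a \<in> carrier R" "b \<in> carrier R" "c \<in> carrier R"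
    using cl assms by auto
  let ?p = "[\<one>, \<ominus> c, \<ominus> b, \<ominus> a]"
  have p: "?p \<in> carrier (K[X])"
    using assms cl by (simp add: univ_poly_def polynomial_def)
  have "y \<otimes> y \<otimes> y \<oplus> (\<ominus> c) \<otimes> (y \<otimes> y) \<oplus> (\<ominus> b) \<otimes> y \<oplus> (\<ominus> a) = \<zero>"
    using ac assms(2) by (simp add: ring_norm assms(7))
  then have ev: "eval ?p y = \<zero>"
    using eval_monic_3[of y "\<ominus> a" "\<ominus> b" "\<ominus> c"] ac assms(2) by simp
  then have alg: "(algebraic over K) y"
    using algebraicI[OF p] by blast
  let ?E = "simple_extension K y"
  have dimE: "dimension (degree (Irr K y)) K ?E"
    using dimension_simple_extension[OF assms(1,2) alg] .
  have KE: "K \<subseteq> ?E" "y \<in> ?E" "subfield ?E R"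
    using simple_extension_incl[OF subfieldE(3)[OF assms(1)] assms(2)]
      simple_extension_mem[OF subfieldE(1)[OF assms(1)] assms(2)]
      simple_extension_is_subfield[OF assms(1,2)] alg by auto
  note clE = subfield_closed[OF KE(3)]
  have "set (exp_base y 3) \<subseteq> ?E"
    using exp_base_3[OF assms(2)] clE KE by auto
  then have "3 \<le> degree (Irr K y)"
    using independent_length_le_dimension[OF assms(1) dimE, of "exp_base y 3"]
      independent_exp_base_3_iff[OF assms(1,2)] assms(3) by (simp add: exp_base_def)
  moreover have "degree (Irr K y) \<le> 3"
  proof -
    have "Irr K y pdivides ?p"
      using Irr_minimal[OF assms(1,2) alg p ev] .
    then show ?thesis
      using pdivides_imp_degree_le[OF subfieldE(1)[OF assms(1)] IrrE(1)[OF assms(1,2) alg] p] by simp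
  qed
  ultimately have "degree (Irr K y) = 3" by simp
  moreover have "?E = generate_field R (insert y K)"
  proof (rule generate_fieldI)
    show "insert y K \<subseteq> carrier R" "insert y K \<subseteq> ?E" "subfield ?E R"
      using KE assms(2) subfieldE(3)[OF assms(1)] by auto
    fix M assume "subfield M R" "insert y K \<subseteq> M"
    then show "?E \<subseteq> M"
      using simple_extension_minimal[OF subfieldE(1)[OF assms(1)] assms(2)] subfieldE(1)[of M R] by blast
  qed
  ultimately show ?thesis using dimE by simp
qed

text \<open>Replacing \<open>y^3\<close> by \<beta> in the monic minimal polynomial leaves a
  relation of degree at most two, all of whose coefficients must vanish.\<close>

lemma Irr_pure_cubic:
  assumes "subfield K R" "subfield L R" "K \<subseteq> L" "dimension 3 K L" "y \<in> L" "y \<notin> K" "y \<otimes> y \<otimes> y = \<beta>" "\<beta> \<in> K"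
  shows "Irr K y = [\<one>, \<zero>, \<zero>, \<ominus> \<beta>]"
proof -
  note cl = subfield_closed[OF assms(1)]
  note b = dimension_3_basis[OF assms(1-6)]
  have yc: "y \<in> carrier R" and bc: "\<beta> \<in> carrier R"
    using subfield_closed(10)[OF assms(2)] cl assms by auto
  let ?I = "Irr K y"
  note I = IrrE[OF assms(1) yc b(5)]
  have "?I \<noteq> []" "length ?I = 4" using b(3) by auto
  then obtain d c b' a where "?I = [d, c, b', a]"
    by (auto simp: length_Suc_conv eval_nat_numeral)
  with I(3) have Ie: "?I = [\<one>, c, b', a]" by simp
  have abc: "a \<in> K" "b' \<in> K" "c \<in> K"
    using I(1) unfolding Ie by (auto simp: univ_poly_def polynomial_def)
  then have abcR: "a \<in> carrier R" "b' \<in> carrier R" "c \<in> carrier R" using cl by auto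
  have e0: "y \<otimes> y \<otimes> y \<oplus> c \<otimes> (y \<otimes> y) \<oplus> b' \<otimes> y \<oplus> a = \<zero>"
    using I(4) eval_monic_3[OF yc abcR] unfolding Ie by simp
  have "a \<oplus> \<beta> \<oplus> b' \<otimes> y \<oplus> c \<otimes> (y \<otimes> y) = y \<otimes> y \<otimes> y \<oplus> c \<otimes> (y \<otimes> y) \<oplus> b' \<otimes> y \<oplus> a"
    unfolding assms(7) using abcR bc yc by (simp add: ring_norm)
  then have "a \<oplus> \<beta> \<oplus> b' \<otimes> y \<oplus> c \<otimes> (y \<otimes> y) = \<zero>" using e0 by simp
  from indep3D[OF b(1) _ _ _ this] cl abc assms(8)
  have z: "a \<oplus> \<beta> = \<zero>" "b' = \<zero>" "c = \<zero>" by auto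
  have "a = \<ominus> \<beta>"
    using z(1) abcR bc eq_neg_iff_add_eq_0 by blast
  with z Ie show ?thesis by simp
qed

subsection \<open>Quadratic extensions and conjugation\<close>

definition qspan :: "'a set \<Rightarrow> 'a \<Rightarrow> 'a set" where
  "qspan F c = {a \<oplus> b \<otimes> c | a b. a \<in> F \<and> b \<in> F}"

lemma qspan_mono: "K \<subseteq> F \<Longrightarrow> qspan K c \<subseteq> qspan F c"
  unfolding qspan_def by blast

end

text \<open>The generator is a root of \<open>X^2 - s X + p\<close>. Separability is deliberately
  left out: \<open>s = c \<oplus> c\<close>, where both roots coincide, can occur in characteristic
  2 and marks the inseparable case.\<close>

locale quadratic_extension = field R for R (structure) +
  fixes F :: "'a set" and c s p :: 'a
  assumes base: "subfield F R"
    and c_carrier: "c \<in> carrier R" and c_notin: "c \<notin> F"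
    and s_in: "s \<in> F" and p_in: "p \<in> F"
    and c_square: "c \<otimes> c = s \<otimes> c \<ominus> p"
begin

lemmas cl = subfield_closed[OF base]

lemma sp_carrier: "s \<in> carrier R" "p \<in> carrier R"
  using s_in p_in cl by auto

lemma qspanE:
  assumes "x \<in> qspan F c"
  obtains a b where "a \<in> F" "b \<in> F" "x = a \<oplus> b \<otimes> c" "a \<in> carrier R" "b \<in> carrier R"
  using assms cl(10) unfolding qspan_def by blast

lemma qspanI: "a \<in> F \<Longrightarrow> b \<in> F \<Longrightarrow> a \<oplus> b \<otimes> c \<in> qspan F c"
  unfolding qspan_def by blast

lemma qspan_zeroD:
  assumes "a \<in> F" "b \<in> F" "a \<oplus> b \<otimes> c = \<zero>"
  shows "a = \<zero>" "b = \<zero>"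
proof -
  note cc = c_carrier
  have ab: "a \<in> carrier R" "b \<in> carrier R" using assms cl by auto
  show b: "b = \<zero>"
  proof (rule ccontr)
    assume nb: "b \<noteq> \<zero>"
    have "c = (a \<oplus> b \<otimes> c) \<oslash> b \<ominus> a \<oslash> b"
      using ab cc nb by (simp add: field_norm)
    also have "\<dots> = \<zero> \<ominus> a \<oslash> b"
      using assms(3) nb ab by (simp add: m_div_def)
    finally have "c \<in> F" using assms cl by simp
    with c_notin show False ..
  qed
  show "a = \<zero>" using assms(3) b ab cc by simp
qed

lemma qspan_unique:
  assumes "a \<in> F" "b \<in> F" "a' \<in> F" "b' \<in> F" "a \<oplus> b \<otimes> c = a' \<oplus> b' \<otimes> c"
  shows "a = a' \<and> b = b'"
proof -
  note cc = c_carrier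
  have ab: "a \<in> carrier R" "b \<in> carrier R" "a' \<in> carrier R" "b' \<in> carrier R" using assms cl by auto
  have "(a \<ominus> a') \<oplus> (b \<ominus> b') \<otimes> c = (a \<oplus> b \<otimes> c) \<ominus> (a' \<oplus> b' \<otimes> c)"
    using ab cc by (simp add: ring_norm)
  also have "\<dots> = \<zero>" using assms(5) ab cc by simp
  finally have "(a \<ominus> a') \<oplus> (b \<ominus> b') \<otimes> c = \<zero>" .
  from qspan_zeroD[OF _ _ this] assms cl have "a \<ominus> a' = \<zero>" "b \<ominus> b' = \<zero>" by auto
  then show ?thesis using ab by simp
qed

text \<open>It sends \<open>c\<close> to the other root \<open>s \<ominus> c\<close> of its
  quadratic equation. The description is meaningful on \<open>qspan F c\<close> only, where
  \<open>qspan_unique\<close> makes the coordinates unique; in the inseparable case it is the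
  identity there.\<close>

definition conjugate :: "'a \<Rightarrow> 'a" where
  "conjugate x = (THE z. \<exists>a\<in>F. \<exists>b\<in>F. x = a \<oplus> b \<otimes> c \<and> z = a \<oplus> b \<otimes> (s \<ominus> c))"

lemma conjugate_eq:
  assumes "a \<in> F" "b \<in> F"
  shows "conjugate (a \<oplus> b \<otimes> c) = a \<oplus> b \<otimes> (s \<ominus> c)"
  unfolding conjugate_def
proof (rule the_equality)
  show "\<exists>a'\<in>F. \<exists>b'\<in>F. a \<oplus> b \<otimes> c = a' \<oplus> b' \<otimes> c \<and> a \<oplus> b \<otimes> (s \<ominus> c) = a' \<oplus> b' \<otimes> (s \<ominus> c)"
    using assms by blast
  show "\<And>z. \<exists>a'\<in>F. \<exists>b'\<in>F. a \<oplus> b \<otimes> c = a' \<oplus> b' \<otimes> c \<and> z = a' \<oplus> b' \<otimes> (s \<ominus> c) \<Longrightarrow> z = a \<oplus> b \<otimes> (s \<ominus> c)"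
    using qspan_unique assms by metis
qed

lemma conjugate_eq':
  assumes "a \<in> F" "b \<in> F"
  shows "conjugate (a \<oplus> b \<otimes> c) = (a \<oplus> b \<otimes> s) \<oplus> (\<ominus> b) \<otimes> c"
proof -
  have "a \<in> carrier R" "b \<in> carrier R" using assms cl by auto
  note cr = this c_carrier sp_carrier
  have "a \<oplus> b \<otimes> (s \<ominus> c) = (a \<oplus> b \<otimes> s) \<oplus> (\<ominus> b) \<otimes> c"
    using cr by (simp add: ring_norm)
  then show ?thesis using conjugate_eq[OF assms] by simp
qed

lemma qspan_mult_eq:
  assumes "a \<in> carrier R" "b \<in> carrier R" "a' \<in> carrier R" "b' \<in> carrier R"
  shows "(a \<oplus> b \<otimes> c) \<otimes> (a' \<oplus> b' \<otimes> c) = (a \<otimes> a' \<ominus> b \<otimes> b' \<otimes> p) \<oplus> (a \<otimes> b' \<oplus> b \<otimes> a' \<oplus> b \<otimes> b' \<otimes> s) \<otimes> c"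
  using assms c_carrier sp_carrier by (simp add: ring_norm c_square)

lemma base_subset_qspan: "F \<subseteq> qspan F c"
proof
  fix x assume "x \<in> F"
  then have "x \<oplus> \<zero> \<otimes> c \<in> qspan F c" "x \<in> carrier R" using cl qspanI by auto
  then show "x \<in> qspan F c" using c_carrier by simp
qed

lemma generator_in_qspan: "c \<in> qspan F c"
proof -
  have "\<zero> \<oplus> \<one> \<otimes> c \<in> qspan F c" using cl qspanI by auto
  then show ?thesis using c_carrier by simp
qed

lemma qspan_carrier: "x \<in> qspan F c \<Longrightarrow> x \<in> carrier R"
  by (elim qspanE) (use c_carrier in simp)

lemma conjugate_closed: "x \<in> qspan F c \<Longrightarrow> conjugate x \<in> qspan F c"
  by (elim qspanE) (use cl s_in conjugate_eq' qspanI in simp)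

lemma conjugate_base:
  assumes "x \<in> F" shows "conjugate x = x"
proof -
  have "x \<in> carrier R" using assms cl by auto
  then show ?thesis
    using conjugate_eq[of x \<zero>] assms cl sp_carrier c_carrier by simp
qed

lemma conjugate_conjugate:
  assumes "x \<in> qspan F c" shows "conjugate (conjugate x) = x"
proof -
  obtain a b where ab: "a \<in> F" "b \<in> F" "x = a \<oplus> b \<otimes> c" "a \<in> carrier R" "b \<in> carrier R"
    using assms by (rule qspanE)
  note cr = ab(4,5) c_carrier sp_carrier
  have "conjugate (conjugate x) = (a \<oplus> b \<otimes> s) \<oplus> (\<ominus> b) \<otimes> (s \<ominus> c)"
    unfolding ab(3) conjugate_eq'[OF ab(1,2)]
    by (rule conjugate_eq) (use ab cl s_in in auto)
  also have "\<dots> = a \<oplus> b \<otimes> c"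
    using cr by (simp add: ring_norm)
  finally show ?thesis using ab(3) by simp
qed

lemma conjugate_add:
  assumes "x \<in> qspan F c" "y \<in> qspan F c"
  shows "conjugate (x \<oplus> y) = conjugate x \<oplus> conjugate y"
proof -
  obtain a b where ab: "a \<in> F" "b \<in> F" "x = a \<oplus> b \<otimes> c" "a \<in> carrier R" "b \<in> carrier R"
    using assms(1) by (rule qspanE)
  obtain a' b' where ab': "a' \<in> F" "b' \<in> F" "y = a' \<oplus> b' \<otimes> c" "a' \<in> carrier R" "b' \<in> carrier R"
    using assms(2) by (rule qspanE)
  note cr = ab(4,5) ab'(4,5) c_carrier sp_carrier
  have "x \<oplus> y = (a \<oplus> a') \<oplus> (b \<oplus> b') \<otimes> c"
    unfolding ab ab' using cr by (simp add: ring_norm)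
  then have "conjugate (x \<oplus> y) = (a \<oplus> a') \<oplus> (b \<oplus> b') \<otimes> (s \<ominus> c)"
    using conjugate_eq[of "a \<oplus> a'" "b \<oplus> b'"] ab ab' cl by simp
  also have "\<dots> = conjugate x \<oplus> conjugate y"
    unfolding ab(3) ab'(3) conjugate_eq[OF ab(1,2)] conjugate_eq[OF ab'(1,2)]
    using cr by (simp add: ring_norm)
  finally show ?thesis .
qed

lemma conjugate_mult:
  assumes "x \<in> qspan F c" "y \<in> qspan F c"
  shows "conjugate (x \<otimes> y) = conjugate x \<otimes> conjugate y"
proof -
  obtain a b where ab: "a \<in> F" "b \<in> F" "x = a \<oplus> b \<otimes> c" "a \<in> carrier R" "b \<in> carrier R"
    using assms(1) by (rule qspanE)
  obtain a' b' where ab': "a' \<in> F" "b' \<in> F" "y = a' \<oplus> b' \<otimes> c" "a' \<in> carrier R" "b' \<in> carrier R"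
    using assms(2) by (rule qspanE)
  note cr = ab(4,5) ab'(4,5) c_carrier sp_carrier
  have "conjugate (x \<otimes> y) = (a \<otimes> a' \<ominus> b \<otimes> b' \<otimes> p) \<oplus> (a \<otimes> b' \<oplus> b \<otimes> a' \<oplus> b \<otimes> b' \<otimes> s) \<otimes> (s \<ominus> c)"
    unfolding ab(3) ab'(3) qspan_mult_eq[OF ab(4,5) ab'(4,5)]
    by (rule conjugate_eq) (use ab ab' cl s_in p_in in auto)
  also have "\<dots> = (a \<oplus> b \<otimes> (s \<ominus> c)) \<otimes> (a' \<oplus> b' \<otimes> (s \<ominus> c))"
    using cr by (simp add: ring_norm c_square)
  also have "\<dots> = conjugate x \<otimes> conjugate y"
    unfolding ab(3) ab'(3) conjugate_eq[OF ab(1,2)] conjugate_eq[OF ab'(1,2)] ..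
  finally show ?thesis .
qed

lemma norm_in_base: "x \<in> qspan F c \<Longrightarrow> x \<otimes> conjugate x \<in> F"
proof -
  assume "x \<in> qspan F c"
  then obtain a b where ab: "a \<in> F" "b \<in> F" "x = a \<oplus> b \<otimes> c" "a \<in> carrier R" "b \<in> carrier R"
    by (rule qspanE)
  note cr = ab(4,5) c_carrier sp_carrier
  have "x \<otimes> conjugate x = a \<otimes> a \<oplus> a \<otimes> b \<otimes> s \<oplus> b \<otimes> b \<otimes> p"
    unfolding ab(3) conjugate_eq[OF ab(1,2)] using cr by (simp add: ring_norm c_square)
  then show ?thesis using ab cl s_in p_in by simp
qed

lemma trace_in_base: "x \<in> qspan F c \<Longrightarrow> x \<oplus> conjugate x \<in> F"
proof -
  assume "x \<in> qspan F c"
  then obtain a b where ab: "a \<in> F" "b \<in> F" "x = a \<oplus> b \<otimes> c" "a \<in> carrier R" "b \<in> carrier R"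
    by (rule qspanE)
  note cr = ab(4,5) c_carrier sp_carrier
  have "x \<oplus> conjugate x = a \<oplus> a \<oplus> b \<otimes> s"
    unfolding ab(3) conjugate_eq[OF ab(1,2)] using cr by (simp add: ring_norm)
  then show ?thesis using ab cl s_in p_in by simp
qed

lemma square_eq_trace_norm:
  assumes "x \<in> qspan F c"
  shows "x \<otimes> x = (x \<oplus> conjugate x) \<otimes> x \<ominus> x \<otimes> conjugate x"
proof -
  define y where "y = conjugate x"
  have cr: "x \<in> carrier R" "y \<in> carrier R"
    using assms qspan_carrier conjugate_closed unfolding y_def by auto
  show ?thesis unfolding y_def[symmetric] using cr by (simp add: ring_norm)
qed

lemma conjugate_zero_iff:
  assumes "x \<in> qspan F c" shows "conjugate x = \<zero> \<longleftrightarrow> x = \<zero>"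
  using conjugate_conjugate[OF assms] conjugate_base[of \<zero>] cl by metis

text \<open>Inverses come from the norm: \<open>x\<close> times its conjugate is a nonzero element
  of \<open>F\<close>, so the conjugate divided by the norm inverts \<open>x\<close>.\<close>

lemma qspan_subfield: "subfield (qspan F c) R"
proof (rule subfieldI_closed)
  show "qspan F c \<subseteq> carrier R" "\<one> \<in> qspan F c"
    using qspan_carrier base_subset_qspan cl by auto
  show "x \<ominus> y \<in> qspan F c" if xy: "x \<in> qspan F c" "y \<in> qspan F c" for x y
  proof -
    obtain a b where ab: "a \<in> F" "b \<in> F" "x = a \<oplus> b \<otimes> c" "a \<in> carrier R" "b \<in> carrier R"
      using xy(1) by (rule qspanE)
    obtain a' b' where ab': "a' \<in> F" "b' \<in> F" "y = a' \<oplus> b' \<otimes> c" "a' \<in> carrier R" "b' \<in> carrier R"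
      using xy(2) by (rule qspanE)
    note cr = ab(4,5) ab'(4,5) c_carrier sp_carrier
    have "x \<ominus> y = (a \<ominus> a') \<oplus> (b \<ominus> b') \<otimes> c"
      unfolding ab ab' using cr by (simp add: ring_norm)
    then show ?thesis using ab ab' cl qspanI by simp
  qed
  show m: "x \<otimes> y \<in> qspan F c" if xy: "x \<in> qspan F c" "y \<in> qspan F c" for x y
  proof -
    obtain a b where ab: "a \<in> F" "b \<in> F" "x = a \<oplus> b \<otimes> c" "a \<in> carrier R" "b \<in> carrier R"
      using xy(1) by (rule qspanE)
    obtain a' b' where ab': "a' \<in> F" "b' \<in> F" "y = a' \<oplus> b' \<otimes> c" "a' \<in> carrier R" "b' \<in> carrier R"
      using xy(2) by (rule qspanE)
    show ?thesis
      unfolding ab(3) ab'(3) qspan_mult_eq[OF ab(4,5) ab'(4,5)]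
      using ab ab' cl s_in p_in by (intro qspanI) auto
  qed
  show "inv x \<in> qspan F c" if x: "x \<in> qspan F c" "x \<noteq> \<zero>" for x
  proof -
    define y where "y = conjugate x"
    have xy: "x \<in> carrier R" "y \<in> carrier R" "y \<noteq> \<zero>" "y \<in> qspan F c"
      using x qspan_carrier conjugate_closed conjugate_zero_iff unfolding y_def by auto
    have n: "x \<otimes> y \<in> F" "x \<otimes> y \<noteq> \<zero>"
      using norm_in_base[OF x(1)] x xy integral unfolding y_def by auto
    have "inv (x \<otimes> y) \<otimes> y \<in> qspan F c"
      using m[of "inv (x \<otimes> y)" y] base_subset_qspan cl(8)[OF n] xy(4) by blast
    moreover have "inv (x \<otimes> y) \<otimes> y = inv x"
    proof (rule comm_inv_char[symmetric])
      have "(x \<otimes> y) \<otimes> inv (x \<otimes> y) = \<one>" using n xy by simp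
      then show "x \<otimes> (inv (x \<otimes> y) \<otimes> y) = \<one>"
        using xy n(2) m_assoc m_comm inv_closed by (metis m_closed)
    qed (use xy n in auto)
    ultimately show ?thesis by simp
  qed
qed

lemma conjugate_one [simp]: "conjugate \<one> = \<one>" and conjugate_zero [simp]: "conjugate \<zero> = \<zero>"
  using conjugate_base cl by auto

lemma conjugate_inv:
  assumes "x \<in> qspan F c" "x \<noteq> \<zero>" shows "conjugate (inv x) = inv (conjugate x)"
proof -
  note q = subfield_closed[OF qspan_subfield]
  have "x \<in> carrier R" "inv x \<in> qspan F c" using assms q by auto
  then have "conjugate x \<otimes> conjugate (inv x) = \<one>"
    using conjugate_mult[of x "inv x"] assms by simp
  then show ?thesis
    using assms conjugate_closed q \<open>inv x \<in> qspan F c\<close>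
    by (metis comm_inv_char)
qed

lemma conjugate_minus:
  assumes "x \<in> qspan F c" shows "conjugate (\<ominus> x) = \<ominus> conjugate x"
proof -
  note q = subfield_closed[OF qspan_subfield]
  have "conjugate (x \<oplus> (\<ominus> x)) = \<zero>" using assms q by (simp add: r_neg)
  then have "conjugate x \<oplus> conjugate (\<ominus> x) = \<zero>" using conjugate_add assms q by simp
  then show ?thesis
    using assms conjugate_closed q by (metis a_comm eq_neg_iff_add_eq_0)
qed

text \<open>The conjugate of \<open>a \<oplus> b \<otimes> c\<close> differs from it by
  \<open>b\<close> times \<open>s \<ominus> (c \<oplus> c)\<close>, and the second factor is nonzero
  precisely by the separability assumption.\<close>

lemma fixed_imp_base:
  assumes "s \<noteq> c \<oplus> c" "x \<in> qspan F c" "conjugate x = x"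
  shows "x \<in> F"
proof -
  obtain a b where ab: "a \<in> F" "b \<in> F" "x = a \<oplus> b \<otimes> c" "a \<in> carrier R" "b \<in> carrier R"
    using assms(2) by (rule qspanE)
  note cr = ab(4,5) c_carrier sp_carrier
  have "b \<otimes> (s \<ominus> (c \<oplus> c)) = (a \<oplus> b \<otimes> (s \<ominus> c)) \<ominus> (a \<oplus> b \<otimes> c)"
    using cr by (simp add: ring_norm)
  also have "\<dots> = \<zero>"
    using assms(3) cr unfolding ab(3) conjugate_eq[OF ab(1,2)] by simp
  finally have "b = \<zero>" using integral[of b "s \<ominus> (c \<oplus> c)"] assms(1) cr by auto
  then show ?thesis using ab cr by simp
qed

lemma generated_eq_qspan:
  assumes "F \<subseteq> G" "c \<in> generate_field R G" "G \<subseteq> qspan F c"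
  shows "generate_field R G = qspan F c"
proof (rule sym, rule generate_fieldI)
  show "subfield (qspan F c) R" by (rule qspan_subfield)
  show "G \<subseteq> carrier R" "G \<subseteq> qspan F c" using assms(3) qspan_carrier by auto
  fix M assume M: "subfield M R" "G \<subseteq> M"
  then have "c \<in> M"
    using generate_field_min_subfield1[OF _ M] assms qspan_carrier by blast
  show "qspan F c \<subseteq> M"
  proof
    fix x assume "x \<in> qspan F c"
    then obtain a b where "a \<in> F" "b \<in> F" "x = a \<oplus> b \<otimes> c" by (rule qspanE)
    then show "x \<in> M"
      using \<open>c \<in> M\<close> assms(1) M(2) subfield_closed(3,4)[OF M(1)] by (metis subsetD)
  qed
qed

lemma dimension_2_qspan: "dimension 2 F (qspan F c)"
proof -
  have one: "independent F [\<one>]" by (rule li_Cons) auto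
  have s: "set [c, \<one>] \<subseteq> carrier R" using c_carrier by auto
  have 1: "Span F [\<one>] = F"
    using independent_length_eq_dimension[OF base dimension_one[OF base] one] cl by simp
  have "independent F [c, \<one>]"
    by (rule li_Cons) (use c_carrier c_notin one 1 in auto)
  moreover have "Span F [c, \<one>] = qspan F c"
  proof -
    have l: "length Ks = length [c, \<one>] \<Longrightarrow> \<exists>b a. Ks = [b, a]" for Ks :: "'a list"
      by (auto simp: length_Suc_conv)
    have eq: "combine [b, a] [c, \<one>] = a \<oplus> b \<otimes> c" if "a \<in> F" "b \<in> F" for a b
      using that cl(10) c_carrier by (simp add: a_comm)
    show ?thesis
    proof
      show "Span F [c, \<one>] \<subseteq> qspan F c"
      proof
        fix x assume "x \<in> Span F [c, \<one>]"
        then obtain Ks where Ks: "set Ks \<subseteq> F" "length Ks = length [c, \<one>]" "x = combine Ks [c, \<one>]"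
          using Span_mem_iff_length_version[OF base s] by blast
        obtain b a where k: "Ks = [b, a]" using l[OF Ks(2)] by blast
        with Ks(1) have ab: "a \<in> F" "b \<in> F" by auto
        then show "x \<in> qspan F c" using Ks(3) eq[OF ab] k qspanI by simp
      qed
      show "qspan F c \<subseteq> Span F [c, \<one>]"
      proof
        fix x assume "x \<in> qspan F c"
        then obtain a b where ab: "a \<in> F" "b \<in> F" "x = a \<oplus> b \<otimes> c" by (rule qspanE)
        then have "x = combine [b, a] [c, \<one>]" using eq by simp
        then show "x \<in> Span F [c, \<one>]"
          unfolding Span_mem_iff_length_version[OF base s] using ab
          by (intro exI[of _ "[b, a]"]) simp
      qed
    qed
  qed
  ultimately show ?thesis
    using dimensionI[OF base, of "[c, \<one>]"] by (simp add: numeral_2_eq_2)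
qed

text \<open>An element of the quadratic extension is a root of the quadratic polynomial formed from
  its trace and norm, and this is a nontrivial relation between 1, \<open>y\<close>,
  \<open>y^2\<close>.\<close>

lemma indep3_not_in_qspan:
  assumes "indep3 F y" shows "y \<notin> qspan F c"
proof
  assume y: "y \<in> qspan F c"
  define t where "t = y \<oplus> conjugate y"
  define n where "n = y \<otimes> conjugate y"
  have tn: "t \<in> F" "n \<in> F" "y \<otimes> y = t \<otimes> y \<ominus> n"
    using trace_in_base norm_in_base square_eq_trace_norm y unfolding t_def n_def by auto
  have cr: "y \<in> carrier R" "t \<in> carrier R" "n \<in> carrier R" using tn cl qspan_carrier y by auto
  have "n \<oplus> (\<ominus> t) \<otimes> y \<oplus> \<one> \<otimes> (y \<otimes> y) = \<zero>"
    using cr by (simp add: ring_norm tn(3))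
  from indep3D(3)[OF assms _ _ _ this] tn cl show False by simp
qed

end

context field
begin

text \<open>Any element outside \<open>K\<close> completes 1 to a basis; expanding its square in
  this basis gives \<open>s\<close> and, up to sign, \<open>p\<close>.\<close>

lemma dimension_2_quadratic_extension:
  assumes "subfield K R" "subfield K' R" "K \<subseteq> K'" "dimension 2 K K'"
  obtains c s p where "quadratic_extension R K c s p" "K' = qspan K c"
proof -
  note cl = subfield_closed[OF assms(1)] and cl' = subfield_closed[OF assms(2)]
  have "K' \<noteq> K"
    using dimension_is_inj[OF assms(1) dimension_one[OF assms(1)]] assms(4) by fastforce
  then obtain c where c: "c \<in> K'" "c \<notin> K" using assms(3) by blast
  have cc: "c \<in> carrier R" using c cl' by auto
  have one: "independent K [\<one>]" by (rule li_Cons) auto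
  have 1: "Span K [\<one>] = K"
    using independent_length_eq_dimension[OF assms(1) dimension_one[OF assms(1)] one] cl by simp
  have i2: "independent K [c, \<one>]"
    by (rule li_Cons) (use cc c one 1 in auto)
  then have Sp: "Span K [c, \<one>] = K'"
    using independent_length_eq_dimension[OF assms(1,4) i2] c cl' by simp
  have rep: "\<exists>a\<in>K. \<exists>b\<in>K. x = a \<oplus> b \<otimes> c" if "x \<in> K'" for x
  proof -
    have "x \<in> line_extension K c (Span K [\<one>])" using that Sp by simp
    then obtain b v where "b \<in> K" "v \<in> K" "x = b \<otimes> c \<oplus> v"
      unfolding 1 line_extension_mem_iff by blast
    then show ?thesis using cl(10) cc by (metis a_comm m_closed)
  qed
  have "c \<otimes> c \<in> K'" using c cl' by auto
  then obtain a b where ab: "a \<in> K" "b \<in> K" "c \<otimes> c = a \<oplus> b \<otimes> c" using rep by blast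
  have abc: "a \<in> carrier R" "b \<in> carrier R" using ab cl by auto
  have "c \<otimes> c = b \<otimes> c \<ominus> (\<ominus> a)"
    using abc cc by (simp add: ring_norm ab(3))
  then have "quadratic_extension R K c b (\<ominus> a)"
    using quadratic_extension.intro[OF field_axioms quadratic_extension_axioms.intro]
      assms(1) c(2) cc ab(2) cl(6)[OF ab(1)] by blast
  moreover have "K' = qspan K c"
  proof
    show "K' \<subseteq> qspan K c" using rep unfolding qspan_def by blast
    show "qspan K c \<subseteq> K'"
      using c(1) cl'(3,4) assms(3) unfolding qspan_def by (force simp: subset_iff)
  qed
  ultimately show thesis using that by blast
qed

lemma quadratic_extension_over:
  assumes "quadratic_extension R K c s p" "subfield F R" "K \<subseteq> F" "c \<notin> F"
  shows "quadratic_extension R F c s p"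
proof -
  interpret quadratic_extension R K c s p by fact
  show ?thesis
    using quadratic_extension.intro[OF field_axioms quadratic_extension_axioms.intro]
      assms c_carrier s_in p_in c_square by blast
qed

text \<open>Both conjugations are computed from the same coordinates with respect to the same
  \<open>c\<close>, so they agree without any choice of an extension.\<close>

lemma conjugate_restrict:
  assumes "quadratic_extension R K c s p" "quadratic_extension R F c s p" "K \<subseteq> F" "x \<in> qspan K c"
  shows "quadratic_extension.conjugate R F c s x = quadratic_extension.conjugate R K c s x"
proof -
  interpret K: quadratic_extension R K c s p by fact
  interpret F: quadratic_extension R F c s p by fact
  obtain a b where "a \<in> K" "b \<in> K" "x = a \<oplus> b \<otimes> c"
    using assms(4) by (rule K.qspanE)
  then show ?thesis using K.conjugate_eq F.conjugate_eq assms(3) by (metis subsetD)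
qed

lemma composite_qspan:
  assumes "quadratic_extension R K c s p" "quadratic_extension R F c s p" "K \<subseteq> F"
  shows "composite F (qspan K c) = qspan F c"
proof -
  interpret K: quadratic_extension R K c s p by fact
  interpret F: quadratic_extension R F c s p by fact
  have "F \<union> qspan K c \<subseteq> qspan F c"
    using F.base_subset_qspan qspan_mono[OF assms(3)] by auto
  moreover have "c \<in> generate_field R (F \<union> qspan K c)"
    by (rule generate_field.incl) (use K.generator_in_qspan in simp)
  ultimately show ?thesis
    unfolding composite_def using F.generated_eq_qspan by simp
qed

subsection \<open>Cube roots\<close>

text \<open>This is the irreducibility of \<open>X^3 - r\<close>, in every characteristic. A
  relation \<open>u^2 = A + B u\<close> multiplied by \<open>u\<close> gives
  \<open>u^3 = A B + (A + B^2) u\<close>. As \<open>u\<close> is not in \<open>M\<close>, this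
  forces \<open>A = - B^2\<close> and makes \<open>r\<close> the cube of \<open>- B\<close>.\<close>

lemma not_cube_indep3:
  assumes "subfield M R" "u \<in> carrier R" "u \<otimes> u \<otimes> u = r" "r \<in> M"
    and nc: "\<And>d. d \<in> M \<Longrightarrow> d \<otimes> d \<otimes> d \<noteq> r"
  shows "indep3 M u"
  unfolding indep3_def
proof (intro ballI impI)
  note cl = subfield_closed[OF assms(1)]
  have uM: "u \<notin> M" using nc assms(3) by blast
  have lin: "a = \<zero> \<and> b = \<zero>" if "a \<in> M" "b \<in> M" "a \<oplus> b \<otimes> u = \<zero>" for a b
  proof -
    have ab: "a \<in> carrier R" "b \<in> carrier R" using that cl by auto
    have "b = \<zero>"
    proof (rule ccontr)
      assume nb: "b \<noteq> \<zero>"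
      have "u = (a \<oplus> b \<otimes> u) \<oslash> b \<ominus> a \<oslash> b"
        using ab assms(2) nb by (simp add: field_norm)
      also have "\<dots> = \<zero> \<ominus> a \<oslash> b"
        using that(3) nb ab by (simp add: m_div_def)
      finally have "u \<in> M" using that cl by simp
      with uM show False ..
    qed
    with that ab assms(2) show ?thesis by simp
  qed
  fix a b c assume abc: "a \<in> M" "b \<in> M" "c \<in> M" "a \<oplus> b \<otimes> u \<oplus> c \<otimes> (u \<otimes> u) = \<zero>"
  have cr: "a \<in> carrier R" "b \<in> carrier R" "c \<in> carrier R" "u \<in> carrier R" "r \<in> carrier R"
    using abc cl assms by auto
  have "c = \<zero>"
  proof (rule ccontr)
    assume nc0: "c \<noteq> \<zero>"
    define A where "A = \<ominus> (a \<oslash> c)"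
    define B where "B = \<ominus> (b \<oslash> c)"
    have AB: "A \<in> M" "B \<in> M" using abc cl unfolding A_def B_def by auto
    have ABc: "A \<in> carrier R" "B \<in> carrier R" using AB cl by auto
    have "u \<otimes> u = (a \<oplus> b \<otimes> u \<oplus> c \<otimes> (u \<otimes> u)) \<oslash> c \<oplus> \<ominus> (a \<oslash> c) \<oplus> \<ominus> (b \<oslash> c) \<otimes> u"
      using cr nc0 by (simp add: field_norm)
    then have u2: "u \<otimes> u = A \<oplus> B \<otimes> u"
      using abc(4) nc0 cr ABc unfolding A_def[symmetric] B_def[symmetric] by (simp add: m_div_def)
    have "(A \<otimes> B \<ominus> r) \<oplus> (A \<oplus> B \<otimes> B) \<otimes> u = A \<otimes> u \<oplus> B \<otimes> (A \<oplus> B \<otimes> u) \<ominus> r"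
      using ABc cr by (simp add: ring_norm)
    also have "\<dots> = (A \<oplus> B \<otimes> u) \<otimes> u \<ominus> r"
      unfolding u2[symmetric] using ABc cr u2 by (metis l_distr m_assoc m_closed)
    also have "\<dots> = \<zero>"
      unfolding u2[symmetric] using assms(3) cr by simp
    finally have "A \<otimes> B \<ominus> r = \<zero> \<and> A \<oplus> B \<otimes> B = \<zero>"
      using lin[of "A \<otimes> B \<ominus> r" "A \<oplus> B \<otimes> B"] AB cl assms(4) by simp
    then have "r = A \<otimes> B" and A: "A = \<ominus> (B \<otimes> B)"
      using ABc cr eq_neg_iff_add_eq_0 by auto
    then have "(\<ominus> B) \<otimes> (\<ominus> B) \<otimes> (\<ominus> B) = r"
      unfolding A using ABc by (simp add: l_minus r_minus)
    then show False using nc[OF cl(6)[OF AB(2)]] by blast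
  qed
  moreover from this have "a = \<zero> \<and> b = \<zero>"
    using lin[OF abc(1,2)] abc(4) cr by simp
  ultimately show "a = \<zero> \<and> b = \<zero> \<and> c = \<zero>" by blast
qed

text \<open>If the cubes agreed, the factorisation of \<open>u^3 - d^3\<close> would make either
  \<open>u - d\<close> or \<open>d^2 + d u + u^2\<close> vanish, and both are relations of degree at
  most two with a coefficient 1.\<close>

lemma indep3_not_cube:
  assumes "subfield M R" "indep3 M u" "u \<in> carrier R" "d \<in> M"
  shows "d \<otimes> d \<otimes> d \<noteq> u \<otimes> u \<otimes> u"
proof
  note cl = subfield_closed[OF assms(1)]
  assume e: "d \<otimes> d \<otimes> d = u \<otimes> u \<otimes> u"
  have cr: "d \<in> carrier R" "u \<in> carrier R" using assms cl by auto
  have "((\<ominus> d) \<oplus> \<one> \<otimes> u \<oplus> \<zero> \<otimes> (u \<otimes> u)) \<otimes> (d \<otimes> d \<oplus> d \<otimes> u \<oplus> \<one> \<otimes> (u \<otimes> u)) = u \<otimes> u \<otimes> u \<ominus> d \<otimes> d \<otimes> d"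
    using cr by (simp add: ring_norm)
  also have "\<dots> = \<zero>" using e cr by simp
  finally have "(\<ominus> d) \<oplus> \<one> \<otimes> u \<oplus> \<zero> \<otimes> (u \<otimes> u) = \<zero> \<or> d \<otimes> d \<oplus> d \<otimes> u \<oplus> \<one> \<otimes> (u \<otimes> u) = \<zero>"
    using integral cr by simp
  then show False
  proof
    assume "(\<ominus> d) \<oplus> \<one> \<otimes> u \<oplus> \<zero> \<otimes> (u \<otimes> u) = \<zero>"
    from indep3D(2)[OF assms(2) _ _ _ this] cl(1,2,6) assms(4) show False by simp
  next
    assume "d \<otimes> d \<oplus> d \<otimes> u \<oplus> \<one> \<otimes> (u \<otimes> u) = \<zero>"
    from indep3D(3)[OF assms(2) _ _ _ this] cl(2,4) assms(4) show False by simp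
  qed
qed

lemma indep3_nonzero:
  assumes "subfield M R" "indep3 M u" "u \<in> carrier R" shows "u \<noteq> \<zero>" "u \<notin> M"
proof -
  note cl = subfield_closed[OF assms(1)]
  show "u \<notin> M" using indep3_not_cube[OF assms] by blast
  then show "u \<noteq> \<zero>" using cl by auto
qed

text \<open>Kummer theory without roots of unity. In the cube of \<open>u\<close> the coefficients
  of \<open>w\<close> and \<open>w^2\<close> are three times \<open>e1\<close> and
  \<open>e2\<close>; both vanish as 3 is nonzero. The equations \<open>e1 = \<zero>\<close> and
  \<open>e2 = \<zero>\<close> leave only one of the three summands, because \<beta> is not a cube in
  \<open>M\<close>.\<close>

lemma cube_root_combination:
  assumes "subfield M R" "indep3 M w" "w \<in> carrier R" "w \<otimes> w \<otimes> w = \<beta>" "\<beta> \<in> M" "\<guillemotleft>3\<guillemotright> \<noteq> \<zero>"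
    and "a \<in> M" "b \<in> M" "c \<in> M" "u = a \<oplus> b \<otimes> w \<oplus> c \<otimes> (w \<otimes> w)" "u \<otimes> u \<otimes> u \<in> M"
  shows "u = a \<or> u = b \<otimes> w \<or> u = c \<otimes> (w \<otimes> w)"
proof -
  note cl = subfield_closed[OF assms(1)]
  have cr: "a \<in> carrier R" "b \<in> carrier R" "c \<in> carrier R" "w \<in> carrier R" "\<beta> \<in> carrier R"
    using assms(3,5,7-9) cl(10) by auto
  define r where "r = u \<otimes> u \<otimes> u"
  have rM: "r \<in> M" "r \<in> carrier R" using assms(11) cl unfolding r_def by auto
  define e1 where "e1 = a \<otimes> a \<otimes> b \<oplus> b \<otimes> b \<otimes> c \<otimes> \<beta> \<oplus> a \<otimes> c \<otimes> c \<otimes> \<beta>"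
  define e2 where "e2 = a \<otimes> a \<otimes> c \<oplus> a \<otimes> b \<otimes> b \<oplus> b \<otimes> c \<otimes> c \<otimes> \<beta>"
  define e0 where "e0 = a \<otimes> a \<otimes> a \<oplus> b \<otimes> b \<otimes> b \<otimes> \<beta> \<oplus> c \<otimes> c \<otimes> c \<otimes> \<beta> \<otimes> \<beta> \<oplus> \<guillemotleft>6\<guillemotright> \<otimes> a \<otimes> b \<otimes> c \<otimes> \<beta>"
  have six: "\<guillemotleft>6\<guillemotright> \<in> M" and three: "\<guillemotleft>3\<guillemotright> \<in> M"
  proof -
    have "\<guillemotleft>6\<guillemotright> = \<one> \<oplus> \<one> \<oplus> \<one> \<oplus> \<one> \<oplus> \<one> \<oplus> \<one>" "\<guillemotleft>3\<guillemotright> = \<one> \<oplus> \<one> \<oplus> \<one>"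
      by (simp_all add: of_integer_def eval_nat_numeral a_assoc)
    then show "\<guillemotleft>6\<guillemotright> \<in> M" "\<guillemotleft>3\<guillemotright> \<in> M" using cl by simp_all
  qed
  have eM: "e0 \<in> M" "e1 \<in> M" "e2 \<in> M"
    unfolding e0_def e1_def e2_def using assms(5,7-9) cl(3,4) six by simp_all
  have ecr: "e0 \<in> carrier R" "e1 \<in> carrier R" "e2 \<in> carrier R" using eM cl by auto
  have w3: "w \<otimes> (w \<otimes> w) = \<beta>" using assms(3,4) by (simp add: m_assoc)
  have exp: "u \<otimes> u \<otimes> u = e0 \<oplus> \<guillemotleft>3\<guillemotright> \<otimes> e1 \<otimes> w \<oplus> \<guillemotleft>3\<guillemotright> \<otimes> e2 \<otimes> (w \<otimes> w)"
    unfolding assms(10) e0_def e1_def e2_def using cr by (simp add: ring_norm w3)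
  have "(e0 \<ominus> r) \<oplus> \<guillemotleft>3\<guillemotright> \<otimes> e1 \<otimes> w \<oplus> \<guillemotleft>3\<guillemotright> \<otimes> e2 \<otimes> (w \<otimes> w)
      = (e0 \<oplus> \<guillemotleft>3\<guillemotright> \<otimes> e1 \<otimes> w \<oplus> \<guillemotleft>3\<guillemotright> \<otimes> e2 \<otimes> (w \<otimes> w)) \<ominus> r"
    using ecr rM cr by (simp add: ring_norm)
  also have "\<dots> = \<zero>" unfolding exp[symmetric] using rM by (simp add: r_def[symmetric])
  finally have "(e0 \<ominus> r) \<oplus> \<guillemotleft>3\<guillemotright> \<otimes> e1 \<otimes> w \<oplus> \<guillemotleft>3\<guillemotright> \<otimes> e2 \<otimes> (w \<otimes> w) = \<zero>" .
  from indep3D(2,3)[OF assms(2) cl(5)[OF eM(1) rM(1)] cl(4)[OF three eM(2)] cl(4)[OF three eM(3)] this]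
  have "\<guillemotleft>3\<guillemotright> \<otimes> e1 = \<zero>" "\<guillemotleft>3\<guillemotright> \<otimes> e2 = \<zero>" .
  then have e12: "e1 = \<zero>" "e2 = \<zero>"
    using assms(6) integral[of "\<guillemotleft>3\<guillemotright>"] ecr by auto
  have nocube: "d \<otimes> d \<otimes> d \<noteq> \<beta>" if "d \<in> M" for d
    using indep3_not_cube[OF assms(1-3) that] assms(4) by simp
  have b0: "\<beta> \<noteq> \<zero>" using nocube[of \<zero>] cl by auto
  show ?thesis
  proof (cases "a = \<zero>")
    case True
    then have "b \<otimes> b \<otimes> c \<otimes> \<beta> = \<zero>" using e12(1) cr unfolding e1_def by simp
    then have "b = \<zero> \<or> c = \<zero>" using integral b0 cr by (metis m_closed)
    then show ?thesis using True assms(10) cr by auto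
  next
    case False
    \<comment> \<open>The combination of \<open>e1\<close> and \<open>e2\<close> is chosen so that
      all monomials without a surviving factor \<open>a\<close> cancel. What remains says that
      \<beta> is the cube of \<open>b \<oslash> c\<close> unless \<open>c\<close> is zero.\<close>
    have "a \<otimes> (c \<otimes> c \<otimes> c \<otimes> \<beta> \<ominus> b \<otimes> b \<otimes> b) = c \<otimes> e1 \<ominus> b \<otimes> e2"
      unfolding e1_def e2_def using cr by (simp add: ring_norm)
    also have "\<dots> = \<zero>" using e12 cr by simp
    finally have "c \<otimes> c \<otimes> c \<otimes> \<beta> \<ominus> b \<otimes> b \<otimes> b = \<zero>"
      using integral[of a] False cr by simp
    then have cb: "c \<otimes> c \<otimes> c \<otimes> \<beta> = b \<otimes> b \<otimes> b" using cr by simp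
    have "c = \<zero>"
    proof (rule ccontr)
      assume c0: "c \<noteq> \<zero>"
      have "(b \<oslash> c) \<otimes> (b \<oslash> c) \<otimes> (b \<oslash> c) = (b \<otimes> b \<otimes> b) \<oslash> (c \<otimes> c \<otimes> c)"
        using cr c0 by (simp add: field_norm)
      also have "\<dots> = \<beta>" unfolding cb[symmetric] using cr c0 by (simp add: field_norm)
      finally show False using nocube[OF cl(7)[OF assms(8,9)]] by blast
    qed
    moreover from this have "b = \<zero>" using cb cr integral by (metis m_closed l_null)
    ultimately show ?thesis using assms(10) cr by simp
  qed
qed

end

text \<open>A cube root \<open>d\<close> of \<beta> in the quadratic extension would have a norm
  \<open>n\<close> with \<open>n^3 = \<beta>^2\<close>, and then \<open>\<beta> \<oslash> n\<close>
  would be a cube root of \<beta> already in \<open>F\<close>. This is where 2 and 3 being coprime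
  enters.\<close>

lemma (in quadratic_extension) indep3_qspan:
  assumes "indep3 F w" "w \<in> carrier R" "w \<otimes> w \<otimes> w \<in> F"
  shows "indep3 (qspan F c) w"
proof (rule not_cube_indep3[OF qspan_subfield assms(2) refl])
  define \<beta> where "\<beta> = w \<otimes> w \<otimes> w"
  have b: "\<beta> \<in> F" "\<beta> \<in> carrier R" using assms cl unfolding \<beta>_def by auto
  then show "w \<otimes> w \<otimes> w \<in> qspan F c" using base_subset_qspan \<beta>_def by auto
  have b0: "\<beta> \<noteq> \<zero>"
    using indep3_not_cube[OF base assms(1,2), of \<zero>] cl unfolding \<beta>_def by auto
  fix d assume d: "d \<in> qspan F c"
  show "d \<otimes> d \<otimes> d \<noteq> w \<otimes> w \<otimes> w"
  proof
    assume e: "d \<otimes> d \<otimes> d = w \<otimes> w \<otimes> w"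
    define e where "e = conjugate d"
    have ed: "e \<in> qspan F c" "e \<in> carrier R" "d \<in> carrier R"
      unfolding e_def using d conjugate_closed qspan_carrier by auto
    note q = subfield_closed[OF qspan_subfield]
    have "e \<otimes> e \<otimes> e = conjugate (d \<otimes> d \<otimes> d)"
      unfolding e_def using conjugate_mult d q by simp
    also have "\<dots> = \<beta>" using e conjugate_base b unfolding \<beta>_def by simp
    finally have e3: "e \<otimes> e \<otimes> e = \<beta>" .
    have d3: "d \<otimes> d \<otimes> d = \<beta>" using e \<beta>_def by simp
    have n: "d \<otimes> e \<in> F" using norm_in_base[OF d] unfolding e_def .
    define n where "n = d \<otimes> e"
    have nc: "n \<in> carrier R" using ed unfolding n_def by simp
    have "n \<otimes> n \<otimes> n = (d \<otimes> d \<otimes> d) \<otimes> (e \<otimes> e \<otimes> e)"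
      unfolding n_def using ed by (simp add: ring_norm)
    then have n3: "n \<otimes> n \<otimes> n = \<beta> \<otimes> \<beta>" unfolding d3 e3 .
    then have n0: "n \<noteq> \<zero>" using b0 b integral by fastforce
    have "(\<beta> \<oslash> n) \<otimes> (\<beta> \<oslash> n) \<otimes> (\<beta> \<oslash> n) = (\<beta> \<otimes> \<beta> \<otimes> \<beta>) \<oslash> (n \<otimes> n \<otimes> n)"
      using n0 nc b by (simp add: field_norm)
    also have "\<dots> = \<beta>" unfolding n3 using b b0 by (simp add: field_norm)
    finally have "(\<beta> \<oslash> n) \<otimes> (\<beta> \<oslash> n) \<otimes> (\<beta> \<oslash> n) = w \<otimes> w \<otimes> w" unfolding \<beta>_def .
    moreover have "\<beta> \<oslash> n \<in> F" using cl(7) b(1) n unfolding n_def by blast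
    ultimately show False
      using indep3_not_cube[OF base assms(1,2)] by blast
  qed
qed

context field
begin

subsection \<open>Valuation rings\<close>

definition vring :: "'a set \<Rightarrow> 'a set \<Rightarrow> bool" where
  "vring F V \<longleftrightarrow> subfield F R \<and> subring V R \<and> V \<subseteq> F \<and> (\<forall>x \<in> F - {\<zero>}. x \<in> V \<or> inv x \<in> V)"

definition vunits :: "'a set \<Rightarrow> 'a set" where
  "vunits V = {x \<in> V. x \<noteq> \<zero> \<and> inv x \<in> V}"

definition vmax :: "'a set \<Rightarrow> 'a set" where
  "vmax V = {x \<in> V. x \<noteq> \<zero> \<longrightarrow> inv x \<notin> V}"

lemma vringD:
  assumes "vring F V"
  shows "subfield F R" "subring V R" "V \<subseteq> F" "\<zero> \<in> V" "\<one> \<in> V"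
    "\<And>x y. x \<in> V \<Longrightarrow> y \<in> V \<Longrightarrow> x \<oplus> y \<in> V" "\<And>x y. x \<in> V \<Longrightarrow> y \<in> V \<Longrightarrow> x \<otimes> y \<in> V"
    "\<And>x. x \<in> V \<Longrightarrow> \<ominus> x \<in> V" "\<And>x. x \<in> V \<Longrightarrow> x \<in> carrier R"
    "\<And>x. x \<in> F \<Longrightarrow> x \<in> carrier R"
    "\<And>x. x \<in> F \<Longrightarrow> x \<noteq> \<zero> \<Longrightarrow> x \<in> V \<or> inv x \<in> V" "\<And>x. x \<in> V \<Longrightarrow> x \<in> F"
proof -
  show a: "subfield F R" "subring V R" "V \<subseteq> F"
    using assms unfolding vring_def by auto
  show "\<zero> \<in> V" "\<one> \<in> V"
    "\<And>x y. x \<in> V \<Longrightarrow> y \<in> V \<Longrightarrow> x \<oplus> y \<in> V" "\<And>x y. x \<in> V \<Longrightarrow> y \<in> V \<Longrightarrow> x \<otimes> y \<in> V"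
    "\<And>x. x \<in> V \<Longrightarrow> \<ominus> x \<in> V"
    using subringE(2,3,5-7)[OF a(2)] by blast+
  show "\<And>x. x \<in> V \<Longrightarrow> x \<in> carrier R" "\<And>x. x \<in> F \<Longrightarrow> x \<in> carrier R" "\<And>x. x \<in> V \<Longrightarrow> x \<in> F"
    using subfieldE(3)[OF a(1)] a(3) by blast+
  show "\<And>x. x \<in> F \<Longrightarrow> x \<noteq> \<zero> \<Longrightarrow> x \<in> V \<or> inv x \<in> V"
    using assms unfolding vring_def by blast
qed

lemma Units_eq_vunits:
  assumes "subring V R" shows "Units (R\<lparr>carrier := V\<rparr>) = vunits V"
proof -
  have c: "V \<subseteq> carrier R" using subringE(1)[OF assms] .
  have "x \<noteq> \<zero> \<and> inv x = y" if "x \<in> V" "y \<in> V" "x \<otimes> y = \<one>" for x y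
    using that c by (metis comm_inv_char l_null one_not_zero subsetD)
  moreover have "x \<otimes> inv x = \<one>" "inv x \<otimes> x = \<one>" if "x \<in> V" "x \<noteq> \<zero>" for x
    using that c by auto
  ultimately show ?thesis
    unfolding Units_def vunits_def by (intro equalityI subsetI) (simp, blast, simp, blast)
qed

lemma vmax_eq_minus_vunits: "vmax V = V - vunits V"
  unfolding vmax_def vunits_def by auto

lemma vunits_iff: "x \<in> vunits V \<longleftrightarrow> x \<in> V \<and> x \<notin> vmax V"
  unfolding vmax_def vunits_def by auto

section \<open>Units and maximal ideal of a valuation ring\<close>

context
  fixes F V
  assumes V: "vring F V"
begin

interpretation V: subring V R using vringD(2)[OF V] .

lemmas vr = vringD[OF V]

lemma vmax_subset: "x \<in> vmax V \<Longrightarrow> x \<in> V" and vunits_subset: "x \<in> vunits V \<Longrightarrow> x \<in> V"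
  unfolding vmax_def vunits_def by auto

lemma vunits_carrier: "x \<in> vunits V \<Longrightarrow> x \<in> carrier R" "x \<in> vunits V \<Longrightarrow> x \<noteq> \<zero>"
  and vmax_carrier: "x \<in> vmax V \<Longrightarrow> x \<in> carrier R"
  using vr(9) unfolding vmax_def vunits_def by auto

lemma vunits_one: "\<one> \<in> vunits V"
  using vr(5) unfolding vunits_def by simp

lemma vunits_mult: "x \<in> vunits V \<Longrightarrow> y \<in> vunits V \<Longrightarrow> x \<otimes> y \<in> vunits V"
  unfolding vunits_def using vr(7,9) by (auto simp: integral_iff nonzero_inverse_mult_distrib)

lemma vunits_inv: "x \<in> vunits V \<Longrightarrow> inv x \<in> vunits V"
  unfolding vunits_def using vr(9) by (auto simp: nonzero_inverse_inverse_eq nonzero_imp_inverse_nonzero)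

lemma vunits_div: "x \<in> vunits V \<Longrightarrow> y \<in> vunits V \<Longrightarrow> x \<oslash> y \<in> vunits V"
  using vunits_mult vunits_inv vunits_carrier by (simp add: m_div_def)

lemma zero_in_vmax: "\<zero> \<in> vmax V" and one_notin_vmax: "\<one> \<notin> vmax V"
  using vr(4,5) unfolding vmax_def by auto

lemma vmax_mult: 
  assumes "x \<in> vmax V" "y \<in> V" shows "x \<otimes> y \<in> vmax V"
proof (cases "x \<otimes> y = \<zero>")
  case True then show ?thesis using zero_in_vmax by simp
next
  case False
  have c: "x \<in> carrier R" "y \<in> carrier R" "x \<in> V" using assms vmax_subset vr(9) by auto
  then have nz: "x \<noteq> \<zero>" "y \<noteq> \<zero>" using False by auto
  have "inv (x \<otimes> y) \<notin> V"
  proof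
    assume "inv (x \<otimes> y) \<in> V"
    then have "y \<otimes> inv (x \<otimes> y) \<in> V" using vr(7) assms(2) by blast
    also have "y \<otimes> inv (x \<otimes> y) = inv x"
      using c nz by (simp add: nonzero_inverse_mult_distrib m_assoc[symmetric])
    finally show False using assms(1) nz unfolding vmax_def by auto
  qed
  then show ?thesis using vr(7) c assms(2) unfolding vmax_def by auto
qed

lemma not_in_vring_inv: "x \<in> F \<Longrightarrow> x \<notin> V \<Longrightarrow> x \<noteq> \<zero> \<and> inv x \<in> vmax V"
  using vr(4) vr(11)[of x] vr(10)[of x] nonzero_inverse_inverse_eq[of x] unfolding vmax_def
  by (cases "x = \<zero>") auto

text \<open>Put \<open>w = 1 + x\<close>. If neither \<open>w\<close> nor \<open>x\<close> were a
  unit, then \<open>1/w = 1 - x/w\<close> and \<open>1/x = w/x - 1\<close> would both lie outside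
  \<open>V\<close>; but one of \<open>x/w\<close> and \<open>w/x\<close> lies in
  \<open>V\<close>.\<close>

lemma one_plus_vmax: 
  assumes "x \<in> vmax V" shows "\<one> \<oplus> x \<in> vunits V"
proof (rule ccontr)
  have x: "x \<in> V" "x \<in> carrier R" using assms vmax_subset vmax_carrier by auto
  assume "\<one> \<oplus> x \<notin> vunits V"
  moreover have in': "\<one> \<oplus> x \<in> V" using x vr(5,6) by blast
  ultimately have m: "\<one> \<oplus> x \<in> vmax V" using vunits_iff by blast
  show False
  proof (cases "x = \<zero> \<or> \<one> \<oplus> x = \<zero>")
    case True
    then show ?thesis
    proof
      assume "x = \<zero>" then show False using m one_notin_vmax by simp
    next
      assume "\<one> \<oplus> x = \<zero>"
      then have "x = \<ominus> \<one>" using x by (metis a_comm eq_neg_iff_add_eq_0 one_closed)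
      moreover have "\<ominus> \<one> \<otimes> \<ominus> \<one> = \<one>" by (simp add: l_minus r_minus)
      ultimately show False using vmax_mult[OF assms x(1)] one_notin_vmax by simp
    qed
  next
    case False
    define w where "w = \<one> \<oplus> x"
    have w: "w \<in> carrier R" "w \<noteq> \<zero>" "w \<in> vmax V" using x False m unfolding w_def by auto
    have wF: "w \<in> F" using in' vr(12) unfolding w_def by blast
    have xw: "x \<oslash> w \<in> F" "x \<oslash> w \<noteq> \<zero>"
      using x(2) w(1,2) False wF subfield_closed(7)[OF vr(1) vr(12)[OF x(1)] wF]
      by (simp_all add: m_div_def integral_iff nonzero_imp_inverse_nonzero)
    have i: "inv (x \<oslash> w) = w \<oslash> x" using x w False 
      by (simp add: m_div_def nonzero_inverse_mult_distrib nonzero_inverse_inverse_eq nonzero_imp_inverse_nonzero)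
    from vr(11)[OF xw(1,2)] i consider "x \<oslash> w \<in> V" | "w \<oslash> x \<in> V" by auto
    then show False
    proof cases
      case 1
      have "inv w = \<one> \<ominus> x \<oslash> w"
      proof -
        have "\<one> \<ominus> x \<oslash> w = (w \<ominus> x) \<oslash> w" using x(2) w(1,2) by (simp add: field_norm)
        also have "w \<ominus> x = \<one>" unfolding w_def using x(2) by (simp add: ring_norm)
        finally show ?thesis using w by (simp add: m_div_def)
      qed
      then have "inv w \<in> V" using 1 vr(5,6,8) by (simp add: a_minus_def)
      then show False using w unfolding vmax_def by auto
    next
      case 2
      have "inv x = w \<oslash> x \<ominus> \<one>"
      proof -
        have "w \<oslash> x \<ominus> \<one> = (w \<ominus> x) \<oslash> x" using x(2) w(1,2) False by (simp add: field_norm)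
        also have "w \<ominus> x = \<one>" unfolding w_def using x(2) by (simp add: ring_norm)
        finally show ?thesis using x False by (simp add: m_div_def)
      qed
      then have "inv x \<in> V" using 2 vr(5,6,8) by (simp add: a_minus_def)
      then show False using assms False unfolding vmax_def by auto
    qed
  qed
qed

text \<open>If the sum \<open>w\<close> were a unit, then \<open>x/w = 1 - y/w\<close> would be a
  unit by \<open>one_plus_vmax\<close> and at the same time an element of the maximal ideal.\<close>

lemma vmax_add:
  assumes "x \<in> vmax V" "y \<in> vmax V" shows "x \<oplus> y \<in> vmax V"
proof (rule ccontr)
  have xy: "x \<in> V" "x \<in> carrier R" "y \<in> V" "y \<in> carrier R" using assms vmax_subset vmax_carrier by auto
  define w where "w = x \<oplus> y"
  assume "x \<oplus> y \<notin> vmax V"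
  moreover have "x \<oplus> y \<in> V" using xy vr(6) by blast
  ultimately have w: "w \<in> vunits V" using vunits_iff unfolding w_def by blast
  have wc: "w \<in> carrier R" "w \<noteq> \<zero>" "inv w \<in> V"
    using vunits_carrier[OF w] vunits_subset[OF vunits_inv[OF w]] by simp_all
  have "x \<otimes> inv w \<in> vmax V" "y \<otimes> (\<ominus> (inv w)) \<in> vmax V"
    using vmax_mult assms wc vr(8) by blast+
  moreover have "\<one> \<oplus> y \<otimes> (\<ominus> (inv w)) = x \<otimes> inv w"
  proof -
    have "\<one> \<ominus> y \<oslash> w = (w \<ominus> y) \<oslash> w" using xy(4) wc(1,2) by (simp add: field_norm)
    also have "w \<ominus> y = x" unfolding w_def using xy(2,4) by (simp add: ring_norm)
    finally show ?thesis using xy wc by (simp add: m_div_def r_minus a_minus_def)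
  qed
  ultimately have "x \<otimes> inv w \<in> vunits V" "x \<otimes> inv w \<in> vmax V" using one_plus_vmax by fastforce+
  then show False using vunits_iff by blast
qed

lemma vmax_uminus: "x \<in> vmax V \<Longrightarrow> \<ominus> x \<in> vmax V"
  using vmax_mult[of x "\<ominus> \<one>"] vmax_carrier vr(5,8) by (simp add: r_minus)

lemma vmax_mult_right: "y \<in> V \<Longrightarrow> x \<in> vmax V \<Longrightarrow> y \<otimes> x \<in> vmax V"
  using vmax_mult[of x y] vmax_carrier vr(9) by (simp add: m_comm)

text \<open>The factors range over the whole field, not only over \<open>V\<close>: an element
  outside the maximal ideal has its inverse in \<open>V\<close>, so multiplication by it can be
  undone inside the ideal.\<close>

lemma vmax_prime:
  assumes "x \<in> F" "y \<in> F" "x \<notin> vmax V" "y \<notin> vmax V" shows "x \<otimes> y \<notin> vmax V"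
proof
  assume a: "x \<otimes> y \<in> vmax V"
  have c: "x \<in> carrier R" "y \<in> carrier R" "x \<noteq> \<zero>" using assms vr(10) zero_in_vmax by auto
  have "inv x \<in> V" using assms(1,3) c vr(11)[of x] unfolding vmax_def by auto
  then have "x \<otimes> y \<otimes> inv x \<in> vmax V" using vmax_mult a by blast
  also have "x \<otimes> y \<otimes> inv x = y" using c by (metis inv_closed m_assoc m_comm r_inv r_one)
  finally show False using assms by blast
qed

lemma place_ring_vmax: "place_ring F (vmax V) = V"
proof -
  have "x \<in> V \<longleftrightarrow> (x \<noteq> \<zero> \<longrightarrow> inv x \<notin> vmax V)" if "x \<in> F" for x
    using not_in_vring_inv[OF that] vr(10)[OF that] vr(4) unfolding vmax_def
    by (auto simp: nonzero_inverse_inverse_eq nonzero_imp_inverse_nonzero)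
  then show ?thesis unfolding place_ring_def using vr(12) by auto
qed

text \<open>Elements with quotient in \<open>vunits V\<close> have the same value in the (so far unnamed) value group.\<close>

lemma sum_same_value:
  assumes "x \<in> F" "y \<in> F" "x \<noteq> \<zero>" "y \<noteq> \<zero>" "x \<oslash> y \<notin> vunits V"
  shows "(x \<oplus> y) \<oslash> x \<in> vunits V \<or> (x \<oplus> y) \<oslash> y \<in> vunits V"
proof -
  have c: "x \<in> carrier R" "y \<in> carrier R" using assms vr(10) by auto
  have nz: "x \<oslash> y \<noteq> \<zero>" "x \<oslash> y \<in> F" using assms c subfield_closed(7)[OF vr(1), of x y]
    by (auto simp: m_div_def integral_iff nonzero_imp_inverse_nonzero)
  have i: "inv (x \<oslash> y) = y \<oslash> x" using c assms
    by (simp add: m_div_def nonzero_inverse_mult_distrib nonzero_inverse_inverse_eq nonzero_imp_inverse_nonzero)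
  consider "x \<oslash> y \<in> vmax V" | "y \<oslash> x \<in> vmax V"
    using not_in_vring_inv[OF nz(2)] i assms(5) vunits_iff by auto
  then show ?thesis
  proof cases
    case 1
    moreover have "(x \<oplus> y) \<oslash> y = \<one> \<oplus> x \<oslash> y" using c assms(4) by (simp add: field_norm)
    ultimately show ?thesis using one_plus_vmax by simp
  next
    case 2
    moreover have "(x \<oplus> y) \<oslash> x = \<one> \<oplus> y \<oslash> x" using c assms(3) by (simp add: field_norm)
    ultimately show ?thesis using one_plus_vmax by simp
  qed
qed

lemma same_value_trans:
  assumes "x \<in> F" "y \<in> F" "z \<in> F" "y \<noteq> \<zero>" "z \<noteq> \<zero>" "x \<oslash> y \<in> vunits V" "y \<oslash> z \<in> vunits V"
  shows "x \<oslash> z \<in> vunits V"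
proof -
  have c: "x \<in> carrier R" "y \<in> carrier R" "z \<in> carrier R" using assms vr(10) by auto
  have "x \<oslash> z = (x \<oslash> y) \<otimes> (y \<oslash> z)" using c assms(4,5) by (simp add: field_norm)
  then show ?thesis using vunits_mult assms by simp
qed

text \<open>Terms whose values are pairwise different, even after scaling by elements of
  \<open>K\<close>, cannot cancel, so a nonzero combination takes the value of one of its terms. The
  induction compares the head term with the partial sum of the rest.\<close>

lemma Span_same_value:
  assumes "subfield K R" "K \<subseteq> F" "set Us \<subseteq> F - {\<zero>}"
    and "sorted_wrt (\<lambda>u u'. \<forall>a \<in> K - {\<zero>}. (a \<otimes> u) \<oslash> u' \<notin> vunits V) Us"
    and "x \<in> Span K Us" "x \<noteq> \<zero>"
  shows "\<exists>a \<in> K - {\<zero>}. \<exists>u \<in> set Us. x \<oslash> (a \<otimes> u) \<in> vunits V"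
  using assms(3-6)
proof (induction Us arbitrary: x)
  case Nil then show ?case by simp
next
  case (Cons u Us)
  note kc = subfield_closed[OF assms(1)] and fc = subfield_closed[OF vr(1)]
  have uF: "u \<in> F" "u \<noteq> \<zero>" "u \<in> carrier R" using Cons.prems vr(10) by auto
  have "x \<in> line_extension K u (Span K Us)" using Cons.prems by simp
  then obtain a s where as: "a \<in> K" "s \<in> Span K Us" "x = a \<otimes> u \<oplus> s"
    unfolding line_extension_mem_iff by blast
  have usc: "set Us \<subseteq> F" "set Us \<subseteq> carrier R" using Cons.prems vr(10) by auto
  have "subalgebra K F R"
    using fc assms(2) subset_iff
    by (intro subalgebra.intro subgroup.intro subalgebra_axioms.intro)
      (auto simp flip: a_inv_def)
  then have sF: "s \<in> F" "s \<in> carrier R"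
    using subalgebra_Span_incl[OF assms(1) _ usc(1)] as(2) vr(10) by blast+
  have aF: "a \<in> F" "a \<in> carrier R" using as assms(2) kc by auto
  have IH: "\<exists>a \<in> K - {\<zero>}. \<exists>u \<in> set Us. s \<oslash> (a \<otimes> u) \<in> vunits V" if "s \<noteq> \<zero>"
    using Cons.IH[OF _ _ as(2) that] Cons.prems by auto
  show ?case
  proof (cases "a = \<zero>")
    case True
    then have "x = s" using as sF uF by simp
    with IH Cons.prems(4) show ?thesis by auto
  next
    case a0: False
    show ?thesis
    proof (cases "s = \<zero>")
      case True
      then have "x \<oslash> (a \<otimes> u) = \<one>" using as(3) aF uF a0 by (simp add: m_div_def integral_iff)
      then have "x \<oslash> (a \<otimes> u) \<in> vunits V" using vunits_one by simp
      with as(1) a0 show ?thesis by auto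
    next
      case False
      from IH[OF this] obtain b u' where b: "b \<in> K" "b \<noteq> \<zero>" "u' \<in> set Us" "s \<oslash> (b \<otimes> u') \<in> vunits V"
        by auto
      have u': "u' \<in> F" "u' \<in> carrier R" "u' \<noteq> \<zero>" using b usc Cons.prems(1) by auto
      have bF: "b \<in> F" "b \<in> carrier R" using b assms(2) kc by auto
      have bu: "b \<otimes> u' \<in> F" "b \<otimes> u' \<noteq> \<zero>" using bF u' fc(4) b(2) integral_iff by auto
      have au: "a \<otimes> u \<in> F" "a \<otimes> u \<noteq> \<zero>" using aF uF fc(4) a0 integral_iff by auto
      \<comment> \<open>By induction \<open>s\<close> has the value of some
        \<open>b \<otimes> u'\<close>; equality of values here would make \<open>u\<close> and
        \<open>u'\<close> comparable through the scalar \<open>a \<oslash> b\<close>, which the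
        sortedness hypothesis forbids.\<close>
      have "(a \<otimes> u) \<oslash> s \<notin> vunits V"
      proof
        assume "(a \<otimes> u) \<oslash> s \<in> vunits V"
        from same_value_trans[OF au(1) sF(1) bu(1) False bu(2) this b(4)]
        have "(a \<otimes> u) \<oslash> (b \<otimes> u') \<in> vunits V" .
        also have "(a \<otimes> u) \<oslash> (b \<otimes> u') = ((a \<oslash> b) \<otimes> u) \<oslash> u'"
          using aF(2) bF(2) uF(3) u'(2,3) b(2) by (simp add: field_norm)
        finally have "((a \<oslash> b) \<otimes> u) \<oslash> u' \<in> vunits V" .
        moreover have "a \<oslash> b \<in> K - {\<zero>}"
          using kc(7)[OF as(1) b(1)] aF bF a0 b(2)
          by (auto simp: m_div_def integral_iff nonzero_imp_inverse_nonzero)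
        ultimately show False using Cons.prems(2) b(3) by auto
      qed
      from sum_same_value[OF au(1) sF(1) au(2) False this] as(3)
      have "x \<oslash> (a \<otimes> u) \<in> vunits V \<or> x \<oslash> s \<in> vunits V" by simp
      then show ?thesis
      proof
        assume "x \<oslash> (a \<otimes> u) \<in> vunits V"
        then show ?thesis using as(1) a0 by auto
      next
        assume "x \<oslash> s \<in> vunits V"
        moreover have "x \<in> F" using as(3) au sF fc(3) by simp
        ultimately have "x \<oslash> (b \<otimes> u') \<in> vunits V"
          using same_value_trans[OF _ sF(1) bu(1) False bu(2) _ b(4)] by blast
        then show ?thesis using b by auto
      qed
    qed
  qed
qed

text \<open>A dependency expresses one element through later ones, and
  \<open>Span_same_value\<close> gives it the value of a scalar multiple of one of them.
  Discreteness of places and the bound on ramification indices both rest on this.\<close>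

lemma independent_of_values:
  assumes "subfield K R" "K \<subseteq> F" "set Us \<subseteq> F - {\<zero>}"
    and "sorted_wrt (\<lambda>u u'. \<forall>a \<in> K - {\<zero>}. (a \<otimes> u) \<oslash> u' \<notin> vunits V) Us"
  shows "independent K Us"
  using assms(3,4)
proof (induction Us)
  case Nil then show ?case by simp
next
  case (Cons u Us)
  note kc = subfield_closed[OF assms(1)]
  have uF: "u \<in> F" "u \<noteq> \<zero>" "u \<in> carrier R" using Cons.prems vr(10) by auto
  have "u \<notin> Span K Us"
  proof
    assume "u \<in> Span K Us"
    from Span_same_value[OF assms(1,2) _ _ this uF(2)] Cons.prems
    obtain a u' where a: "a \<in> K" "a \<noteq> \<zero>" "u' \<in> set Us" "u \<oslash> (a \<otimes> u') \<in> vunits V" by auto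
    have c: "a \<in> carrier R" "u' \<in> carrier R" "u' \<noteq> \<zero>" using a kc Cons.prems vr(10) by auto
    have "u \<oslash> (a \<otimes> u') = (inv a \<otimes> u) \<oslash> u'"
      using c a uF by (simp add: m_div_def nonzero_inverse_mult_distrib m_ac integral_iff)
    moreover have "inv a \<in> K - {\<zero>}" using kc(8) a c nonzero_imp_inverse_nonzero by auto
    ultimately show False using a Cons.prems(2) by auto
  qed
  with Cons uF show ?case by (intro li_Cons) auto
qed

end

subsection \<open>Places of function fields are discrete\<close>

lemma finite_dimension_independent_bound:
  assumes "subfield K R" "finite_dimension K E"
    and "\<And>n::nat. independent K (Us n)" "\<And>n. set (Us n) \<subseteq> E" "\<And>n. length (Us n) = n"
  shows False
proof -
  obtain d where "dimension d K E" using assms(2) by (auto elim: finite_dimensionE')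
  from independent_length_le_dimension[OF assms(1) this assms(3)[of "Suc d"] assms(4)] assms(5)
  show False by simp
qed

lemma div_nonzero: "x \<in> carrier R \<Longrightarrow> y \<in> carrier R \<Longrightarrow> x \<noteq> \<zero> \<Longrightarrow> y \<noteq> \<zero> \<Longrightarrow> x \<oslash> y \<noteq> \<zero>"
  by (simp add: m_div_def integral_iff nonzero_imp_inverse_nonzero)

lemma inv_div: "x \<in> carrier R \<Longrightarrow> y \<in> carrier R \<Longrightarrow> x \<noteq> \<zero> \<Longrightarrow> y \<noteq> \<zero> \<Longrightarrow> inv (x \<oslash> y) = y \<oslash> x"
  by (simp add: m_div_def nonzero_inverse_mult_distrib nonzero_inverse_inverse_eq nonzero_imp_inverse_nonzero)

lemma pow_nonzero: "x \<in> carrier R \<Longrightarrow> x \<noteq> \<zero> \<Longrightarrow> x [^] (n::nat) \<noteq> \<zero>"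
  by (induction n) (auto simp: integral_iff)

text \<open>Quotients of powers are powers again, so it is enough to compare the positive powers of
  \<open>x\<close> with scalars.\<close>

lemma independent_powers:
  assumes "vring F V" "subfield K R" "K \<subseteq> F" "x \<in> F" "x \<noteq> \<zero>"
    and "\<And>d a. 0 < d \<Longrightarrow> a \<in> K - {\<zero>} \<Longrightarrow> d < n \<Longrightarrow> a \<otimes> x [^] (d::nat) \<notin> vunits V"
  shows "independent K (exp_base x n)"
proof (rule independent_of_values[OF assms(1-3)])
  note vr = vringD[OF assms(1)]
  have x: "x \<in> carrier R" using assms(4) vr by auto
  show "set (exp_base x n) \<subseteq> F - {\<zero>}"
    using subfield_closed(9)[OF vr(1) assms(4)] pow_nonzero[OF x assms(5)] by (auto simp: exp_base_def)
  have *: "(a \<otimes> x [^] i) \<oslash> x [^] j \<notin> vunits V" if aj: "a \<in> K - {\<zero>}" "j < i" "i < n" for a and i j :: nat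
  proof -
    have a: "a \<in> carrier R" using aj assms(3) vr(10) by auto
    obtain d where d: "i = j + d" "d > 0" using aj(2) by (metis less_imp_add_positive)
    have "x [^] i = x [^] j \<otimes> x [^] d" unfolding d using x by (simp add: nat_pow_mult)
    moreover define xj xd where "xj = x [^] j" and "xd = x [^] d"
    moreover have "(a \<otimes> (xj \<otimes> xd)) \<oslash> xj = a \<otimes> xd"
    proof -
      have "xj \<in> carrier R" "xd \<in> carrier R" "xj \<noteq> \<zero>"
        unfolding xj_def xd_def using x pow_nonzero[OF x assms(5)] by auto
      with a show ?thesis by (simp add: field_norm)
    qed
    ultimately have "(a \<otimes> x [^] i) \<oslash> x [^] j = a \<otimes> x [^] d" by simp
    then show ?thesis using assms(6)[OF d(2) aj(1)] d aj(3) by simp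
  qed
  have "sorted_wrt (<) [0..<n]" by simp
  then have "sorted_wrt (\<lambda>j i. \<forall>a\<in>K - {\<zero>}. (a \<otimes> x [^] i) \<oslash> x [^] j \<notin> vunits V) [0..<n]"
    by (rule sorted_wrt_mono_rel[rotated]) (use * in auto)
  then show "sorted_wrt (\<lambda>u u'. \<forall>a\<in>K - {\<zero>}. (a \<otimes> u) \<oslash> u' \<notin> vunits V) (exp_base x n)"
    by (simp add: exp_base_def sorted_wrt_map sorted_wrt_rev)
qed

lemma vmax_pow:
  assumes "vring F V" "x \<in> vmax V" "0 < n" shows "x [^] (n::nat) \<in> vmax V"
proof -
  obtain m where n: "n = Suc m" using assms(3) by (cases n) auto
  have V: "x \<in> V" "x \<in> carrier R" using vmax_subset[OF assms(1,2)] vmax_carrier[OF assms(1,2)] by auto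
  have "x [^] m \<in> V"
    using V vringD(5,7)[OF assms(1)] by (induction m) auto
  then show ?thesis unfolding n using vmax_mult_right[OF assms(1) _ assms(2)] by simp
qed

text \<open>Valuation rings are integrally closed: the nonzero elements of \<kappa> are units of
  \<open>V\<close>, so for \<open>x\<close> outside \<open>V\<close> all powers of \<open>x\<close>
  have values that differ modulo scalars. They would be independent, although the simple extension
  is finite.\<close>

lemma algebraic_in_vring:
  assumes "vring F V" "subfield \<kappa> R" "\<kappa> \<subseteq> V" "x \<in> F" "(algebraic over \<kappa>) x"
  shows "x \<in> V"
proof (rule ccontr)
  note vr = vringD[OF assms(1)]
  assume nV: "x \<notin> V"
  have x: "x \<in> carrier R" "x \<noteq> \<zero>" and m: "inv x \<in> vmax V"
    using not_in_vring_inv[OF assms(1,4) nV] assms(4) vr by auto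
  have "independent \<kappa> (exp_base x n)" for n
  proof (rule independent_powers[OF assms(1,2)])
    show "\<kappa> \<subseteq> F" using assms(3) vr(3) by auto
    show "x \<in> F" "x \<noteq> \<zero>" by fact+
    fix d :: nat and a assume d: "0 < d" and a: "a \<in> \<kappa> - {\<zero>}"
    have ac: "a \<in> carrier R" "a \<noteq> \<zero>" "a \<in> V" using a assms(3) vr(9) by auto
    show "a \<otimes> x [^] d \<notin> vunits V"
    proof
      assume "a \<otimes> x [^] d \<in> vunits V"
      then have "(a \<otimes> x [^] d) \<otimes> inv x [^] d \<in> vmax V"
        using vmax_mult_right[OF assms(1) vunits_subset[OF assms(1)] vmax_pow[OF assms(1) m d]] by blast
      also have "(a \<otimes> x [^] d) \<otimes> inv x [^] d = a"
        using ac x by (simp add: m_assoc flip: nat_pow_distrib)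
      finally have "a \<in> vmax V" .
      moreover have "inv a \<in> V" using subfield_closed(8)[OF assms(2)] a assms(3) by auto
      ultimately show False using ac unfolding vmax_def by auto
    qed
  qed
  moreover have "set (exp_base x n) \<subseteq> simple_extension \<kappa> x" for n
    using subfield_closed(9)[of "simple_extension \<kappa> x" x] simple_extension_is_subfield[OF assms(2) x(1)] assms(5)
      simple_extension_mem[OF subfieldE(1)[OF assms(2)] x(1)] by (auto simp: exp_base_def)
  moreover have "finite_dimension \<kappa> (simple_extension \<kappa> x)"
    using finite_dimension_simple_extension[OF assms(2) x(1)] assms(5) by blast
  ultimately show False
    using finite_dimension_independent_bound[OF assms(2), of "simple_extension \<kappa> x" "exp_base x"]
    by (simp add: exp_base_def)
qed

lemma subfield_units:
  assumes "subfield \<kappa> R" "\<kappa> \<subseteq> V" "a \<in> \<kappa>" "a \<noteq> \<zero>" shows "a \<in> vunits V"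
  using subfield_closed(8)[OF assms(1,3,4)] assms unfolding vunits_def by auto

lemma generate_field_quotient:
  assumes "subfield k R" "y \<in> carrier R" "a \<in> generate_field R (insert y k)"
  shows "\<exists>p\<in>simple_extension k y. \<exists>q\<in>simple_extension k y. q \<noteq> \<zero> \<and> a = p \<oslash> q"
proof -
  let ?E = "simple_extension k y"
  have E: "subring ?E R" using simple_extension_is_subring[OF subfieldE(1)[OF assms(1)] assms(2)] .
  note Ec = subringE[OF E]
  have Ecar: "x \<in> carrier R" if "x \<in> ?E" for x using that Ec(1) by blast
  have kE: "k \<subseteq> ?E" "y \<in> ?E"
    using simple_extension_incl[OF subfieldE(3)[OF assms(1)] assms(2)]
      simple_extension_mem[OF subfieldE(1)[OF assms(1)] assms(2)] by auto
  have triv: "\<exists>p\<in>?E. \<exists>q\<in>?E. q \<noteq> \<zero> \<and> x = p \<oslash> q" if "x \<in> ?E" for x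
    using that Ec(3) Ecar by (intro bexI[of _ x] bexI[of _ \<one>]) auto
  from assms(3) show ?thesis
  proof (induction rule: generate_field.induct)
    case one then show ?case using triv Ec(3) by blast
  next
    case (incl h) then show ?case using triv kE by blast
  next
    case (a_inv h)
    then obtain p q where "p \<in> ?E" "q \<in> ?E" "q \<noteq> \<zero>" "h = p \<oslash> q" by blast
    then show ?case using Ec(5) Ecar by (intro bexI[of _ "\<ominus> p"] bexI[of _ q]) auto
  next
    case (m_inv h)
    then obtain p q where pq: "p \<in> ?E" "q \<in> ?E" "q \<noteq> \<zero>" "h = p \<oslash> q" by blast
    then have "p \<noteq> \<zero>" using m_inv(2) Ecar by (auto simp: m_div_def)
    then have "inv h = q \<oslash> p" using inv_div pq Ecar by auto
    then show ?case using pq \<open>p \<noteq> \<zero>\<close> by blast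
  next
    case (eng_add g h)
    then obtain p q p' q' where pq: "p \<in> ?E" "q \<in> ?E" "q \<noteq> \<zero>" "g = p \<oslash> q" "p' \<in> ?E" "q' \<in> ?E" "q' \<noteq> \<zero>" "h = p' \<oslash> q'"
      by blast
    then have cr: "p \<in> carrier R" "q \<in> carrier R" "p' \<in> carrier R" "q' \<in> carrier R" using Ecar by auto
    have "g \<oplus> h = (p \<otimes> q' \<oplus> p' \<otimes> q) \<oslash> (q \<otimes> q')"
      unfolding pq(4,8) using cr pq(3,7) by (simp add: field_norm)
    moreover have "q \<otimes> q' \<noteq> \<zero>" using cr pq integral_iff by simp
    moreover have "p \<otimes> q' \<oplus> p' \<otimes> q \<in> ?E" "q \<otimes> q' \<in> ?E" using pq Ec(6,7) by auto
    ultimately show ?case by blast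
  next
    case (eng_mult g h)
    then obtain p q p' q' where pq: "p \<in> ?E" "q \<in> ?E" "q \<noteq> \<zero>" "g = p \<oslash> q" "p' \<in> ?E" "q' \<in> ?E" "q' \<noteq> \<zero>" "h = p' \<oslash> q'"
      by blast
    then have cr: "p \<in> carrier R" "q \<in> carrier R" "p' \<in> carrier R" "q' \<in> carrier R" using Ecar by auto
    have "g \<otimes> h = (p \<otimes> p') \<oslash> (q \<otimes> q')"
      unfolding pq(4,8) using cr pq(3,7) by (simp add: field_norm)
    moreover have "q \<otimes> q' \<noteq> \<zero>" using cr pq integral_iff by simp
    moreover have "p \<otimes> p' \<in> ?E" "q \<otimes> q' \<in> ?E" using pq Ec(6,7) by auto
    ultimately show ?case by blast
  qed
qed

text \<open>Induction along Horner's rule. A nonzero constant term is a unit and dominates the rest,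
  which lies in the maximal ideal; if the constant term is zero, a factor \<open>y\<close> splits
  off.\<close>

lemma simple_extension_value:
  assumes "vring F V" "subfield k R" "k \<subseteq> V" "y \<in> vmax V" "y \<noteq> \<zero>" "a \<in> simple_extension k y" "a \<noteq> \<zero>"
  shows "\<exists>n::nat. \<exists>u\<in>vunits V. a = u \<otimes> y [^] n"
  using assms(6,7)
proof (induction rule: simple_extension.induct)
  case zero then show ?case by simp
next
  case (lin b c)
  note vr = vringD[OF assms(1)]
  have y: "y \<in> carrier R" using vmax_carrier[OF assms(1,4)] .
  have kc: "k \<subseteq> carrier R" using subfieldE(3)[OF assms(2)] .
  have b: "b \<in> carrier R" "c \<in> carrier R"
    using simple_extension_in_carrier[OF kc y] lin.hyps kc by auto
  show ?case
  proof (cases "c = \<zero>")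
    case True
    then have "b \<noteq> \<zero>" using lin.prems b y by auto
    then obtain n u where nu: "u \<in> vunits V" "b = u \<otimes> y [^] (n::nat)" using lin.IH by blast
    then have "b \<otimes> y \<oplus> c = u \<otimes> y [^] Suc n"
      using True y vunits_carrier[OF assms(1)] by (simp add: m_assoc)
    then show ?thesis using nu by blast
  next
    case False
    have cu: "c \<in> vunits V" using subfield_units[OF assms(2,3) lin.hyps(2) False] .
    have bV: "b \<in> V"
    proof (cases "b = \<zero>")
      case True then show ?thesis using vr(4) by simp
    next
      case False
      then obtain n u where nu: "u \<in> vunits V" "b = u \<otimes> y [^] (n::nat)" using lin.IH by blast
      have "y [^] n \<in> V" using vmax_subset[OF assms(1,4)] vr(5,7) by (induction n) auto
      then show ?thesis using nu vr(7) vunits_subset[OF assms(1)] by blast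
    qed
    have "(b \<otimes> y) \<otimes> inv c \<in> vmax V"
      using vmax_mult[OF assms(1) vmax_mult_right[OF assms(1) bV assms(4)]]
        vunits_subset[OF assms(1) vunits_inv[OF assms(1) cu]] by blast
    from vunits_mult[OF assms(1) cu one_plus_vmax[OF assms(1) this]]
    have "c \<otimes> (\<one> \<oplus> (b \<otimes> y) \<otimes> inv c) \<in> vunits V" .
    also have "c \<otimes> (\<one> \<oplus> (b \<otimes> y) \<otimes> inv c) = b \<otimes> y \<oplus> c"
    proof -
      have "c \<otimes> (\<one> \<oplus> (b \<otimes> y) \<oslash> c) = b \<otimes> y \<oplus> c"
        using b y False by (simp add: field_norm)
      then show ?thesis using False by (simp add: m_div_def)
    qed
    finally have "b \<otimes> y \<oplus> c \<in> vunits V" .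
    then show ?thesis using b y by (intro exI[of _ 0] bexI[of _ "b \<otimes> y \<oplus> c"]) auto
  qed
qed

text \<open>Elements of \<open>k(y)\<close> are fractions of polynomials in \<open>y\<close>, so
  their values are integer multiples of the value of \<open>y\<close>. The two alternatives stand
  for the two signs of the exponent.\<close>

lemma generate_field_value:
  assumes "vring F V" "subfield k R" "k \<subseteq> V" "y \<in> vmax V" "y \<noteq> \<zero>" "a \<in> generate_field R (insert y k)" "a \<noteq> \<zero>"
  shows "\<exists>n::nat. \<exists>u\<in>vunits V. a = u \<otimes> y [^] n \<or> a = u \<oslash> y [^] n"
proof -
  have y: "y \<in> carrier R" using vmax_carrier[OF assms(1,4)] .
  obtain p q where pq: "p \<in> simple_extension k y" "q \<in> simple_extension k y" "q \<noteq> \<zero>" "a = p \<oslash> q"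
    using generate_field_quotient[OF assms(2) y assms(6)] by blast
  have pc: "p \<in> carrier R" "q \<in> carrier R"
    using simple_extension_in_carrier[OF subfieldE(3)[OF assms(2)] y] pq by auto
  then have "p \<noteq> \<zero>" using pq assms(7) by (auto simp: m_div_def)
  then obtain i u where u: "u \<in> vunits V" "p = u \<otimes> y [^] (i::nat)"
    using simple_extension_value[OF assms(1-5) pq(1)] by blast
  obtain j w where w: "w \<in> vunits V" "q = w \<otimes> y [^] (j::nat)"
    using simple_extension_value[OF assms(1-5) pq(2,3)] by blast
  note uc = vunits_carrier[OF assms(1) u(1)] vunits_carrier[OF assms(1) w(1)]
  have uw: "u \<oslash> w \<in> vunits V" using vunits_div[OF assms(1) u(1) w(1)] .
  define yi where "yi = y [^] i"
  define yj where "yj = y [^] j"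
  have yc: "yi \<in> carrier R" "yj \<in> carrier R" "yi \<noteq> \<zero>" "yj \<noteq> \<zero>"
    using pow_nonzero[OF y assms(5)] y unfolding yi_def yj_def by auto
  have a: "a = (u \<otimes> yi) \<oslash> (w \<otimes> yj)" using pq(4) u w unfolding yi_def yj_def by simp
  show ?thesis
  proof (cases "j \<le> i")
    case True
    define yd where "yd = y [^] (i - j)"
    have d: "yi = yj \<otimes> yd" "yd \<in> carrier R"
      unfolding yi_def yj_def yd_def using True y by (simp_all add: nat_pow_mult)
    have "a = (u \<oslash> w) \<otimes> yd" unfolding a d(1) using uc yc d(2) by (simp add: field_norm)
    then show ?thesis using uw unfolding yd_def by blast
  next
    case False
    define yd where "yd = y [^] (j - i)"
    have d: "yj = yi \<otimes> yd" "yd \<in> carrier R"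
      unfolding yi_def yj_def yd_def using False y by (simp_all add: nat_pow_mult)
    then have "yd \<noteq> \<zero>" using yc by auto
    then have "a = (u \<oslash> w) \<oslash> yd" unfolding a d(1) using uc yc d(2) by (simp add: field_norm)
    then show ?thesis using uw unfolding yd_def by blast
  qed
qed

lemma finite_dimension_over_intermediate:
  assumes "subfield K R" "subfield M R" "subfield L R" "K \<subseteq> M" "M \<subseteq> L" "finite_dimension K L"
  shows "finite_dimension M L"
  using assms(6) dimension_over_intermediate[OF assms(1-5)] finite_dimensionI
  by (metis finite_dimensionE')

lemma function_fieldE:
  assumes "function_field k F"
  obtains x where "subfield k R" "subfield F R" "k \<subseteq> F" "x \<in> F" "(transcendental over k) x"
    "finite_dimension (generate_field R (insert x k)) F"
  using assms unfolding function_field_def field_extension_def by blast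

lemma generate_field_inv:
  assumes "subfield k R" "x \<in> carrier R" "x \<noteq> \<zero>"
  shows "generate_field R (insert (inv x) k) = generate_field R (insert x k)"
proof -
  have *: "generate_field R (insert (inv x) k) \<subseteq> generate_field R (insert x k)"
    if "x \<in> carrier R" "x \<noteq> \<zero>" for x
  proof (rule generate_field_min_subfield1)
    have s: "insert x k \<subseteq> carrier R" using that subfieldE(3)[OF assms(1)] by auto
    show "insert (inv x) k \<subseteq> carrier R" using that subfieldE(3)[OF assms(1)] by auto
    show sf: "subfield (generate_field R (insert x k)) R" using generate_field_is_subfield[OF s] .
    have "x \<in> generate_field R (insert x k)" by (simp add: generate_field.incl)
    then show "insert (inv x) k \<subseteq> generate_field R (insert x k)"
      using that generate_field.m_inv by (auto intro: generate_field.incl)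
  qed
  show ?thesis using *[OF assms(2,3)] *[of "inv x"] assms nonzero_imp_inverse_nonzero nonzero_inverse_inverse_eq by auto
qed

text \<open>If \<open>y = p(x)\<close>, then \<open>x\<close> is a root of \<open>p(X) - y\<close>.
  This polynomial over \<open>k(y)\<close> is not zero, because \<open>p\<close> has its
  coefficients in \<open>k\<close> while \<open>y\<close> lies outside \<open>k\<close>.\<close>

lemma algebraic_over_value:
  assumes "subfield k R" "x \<in> carrier R" "y \<in> simple_extension k x" "y \<notin> k"
  shows "(algebraic over (generate_field R (insert y k))) x"
proof -
  let ?K = "generate_field R (insert y k)"
  have y: "y \<in> carrier R" using simple_extension_in_carrier[OF subfieldE(3)[OF assms(1)] assms(2)] assms(3) by auto
  have K: "subfield ?K R" using generate_field_is_subfield y subfieldE(3)[OF assms(1)] by simp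
  have yK: "y \<in> ?K" "k \<subseteq> ?K" by (auto intro: generate_field.incl)
  have y0: "y \<noteq> \<zero>" using assms(4) subfield_closed(1)[OF assms(1)] by auto
  obtain p where p: "p \<in> carrier (k[X])" "y = eval p x"
    using simple_extension_as_eval_img[OF subfieldE(3)[OF assms(1)] assms(2)] assms(3) by auto
  interpret KX: ring "?K[X]" using univ_poly_is_ring[OF subfieldE(1)[OF K]] .
  interpret ev: ring_hom_ring "?K[X]" R "\<lambda>p. eval p x"
    using eval_ring_hom[OF subfieldE(1)[OF K] assms(2)] .
  have pK: "p \<in> carrier (?K[X])" using p(1) yK(2) unfolding univ_poly_def polynomial_def by auto
  have yX: "[y] \<in> carrier (?K[X])" using yK(1) y0 unfolding univ_poly_def polynomial_def by auto
  define q where "q = p \<ominus>\<^bsub>?K[X]\<^esub> [y]"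
  have q: "q \<in> carrier (?K[X])" unfolding q_def using pK yX by simp
  have evy: "eval [y] x = y" using y assms(2) by simp
  have "eval q x = eval p x \<ominus> eval [y] x"
    unfolding q_def a_minus_def using pK yX ev.hom_a_inv ev.hom_add by simp
  then have "eval q x = \<zero>" using p(2) evy y by simp
  moreover have "q \<noteq> []"
  proof
    assume "q = []"
    then have "p \<ominus>\<^bsub>?K[X]\<^esub> [y] = \<zero>\<^bsub>?K[X]\<^esub>" unfolding q_def by (simp add: univ_poly_zero)
    then have "p = [y]" using KX.eq_diff0 pK yX by blast
    then show False using p(1) assms(4) unfolding univ_poly_def polynomial_def by auto
  qed
  ultimately show ?thesis using algebraicI[OF q] by blast
qed

lemma vring_contains_generate_field:
  assumes "vring F V" "subfield k R" "k \<subseteq> V" "x \<in> V"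
    and "\<And>y. y \<in> simple_extension k x \<Longrightarrow> y \<noteq> \<zero> \<Longrightarrow> y \<in> vunits V"
  shows "generate_field R (insert x k) \<subseteq> V"
proof
  fix a assume "a \<in> generate_field R (insert x k)"
  then obtain p q where pq: "p \<in> simple_extension k x" "q \<in> simple_extension k x" "q \<noteq> \<zero>" "a = p \<oslash> q"
    using generate_field_quotient[OF assms(2)] vringD(9)[OF assms(1,4)] by blast
  have "q \<in> vunits V" using assms(5) pq by blast
  moreover have "p \<in> V" using assms(5)[OF pq(1)] vringD(4)[OF assms(1)] vunits_subset[OF assms(1)] by blast
  ultimately show "a \<in> V"
    using pq vringD(7)[OF assms(1)] vunits_subset[OF assms(1) vunits_inv[OF assms(1)]] by (simp add: m_div_def)
qed

text \<open>Discreteness will be measured against \<open>k(y)\<close>, which requires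
  \<open>y\<close> in the maximal ideal and \<open>F\<close> finite over \<open>k(y)\<close>. A
  given transcendental generator is first inverted if it is not in \<open>V\<close>; a nonunit
  polynomial in it then serves as \<open>y\<close>, and the generator is algebraic over
  \<open>k(y)\<close>.\<close>

lemma exists_base_of_vring:
  assumes "function_field k F" "vring F V" "k \<subseteq> V" "V \<noteq> F"
  obtains y where "y \<in> vmax V" "y \<noteq> \<zero>" "finite_dimension (generate_field R (insert y k)) F"
proof -
  note vr = vringD[OF assms(2)]
  obtain x' where x': "subfield k R" "subfield F R" "k \<subseteq> F" "x' \<in> F"
    "(transcendental over k) x'" "finite_dimension (generate_field R (insert x' k)) F"
    using function_fieldE[OF assms(1)] .
  have "\<exists>x\<in>V. finite_dimension (generate_field R (insert x k)) F"
  proof (cases "x' \<in> V")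
    case True then show ?thesis using x' by blast
  next
    case False
    then have "x' \<noteq> \<zero>" "inv x' \<in> V"
      using not_in_vring_inv[OF assms(2) x'(4)] vmax_subset[OF assms(2)] by auto
    then show ?thesis using generate_field_inv[OF x'(1) vr(10)[OF x'(4)]] x'(6) by metis
  qed
  then obtain x where x: "x \<in> V" "finite_dimension (generate_field R (insert x k)) F" by blast
  have xc: "x \<in> carrier R" "x \<in> F" using x vr(9,12) by auto
  let ?K1 = "generate_field R (insert x k)"
  have kc: "insert x k \<subseteq> carrier R" using xc subfieldE(3)[OF x'(1)] by auto
  have K1: "subfield ?K1 R" using generate_field_is_subfield[OF kc] .
  have xK1: "insert x k \<subseteq> ?K1" by (auto intro: generate_field.incl)
  \<comment> \<open>If all nonzero polynomials in \<open>x\<close> were units, \<open>V\<close>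
    would contain \<open>k(x)\<close> and with it every element algebraic over \<open>k(x)\<close>,
    that is, all of \<open>F\<close>.\<close>
  have "\<exists>y\<in>simple_extension k x. y \<noteq> \<zero> \<and> y \<notin> vunits V"
  proof (rule ccontr)
    assume "\<not> ?thesis"
    then have K1V: "?K1 \<subseteq> V" using vring_contains_generate_field[OF assms(2) x'(1) assms(3) x(1)] by blast
    have "F \<subseteq> V"
    proof
      fix z assume z: "z \<in> F"
      have "(algebraic over ?K1) z"
        using finite_dimension_imp_algebraic[OF K1 subfieldE(1)[OF x'(2)] x(2) z] .
      then show "z \<in> V" using algebraic_in_vring[OF assms(2) K1 K1V z] by blast
    qed
    then show False using assms(4) vr(3) by auto
  qed
  then obtain y where y: "y \<in> simple_extension k x" "y \<noteq> \<zero>" "y \<notin> vunits V" by blast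
  have "simple_extension k x \<subseteq> V"
    using simple_extension_minimal[OF subfieldE(1)[OF x'(1)] xc(1)] vr(2) assms(3) x(1) by blast
  then have yV: "y \<in> V" "y \<in> vmax V" using y vunits_iff by auto
  have yk: "y \<notin> k" using subfield_units[OF x'(1) assms(3)] y by blast
  let ?K = "generate_field R (insert y k)"
  have ycr: "y \<in> carrier R" "y \<in> F" using yV vr(9,12) by auto
  have yc: "insert y k \<subseteq> carrier R" using subfieldE(3)[OF x'(1)] ycr by auto
  have K: "subfield ?K R" using generate_field_is_subfield[OF yc] .
  have alg: "(algebraic over ?K) x" using algebraic_over_value[OF x'(1) xc(1) y(1) yk] .
  let ?K2 = "simple_extension ?K x"
  have K2: "subfield ?K2 R" using simple_extension_is_subfield[OF K xc(1)] alg by blast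
  have f1: "finite_dimension ?K ?K2" using finite_dimension_simple_extension[OF K xc(1)] alg by blast
  have KF: "?K \<subseteq> F"
    by (rule generate_field_min_subfield1[OF yc x'(2)]) (use x'(3) ycr in auto)
  have KK2: "?K \<subseteq> ?K2" "x \<in> ?K2"
    using simple_extension_incl[OF subfieldE(3)[OF K] xc(1)] simple_extension_mem[OF subfieldE(1)[OF K] xc(1)] by auto
  have K12: "?K1 \<subseteq> ?K2"
  proof (rule generate_field_min_subfield1[OF kc K2])
    have "k \<subseteq> ?K" by (auto intro: generate_field.incl)
    then show "insert x k \<subseteq> ?K2" using KK2 by auto
  qed
  have K2F: "?K2 \<subseteq> F"
    using simple_extension_minimal[OF subfieldE(1)[OF K] xc(1)] subfieldE(1)[OF x'(2)] KF xc(2) by blast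
  have f2: "finite_dimension ?K2 F"
    using finite_dimension_over_intermediate[OF K1 K2 x'(2) K12 K2F x(2)] .
  have "finite_dimension ?K F" using telescopic_base_dim(1)[OF K K2 f1 f2] .
  then show thesis using that yV y(2) by blast
qed

text \<open>For a nonzero base the integer powers of the ring are those of its multiplicative group,
  whose power laws can therefore be taken over.\<close>

lemma int_pow_eq_mult_of:
  assumes "t \<in> carrier R" "t \<noteq> \<zero>"
  shows "t [^] (n::int) = t [^]\<^bsub>Multiplicative_Group.mult_of R\<^esub> n"
proof -
  have i: "inv\<^bsub>Multiplicative_Group.mult_of R\<^esub> (t [^] (m::nat)) = inv (t [^] m)" for m
    by (rule m_inv_mult_of) (use assms pow_nonzero[OF assms, of m] in simp)
  then show ?thesis
    unfolding int_pow_def2[where G = R and a = t and z = n]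
      int_pow_def2[where G = "Multiplicative_Group.mult_of R" and a = t and z = n]
      Multiplicative_Group.nat_pow_mult_of
    by (simp only: i)
qed

lemma int_pow_nonzero:
  assumes "t \<in> carrier R" "t \<noteq> \<zero>"
  shows "t [^] (n::int) \<in> carrier R" "t [^] (n::int) \<noteq> \<zero>"
proof -
  interpret G: group "Multiplicative_Group.mult_of R" by (rule field_mult_group)
  have "t [^]\<^bsub>Multiplicative_Group.mult_of R\<^esub> n \<in> carrier (Multiplicative_Group.mult_of R)"
    using G.int_pow_closed assms by simp
  then show "t [^] (n::int) \<in> carrier R" "t [^] (n::int) \<noteq> \<zero>"
    using int_pow_eq_mult_of[OF assms] by auto
qed

lemma int_pow_add:
  assumes "t \<in> carrier R" "t \<noteq> \<zero>"
  shows "t [^] (m + n :: int) = t [^] m \<otimes> t [^] n"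
proof -
  interpret G: group "Multiplicative_Group.mult_of R" by (rule field_mult_group)
  show ?thesis using G.int_pow_mult[of t m n] assms int_pow_eq_mult_of[OF assms] by simp
qed

lemma int_pow_distrib:
  assumes "t \<in> carrier R" "t \<noteq> \<zero>" "w \<in> carrier R" "w \<noteq> \<zero>"
  shows "(t \<otimes> w) [^] (n :: int) = t [^] n \<otimes> w [^] n"
proof -
  interpret G: group "Multiplicative_Group.mult_of R" by (rule field_mult_group)
  have "t \<otimes> w \<noteq> \<zero>" "t \<otimes> w \<in> carrier R" using assms integral_iff by auto
  then show ?thesis
    using G.int_pow_mult_distrib[of t w n] assms int_pow_eq_mult_of m_comm by simp
qed

text \<open>The values of the \<open>t i\<close> decrease strictly from that of \<open>y\<close> and
  stay positive, while values on \<open>k(y)\<close> are multiples of the value of \<open>y\<close>.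
  So no two of them agree modulo scalars, and a finite extension of \<open>k(y)\<close> would
  contain arbitrarily many independent elements.\<close>

lemma no_infinite_descent:
  assumes "vring F V" "subfield k R" "k \<subseteq> V" "y \<in> vmax V" "y \<noteq> \<zero>"
    and "finite_dimension (generate_field R (insert y k)) F"
    and "t 0 = y" "\<And>i::nat. t i \<in> vmax V" "\<And>i. t i \<noteq> \<zero>" "\<And>i. t i \<oslash> t (Suc i) \<in> vmax V"
  shows False
proof -
  let ?K = "generate_field R (insert y k)"
  note vr = vringD[OF assms(1)]
  have yc: "y \<in> carrier R" using vmax_carrier[OF assms(1,4)] .
  have tc: "t i \<in> carrier R" "t i \<in> V" for i
    using vmax_carrier[OF assms(1) assms(8)] vmax_subset[OF assms(1) assms(8)] by auto
  have kc: "insert y k \<subseteq> carrier R" using yc subfieldE(3)[OF assms(2)] by auto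
  have K: "subfield ?K R" using generate_field_is_subfield[OF kc] .
  have KF: "?K \<subseteq> F"
    by (rule generate_field_min_subfield1[OF kc vr(1)]) (use assms(3,4) vr(3) vmax_subset[OF assms(1)] in auto)
  have lt: "t i \<oslash> t (i + Suc d) \<in> vmax V" for i d
  proof (induction d)
    case 0 then show ?case using assms(10) by simp
  next
    case (Suc d)
    have "t i \<oslash> t (i + Suc (Suc d)) = (t i \<oslash> t (i + Suc d)) \<otimes> (t (i + Suc d) \<oslash> t (Suc (i + Suc d)))"
    proof -
      define a b c where "a = t i" and "b = t (i + Suc d)" and "c = t (Suc (i + Suc d))"
      have abc: "a \<in> carrier R" "b \<in> carrier R" "c \<in> carrier R" "b \<noteq> \<zero>" "c \<noteq> \<zero>"
        unfolding a_def b_def c_def using tc assms(9) by auto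
      have "a \<oslash> c = (a \<oslash> b) \<otimes> (b \<oslash> c)" using abc by (simp add: field_norm)
      then show ?thesis unfolding a_def b_def c_def by simp
    qed
    then show ?case using vmax_mult[OF assms(1) Suc vmax_subset[OF assms(1) assms(10)]] by simp
  qed
  have yt: "y \<oslash> t i \<in> V" for i
  proof (cases i)
    case 0 then show ?thesis using assms(5,7) yc vr(5) by (simp add: m_div_def)
  next
    case (Suc d) then show ?thesis using lt[of 0 d] assms(7) vmax_subset[OF assms(1)] by simp
  qed
  have yn: "y [^] (n::nat) \<in> V" for n
    using vmax_subset[OF assms(1,4)] vr(5,7) by (induction n) auto
  have inc: "(a \<otimes> t i) \<oslash> t j \<notin> vunits V" if aij: "a \<in> ?K - {\<zero>}" "i < j" for a i j
  proof
    assume un: "(a \<otimes> t i) \<oslash> t j \<in> vunits V"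
    define w where "w = (a \<otimes> t i) \<oslash> t j"
    obtain d where j: "j = i + Suc d" using aij(2) less_iff_Suc_add by auto
    have ac: "a \<in> carrier R" "a \<noteq> \<zero>" using aij KF vr(10) by auto
    obtain n u where nu: "u \<in> vunits V" "a = u \<otimes> y [^] (n::nat) \<or> a = u \<oslash> y [^] n"
      using generate_field_value[OF assms(1-5), of a] aij by blast
    have uc: "u \<in> carrier R" "u \<in> V" using vunits_carrier[OF assms(1) nu(1)] vunits_subset[OF assms(1) nu(1)] by auto
    have pc: "y [^] n \<in> carrier R" using yc by simp
    have aV: "a \<notin> V"
    proof
      assume "a \<in> V"
      then have "a \<otimes> (t i \<oslash> t j) \<in> vmax V" using vmax_mult_right[OF assms(1) _ lt] j by blast
      moreover have "a \<otimes> (t i \<oslash> t j) = (a \<otimes> t i) \<oslash> t j" using ac tc assms(9) by (simp add: m_div_def m_assoc)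
      ultimately show False using un vunits_iff by simp
    qed
    with nu(2) have a: "a = u \<oslash> y [^] n" using vr(7)[OF uc(2) yn] by auto
    have "n \<noteq> 0" using aV a uc by (intro notI) simp
    then obtain m where m: "n = Suc m" by (cases n) auto
    define ym where "ym = y [^] m"
    define ti tj where "ti = t i" and "tj = t j"
    have cr: "ym \<in> carrier R" "ym \<noteq> \<zero>" "ym \<in> V" "ti \<in> carrier R" "tj \<in> carrier R" "ti \<noteq> \<zero>" "tj \<noteq> \<zero>"
      "w \<in> carrier R" "w \<in> V"
      unfolding ym_def ti_def tj_def w_def
      using pow_nonzero[OF yc assms(5)] yn tc assms(9) yc vunits_carrier[OF assms(1) un] vunits_subset[OF assms(1) un] by auto
    have w: "w = ((u \<oslash> (ym \<otimes> y)) \<otimes> ti) \<oslash> tj"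
      unfolding w_def a m ym_def ti_def tj_def by simp
    \<comment> \<open>Solving for \<open>u\<close> exhibits the unit \<open>u\<close> as a multiple
      of \<open>t j\<close>: the factors \<open>w\<close>, \<open>ym\<close> and
      \<open>y \<oslash> t i\<close> lie in \<open>V\<close>, and \<open>t j\<close> lies in the
      maximal ideal.\<close>
    have "u = w \<otimes> ym \<otimes> (y \<oslash> ti) \<otimes> tj"
      unfolding w using cr(1,2,4-7) uc(1) yc assms(5) by (simp add: field_norm)
    also have "\<dots> \<in> vmax V"
      using vmax_mult_right[OF assms(1) vr(7)[OF vr(7)[OF cr(9,3)] yt] assms(8)]
      unfolding ti_def tj_def .
    finally show False using nu(1) vunits_iff by blast
  qed
  have "independent ?K (map t [0..<n])" for n
  proof (rule independent_of_values[OF assms(1) K KF])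
    show "set (map t [0..<n]) \<subseteq> F - {\<zero>}" using tc vr(12) assms(9) by auto
    have "sorted_wrt (<) [0..<n]" by simp
    then have "sorted_wrt (\<lambda>i j. \<forall>a\<in>?K - {\<zero>}. (a \<otimes> t i) \<oslash> t j \<notin> vunits V) [0..<n]"
      by (rule sorted_wrt_mono_rel[rotated]) (use inc in auto)
    then show "sorted_wrt (\<lambda>u u'. \<forall>a\<in>?K - {\<zero>}. (a \<otimes> u) \<oslash> u' \<notin> vunits V) (map t [0..<n])"
      by (simp add: sorted_wrt_map)
  qed
  then show False
    using finite_dimension_independent_bound[OF K assms(6), of "\<lambda>n. map t [0..<n]"] tc vr(12) by auto
qed

text \<open>An element of least positive value, expressed by quotients;
  \<open>uniformizer_iff\<close> translates this into generating the maximal ideal.\<close>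

definition vuniformizer :: "'a set \<Rightarrow> 'a \<Rightarrow> bool" where
  "vuniformizer V t \<longleftrightarrow> t \<in> vmax V \<and> t \<noteq> \<zero> \<and> (\<forall>z\<in>vmax V. z \<oslash> t \<in> V)"

text \<open>Divide by \<open>t\<close> as long as the quotient stays in the maximal ideal. At the
  first exit the quotient is still in \<open>V\<close>, since the preceding one was in the ideal and
  \<open>t\<close> has least positive value; hence it is a unit.\<close>

lemma vuniformizer_least_power:
  assumes "vring F V" "vuniformizer V t" "z \<in> V" "z \<oslash> t [^] (i::nat) \<notin> vmax V"
  shows "\<exists>n::nat. \<exists>u\<in>vunits V. z = t [^] n \<otimes> u"
proof -
  note vr = vringD[OF assms(1)]
  have t: "t \<in> carrier R" "t \<noteq> \<zero>" and z: "z \<in> carrier R"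
    using assms vmax_carrier[OF assms(1)] vr(9) unfolding vuniformizer_def by auto
  define m where "m = (LEAST i::nat. z \<oslash> t [^] i \<notin> vmax V)"
  have m: "z \<oslash> t [^] m \<notin> vmax V"
    unfolding m_def by (rule LeastI[of "\<lambda>i. z \<oslash> t [^] i \<notin> vmax V", OF assms(4)])
  have m': "z \<oslash> t [^] j \<in> vmax V" if "j < m" for j
    using not_less_Least[of j "\<lambda>i. z \<oslash> t [^] i \<notin> vmax V"] that unfolding m_def by simp
  define tm where "tm = t [^] m"
  have tm: "tm \<in> carrier R" "tm \<noteq> \<zero>" unfolding tm_def using t pow_nonzero by auto
  have "z \<oslash> tm \<in> V"
  proof (cases m)
    case 0 then show ?thesis using assms(3) z unfolding tm_def by simp
  next
    case (Suc j)
    define tj where "tj = t [^] j"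
    have tj: "tj \<in> carrier R" "tj \<noteq> \<zero>" "tm = tj \<otimes> t" unfolding tj_def tm_def using t pow_nonzero Suc by auto
    have "z \<oslash> tm = (z \<oslash> tj) \<oslash> t" unfolding tj(3) using tj(1,2) t z by (simp add: field_norm)
    then show ?thesis using m'[of j] Suc assms(2) unfolding vuniformizer_def tj_def by simp
  qed
  then have "z \<oslash> tm \<in> vunits V" using m vunits_iff unfolding tm_def by blast
  moreover have "z = tm \<otimes> (z \<oslash> tm)" using z tm by (simp add: field_norm)
  ultimately show ?thesis unfolding tm_def by blast
qed

lemma exists_vuniformizer:
  assumes "function_field k F" "vring F V" "k \<subseteq> V" "V \<noteq> F"
  obtains t where "vuniformizer V t"
    "\<And>z. z \<in> V \<Longrightarrow> z \<noteq> \<zero> \<Longrightarrow> \<exists>n::nat. \<exists>u\<in>vunits V. z = t [^] n \<otimes> u"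
proof -
  note vr = vringD[OF assms(2)]
  have k: "subfield k R" using assms(1) by (auto elim: function_fieldE)
  obtain y where y: "y \<in> vmax V" "y \<noteq> \<zero>" "finite_dimension (generate_field R (insert y k)) F"
    using exists_base_of_vring[OF assms] .
  have yc: "y \<in> carrier R" "y \<in> V" using vmax_carrier[OF assms(2)] vmax_subset[OF assms(2)] y by auto
  note descent = no_infinite_descent[OF assms(2) k assms(3) y]
  \<comment> \<open>Otherwise every element of positive value has one of smaller positive value
    below it, and dependent choice starting at \<open>y\<close> builds a forbidden descent.\<close>
  have "\<exists>t. vuniformizer V t"
  proof (rule ccontr)
    assume "\<not> ?thesis"
    then have step: "\<exists>z\<in>vmax V. z \<oslash> s \<notin> V" if "s \<in> vmax V" "s \<noteq> \<zero>" for s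
      using that unfolding vuniformizer_def by blast
    have "\<exists>f. \<forall>n. (f n \<in> vmax V \<and> f n \<noteq> \<zero> \<and> (n = 0 \<longrightarrow> f n = y)) \<and> f n \<oslash> f (Suc n) \<in> vmax V"
    proof (rule dependent_nat_choice)
      show "\<exists>x. x \<in> vmax V \<and> x \<noteq> \<zero> \<and> ((0::nat) = 0 \<longrightarrow> x = y)" using y by blast
      fix s and n :: nat assume s: "s \<in> vmax V \<and> s \<noteq> \<zero> \<and> (n = 0 \<longrightarrow> s = y)"
      then obtain z where z: "z \<in> vmax V" "z \<oslash> s \<notin> V" using step by blast
      have c: "z \<in> carrier R" "s \<in> carrier R" "z \<in> F" "s \<in> F"
        using z s vmax_carrier[OF assms(2)] vmax_subset[OF assms(2)] vr(12) by auto
      have "z \<oslash> s \<in> F" using subfield_closed(7)[OF vr(1) c(3,4)] .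
      then have *: "z \<oslash> s \<noteq> \<zero>" "inv (z \<oslash> s) \<in> vmax V" using not_in_vring_inv[OF assms(2) _ z(2)] by auto
      then have "z \<noteq> \<zero>" using c s by (auto simp: m_div_def)
      then have "s \<oslash> z \<in> vmax V" using * inv_div[of z s] c s by simp
      then show "\<exists>z. (z \<in> vmax V \<and> z \<noteq> \<zero> \<and> (Suc n = 0 \<longrightarrow> z = y)) \<and> s \<oslash> z \<in> vmax V"
        using z \<open>z \<noteq> \<zero>\<close> by blast
    qed
    then obtain f where "f 0 = y" "\<And>n. f n \<in> vmax V" "\<And>n. f n \<noteq> \<zero>" "\<And>n. f n \<oslash> f (Suc n) \<in> vmax V"
      by blast
    then show False by (rule descent)
  qed
  then obtain t where t: "vuniformizer V t" by blast
  have tc: "t \<in> carrier R" "t \<noteq> \<zero>" "t \<in> vmax V" using t vmax_carrier[OF assms(2)] unfolding vuniformizer_def by auto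
  \<comment> \<open>The elements \<open>y \<oslash> t [^] i\<close> would themselves be a descent
    starting at \<open>y\<close>, the quotient of consecutive members being
    \<open>t\<close>.\<close>
  have "\<exists>i. y \<oslash> t [^] (i::nat) \<notin> vmax V"
  proof (rule ccontr)
    assume "\<not> ?thesis"
    then have all: "y \<oslash> t [^] i \<in> vmax V" for i :: nat by blast
    show False
    proof (rule descent)
      show "y \<oslash> t [^] (0::nat) = y" using yc by simp
      show "y \<oslash> t [^] i \<in> vmax V" for i :: nat by (rule all)
      show "y \<oslash> t [^] i \<noteq> \<zero>" for i :: nat
        using div_nonzero[OF yc(1) _ y(2)] pow_nonzero[OF tc(1,2)] tc(1) by simp
      show "(y \<oslash> t [^] i) \<oslash> (y \<oslash> t [^] Suc i) \<in> vmax V" for i :: nat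
      proof -
        define ti where "ti = t [^] i"
        have ti: "ti \<in> carrier R" "ti \<noteq> \<zero>" unfolding ti_def using tc pow_nonzero by auto
        have tt: "ti \<otimes> t \<noteq> \<zero>" "ti \<otimes> t \<in> carrier R" using ti tc integral_iff by auto
        have "(y \<oslash> ti) \<oslash> (y \<oslash> (ti \<otimes> t)) = (y \<oslash> ti) \<otimes> ((ti \<otimes> t) \<oslash> y)"
          using inv_div[OF yc(1) tt(2) y(2) tt(1)] div_nonzero[OF yc(1) tt(2) y(2) tt(1)] by (simp add: m_div_def)
        also have "\<dots> = t" using yc(1) y(2) ti tc(1) by (simp add: field_norm)
        finally show ?thesis using tc(3) unfolding ti_def by simp
      qed
    qed
  qed
  then obtain m w where w: "w \<in> vunits V" "y = t [^] (m::nat) \<otimes> w"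
    using vuniformizer_least_power[OF assms(2) t yc(2)] by blast
  have wc: "w \<in> carrier R" "w \<noteq> \<zero>" using vunits_carrier[OF assms(2) w(1)] by auto
  let ?K = "generate_field R (insert y k)"
  have kc: "insert y k \<subseteq> carrier R" using yc subfieldE(3)[OF k] by auto
  have K: "subfield ?K R" using generate_field_is_subfield[OF kc] .
  have KF: "?K \<subseteq> F"
    by (rule generate_field_min_subfield1[OF kc vr(1)]) (use assms(3) vr(3) yc in auto)
  have "\<exists>n::nat. \<exists>u\<in>vunits V. z = t [^] n \<otimes> u" if z: "z \<in> V" "z \<noteq> \<zero>" for z
  proof -
    have zc: "z \<in> carrier R" "z \<in> F" using z vr(9,12) by auto
    \<comment> \<open>For general \<open>z\<close> the descent lemma does not apply, as it has to
      start at \<open>y\<close>. But \<open>y\<close> is a power of \<open>t\<close> times a unit,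
      so \<open>z\<close> would be divisible by every power of \<open>y\<close>, and the powers of
      \<open>z\<close> would be independent over \<open>k(y)\<close>.\<close>
    have "\<exists>i. z \<oslash> t [^] (i::nat) \<notin> vmax V"
    proof (rule ccontr)
      assume "\<not> ?thesis"
      then have all: "z \<oslash> t [^] i \<in> vmax V" for i :: nat by blast
      have zm: "z \<in> vmax V" using all[of 0] zc by simp
      have ay: "z \<oslash> y [^] n \<in> vmax V" for n :: nat
      proof -
        define tn where "tn = t [^] (m * n)"
        define wn where "wn = w [^] n"
        have wnu: "wn \<in> vunits V"
          unfolding wn_def using w(1) vunits_mult[OF assms(2)] vunits_one[OF assms(2)] by (induction n) auto
        then have wn: "inv wn \<in> V" "wn \<in> carrier R" "wn \<noteq> \<zero>"
          using vunits_carrier[OF assms(2) wnu] vunits_subset[OF assms(2) vunits_inv[OF assms(2) wnu]] by simp_all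
        have tn: "tn \<in> carrier R" "tn \<noteq> \<zero>" unfolding tn_def using tc pow_nonzero by auto
        have yn: "y [^] n = tn \<otimes> wn"
          unfolding w(2) tn_def wn_def using tc wc by (simp add: nat_pow_distrib nat_pow_pow)
        have "z \<oslash> (tn \<otimes> wn) = (z \<oslash> tn) \<otimes> inv wn"
          using zc tn wn by (simp add: m_div_def integral_iff nonzero_inverse_mult_distrib m_ac)
        then show ?thesis using vmax_mult[OF assms(2) all wn(1)] unfolding yn tn_def by simp
      qed
      have "independent ?K (exp_base z n)" for n
      proof (rule independent_powers[OF assms(2) K KF zc(2) z(2)])
        fix d :: nat and a assume d: "0 < d" and a: "a \<in> ?K - {\<zero>}"
        obtain e where e: "d = Suc e" using d by (cases d) auto
        have ze: "z [^] e \<in> V" using z(1) vr(5,7) by (induction e) auto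
        obtain n u where nu: "u \<in> vunits V" "a = u \<otimes> y [^] (n::nat) \<or> a = u \<oslash> y [^] n"
          using generate_field_value[OF assms(2) k assms(3) y(1,2), of a] a by blast
        have uV: "u \<in> V" "u \<in> carrier R" using vunits_subset[OF assms(2) nu(1)] vunits_carrier[OF assms(2) nu(1)] by auto
        have yn: "y [^] n \<in> V" using yc(2) vr(5,7) by (induction n) auto
        have yn': "y [^] n \<noteq> \<zero>" "y [^] n \<in> carrier R" using pow_nonzero yc y by auto
        from nu(2) have "a \<otimes> z [^] d \<in> vmax V"
        proof
          assume "a = u \<otimes> y [^] n"
          then show ?thesis
            using vmax_mult_right[OF assms(2) vr(7)[OF uV(1) yn] vmax_pow[OF assms(2) zm d]] by simp
        next
          assume a: "a = u \<oslash> y [^] n"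
          have "a \<otimes> z [^] d = (u \<otimes> z [^] e) \<otimes> (z \<oslash> y [^] n)"
            unfolding a e using uV zc yn' by (simp add: m_div_def m_ac)
          then show ?thesis using vmax_mult_right[OF assms(2) vr(7)[OF uV(1) ze] ay] by simp
        qed
        then show "a \<otimes> z [^] d \<notin> vunits V" using vunits_iff by blast
      qed
      moreover have "set (exp_base z n) \<subseteq> F" for n
        using subfield_closed(9)[OF vr(1) zc(2)] by (auto simp: exp_base_def)
      ultimately show False
        using finite_dimension_independent_bound[OF K y(3), of "exp_base z"] by (simp add: exp_base_def)
    qed
    then show ?thesis using vuniformizer_least_power[OF assms(2) t z(1)] by blast
  qed
  then show thesis using that t by blast
qed

text \<open>A normalised discrete valuation with ring \<open>V\<close>. The ultrametric inequality
  is not postulated, since it follows from \<open>V\<close> being a ring; the value at zero is left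
  unconstrained, and the element of value 1 fixes the scaling.\<close>

definition dval :: "'a set \<Rightarrow> 'a set \<Rightarrow> ('a \<Rightarrow> int) \<Rightarrow> bool" where
  "dval F V v \<longleftrightarrow> vring F V \<and> (\<forall>x\<in>F - {\<zero>}. \<forall>y\<in>F - {\<zero>}. v (x \<otimes> y) = v x + v y) \<and>
     (\<forall>x\<in>F - {\<zero>}. x \<in> V \<longleftrightarrow> 0 \<le> v x) \<and> (\<exists>t\<in>F - {\<zero>}. v t = 1)"

section \<open>Places as maximal ideals of valuation rings\<close>

lemma placesE:
  assumes "P \<in> places k F" "subfield F R"
  shows "vring F (place_ring F P)" "P = vmax (place_ring F P)" "k \<subset> place_ring F P" "place_ring F P \<subset> F"
proof -
  obtain V where V: "valuation_ring k F V" "P = V - Units (R\<lparr>carrier := V\<rparr>)"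
    using assms unfolding places_def by blast
  then have vr: "vring F V" and P: "P = vmax V"
    using assms Units_eq_vunits[of V] vmax_eq_minus_vunits[of V] unfolding valuation_ring_def vring_def by auto
  then have "place_ring F P = V" using place_ring_vmax by simp
  then show "vring F (place_ring F P)" "P = vmax (place_ring F P)" "k \<subset> place_ring F P" "place_ring F P \<subset> F"
    using vr P V(1) unfolding valuation_ring_def by auto
qed

lemma placesI:
  assumes "vring F V" "k \<subseteq> V" "k \<noteq> V" "V \<noteq> F"
  shows "vmax V \<in> places k F"
proof -
  have "valuation_ring k F V" using assms unfolding valuation_ring_def vring_def by auto
  moreover have "vmax V = V - Units (R\<lparr>carrier := V\<rparr>)"
    using assms Units_eq_vunits[of V] vmax_eq_minus_vunits[of V] vringD(2) by simp
  ultimately show ?thesis unfolding places_def by blast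
qed

text \<open>The existence assumption keeps the maximal ideal from being zero; otherwise
  \<open>\<zero>\<close> would generate it and satisfy \<open>uniformizer\<close>.\<close>

lemma uniformizer_iff:
  assumes "vring F V" "\<exists>t. vuniformizer V t"
  shows "uniformizer F (vmax V) t \<longleftrightarrow> vuniformizer V t"
proof
  note vr = vringD[OF assms(1)]
  obtain s where s: "s \<in> vmax V" "s \<noteq> \<zero>" using assms(2) unfolding vuniformizer_def by blast
  assume "uniformizer F (vmax V) t"
  then have t: "t \<in> vmax V" "vmax V = {t \<otimes> z | z. z \<in> V}"
    unfolding uniformizer_def place_ring_vmax[OF assms(1)] by auto
  have tc: "t \<in> carrier R" using vmax_carrier[OF assms(1) t(1)] .
  obtain z where z: "z \<in> V" "s = t \<otimes> z" using s(1) t(2) by blast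
  then have t0: "t \<noteq> \<zero>" using s vr(9) by auto
  have "z \<oslash> t \<in> V" if zm: "z \<in> vmax V" for z
  proof -
    obtain w where "w \<in> V" "z = t \<otimes> w" using zm t(2) by blast
    moreover have "(t \<otimes> w) \<oslash> t = w"
    proof -
      have "w \<in> carrier R" using \<open>w \<in> V\<close> vr(9) by blast
      with tc t0 show ?thesis by (simp add: field_norm)
    qed
    ultimately have "z \<oslash> t = w" by simp
    then show ?thesis using \<open>w \<in> V\<close> by simp
  qed
  then show "vuniformizer V t" using t t0 unfolding vuniformizer_def by blast
next
  note vr = vringD[OF assms(1)]
  assume t: "vuniformizer V t"
  then have tc: "t \<in> carrier R" "t \<in> vmax V" "t \<noteq> \<zero>" using vmax_carrier[OF assms(1)] unfolding vuniformizer_def by auto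
  have "vmax V = {t \<otimes> z | z. z \<in> V}"
  proof (intro equalityI subsetI)
    fix z assume z: "z \<in> vmax V"
    then have zc: "z \<in> carrier R" using vmax_carrier[OF assms(1)] by blast
    have "z = t \<otimes> (z \<oslash> t)" using zc tc(1,3) by (simp add: field_norm)
    then show "z \<in> {t \<otimes> z | z. z \<in> V}" using t z unfolding vuniformizer_def by blast
  next
    fix x assume "x \<in> {t \<otimes> z | z. z \<in> V}"
    then show "x \<in> vmax V" using vmax_mult[OF assms(1) tc(2)] by blast
  qed
  then show "uniformizer F (vmax V) t"
    using tc unfolding uniformizer_def place_ring_vmax[OF assms(1)] by blast
qed

lemma vunits_int_pow:
  assumes "vring F V" "w \<in> vunits V" shows "w [^] (n::int) \<in> vunits V"
proof -
  have "w [^] (m::nat) \<in> vunits V" for m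
    using assms(2) vunits_mult[OF assms(1)] vunits_one[OF assms(1)] by (induction m) auto
  then show ?thesis
    using vunits_inv[OF assms(1)] by (cases "n < 0") (simp_all only: int_pow_def2 if_True if_False)
qed

text \<open>The task is to justify the definite description in \<open>place_val\<close>: every
  nonzero element is an integer power of a uniformizer times a unit, and the exponent depends
  neither on the representation nor on the uniformizer.\<close>

lemma dval_place_val:
  assumes "function_field k F" "P \<in> places k F"
  shows "dval F (place_ring F P) (place_val F P)"
proof -
  have F: "subfield F R" using assms(1) by (auto elim: function_fieldE)
  define V where "V = place_ring F P"
  have V: "vring F V" "P = vmax V" "k \<subseteq> V" "V \<noteq> F"
    using placesE[OF assms(2) F] unfolding V_def by auto
  note vr = vringD[OF V(1)]
  obtain t where t: "vuniformizer V t" "\<And>z. z \<in> V \<Longrightarrow> z \<noteq> \<zero> \<Longrightarrow> \<exists>n::nat. \<exists>u\<in>vunits V. z = t [^] n \<otimes> u"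
    using exists_vuniformizer[OF assms(1) V(1,3,4)] by blast
  have tc: "t \<in> carrier R" "t \<noteq> \<zero>" "t \<in> vmax V" "t \<in> F"
    using t(1) vmax_carrier[OF V(1)] vmax_subset[OF V(1)] vr(12) unfolding vuniformizer_def by auto
  have ex: "\<exists>n::int. \<exists>u\<in>vunits V. x = t [^] n \<otimes> u" if x: "x \<in> F" "x \<noteq> \<zero>" for x
  proof (cases "x \<in> V")
    case True
    then obtain n u where "u \<in> vunits V" "x = t [^] (n::nat) \<otimes> u" using t(2) x by blast
    then show ?thesis by (intro exI[of _ "int n"] bexI[of _ u]) (auto simp: int_pow_int)
  next
    case False
    have xc: "x \<in> carrier R" "inv x \<in> V" "inv x \<noteq> \<zero>"
      using x vr(10) not_in_vring_inv[OF V(1) x(1) False] vmax_subset[OF V(1)] nonzero_imp_inverse_nonzero by auto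
    then obtain n u where nu: "u \<in> vunits V" "inv x = t [^] (n::nat) \<otimes> u" using t(2) by blast
    have "x = inv (t [^] n \<otimes> u)" using nu(2) nonzero_inverse_inverse_eq[OF xc(1) x(2)] by simp
    also have "\<dots> = inv (t [^] n) \<otimes> inv u"
      using nu(1) vunits_carrier[OF V(1)] tc pow_nonzero nonzero_inverse_mult_distrib
      by (simp add: m_comm)
    also have "inv (t [^] n) = t [^] (- int n)"
      by (cases "n = 0") (simp_all add: int_pow_def2[where a = t and G = R and z = "- int n"])
    finally show ?thesis using vunits_inv[OF V(1) nu(1)] by blast
  qed
  have pos: "n \<ge> 0 \<longleftrightarrow> t [^] n \<otimes> u \<in> V" if u: "u \<in> vunits V" for n :: int and u
  proof
    assume "n \<ge> 0"
    then have "t [^] n = t [^] nat n" by simp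
    moreover have "t [^] (m::nat) \<in> V" for m
      using vmax_subset[OF V(1) tc(3)] vr(5,7) by (induction m) auto
    ultimately show "t [^] n \<otimes> u \<in> V" using vr(7) vunits_subset[OF V(1) u] by simp
  next
    have uc: "u \<in> carrier R" "u \<noteq> \<zero>" "inv u \<in> V"
      using vunits_carrier[OF V(1) u] vunits_subset[OF V(1) vunits_inv[OF V(1) u]] by auto
    assume "t [^] n \<otimes> u \<in> V"
    then have "(t [^] n \<otimes> u) \<otimes> inv u \<in> V" using vr(7) uc by blast
    then have tn: "t [^] n \<in> V" using uc int_pow_nonzero[OF tc(1,2)] by (simp add: m_assoc)
    show "n \<ge> 0"
    proof (rule ccontr)
      assume n: "\<not> n \<ge> 0"
      then have "t [^] (- n) = t [^] nat (- n)" by simp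
      also have "\<dots> \<in> vmax V" by (rule vmax_pow[OF V(1) tc(3)]) (use n in simp)
      finally have "t [^] n \<otimes> t [^] (- n) \<in> vmax V" using vmax_mult_right[OF V(1) tn] by blast
      also have "t [^] n \<otimes> t [^] (- n) = \<one>" using int_pow_add[OF tc(1,2), of n "- n"] by simp
      finally show False using one_notin_vmax[OF V(1)] by simp
    qed
  qed
  have uniq: "n = m" if e: "u \<in> vunits V" "w \<in> vunits V" "t [^] n \<otimes> u = t [^] m \<otimes> w" for n m :: int and u w
  proof -
    have le: "m \<le> n" if e: "u \<in> vunits V" "w \<in> vunits V" "t [^] n \<otimes> u = t [^] m \<otimes> w" for n m :: int and u w
    proof -
      have c: "u \<in> carrier R" "w \<in> carrier R" "u \<noteq> \<zero>" "w \<noteq> \<zero>" using vunits_carrier[OF V(1)] e by auto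
      define tn tm td where "tn = t [^] n" and "tm = t [^] m" and "td = t [^] (n - m)"
      have tt: "tn \<in> carrier R" "tm \<in> carrier R" "td \<in> carrier R" "tn \<noteq> \<zero>" "tm \<noteq> \<zero>" "tn = tm \<otimes> td"
        unfolding tn_def tm_def td_def using int_pow_nonzero[OF tc(1,2)] int_pow_add[OF tc(1,2), of m "n - m"] by auto
      have "tm \<otimes> (td \<otimes> u) = tm \<otimes> w"
        using e(3) tt c unfolding tn_def[symmetric] tm_def[symmetric] by (simp add: m_assoc)
      then have "td \<otimes> u = w" using tt c m_lcancel by auto
      then have "0 \<le> n - m" using pos[OF e(1), of "n - m"] vunits_subset[OF V(1) e(2)] unfolding td_def by simp
      then show ?thesis by simp
    qed
    show ?thesis using le[OF e] le[OF e(2,1) e(3)[symmetric]] by simp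
  qed
  \<comment> \<open>Another uniformizer \<open>s\<close> is \<open>t\<close> times a unit, and the
    power of that unit is absorbed into the unit factor, so the exponent is unchanged.\<close>
  have val: "place_val F P x = n" if x: "u \<in> vunits V" "x = t [^] n \<otimes> u" for x n u
    unfolding place_val_def
  proof (rule the_equality)
    have un: "uniformizer F P s \<longleftrightarrow> vuniformizer V s" for s
      using uniformizer_iff[OF V(1)] t(1) V(2) by blast
    have units: "Units (R\<lparr>carrier := place_ring F P\<rparr>) = vunits V"
      using Units_eq_vunits[OF vr(2)] unfolding V_def .
    show "\<exists>t u. uniformizer F P t \<and> u \<in> Units (R\<lparr>carrier := place_ring F P\<rparr>) \<and> x = t [^] n \<otimes> u"
      unfolding un units using t(1) x by blast
    fix m :: int assume "\<exists>t u. uniformizer F P t \<and> u \<in> Units (R\<lparr>carrier := place_ring F P\<rparr>) \<and> x = t [^] m \<otimes> u"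
    then obtain s w where s: "vuniformizer V s" "w \<in> vunits V" "x = s [^] m \<otimes> w" unfolding un units by blast
    have sc: "s \<in> carrier R" "s \<noteq> \<zero>" "s \<in> vmax V" using s(1) vmax_carrier[OF V(1)] unfolding vuniformizer_def by auto
    have "s \<oslash> t \<in> V" "t \<oslash> s \<in> V" using s t(1) unfolding vuniformizer_def by auto
    then have st: "s \<oslash> t \<in> vunits V"
      using inv_div[OF sc(1) tc(1) sc(2) tc(2)] div_nonzero[OF sc(1) tc(1) sc(2) tc(2)] unfolding vunits_def by simp
    define e where "e = s \<oslash> t"
    have e: "e \<in> vunits V" "s = t \<otimes> e" "e \<in> carrier R" "e \<noteq> \<zero>"
      using st vunits_carrier[OF V(1) st] unfolding e_def apply simp_all using sc tc(1,2) by (simp add: field_norm)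
    have tm: "t [^] m \<in> carrier R" using int_pow_nonzero[OF tc(1,2)] by simp
    have em: "e [^] m \<in> carrier R" using int_pow_nonzero[OF e(3,4)] by simp
    have "x = t [^] m \<otimes> (e [^] m \<otimes> w)"
      unfolding s(3) e(2) using int_pow_distrib[OF tc(1,2) e(3,4)] tm em vunits_carrier[OF V(1) s(2)] by (simp add: m_assoc)
    moreover have "e [^] m \<otimes> w \<in> vunits V" using vunits_mult[OF V(1) vunits_int_pow[OF V(1) e(1)] s(2)] .
    ultimately show "m = n" using uniq x by metis
  qed
  show ?thesis unfolding dval_def V_def[symmetric]
  proof (intro conjI ballI V(1))
    fix x y assume xy: "x \<in> F - {\<zero>}" "y \<in> F - {\<zero>}"
    obtain n u where nu: "u \<in> vunits V" "x = t [^] (n::int) \<otimes> u" using ex xy by blast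
    obtain m w where mw: "w \<in> vunits V" "y = t [^] (m::int) \<otimes> w" using ex xy by blast
    note tp = int_pow_nonzero(1)[OF tc(1,2)]
    have "x \<otimes> y = t [^] (n + m) \<otimes> (u \<otimes> w)"
      unfolding nu(2) mw(2) int_pow_add[OF tc(1,2)] using tp vunits_carrier(1)[OF V(1)] nu(1) mw(1) by (simp add: m_ac)
    then show "place_val F P (x \<otimes> y) = place_val F P x + place_val F P y"
      using val[OF vunits_mult[OF V(1) nu(1) mw(1)]] val[OF nu] val[OF mw] by simp
  next
    fix x assume x: "x \<in> F - {\<zero>}"
    obtain n u where nu: "u \<in> vunits V" "x = t [^] (n::int) \<otimes> u" using ex x by blast
    then show "(x \<in> V) = (0 \<le> place_val F P x)" using val[OF nu] pos[OF nu(1)] by simp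
  next
    have "t = t [^] (1::int) \<otimes> \<one>" using tc int_pow_int[where x = t and G = R and n = 1] by simp
    then have "place_val F P t = 1" using val[OF vunits_one[OF V(1)]] by blast
    then show "\<exists>t\<in>F - {\<zero>}. place_val F P t = 1" using tc by blast
  qed
qed

subsection \<open>Extension of places\<close>

text \<open>Candidates for the maximal ideal of a valuation ring over the ideal \<open>I\<close> of \<open>A\<close>: by Zorn's
  lemma there is a maximal one, and its multiplier ring turns out to be a valuation ring.\<close>

definition candidate :: "'a set \<Rightarrow> 'a set \<Rightarrow> 'a set \<Rightarrow> 'a set \<Rightarrow> bool" where
  "candidate E A I J \<longleftrightarrow> I \<subseteq> J \<and> J \<subseteq> E \<and> \<zero> \<in> J \<and> \<one> \<notin> J \<and>
     (\<forall>x\<in>J. \<forall>y\<in>J. x \<ominus> y \<in> J \<and> x \<otimes> y \<in> J) \<and> (\<forall>a\<in>A. \<forall>x\<in>J. a \<otimes> x \<in> J)"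

text \<open>The values at \<open>x\<close> of polynomials of degree at most \<open>n\<close> with
  all coefficients in \<open>J\<close>, built by Horner's rule. As \<open>J\<close> will be a ring
  without 1, neither 1 nor \<open>x\<close> is automatically among them.\<close>

primrec jpoly :: "'a set \<Rightarrow> 'a \<Rightarrow> nat \<Rightarrow> 'a set" where
  "jpoly J x 0 = J"
| "jpoly J x (Suc n) = {y \<otimes> x \<oplus> j | y j. y \<in> jpoly J x n \<and> j \<in> J}"

context
  fixes J :: "'a set" and x :: 'a
  assumes Jc: "J \<subseteq> carrier R" and xc: "x \<in> carrier R" and J0: "\<zero> \<in> J"
    and Jsub: "\<And>a b. a \<in> J \<Longrightarrow> b \<in> J \<Longrightarrow> a \<ominus> b \<in> J"
    and Jmul: "\<And>a b. a \<in> J \<Longrightarrow> b \<in> J \<Longrightarrow> a \<otimes> b \<in> J"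
begin

lemma jpoly_carrier: "y \<in> jpoly J x n \<Longrightarrow> y \<in> carrier R"
  using Jc xc by (induction n arbitrary: y) auto

lemma J_carrier: "y \<in> J \<Longrightarrow> y \<in> carrier R"
  using Jc by blast

lemma jpoly_Suc: "y \<in> jpoly J x n \<Longrightarrow> y \<in> jpoly J x (Suc n)"
proof (induction n arbitrary: y)
  case 0
  then have "y = \<zero> \<otimes> x \<oplus> y" using Jc xc by auto
  then show ?case using 0 J0 by auto
next
  case (Suc n)
  then obtain z j where "y = z \<otimes> x \<oplus> j" "z \<in> jpoly J x n" "j \<in> J" by auto
  then show ?case using Suc.IH[of z] by auto
qed

lemma jpoly_mono: "n \<le> m \<Longrightarrow> y \<in> jpoly J x n \<Longrightarrow> y \<in> jpoly J x m"
  by (induction rule: dec_induct) (use jpoly_Suc in blast)+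

lemma jpoly_zero: "\<zero> \<in> jpoly J x n"
  using jpoly_mono[of 0 n \<zero>] J0 by simp

lemma jpoly_minus: "y \<in> jpoly J x n \<Longrightarrow> z \<in> jpoly J x n \<Longrightarrow> y \<ominus> z \<in> jpoly J x n"
proof (induction n arbitrary: y z)
  case 0 then show ?case using Jsub by simp
next
  case (Suc n)
  obtain y' j where y: "y = y' \<otimes> x \<oplus> j" "y' \<in> jpoly J x n" "j \<in> J" using Suc.prems by auto
  obtain z' l where z: "z = z' \<otimes> x \<oplus> l" "z' \<in> jpoly J x n" "l \<in> J" using Suc.prems by auto
  have c: "y' \<in> carrier R" "z' \<in> carrier R" "j \<in> carrier R" "l \<in> carrier R" "x \<in> carrier R"
    using y z jpoly_carrier J_carrier xc by auto
  have "y \<ominus> z = (y' \<ominus> z') \<otimes> x \<oplus> (j \<ominus> l)" unfolding y z using c by (simp add: ring_norm)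
  moreover have "y' \<ominus> z' \<in> jpoly J x n" "j \<ominus> l \<in> J" using Suc.IH y z Jsub by auto
  ultimately show ?case by auto
qed

lemma jpoly_add: "y \<in> jpoly J x n \<Longrightarrow> z \<in> jpoly J x n \<Longrightarrow> y \<oplus> z \<in> jpoly J x n"
proof -
  assume yz: "y \<in> jpoly J x n" "z \<in> jpoly J x n"
  have c: "y \<in> carrier R" "z \<in> carrier R" using yz jpoly_carrier by auto
  have "y \<ominus> (\<zero> \<ominus> z) \<in> jpoly J x n" using yz jpoly_minus jpoly_zero by blast
  then show ?thesis using c by (simp add: a_minus_def)
qed

lemma jpoly_smult:
  assumes "a \<in> carrier R" "\<And>j. j \<in> J \<Longrightarrow> a \<otimes> j \<in> J"
  shows "y \<in> jpoly J x n \<Longrightarrow> a \<otimes> y \<in> jpoly J x n"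
proof (induction n arbitrary: y)
  case 0 then show ?case using assms by simp
next
  case (Suc n)
  obtain y' j where y: "y = y' \<otimes> x \<oplus> j" "y' \<in> jpoly J x n" "j \<in> J" using Suc.prems by auto
  have c: "y' \<in> carrier R" "j \<in> carrier R" "x \<in> carrier R" using y jpoly_carrier J_carrier xc by auto
  have "a \<otimes> y = (a \<otimes> y') \<otimes> x \<oplus> a \<otimes> j" unfolding y using c assms(1) by (simp add: ring_norm)
  moreover have "a \<otimes> y' \<in> jpoly J x n" "a \<otimes> j \<in> J" using Suc.IH y assms by auto
  ultimately show ?case by auto
qed

lemma jpoly_mult_var: "y \<in> jpoly J x n \<Longrightarrow> y \<otimes> x \<in> jpoly J x (Suc n)"
proof -
  assume y: "y \<in> jpoly J x n"
  have "y \<otimes> x = y \<otimes> x \<oplus> \<zero>" using jpoly_carrier[OF y] xc by simp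
  then show ?thesis using y J0 by auto
qed

lemma jpoly_mult: "y \<in> jpoly J x n \<Longrightarrow> z \<in> jpoly J x m \<Longrightarrow> y \<otimes> z \<in> jpoly J x (n + m)"
proof (induction n arbitrary: y)
  case 0 then show ?case using jpoly_smult Jmul J_carrier by simp
next
  case (Suc n)
  obtain y' j where y: "y = y' \<otimes> x \<oplus> j" "y' \<in> jpoly J x n" "j \<in> J" using Suc.prems by auto
  have c: "y' \<in> carrier R" "j \<in> carrier R" "x \<in> carrier R" "z \<in> carrier R"
    using y jpoly_carrier J_carrier xc Suc.prems by auto
  have "y \<otimes> z = (y' \<otimes> z) \<otimes> x \<oplus> j \<otimes> z" unfolding y using c by (simp add: ring_norm)
  moreover have "(y' \<otimes> z) \<otimes> x \<in> jpoly J x (Suc n + m)"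
    using jpoly_mult_var[OF Suc.IH[OF y(2) Suc.prems(2)]] by simp
  moreover have "j \<otimes> z \<in> jpoly J x m" using jpoly_smult Jmul J_carrier y(3) Suc.prems by blast
  then have "j \<otimes> z \<in> jpoly J x (Suc n + m)" using jpoly_mono[of m "Suc n + m"] by simp
  ultimately show ?case using jpoly_add[of "(y' \<otimes> z) \<otimes> x" "Suc n + m" "j \<otimes> z"] by metis
qed

lemma jpoly_monomial: "j \<in> J \<Longrightarrow> j \<otimes> x [^] (n::nat) \<in> jpoly J x n"
proof (induction n)
  case 0 then show ?case using J_carrier by simp
next
  case (Suc n)
  have "j \<otimes> x [^] Suc n = (j \<otimes> x [^] n) \<otimes> x" using J_carrier[OF Suc.prems] xc by (simp add: m_assoc)
  then show ?case using jpoly_mult_var[OF Suc.IH[OF Suc.prems]] by simp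
qed

text \<open>Horner's rule isolates the constant term; lowering the degree of a relation requires the
  leading term instead.\<close>

lemma jpoly_top:
  "y \<in> jpoly J x (Suc n) \<Longrightarrow> \<exists>j\<in>J. \<exists>q\<in>jpoly J x n. y = j \<otimes> x [^] Suc n \<oplus> q"
proof (induction n arbitrary: y)
  case 0
  then obtain z j where "y = z \<otimes> x \<oplus> j" "z \<in> J" "j \<in> J" by auto
  then show ?case using xc by (intro bexI[of _ z] bexI[of _ j]) auto
next
  case (Suc n)
  obtain y' l where y: "y = y' \<otimes> x \<oplus> l" "y' \<in> jpoly J x (Suc n)" "l \<in> J"
    using Suc.prems by (auto simp del: jpoly.simps simp: jpoly.simps(2)[of J x "Suc n"])
  obtain j q where j: "j \<in> J" "q \<in> jpoly J x n" "y' = j \<otimes> x [^] Suc n \<oplus> q" using Suc.IH[OF y(2)] by blast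
  define xn where "xn = x [^] Suc n"
  have c: "j \<in> carrier R" "q \<in> carrier R" "l \<in> carrier R" "x \<in> carrier R" "xn \<in> carrier R"
    using y j jpoly_carrier J_carrier xc unfolding xn_def by auto
  have "(j \<otimes> xn \<oplus> q) \<otimes> x \<oplus> l = j \<otimes> (xn \<otimes> x) \<oplus> (q \<otimes> x \<oplus> l)" using c by (simp add: ring_norm)
  then have "y = j \<otimes> x [^] Suc (Suc n) \<oplus> (q \<otimes> x \<oplus> l)" unfolding y j xn_def by simp
  moreover have "q \<otimes> x \<oplus> l \<in> jpoly J x (Suc n)" using j y by auto
  ultimately show ?case using j(1) by blast
qed

end

text \<open>Multiplication by \<open>x [^] n\<close> reverses the coefficients of a polynomial in
  the inverse of \<open>x\<close>.\<close>

lemma jpoly_reverse: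
  assumes Jc: "J \<subseteq> carrier R" and xc: "x \<in> carrier R" "x \<noteq> \<zero>" and J0: "\<zero> \<in> J"
    and Jsub: "\<And>a b. a \<in> J \<Longrightarrow> b \<in> J \<Longrightarrow> a \<ominus> b \<in> J"
    and Jmul: "\<And>a b. a \<in> J \<Longrightarrow> b \<in> J \<Longrightarrow> a \<otimes> b \<in> J"
  shows "y \<in> jpoly J (inv x) n \<Longrightarrow> y \<otimes> x [^] n \<in> jpoly J x n"
proof (induction n arbitrary: y)
  case 0 then show ?case using Jc by auto
next
  case (Suc n)
  note facts = Jc xc(1) J0 Jsub Jmul
  have ic: "inv x \<in> carrier R" using xc by simp
  obtain z j where y: "y = z \<otimes> inv x \<oplus> j" "z \<in> jpoly J (inv x) n" "j \<in> J" using Suc.prems by auto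
  define xn where "xn = x [^] n"
  have c: "z \<in> carrier R" "j \<in> carrier R" "x \<in> carrier R" "xn \<in> carrier R"
    using y xc jpoly_carrier[OF Jc ic J0 Jsub Jmul] Jc unfolding xn_def by auto
  have "(z \<oslash> x \<oplus> j) \<otimes> (xn \<otimes> x) = z \<otimes> xn \<oplus> j \<otimes> (xn \<otimes> x)" using c xc(2) by (simp add: field_norm)
  then have "y \<otimes> x [^] Suc n = z \<otimes> x [^] n \<oplus> j \<otimes> x [^] Suc n"
    unfolding y xn_def using xc(2) by (simp add: m_div_def)
  moreover have "z \<otimes> x [^] n \<in> jpoly J x (Suc n)" using jpoly_Suc[OF facts Suc.IH[OF y(2)]] .
  moreover have "j \<otimes> x [^] Suc n \<in> jpoly J x (Suc n)" using jpoly_monomial[OF facts y(3)] .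
  ultimately show ?case using jpoly_add[OF facts, of "z \<otimes> x [^] n" "Suc n"] by metis
qed

text \<open>Chevalley's extension argument, run on the maximal \<open>J\<close> alone rather than on
  pairs of a ring and an ideal. Maximality is used against two enlargements: fractions with
  denominators in 1 + \<open>J\<close>, and polynomials over \<open>J\<close> in an element outside
  the multiplier ring.\<close>

theorem exists_valuation_ring:
  assumes "subfield E R" "subring A R" "A \<subseteq> E" "I \<subseteq> A" "\<zero> \<in> I" "\<one> \<notin> I"
    and "\<And>x y. x \<in> I \<Longrightarrow> y \<in> I \<Longrightarrow> x \<ominus> y \<in> I" "\<And>a x. a \<in> A \<Longrightarrow> x \<in> I \<Longrightarrow> a \<otimes> x \<in> I"
  obtains V where "vring E V" "A \<subseteq> V" "I \<subseteq> vmax V"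
proof -
  note ec = subfield_closed[OF assms(1)] and ac = subringE[OF assms(2)]
  let ?S = "{J. candidate E A I J}"
  have "\<exists>M\<in>?S. \<forall>Y\<in>?S. M \<subseteq> Y \<longrightarrow> Y = M"
  proof (rule subset_Zorn_nonempty)
    have "candidate E A I I" unfolding candidate_def using assms(3-8) by blast
    then show "?S \<noteq> {}" by blast
    fix C assume C: "C \<noteq> {}" "subset.chain ?S C"
    have cand: "candidate E A I J" if "J \<in> C" for J using C(2) that unfolding subset.chain_def by blast
    have two: "\<exists>J\<in>C. x \<in> J \<and> y \<in> J" if xy: "x \<in> \<Union>C" "y \<in> \<Union>C" for x y
    proof -
      obtain J J' where "J \<in> C" "x \<in> J" "J' \<in> C" "y \<in> J'" using xy by blast
      moreover have "J \<subseteq> J' \<or> J' \<subseteq> J" using C(2) calculation unfolding subset.chain_def by blast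
      ultimately show ?thesis by blast
    qed
    have "I \<subseteq> \<Union>C" "\<Union>C \<subseteq> E" "\<zero> \<in> \<Union>C" "\<one> \<notin> \<Union>C" "\<forall>a\<in>A. \<forall>x\<in>\<Union>C. a \<otimes> x \<in> \<Union>C"
      using C(1) cand unfolding candidate_def by blast+
    moreover have "x \<ominus> y \<in> \<Union>C \<and> x \<otimes> y \<in> \<Union>C" if "x \<in> \<Union>C" "y \<in> \<Union>C" for x y
      using two[OF that] cand unfolding candidate_def by blast
    ultimately show "\<Union>C \<in> ?S" unfolding candidate_def by blast
  qed
  then obtain J where J: "candidate E A I J" and max: "\<And>Y. candidate E A I Y \<Longrightarrow> J \<subseteq> Y \<Longrightarrow> Y = J" by blast
  have JE: "I \<subseteq> J" "J \<subseteq> E" "\<zero> \<in> J" "\<one> \<notin> J" and Jsub: "\<And>a b. a \<in> J \<Longrightarrow> b \<in> J \<Longrightarrow> a \<ominus> b \<in> J"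
    and Jmul: "\<And>a b. a \<in> J \<Longrightarrow> b \<in> J \<Longrightarrow> a \<otimes> b \<in> J" and JA: "\<And>a j. a \<in> A \<Longrightarrow> j \<in> J \<Longrightarrow> a \<otimes> j \<in> J"
    using J unfolding candidate_def by auto
  have Jc: "J \<subseteq> carrier R" using JE(2) ec(10) by blast
  have Jcar: "\<And>j. j \<in> J \<Longrightarrow> j \<in> carrier R" using Jc by blast
  have Jadd: "a \<oplus> b \<in> J" if "a \<in> J" "b \<in> J" for a b
    using Jsub[OF that(1) Jsub[OF JE(3) that(2)]] that Jcar by (simp add: a_minus_def)
  define V where "V = {y \<in> E. \<forall>j\<in>J. y \<otimes> j \<in> J}"
  have VE: "V \<subseteq> E" and Vc: "\<And>y. y \<in> V \<Longrightarrow> y \<in> carrier R" unfolding V_def using ec(10) by auto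
  have Vsubring: "subring V R"
  proof (rule subringI)
    show "V \<subseteq> carrier R" using Vc by blast
    show "\<one> \<in> V" unfolding V_def using ec(2) Jcar by simp
    show "\<ominus> h \<in> V" if "h \<in> V" for h
    proof -
      have "\<ominus> h \<otimes> j \<in> J" if j: "j \<in> J" for j
      proof -
        have "\<zero> \<ominus> h \<otimes> j \<in> J" using Jsub JE(3) \<open>h \<in> V\<close> j unfolding V_def by blast
        then show ?thesis using Vc[OF \<open>h \<in> V\<close>] Jcar[OF j] by (simp add: l_minus)
      qed
      then show ?thesis using \<open>h \<in> V\<close> ec(6) unfolding V_def by blast
    qed
    show "g \<otimes> h \<in> V" if "g \<in> V" "h \<in> V" for g h
    proof -
      have "(g \<otimes> h) \<otimes> j \<in> J" if j: "j \<in> J" for j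
      proof -
        have "g \<otimes> (h \<otimes> j) \<in> J" using \<open>g \<in> V\<close> \<open>h \<in> V\<close> j unfolding V_def by blast
        then show ?thesis using Vc \<open>g \<in> V\<close> \<open>h \<in> V\<close> Jcar[OF j] by (simp add: m_assoc)
      qed
      then show ?thesis using that ec(4) unfolding V_def by blast
    qed
    show "g \<oplus> h \<in> V" if "g \<in> V" "h \<in> V" for g h
    proof -
      have "(g \<oplus> h) \<otimes> j \<in> J" if j: "j \<in> J" for j
      proof -
        have "g \<otimes> j \<oplus> h \<otimes> j \<in> J" using Jadd \<open>g \<in> V\<close> \<open>h \<in> V\<close> j unfolding V_def by blast
        then show ?thesis using Vc \<open>g \<in> V\<close> \<open>h \<in> V\<close> Jcar[OF j] by (simp add: l_distr)
      qed
      then show ?thesis using that ec(3) unfolding V_def by blast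
    qed
  qed
  have AV: "A \<subseteq> V" unfolding V_def using assms(3) JA by blast
  \<comment> \<open>The fractions with numerator in \<open>J\<close> and denominator in 1 +
    \<open>J\<close> form a candidate containing \<open>J\<close>, so they add nothing. Hence
    elements of 1 + \<open>J\<close> are invertible in \<open>V\<close>.\<close>
  have unit: "\<one> \<oplus> d \<noteq> \<zero> \<and> inv (\<one> \<oplus> d) \<in> V" if d: "d \<in> J" for d
  proof -
    have nz: "\<one> \<oplus> d \<noteq> \<zero>" if "d \<in> J" for d
    proof
      assume "\<one> \<oplus> d = \<zero>"
      then have "\<one> = \<zero> \<ominus> d" using Jcar[OF that] eq_neg_iff_add_eq_0 by simp
      then show False using Jsub[OF JE(3) that] JE(4) by metis
    qed
    define J' where "J' = {j \<oslash> (\<one> \<oplus> d) | j d. j \<in> J \<and> d \<in> J}"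
    have J'I: "j \<oslash> (\<one> \<oplus> d) \<in> J'" if "j \<in> J" "d \<in> J" for j d unfolding J'_def using that by blast
    have JJ': "J \<subseteq> J'"
    proof
      fix j assume j: "j \<in> J"
      have "j = j \<oslash> (\<one> \<oplus> \<zero>)" using Jcar[OF j] by simp
      then show "j \<in> J'" using J'I[OF j JE(3)] by simp
    qed
    have "candidate E A I J'"
      unfolding candidate_def
    proof (intro conjI ballI)
      show "I \<subseteq> J'" "\<zero> \<in> J'" using JJ' JE by auto
      show "J' \<subseteq> E" unfolding J'_def using ec(2) JE(2) by (auto intro!: ec(3,7))
      show "\<one> \<notin> J'"
      proof
        assume "\<one> \<in> J'"
        then obtain j e where je: "j \<in> J" "e \<in> J" "\<one> = j \<oslash> (\<one> \<oplus> e)" unfolding J'_def by blast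
        define w where "w = \<one> \<oplus> e"
        have w: "w \<in> carrier R" "w \<noteq> \<zero>" "j \<in> carrier R" "e \<in> carrier R" using nz[OF je(2)] je Jcar unfolding w_def by auto
        have "(j \<oslash> w) \<otimes> w = j" using w by (simp add: field_norm)
        then have "\<one> \<otimes> w = j" using je(3) unfolding w_def[symmetric] by metis
        then have "j = \<one> \<oplus> e" using w(1) unfolding w_def by simp
        then have "\<one> = j \<ominus> e" using w(4) by (simp add: a_minus_def a_assoc r_neg)
        then show False using Jsub[OF je(1,2)] JE(4) by simp
      qed
      fix a b assume "a \<in> J'" "b \<in> J'"
      then obtain j d l e where ab: "j \<in> J" "d \<in> J" "a = j \<oslash> (\<one> \<oplus> d)" "l \<in> J" "e \<in> J" "b = l \<oslash> (\<one> \<oplus> e)"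
        unfolding J'_def by blast
      have c: "j \<in> carrier R" "d \<in> carrier R" "l \<in> carrier R" "e \<in> carrier R" "\<one> \<oplus> d \<noteq> \<zero>" "\<one> \<oplus> e \<noteq> \<zero>"
        using ab Jcar nz by auto
      have de: "d \<oplus> e \<oplus> d \<otimes> e \<in> J" by (intro Jadd Jmul ab)
      have eq1: "\<one> \<oplus> (d \<oplus> e \<oplus> d \<otimes> e) = (\<one> \<oplus> d) \<otimes> (\<one> \<oplus> e)" using c(1-4) by (simp add: ring_norm)
      have "a \<ominus> b = ((j \<oplus> j \<otimes> e) \<ominus> (l \<oplus> l \<otimes> d)) \<oslash> ((\<one> \<oplus> d) \<otimes> (\<one> \<oplus> e))"
      proof -
        define D F where "D = \<one> \<oplus> d" and "F = \<one> \<oplus> e"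
        have DF: "D \<in> carrier R" "F \<in> carrier R" "D \<noteq> \<zero>" "F \<noteq> \<zero>" unfolding D_def F_def using c by auto
        have "(j \<oplus> j \<otimes> e) \<ominus> (l \<oplus> l \<otimes> d) = j \<otimes> F \<ominus> l \<otimes> D" unfolding D_def F_def using c(1-4) by (simp add: ring_norm)
        moreover have "j \<oslash> D \<ominus> l \<oslash> F = (j \<otimes> F \<ominus> l \<otimes> D) \<oslash> (D \<otimes> F)" using c(1,3) DF by (simp add: field_norm)
        ultimately show ?thesis unfolding ab D_def[symmetric] F_def[symmetric] by simp
      qed
      then show "a \<ominus> b \<in> J'"
        unfolding eq1[symmetric] using J'I[OF _ de] Jsub Jadd Jmul ab by simp
      have "a \<otimes> b = (j \<otimes> l) \<oslash> ((\<one> \<oplus> d) \<otimes> (\<one> \<oplus> e))"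
      proof -
        define D F where "D = \<one> \<oplus> d" and "F = \<one> \<oplus> e"
        have DF: "D \<in> carrier R" "F \<in> carrier R" "D \<noteq> \<zero>" "F \<noteq> \<zero>" unfolding D_def F_def using c by auto
        have "(j \<oslash> D) \<otimes> (l \<oslash> F) = (j \<otimes> l) \<oslash> (D \<otimes> F)" using c(1,3) DF by (simp add: field_norm)
        then show ?thesis unfolding ab D_def[symmetric] F_def[symmetric] by simp
      qed
      then show "a \<otimes> b \<in> J'"
        unfolding eq1[symmetric] using J'I[OF _ de] Jmul ab by simp
    next
      fix a b assume a: "a \<in> A" "b \<in> J'"
      then obtain j d where b: "j \<in> J" "d \<in> J" "b = j \<oslash> (\<one> \<oplus> d)" unfolding J'_def by blast
      have "a \<otimes> b = (a \<otimes> j) \<oslash> (\<one> \<oplus> d)"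
        unfolding b using ac(1) a b Jcar nz by (auto simp: m_div_def m_assoc)
      then show "a \<otimes> b \<in> J'" using J'I[OF JA[OF a(1) b(1)] b(2)] by simp
    qed
    then have J': "J' = J" using max JJ' by blast
    have "inv (\<one> \<oplus> d) \<otimes> j \<in> J" if "j \<in> J" for j
      using J'I[OF that d] Jcar that d nz[OF d] unfolding J' by (simp add: m_div_def m_comm)
    moreover have "inv (\<one> \<oplus> d) \<in> E"
      by (intro ec(8) ec(3) ec(2) nz[OF d]) (use d JE(2) in blast)
    ultimately have "inv (\<one> \<oplus> d) \<in> V" unfolding V_def by simp
    then show ?thesis using nz[OF d] by simp
  qed
  \<comment> \<open>If 1 were not a polynomial in \<open>x\<close> over \<open>J\<close>, these
    polynomials would form a candidate and hence equal \<open>J\<close>; then \<open>x\<close> would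
    multiply \<open>J\<close> into itself and belong to \<open>V\<close>.\<close>
  have big: "\<exists>n. \<one> \<in> jpoly J x n" if x: "x \<in> E" "x \<notin> V" for x
  proof (rule ccontr)
    assume no: "\<not> ?thesis"
    have xc: "x \<in> carrier R" using x(1) by (rule ec(10))
    note facts = Jc xc JE(3) Jsub Jmul
    define M where "M = (\<Union>n. jpoly J x n)"
    have JM: "J \<subseteq> M" unfolding M_def using jpoly.simps(1)[of J x] by blast
    have two: "\<exists>n. y \<in> jpoly J x n \<and> z \<in> jpoly J x n" if yz: "y \<in> M" "z \<in> M" for y z
    proof -
      obtain n m where "y \<in> jpoly J x n" "z \<in> jpoly J x m" using yz unfolding M_def by blast
      then show ?thesis
        using jpoly_mono[OF facts, of n "max n m"] jpoly_mono[OF facts, of m "max n m"] by auto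
    qed
    have "jpoly J x n \<subseteq> E" for n
    proof (induction n)
      case (Suc n) then show ?case using ec(3,4) x(1) JE(2) by auto blast
    qed (use JE(2) in simp)
    then have ME: "M \<subseteq> E" unfolding M_def by blast
    have "candidate E A I M"
      unfolding candidate_def
    proof (intro conjI ballI)
      show "I \<subseteq> M" "\<zero> \<in> M" "M \<subseteq> E" using JM JE ME by auto
      show "\<one> \<notin> M" using no unfolding M_def by blast
      fix y z assume "y \<in> M" "z \<in> M"
      then obtain n where n: "y \<in> jpoly J x n" "z \<in> jpoly J x n" using two by blast
      show "y \<ominus> z \<in> M" using jpoly_minus[OF facts n] unfolding M_def by blast
      show "y \<otimes> z \<in> M" using jpoly_mult[OF facts n] unfolding M_def by blast
    next
      fix a y assume "a \<in> A" "y \<in> M"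
      then obtain n where "y \<in> jpoly J x n" unfolding M_def by blast
      then have "a \<otimes> y \<in> jpoly J x n" using jpoly_smult[OF facts _ JA] \<open>a \<in> A\<close> ac(1) by blast
      then show "a \<otimes> y \<in> M" unfolding M_def by blast
    qed
    then have MJ: "M = J" using max JM by blast
    have "x \<otimes> j \<in> J" if "j \<in> J" for j
    proof -
      have "j \<otimes> x \<in> jpoly J x (Suc 0)" using jpoly_mult_var[OF facts, of j 0] that by simp
      then have "j \<otimes> x \<in> M" unfolding M_def by blast
      then show ?thesis using m_comm[OF Jcar[OF that] xc] MJ by simp
    qed
    then show False using x unfolding V_def by blast
  qed
  \<comment> \<open>In the relation for the inverse of \<open>x\<close>, the constant term is moved
    to the left, where 1 minus it is invertible in \<open>V\<close>. Multiplied by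
    \<open>x [^] m\<close> this expresses \<open>x [^] m\<close> by lower powers, and substitution
    into the leading term of the other relation lowers its degree.\<close>
  have reduce: "\<exists>n'<n. \<one> \<in> jpoly J x n'"
    if x: "x \<in> E" "x \<noteq> \<zero>" and n: "\<one> \<in> jpoly J x n" and m: "\<one> \<in> jpoly J (inv x) m" and mn: "m \<le> n" for x n m
  proof -
    have xc: "x \<in> carrier R" and ic: "inv x \<in> carrier R" using x ec by auto
    note facts = Jc xc JE(3) Jsub Jmul
    have "m \<noteq> 0" using m JE(4) by (intro notI) simp
    then obtain m' where m': "m = Suc m'" by (cases m) auto
    obtain n' where n': "n = Suc n'" using mn m' by (cases n) auto
    obtain y l where yl: "y \<in> jpoly J (inv x) m'" "l \<in> J" "\<one> = y \<otimes> inv x \<oplus> l" using m unfolding m' by auto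
    have yc: "y \<in> carrier R" using jpoly_carrier[OF Jc ic JE(3) Jsub Jmul yl(1)] .
    have lc: "l \<in> carrier R" using Jcar yl by blast
    have ml: "\<zero> \<ominus> l \<in> J" using Jsub JE(3) yl by blast
    define w where "w = \<one> \<oplus> (\<zero> \<ominus> l)"
    have w: "w \<noteq> \<zero>" "inv w \<in> V" "w \<in> carrier R" using unit[OF ml] lc unfolding w_def by auto
    define X0 X1 where "X0 = x [^] m" and "X1 = x [^] m'"
    have Xc: "X0 \<in> carrier R" "X1 \<in> carrier R" "X0 = X1 \<otimes> x" unfolding X0_def X1_def m' using xc by auto
    have yX: "y \<otimes> X1 \<in> jpoly J x m'"
      using jpoly_reverse[OF Jc xc x(2) JE(3) Jsub Jmul yl(1)] unfolding X1_def .
    have "w \<otimes> X0 = (y \<oslash> x) \<otimes> X0"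
    proof -
      have "(y \<oslash> x \<oplus> l) \<oplus> (\<zero> \<ominus> l) = y \<oslash> x" using yc xc lc x(2) by (simp add: field_norm)
      then show ?thesis unfolding w_def using yl(3) x(2) by (simp add: m_div_def)
    qed
    also have "\<dots> = y \<otimes> X1" unfolding Xc(3) using yc xc Xc(2) x(2) by (simp add: field_norm)
    finally have "w \<otimes> X0 \<in> jpoly J x m'" using yX by simp
    then have "inv w \<otimes> (w \<otimes> X0) \<in> jpoly J x m'"
      using jpoly_smult[OF facts, of "inv w"] w unfolding V_def by simp
    then have Xin: "X0 \<in> jpoly J x m'" using w Xc by (simp add: m_assoc[symmetric])
    obtain j q where jq: "j \<in> J" "q \<in> jpoly J x n'" "\<one> = j \<otimes> x [^] Suc n' \<oplus> q"
      using jpoly_top[OF facts] n unfolding n' by blast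
    have "x [^] Suc n' = x [^] (n - m) \<otimes> X0"
      unfolding X0_def n'[symmetric] using mn xc by (simp add: nat_pow_mult)
    then have "j \<otimes> x [^] Suc n' = (j \<otimes> x [^] (n - m)) \<otimes> X0" using Jcar jq xc Xc by (simp add: m_assoc)
    also have "\<dots> \<in> jpoly J x ((n - m) + m')"
      using jpoly_mult[OF facts jpoly_monomial[OF facts jq(1)] Xin] .
    also have "(n - m) + m' = n'" using mn unfolding m' n' by simp
    finally have "\<one> \<in> jpoly J x n'" using jq jpoly_add[OF facts] by simp
    then show ?thesis unfolding n' by blast
  qed
  have val: "x \<in> V \<or> inv x \<in> V" if x: "x \<in> E" "x \<noteq> \<zero>" for x
  proof (rule ccontr)
    assume no: "\<not> ?thesis"
    have ix: "inv x \<in> E" "inv x \<noteq> \<zero>" "inv (inv x) = x"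
      using x ec(8,10) nonzero_imp_inverse_nonzero nonzero_inverse_inverse_eq by auto
    \<comment> \<open>With both degrees minimal, the larger one can still be lowered;
      \<open>reduce\<close> is applied to \<open>x\<close> or to its inverse accordingly.\<close>
    define n where "n = (LEAST n. \<one> \<in> jpoly J x n)"
    define m where "m = (LEAST n. \<one> \<in> jpoly J (inv x) n)"
    have ex: "\<exists>n. \<one> \<in> jpoly J x n" "\<exists>m. \<one> \<in> jpoly J (inv x) m" using big x(1) ix(1) no by blast+
    have n: "\<one> \<in> jpoly J x n" unfolding n_def using ex(1) by (rule LeastI_ex)
    have m: "\<one> \<in> jpoly J (inv x) m" unfolding m_def using ex(2) by (rule LeastI_ex)
    have nmin: "\<one> \<notin> jpoly J x i" if "i < n" for i using not_less_Least that unfolding n_def by blast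
    have mmin: "\<one> \<notin> jpoly J (inv x) i" if "i < m" for i using not_less_Least that unfolding m_def by blast
    show False
    proof (cases "m \<le> n")
      case True then show ?thesis using reduce[OF x n m] nmin by blast
    next
      case False
      then have "n \<le> m" by simp
      moreover have "\<one> \<in> jpoly J (inv (inv x)) n" using n ix(3) by simp
      ultimately obtain i where "i < m" "\<one> \<in> jpoly J (inv x) i" using reduce[OF ix(1,2) m] by blast
      then show ?thesis using mmin by blast
    qed
  qed
  have V: "vring E V" unfolding vring_def using assms(1) Vsubring VE val by blast
  moreover have "I \<subseteq> vmax V"
  proof
    fix j assume "j \<in> I"
    then have j: "j \<in> J" using JE by blast
    then have "j \<in> V" unfolding V_def using JE(2) Jmul by blast
    moreover have "inv j \<notin> V" if "j \<noteq> \<zero>"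
    proof
      assume "inv j \<in> V"
      then have "inv j \<otimes> j \<in> J" using j unfolding V_def by blast
      then show False using that JE(4) Jcar[OF j] by simp
    qed
    ultimately show "j \<in> vmax V" unfolding vmax_def by blast
  qed
  ultimately show thesis using that AV by blast
qed

subsection \<open>Ramification\<close>

context
  fixes F V v
  assumes D: "dval F V v"
begin

lemma dval_vring: "vring F V"
  using D unfolding dval_def by blast

lemmas dvr = vringD[OF dval_vring]

lemma dval_mult: "x \<in> F \<Longrightarrow> y \<in> F \<Longrightarrow> x \<noteq> \<zero> \<Longrightarrow> y \<noteq> \<zero> \<Longrightarrow> v (x \<otimes> y) = v x + v y"
  using D unfolding dval_def by blast

lemma dval_in_iff: "x \<in> F \<Longrightarrow> x \<noteq> \<zero> \<Longrightarrow> x \<in> V \<longleftrightarrow> 0 \<le> v x"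
  using D unfolding dval_def by blast

lemma dval_one: "v \<one> = 0"
  using dval_mult[of \<one> \<one>] subfield_closed(2)[OF dvr(1)] by simp

lemma dval_inv: "x \<in> F \<Longrightarrow> x \<noteq> \<zero> \<Longrightarrow> v (inv x) = - v x"
  using dval_mult[of x "inv x"] subfield_closed(8)[OF dvr(1)] dvr(10) nonzero_imp_inverse_nonzero dval_one
  by simp

lemma dval_div: "x \<in> F \<Longrightarrow> y \<in> F \<Longrightarrow> x \<noteq> \<zero> \<Longrightarrow> y \<noteq> \<zero> \<Longrightarrow> v (x \<oslash> y) = v x - v y"
  using dval_mult[of x "inv y"] dval_inv[of y] subfield_closed(8)[OF dvr(1)] dvr(10) nonzero_imp_inverse_nonzero
  by (simp add: m_div_def)

lemma dval_vmax_iff: "x \<in> F \<Longrightarrow> x \<noteq> \<zero> \<Longrightarrow> x \<in> vmax V \<longleftrightarrow> 0 < v x"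
  using dval_in_iff[of x] dval_in_iff[of "inv x"] dval_inv[of x] subfield_closed(8)[OF dvr(1), of x] dvr(10)[of x]
    nonzero_imp_inverse_nonzero[of x]
  unfolding vmax_def by auto

lemma dval_vunits_iff: "x \<in> F \<Longrightarrow> x \<noteq> \<zero> \<Longrightarrow> x \<in> vunits V \<longleftrightarrow> v x = 0"
  using dval_in_iff[of x] dval_vmax_iff[of x] unfolding vunits_iff by auto

lemma dval_pow: "x \<in> F \<Longrightarrow> x \<noteq> \<zero> \<Longrightarrow> v (x [^] (n::nat)) = int n * v x"
proof (induction n)
  case 0 then show ?case using dval_one by simp
next
  case (Suc n)
  have "x [^] n \<in> F" "x [^] n \<noteq> \<zero>"
    using Suc.prems subfield_closed(9)[OF dvr(1)] pow_nonzero dvr(10) by auto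
  then show ?case using Suc dval_mult[of "x [^] n" x] by (simp add: algebra_simps)
qed

lemma dval_cube: "x \<in> F \<Longrightarrow> x \<noteq> \<zero> \<Longrightarrow> v (x \<otimes> x \<otimes> x) = 3 * v x"
  using dval_mult[of x x] dval_mult[of "x \<otimes> x" x] subfield_closed(4)[OF dvr(1), of x x] dvr(10)[of x]
  by (simp add: integral_iff)

text \<open>Factor out \<open>x\<close>: the remaining factor is 1 plus an element of the maximal
  ideal, hence a unit.\<close>

lemma dval_add_less:
  assumes "x \<in> F" "y \<in> F" "x \<noteq> \<zero>" "y \<noteq> \<zero>" "v x < v y"
  shows "x \<oplus> y \<noteq> \<zero>" "v (x \<oplus> y) = v x"
proof -
  have c: "x \<in> carrier R" "y \<in> carrier R" using assms dvr(10) by auto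
  have yx: "y \<oslash> x \<in> F" "y \<oslash> x \<noteq> \<zero>"
    using subfield_closed(7)[OF dvr(1) assms(2,1)] div_nonzero[OF c(2,1) assms(4,3)] by auto
  have "y \<oslash> x \<in> vmax V"
    using dval_vmax_iff[OF yx] dval_div[OF assms(2,1,4,3)] assms(5) by simp
  then have u: "\<one> \<oplus> y \<oslash> x \<in> vunits V" using one_plus_vmax[OF dval_vring] by blast
  then have uF: "\<one> \<oplus> y \<oslash> x \<in> F" "\<one> \<oplus> y \<oslash> x \<noteq> \<zero>"
    using vunits_subset[OF dval_vring] dvr(12) vunits_carrier[OF dval_vring] by blast+
  have "x \<otimes> (\<one> \<oplus> y \<oslash> x) = x \<oplus> y" using c assms(3) by (simp add: field_norm)
  then show "x \<oplus> y \<noteq> \<zero>" "v (x \<oplus> y) = v x"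
    using dval_mult[OF assms(1) uF(1) assms(3) uF(2)] dval_vunits_iff[OF uF] u uF c assms(3) integral_iff
    by auto
qed

lemma dval_uniformizer:
  obtains t where "t \<in> F" "t \<noteq> \<zero>" "v t = 1"
  using D unfolding dval_def by blast

end

text \<open>Only the inclusion of the maximal ideals is given. It already forces units of
  \<open>V\<close> to have value 0 under \<open>w\<close>, and dividing an element by the right
  power of a uniformizer of \<open>v\<close> then shows that \<open>w\<close> is a multiple of
  \<open>v\<close> on \<open>F\<close>.\<close>

lemma dval_extension:
  assumes "dval F V v" "dval E W w" "F \<subseteq> E" "vmax V \<subseteq> vmax W"
  obtains e :: nat where "e > 0" "\<And>x. x \<in> F \<Longrightarrow> x \<noteq> \<zero> \<Longrightarrow> w x = int e * v x"
proof -
  note f = subfield_closed[OF vringD(1)[OF dval_vring[OF assms(1)]]]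
  obtain t where t: "t \<in> F" "t \<noteq> \<zero>" "v t = 1" using dval_uniformizer[OF assms(1)] .
  have "t \<in> vmax W" using dval_vmax_iff[OF assms(1) t(1,2)] t(3) assms(4) by auto
  then have wt: "w t > 0" using dval_vmax_iff[OF assms(2), of t] t assms(3) by auto
  have ge: "w x \<ge> 0" if x: "x \<in> F" "x \<noteq> \<zero>" "v x = 0" for x
  proof (rule ccontr)
    assume neg: "\<not> ?thesis"
    \<comment> \<open>If \<open>w x\<close> is at most -1, this exponent is large enough to make the
      value of \<open>x [^] n \<otimes> t\<close> nonpositive under \<open>w\<close>, although that
      element still has value 1 under \<open>v\<close>.\<close>
    define n where "n = nat (w t)"
    have xn: "x [^] n \<in> F" "x [^] n \<noteq> \<zero>" using f(9,10) x pow_nonzero by auto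
    have y: "x [^] n \<otimes> t \<in> F" "x [^] n \<otimes> t \<noteq> \<zero>" using xn t f(4,10) integral_iff by auto
    have "v (x [^] n \<otimes> t) = 1" using dval_mult[OF assms(1) xn(1) t(1) xn(2) t(2)] dval_pow[OF assms(1) x(1,2)] x(3) t(3) by simp
    then have "x [^] n \<otimes> t \<in> vmax W" using dval_vmax_iff[OF assms(1) y] assms(4) by auto
    then have "0 < w (x [^] n \<otimes> t)" using dval_vmax_iff[OF assms(2), of "x [^] n \<otimes> t"] y assms(3) by auto
    also have "w (x [^] n \<otimes> t) = int n * w x + w t"
      using dval_mult[OF assms(2), of "x [^] n" t] dval_pow[OF assms(2), of x n] subsetD[OF assms(3)] xn t x by simp
    also have "int n * w x \<le> int n * (- 1)" using neg by (intro mult_left_mono) auto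
    finally show False using wt unfolding n_def by simp
  qed
  have unit: "w x = 0" if x: "x \<in> F" "x \<noteq> \<zero>" "v x = 0" for x
  proof -
    have ix: "inv x \<in> F" "inv x \<noteq> \<zero>" using x f(8,10) nonzero_imp_inverse_nonzero by auto
    have "w (inv x) = - w x" using dval_inv[OF assms(2), of x] x assms(3) by auto
    then show ?thesis using ge[OF x] ge[OF ix] dval_inv[OF assms(1) x(1,2)] x(3) by simp
  qed
  have "w x = w t * v x" if x: "x \<in> F" "x \<noteq> \<zero>" for x
  proof (cases "v x \<ge> 0")
    case True
    define n where "n = nat (v x)"
    have ni: "int n = v x" using True unfolding n_def by simp
    have tn: "t [^] n \<in> F" "t [^] n \<noteq> \<zero>" using f(9,10) t pow_nonzero by auto
    define y where "y = x \<oslash> t [^] n"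
    have y: "y \<in> F" "y \<noteq> \<zero>" unfolding y_def using f(7)[OF x(1) tn(1)] div_nonzero[of x "t [^] n"] x tn f(10) by auto
    have "v y = 0" unfolding y_def using dval_div[OF assms(1) x(1) tn(1) x(2) tn(2)] dval_pow[OF assms(1) t(1,2), of n] t(3) ni by simp
    then have "w y = 0" using unit y by blast
    moreover have "w y = w x - int n * w t"
      unfolding y_def using dval_div[OF assms(2), of x "t [^] n"] dval_pow[OF assms(2), of t n] x t tn subsetD[OF assms(3)] by simp
    ultimately show ?thesis using ni by (simp add: mult.commute)
  next
    case False
    define n where "n = nat (- v x)"
    have ni: "int n = - v x" using False unfolding n_def by simp
    have tn: "t [^] n \<in> F" "t [^] n \<noteq> \<zero>" using f(9,10) t pow_nonzero by auto
    define y where "y = x \<otimes> t [^] n"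
    have y: "y \<in> F" "y \<noteq> \<zero>" unfolding y_def using f(4)[OF x(1) tn(1)] x tn f(10) integral_iff by auto
    have "v y = 0" unfolding y_def using dval_mult[OF assms(1) x(1) tn(1) x(2) tn(2)] dval_pow[OF assms(1) t(1,2), of n] t(3) ni by simp
    then have "w y = 0" using unit y by blast
    moreover have "w y = w x + int n * w t"
      unfolding y_def using dval_mult[OF assms(2), of x "t [^] n"] dval_pow[OF assms(2), of t n] x t tn subsetD[OF assms(3)] by simp
    ultimately show ?thesis using ni by (simp add: algebra_simps)
  qed
  then show thesis using that[of "nat (w t)"] wt by auto
qed

text \<open>Both valuations live on the same field, so the factor \<open>e\<close> between them
  divides the value 1 attained by \<open>w\<close>.\<close>

lemma dval_unique:
  assumes "dval F V v" "dval F W w" "vmax V \<subseteq> vmax W" "x \<in> F" "x \<noteq> \<zero>"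
  shows "w x = v x"
proof -
  obtain e where e: "e > 0" "\<And>x. x \<in> F \<Longrightarrow> x \<noteq> \<zero> \<Longrightarrow> w x = int e * v x"
    using dval_extension[OF assms(1,2) subset_refl assms(3)] by blast
  obtain t where "t \<in> F" "t \<noteq> \<zero>" "w t = 1" using dval_uniformizer[OF assms(2)] .
  then have "int e * v t = 1" using e by simp
  then have "e = 1" using e(1) by (auto simp: zmult_eq_1_iff)
  then show ?thesis using e(2)[OF assms(4,5)] by simp
qed

lemma dval_vmax_eq:
  assumes "dval F V v" "dval F W w" "vmax V \<subseteq> vmax W"
  shows "vmax V = vmax W"
proof -
  have "x \<in> vmax V" if "x \<in> vmax W" for x
  proof (cases "x = \<zero>")
    case True then show ?thesis using zero_in_vmax[OF dval_vring[OF assms(1)]] by simp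
  next
    case False
    have "x \<in> F" using that vmax_subset[OF dval_vring[OF assms(2)]] vringD(12)[OF dval_vring[OF assms(2)]] by blast
    then show ?thesis using dval_unique[OF assms _ False] dval_vmax_iff[OF assms(1) _ False] dval_vmax_iff[OF assms(2) _ False] that by auto
  qed
  then show ?thesis using assms(3) by blast
qed

text \<open>The first \<open>e\<close> powers of a uniformizer have values that are distinct modulo
  \<open>e\<close>, and elements of \<open>F\<close> have values divisible by \<open>e\<close>; so
  these powers are independent over \<open>F\<close>.\<close>

lemma ramification_index_le:
  assumes "dval E W w" "subfield F R" "F \<subseteq> E" "dimension n F E" "e > 0"
    and "\<And>x. x \<in> F \<Longrightarrow> x \<noteq> \<zero> \<Longrightarrow> int e dvd w x"
  shows "e \<le> n"
proof -
  note ec = subfield_closed[OF vringD(1)[OF dval_vring[OF assms(1)]]]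
  obtain t where t: "t \<in> E" "t \<noteq> \<zero>" "w t = 1" using dval_uniformizer[OF assms(1)] .
  have "independent F (exp_base t e)"
  proof (rule independent_powers[OF dval_vring[OF assms(1)] assms(2,3) t(1,2)])
    fix d a assume d: "0 < d" "d < e" and a: "a \<in> F - {\<zero>}"
    have td: "t [^] d \<in> E" "t [^] d \<noteq> \<zero>" using ec(9,10) t pow_nonzero by auto
    have aE: "a \<in> E" "a \<noteq> \<zero>" using a assms(3) by auto
    have "w (a \<otimes> t [^] d) = w a + int d"
      using dval_mult[OF assms(1) aE(1) td(1) aE(2) td(2)] dval_pow[OF assms(1) t(1,2)] t(3) by simp
    moreover have "w a + int d \<noteq> 0"
    proof
      assume "w a + int d = 0"
      moreover have "int e dvd w a" using assms(6) a by auto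
      ultimately have "int e dvd int d" by (metis add_eq_0_iff dvd_minus_iff)
      then show False using d zdvd_not_zless[of "int d" "int e"] by simp
    qed
    moreover have "a \<otimes> t [^] d \<in> E" "a \<otimes> t [^] d \<noteq> \<zero>" using ec(4,10) aE td integral_iff by auto
    ultimately show "a \<otimes> t [^] d \<notin> vunits W" using dval_vunits_iff[OF assms(1)] by auto
  qed
  moreover have "set (exp_base t e) \<subseteq> E" using ec(9) t by (auto simp: exp_base_def)
  ultimately show ?thesis
    using independent_length_le_dimension[OF assms(2,4)] by (fastforce simp: exp_base_def)
qed

text \<open>If the ramification index is 3, then so is the degree of the subextension generated by a
  uniformizer \<open>t\<close>, and the values of \<open>a\<close>, \<open>b t\<close>, \<open>c t\<^sup>2\<close> are distinct modulo 3.\<close>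

lemma totally_ramified_approximation:
  assumes "dval E W w" "subfield F R" "F \<subseteq> E" "dimension 3 F E"
    and "\<And>x. x \<in> F \<Longrightarrow> x \<noteq> \<zero> \<Longrightarrow> 3 dvd w x"
    and "u \<in> E" "u \<notin> F" "w u = 0"
  obtains a z where "a \<in> F" "a \<noteq> \<zero>" "z \<in> E" "z \<noteq> \<zero>" "w a = 0" "w z > 0" "\<not> 3 dvd w z" "u = a \<oplus> z"
proof -
  have E: "subfield E R" using vringD(1)[OF dval_vring[OF assms(1)]] .
  note ec = subfield_closed[OF E] and fc = subfield_closed[OF assms(2)]
  note mult = dval_mult[OF assms(1)]
  obtain t where t: "t \<in> E" "t \<noteq> \<zero>" "w t = 1" using dval_uniformizer[OF assms(1)] .
  have tF: "t \<notin> F" using assms(5)[of t] t by auto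
  obtain a b c where abc: "a \<in> F" "b \<in> F" "c \<in> F" "u = a \<oplus> b \<otimes> t \<oplus> c \<otimes> (t \<otimes> t)"
    using dimension_3_basis(2)[OF assms(2) E assms(3,4) t(1) tF assms(6)] by blast
  define z1 z2 where "z1 = b \<otimes> t" and "z2 = c \<otimes> (t \<otimes> t)"
  have aE: "a \<in> E" "b \<in> E" "c \<in> E" using abc assms(3) by auto
  have t2: "t \<otimes> t \<in> E" "t \<otimes> t \<noteq> \<zero>" "w (t \<otimes> t) = 2"
    using mult[OF t(1,1,2,2)] t ec(4,10) integral_iff by auto
  have z1: "z1 \<in> E" "b \<noteq> \<zero> \<Longrightarrow> z1 \<noteq> \<zero> \<and> w z1 = w b + 1" "b = \<zero> \<Longrightarrow> z1 = \<zero>"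
    unfolding z1_def using mult[OF aE(2) t(1) _ t(2)] t ec(4,10) aE integral_iff by auto
  have z2: "z2 \<in> E" "c \<noteq> \<zero> \<Longrightarrow> z2 \<noteq> \<zero> \<and> w z2 = w c + 2" "c = \<zero> \<Longrightarrow> z2 = \<zero>"
    unfolding z2_def using mult[OF aE(3) t2(1) _ t2(2)] t2 ec(4,10) aE integral_iff by auto
  define z where "z = z1 \<oplus> z2"
  have zE: "z \<in> E" unfolding z_def using z1 z2 ec(3) by simp
  have u: "u = a \<oplus> z" unfolding abc(4) z_def z1_def z2_def using aE t ec(4,10) by (simp add: a_assoc)
  have zn: "z \<noteq> \<zero>" using u assms(7) abc(1) fc(10) by auto
  have b3: "b \<noteq> \<zero> \<Longrightarrow> 3 dvd w b" and c3: "c \<noteq> \<zero> \<Longrightarrow> 3 dvd w c" using assms(5) abc by auto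
  have z3: "\<not> 3 dvd w z"
  proof -
    consider "b = \<zero>" "c \<noteq> \<zero>" | "b \<noteq> \<zero>" "c = \<zero>" | "b \<noteq> \<zero>" "c \<noteq> \<zero>"
      using zn z1(3) z2(3) unfolding z_def by fastforce
    then show ?thesis
    proof cases
      case 1
      then have "w z = w c + 2" unfolding z_def using z1 z2 ec(10) by simp
      then show ?thesis using c3[OF 1(2)] by presburger
    next
      case 2
      then have "w z = w b + 1" unfolding z_def using z1 z2 ec(10) by simp
      then show ?thesis using b3[OF 2(1)] by presburger
    next
      case 3
      have w1: "z1 \<noteq> \<zero>" "w z1 = w b + 1" and w2: "z2 \<noteq> \<zero>" "w z2 = w c + 2" using z1(2)[OF 3(1)] z2(2)[OF 3(2)] by auto
      have "w z1 \<noteq> w z2" using w1(2) w2(2) b3[OF 3(1)] c3[OF 3(2)] by presburger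
      then consider "w z1 < w z2" | "w z2 < w z1" by linarith
      then have "w z = w z1 \<or> w z = w z2"
      proof cases
        case 1 then show ?thesis unfolding z_def using dval_add_less(2)[OF assms(1) z1(1) z2(1) w1(1) w2(1)] by simp
      next
        case 2 
        then have "w (z2 \<oplus> z1) = w z2" using dval_add_less(2)[OF assms(1) z2(1) z1(1) w2(1) w1(1)] by simp
        then show ?thesis unfolding z_def using a_comm[of z1 z2] z1(1) z2(1) ec(10) by simp
      qed
      then show ?thesis using w1(2) w2(2) b3[OF 3(1)] c3[OF 3(2)] by presburger
    qed
  qed
  have a0: "a \<noteq> \<zero>" using u assms(8) z3 ec(10) zE by (intro notI) auto
  have wa: "3 dvd w a" using assms(5) abc(1) a0 by blast
  then have "w a \<noteq> w z" using z3 by auto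
  then consider "w a < w z" | "w z < w a" by linarith
  then have "w a = 0 \<and> w z > 0"
  proof cases
    case 1 then show ?thesis using dval_add_less(2)[OF assms(1) aE(1) zE a0 zn] u assms(8) by simp
  next
    case 2 
    then have "w (z \<oplus> a) = w z" using dval_add_less(2)[OF assms(1) zE aE(1) zn a0] by simp
    then show ?thesis using u a_comm[of a z] aE zE ec(10) assms(8) z3 by simp
  qed
  then show thesis using that[OF abc(1) a0 zE zn] z3 u by blast
qed

lemma three_in_subfield: "subfield F R \<Longrightarrow> \<guillemotleft>3\<guillemotright> \<in> F"
proof -
  assume "subfield F R"
  note cl = subfield_closed[OF this]
  have "\<guillemotleft>3\<guillemotright> = \<one> \<oplus> \<one> \<oplus> \<one>" by (simp add: of_integer_def eval_nat_numeral a_assoc)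
  then show ?thesis using cl by simp
qed

text \<open>Approximate \<open>u\<close> by \<open>a\<close> in \<open>F\<close> with error
  \<open>z\<close> of positive value prime to 3. Then
  \<open>u^3 - a^3 = z (3 a^2 + 3 a z + z^2)\<close>, where the second factor is a unit because 3
  and \<open>a\<close> are. The left side lies in \<open>F\<close>, so its value is divisible by 3,
  whereas the value of \<open>z\<close> is not.\<close>

lemma unit_cube_root_unramified:
  assumes "dval E W w" "subfield F R" "F \<subseteq> E" "dimension 3 F E"
    and "\<And>x. x \<in> F \<Longrightarrow> x \<noteq> \<zero> \<Longrightarrow> 3 dvd w x"
    and "u \<in> E" "u \<notin> F" "w u = 0" "u \<otimes> u \<otimes> u \<in> F"
    and "\<guillemotleft>3\<guillemotright> \<noteq> \<zero>" "w \<guillemotleft>3\<guillemotright> = 0"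
  shows False
proof -
  have E: "subfield E R" using vringD(1)[OF dval_vring[OF assms(1)]] .
  note ec = subfield_closed[OF E] and fc = subfield_closed[OF assms(2)]
  note mult = dval_mult[OF assms(1)]
  obtain a z where az: "a \<in> F" "a \<noteq> \<zero>" "z \<in> E" "z \<noteq> \<zero>" "w a = 0" "w z > 0" "\<not> 3 dvd w z" "u = a \<oplus> z"
    using totally_ramified_approximation[OF assms(1-8)] .
  have aE: "a \<in> E" using az assms(3) by auto
  have c: "a \<in> carrier R" "z \<in> carrier R" using aE az ec by auto
  have t3: "\<guillemotleft>3\<guillemotright> \<in> E" using three_in_subfield[OF E] .
  define h where "h = \<guillemotleft>3\<guillemotright> \<otimes> (a \<otimes> a)"
  have aa: "a \<otimes> a \<in> E" "a \<otimes> a \<noteq> \<zero>" "w (a \<otimes> a) = 0"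
    using mult[OF aE aE az(2,2)] az(2,5) aE c ec(4) integral_iff by auto
  have h: "h \<in> E" "h \<noteq> \<zero>" "w h = 0"
    unfolding h_def using mult[OF t3 aa(1) assms(10) aa(2)] aa assms(10,11) t3 ec(4,10) integral_iff by auto
  define g where "g = \<guillemotleft>3\<guillemotright> \<otimes> a \<oplus> z"
  have g: "g \<in> E" unfolding g_def using t3 aE az(3) ec(3,4) by simp
  have gz: "g \<in> W"
  proof -
    have "\<guillemotleft>3\<guillemotright> \<in> W" "a \<in> W" "z \<in> W" using dval_in_iff[OF assms(1)] t3 assms(10,11) aE az by auto
    then show ?thesis unfolding g_def using vringD(6,7)[OF dval_vring[OF assms(1)]] by blast
  qed
  define d where "d = h \<oplus> g \<otimes> z"
  have d: "d \<in> E" "d \<noteq> \<zero>" "w d = 0"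
  proof -
    have "z \<in> vmax W" using dval_vmax_iff[OF assms(1) az(3,4)] az(6) by simp
    then have gzm: "g \<otimes> z \<in> vmax W" using vmax_mult_right[OF dval_vring[OF assms(1)] gz] by blast
    show "d \<in> E" unfolding d_def using h g az(3) ec(3,4) by simp
    have "d \<noteq> \<zero> \<and> w d = 0"
    proof (cases "g \<otimes> z = \<zero>")
      case True then show ?thesis unfolding d_def using h ec(10) by simp
    next
      case False
      have "w (g \<otimes> z) > 0" using dval_vmax_iff[OF assms(1) _ False] gzm g az(3) ec(4) by simp
      then show ?thesis unfolding d_def using dval_add_less[OF assms(1) h(1) _ h(2) False] h(3) g az(3) ec(4) by simp
    qed
    then show "d \<noteq> \<zero>" "w d = 0" by auto
  qed
  have eq: "u \<otimes> u \<otimes> u \<ominus> a \<otimes> a \<otimes> a = z \<otimes> d"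
    unfolding az(8) d_def g_def h_def using c by (simp add: ring_norm)
  have zd: "z \<otimes> d \<noteq> \<zero>" using az d ec(10) integral_iff by simp
  have "u \<otimes> u \<otimes> u \<ominus> a \<otimes> a \<otimes> a \<in> F" using assms(9) az(1) fc(4,5) by simp
  then have "3 dvd w (z \<otimes> d)" using assms(5)[of "z \<otimes> d"] zd unfolding eq by blast
  then show False using mult[OF az(3) d(1) az(4) d(2)] d(3) az(7) by simp
qed

text \<open>The scheme of \<open>unit_cube_root_unramified\<close> with \<open>X^3 - r\<close>
  replaced by the minimal polynomial of an algebraic element \<theta>. Evaluating that polynomial at
  the approximation \<open>a = \<theta> - z\<close> gives \<open>z\<close> times a unit, because its
  derivative at \<theta> is a nonzero algebraic element and so has value 0.\<close>

lemma constant_extension_unramified: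
  assumes "dval E W w" "subfield F R" "F \<subseteq> E" "dimension 3 F E"
    and "\<And>x. x \<in> F \<Longrightarrow> x \<noteq> \<zero> \<Longrightarrow> 3 dvd w x"
    and "subfield \<kappa> R" "\<kappa> \<subseteq> F" "\<kappa> \<subseteq> W" "subfield l R" "\<kappa> \<subseteq> l" "l \<subseteq> E" "dimension 3 \<kappa> l"
    and "\<guillemotleft>3\<guillemotright> \<noteq> \<zero>"
  shows "l \<subseteq> F"
proof (rule ccontr)
  assume "\<not> l \<subseteq> F"
  then obtain \<theta> where th: "\<theta> \<in> l" "\<theta> \<notin> F" by blast
  have E: "subfield E R" using vringD(1)[OF dval_vring[OF assms(1)]] .
  note ec = subfield_closed[OF E] and fc = subfield_closed[OF assms(2)] and lc = subfield_closed[OF assms(9)]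
    and kc = subfield_closed[OF assms(6)]
  note mult = dval_mult[OF assms(1)]
  have lW: "l \<subseteq> W"
  proof
    fix x assume x: "x \<in> l"
    have "(algebraic over \<kappa>) x"
      using finite_dimension_imp_algebraic[OF assms(6) subfieldE(1)[OF assms(9)] finite_dimensionI[OF assms(12)] x] .
    then show "x \<in> W" using algebraic_in_vring[OF dval_vring[OF assms(1)] assms(6,8)] x assms(11) by blast
  qed
  have lunit: "w x = 0" if "x \<in> l" "x \<noteq> \<zero>" for x
    using subfield_units[OF assms(9) lW that] dval_vunits_iff[OF assms(1), of x] that assms(11) by blast
  have thk: "\<theta> \<notin> \<kappa>" "\<theta> \<noteq> \<zero>" "\<theta> \<in> E" using th assms(7,11) fc(1) by auto
  note bas = dimension_3_basis[OF assms(6,9,10,12) th(1) thk(1)]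
  have th3: "\<theta> \<otimes> \<theta> \<otimes> \<theta> \<in> l" using th(1) lc(4) by simp
  obtain p q r where pqr: "p \<in> \<kappa>" "q \<in> \<kappa>" "r \<in> \<kappa>" "\<theta> \<otimes> \<theta> \<otimes> \<theta> = p \<oplus> q \<otimes> \<theta> \<oplus> r \<otimes> (\<theta> \<otimes> \<theta>)"
    using bas(2)[OF th3] by blast
  obtain a z where az: "a \<in> F" "a \<noteq> \<zero>" "z \<in> E" "z \<noteq> \<zero>" "w a = 0" "w z > 0" "\<not> 3 dvd w z" "\<theta> = a \<oplus> z"
    using totally_ramified_approximation[OF assms(1-5) thk(3) th(2) lunit[OF th(1) thk(2)]] .
  have c: "p \<in> carrier R" "q \<in> carrier R" "r \<in> carrier R" "\<theta> \<in> carrier R" "a \<in> carrier R" "z \<in> carrier R"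
    using pqr kc(10) th lc(10) az(1) fc(10) az(3) ec(10) by auto
  \<comment> \<open>The derivative at \<theta> of \<open>X^3 - r X^2 - q X - p\<close>; its leading
    coefficient 3 keeps it from vanishing.\<close>
  define g where "g = (\<ominus> q) \<oplus> (\<ominus> (r \<oplus> r)) \<otimes> \<theta> \<oplus> \<guillemotleft>3\<guillemotright> \<otimes> (\<theta> \<otimes> \<theta>)"
  have g0: "g \<noteq> \<zero>"
  proof
    assume "g = \<zero>"
    then have "\<guillemotleft>3\<guillemotright> = \<zero>"
      using indep3D(3)[OF bas(1), of "\<ominus> q" "\<ominus> (r \<oplus> r)" "\<guillemotleft>3\<guillemotright>"] pqr kc(3,6) three_in_subfield[OF assms(6)]
      unfolding g_def by blast
    with assms(13) show False ..
  qed
  have gl: "g \<in> l" unfolding g_def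
    using pqr assms(10) th(1) three_in_subfield[OF assms(9)] lc(3,4,6) by (meson subsetD)
  then have g: "g \<in> E" "w g = 0" using lunit[OF _ g0] assms(11) by auto
  \<comment> \<open>The remaining part of the Taylor expansion at \<theta>: the polynomial at
    \<open>\<theta> - z\<close> equals \<open>- z (g + h z)\<close>.\<close>
  define h where "h = z \<ominus> (\<guillemotleft>3\<guillemotright> \<otimes> \<theta> \<ominus> r)"
  have "\<guillemotleft>3\<guillemotright> \<otimes> \<theta> \<ominus> r \<in> l" using pqr(3) assms(10) th(1) three_in_subfield[OF assms(9)] lc(4,5) by blast
  then have "\<guillemotleft>3\<guillemotright> \<otimes> \<theta> \<ominus> r \<in> W" using lW by blast
  moreover have zm: "z \<in> vmax W" using dval_vmax_iff[OF assms(1) az(3,4)] az(6) by simp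
  ultimately have hW: "h \<in> W"
    unfolding h_def a_minus_def[where x = z] using vringD(6,8)[OF dval_vring[OF assms(1)]] vmax_subset[OF dval_vring[OF assms(1)]] by blast
  then have hz: "h \<otimes> z \<in> vmax W" "h \<in> E"
    using vmax_mult_right[OF dval_vring[OF assms(1)] _ zm] vringD(12)[OF dval_vring[OF assms(1)]] by auto
  define d where "d = g \<oplus> h \<otimes> z"
  have dE: "d \<in> E" unfolding d_def using g hz az(3) ec(3,4) by simp
  have d: "d \<noteq> \<zero>" "w d = 0"
  proof -
    have "d \<noteq> \<zero> \<and> w d = 0"
    proof (cases "h \<otimes> z = \<zero>")
      case True then show ?thesis unfolding d_def using g g0 ec(10) by simp
    next
      case False
      have "w (h \<otimes> z) > 0" using dval_vmax_iff[OF assms(1) _ False] hz az(3) ec(4) by simp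
      then show ?thesis unfolding d_def using dval_add_less[OF assms(1) g(1) _ g0 False] g(2) hz az(3) ec(4) by simp
    qed
    then show "d \<noteq> \<zero>" "w d = 0" by auto
  qed
  have az': "a = \<theta> \<ominus> z" unfolding az(8) using c by (simp add: ring_norm)
  have "a \<otimes> a \<otimes> a \<ominus> (p \<oplus> q \<otimes> a \<oplus> r \<otimes> (a \<otimes> a)) = \<ominus> (z \<otimes> d)"
    unfolding d_def g_def h_def az' using c(1-4,6) by (simp add: ring_norm pqr(4))
  moreover have "a \<otimes> a \<otimes> a \<ominus> (p \<oplus> q \<otimes> a \<oplus> r \<otimes> (a \<otimes> a)) \<in> F"
    using az(1) pqr(1-3) assms(7) fc(3,4,5) by (meson subsetD)
  ultimately have "\<ominus> (z \<otimes> d) \<in> F" by simp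
  moreover have zd: "z \<otimes> d \<in> E" "z \<otimes> d \<noteq> \<zero>" using az d dE ec(4,10) integral_iff by auto
  then have "\<ominus> (\<ominus> (z \<otimes> d)) = z \<otimes> d" using ec(10) by simp
  ultimately have "z \<otimes> d \<in> F" using fc(6) by metis
  then have "3 dvd w (z \<otimes> d)" using assms(5) zd by blast
  then show False using mult[OF az(3) dE az(4) d(1)] d(2) az(7) by simp
qed

subsection \<open>Cubic extensions\<close>

lemma subfield_inter:
  assumes "subfield F R" "subfield L R" shows "subfield (F \<inter> L) R"
proof (rule subfieldI_closed)
  note f = subfield_closed[OF assms(1)] and l = subfield_closed[OF assms(2)]
  show "F \<inter> L \<subseteq> carrier R" using f(10) by blast
  show "\<one> \<in> F \<inter> L" using f(2) l(2) by simp
  show "\<And>x y. x \<in> F \<inter> L \<Longrightarrow> y \<in> F \<inter> L \<Longrightarrow> x \<ominus> y \<in> F \<inter> L" using f(5) l(5) by simp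
  show "\<And>x y. x \<in> F \<inter> L \<Longrightarrow> y \<in> F \<inter> L \<Longrightarrow> x \<otimes> y \<in> F \<inter> L" using f(4) l(4) by simp
  show "\<And>x. x \<in> F \<inter> L \<Longrightarrow> x \<noteq> \<zero> \<Longrightarrow> inv x \<in> F \<inter> L" using f(8) l(8) by simp
qed

lemma constant_field_subfield:
  assumes "subfield k R" "subfield F R" "k \<subseteq> F"
  shows "subfield (constant_field k F) R" "k \<subseteq> constant_field k F" "constant_field k F \<subseteq> F"
proof -
  have "constant_field k F = F \<inter> {x \<in> carrier R. (algebraic over k) x}"
    unfolding constant_field_def using subfield_closed(10)[OF assms(2)] by blast
  then show "subfield (constant_field k F) R"
    using subfield_inter[OF assms(2) subfield_of_algebraics[OF assms(1)]] by simp
  show "k \<subseteq> constant_field k F"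
    unfolding constant_field_def using assms(3) algebraic_self[OF subfieldE(1)[OF assms(1)]] by blast
  show "constant_field k F \<subseteq> F" unfolding constant_field_def by blast
qed

lemma constant_field_in_vring:
  assumes "vring F V" "subfield k R" "k \<subseteq> V"
  shows "constant_field k F \<subseteq> V"
  unfolding constant_field_def using algebraic_in_vring[OF assms] by blast

section \<open>Separability of cubic extensions when 3 is nonzero\<close>

lemma coeff_mult_root_factor:
  assumes "a \<in> carrier R" "h2 \<in> carrier R" "h1 \<in> carrier R" "h0 \<in> carrier R"
  shows "coeff (poly_mult [\<one>, \<ominus> a] [h2, h1, h0]) =
    (\<lambda>i. coeff [h2, h1, h0, \<zero>] i \<oplus> coeff [\<ominus> a \<otimes> h2, \<ominus> a \<otimes> h1, \<ominus> a \<otimes> h0] i)"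
proof -
  have "poly_mult [\<one>, \<ominus> a] [h2, h1, h0] = poly_add [h2, h1, h0, \<zero>] (poly_mult [\<ominus> a] [h2, h1, h0])"
    using assms by simp
  moreover have "coeff (poly_mult [\<ominus> a] [h2, h1, h0]) = coeff [\<ominus> a \<otimes> h2, \<ominus> a \<otimes> h1, \<ominus> a \<otimes> h0]"
    using assms poly_add_coeff[of "[\<ominus> a \<otimes> h2, \<ominus> a \<otimes> h1, \<ominus> a \<otimes> h0]" "[]"] by auto
  moreover have "set (poly_mult [\<ominus> a] [h2, h1, h0]) \<subseteq> carrier R"
    using poly_mult_in_carrier[of "[\<ominus> a]" "[h2, h1, h0]"] assms by auto
  ultimately show ?thesis
    using poly_add_coeff[of "[h2, h1, h0, \<zero>]" "poly_mult [\<ominus> a] [h2, h1, h0]"] assms by simp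
qed

lemma coeff_mult_root_factor':
  assumes "a \<in> carrier R" "r1 \<in> carrier R" "r0 \<in> carrier R"
  shows "coeff (poly_mult [\<one>, \<ominus> a] [r1, r0]) =
    (\<lambda>i. coeff [r1, r0, \<zero>] i \<oplus> coeff [\<ominus> a \<otimes> r1, \<ominus> a \<otimes> r0] i)"
proof -
  have "poly_mult [\<one>, \<ominus> a] [r1, r0] = poly_add [r1, r0, \<zero>] (poly_mult [\<ominus> a] [r1, r0])"
    using assms by simp
  moreover have "coeff (poly_mult [\<ominus> a] [r1, r0]) = coeff [\<ominus> a \<otimes> r1, \<ominus> a \<otimes> r0]"
    using assms poly_add_coeff[of "[\<ominus> a \<otimes> r1, \<ominus> a \<otimes> r0]" "[]"] by auto
  moreover have "set (poly_mult [\<ominus> a] [r1, r0]) \<subseteq> carrier R"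
    using poly_mult_in_carrier[of "[\<ominus> a]" "[r1, r0]"] assms by auto
  ultimately show ?thesis
    using poly_add_coeff[of "[r1, r0, \<zero>]" "poly_mult [\<ominus> a] [r1, r0]"] assms by simp
qed

text \<open>A double root \<open>a\<close> is a common root of the minimal polynomial and of its
  derivative, which has degree two with leading coefficient 3. For a generator of degree three this
  contradicts the independence of 1, \<open>a\<close>, \<open>a^2\<close>; for an element of
  \<open>K\<close> the degree 1 already excludes a double root.\<close>

lemma separable_extension_degree_3:
  assumes "field_extension K L" "dimension 3 K L" "\<guillemotleft>3\<guillemotright> \<noteq> \<zero>"
  shows "separable_extension K L"
  unfolding separable_extension_def
proof (intro conjI ballI assms(1))
  have sf: "subfield K R" "subfield L R" "K \<subseteq> L" using assms(1) unfolding field_extension_def by auto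
  note kc = subfield_closed[OF sf(1)]
  fix x assume x: "x \<in> L"
  have xc: "x \<in> carrier R" using x subfield_closed(10)[OF sf(2)] by blast
  show alg: "(algebraic over K) x"
    using finite_dimension_imp_algebraic[OF sf(1) subfieldE(1)[OF sf(2)] finite_dimensionI[OF assms(2)] x] .
  fix a assume a: "a \<in> carrier R"
  let ?p = "Irr K x"
  let ?l = "[\<one>, \<ominus> a]"
  note I = IrrE[OF sf(1) xc alg]
  have p: "?p \<in> carrier (poly_ring R)" "?p \<noteq> []"
    using carrier_polynomial_shell[OF subfieldE(1)[OF sf(1)] I(1)]
      pirreducibleE(1)[OF subfieldE(1)[OF sf(1)] I(1,2)] by auto
  show "alg_mult ?p a \<le> 1"
  proof (rule ccontr)
    assume "\<not> ?thesis"
    then have "(?l [^]\<^bsub>poly_ring R\<^esub> (2::nat)) pdivides ?p"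
      using le_alg_mult_imp_pdivides[OF a p(1), of 2] by simp
    interpret UP: domain "poly_ring R" using univ_poly_is_domain[OF carrier_is_subring] .
    have l: "?l \<in> carrier (poly_ring R)" using a unfolding univ_poly_def polynomial_def by auto
    have "?l [^]\<^bsub>poly_ring R\<^esub> (2::nat) = ?l \<otimes>\<^bsub>poly_ring R\<^esub> ?l"
      using l by (simp add: numeral_2_eq_2)
    then obtain r where r: "r \<in> carrier (poly_ring R)" "?p = ?l \<otimes>\<^bsub>poly_ring R\<^esub> ?l \<otimes>\<^bsub>poly_ring R\<^esub> r"
      using \<open>_ pdivides ?p\<close> unfolding pdivides_def factor_def by auto
    define h where "h = ?l \<otimes>\<^bsub>poly_ring R\<^esub> r"
    have h: "h \<in> carrier (poly_ring R)" unfolding h_def using l r by simp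
    have "?p = ?l \<otimes>\<^bsub>poly_ring R\<^esub> h"
      unfolding h_def r(2) by (rule UP.m_assoc[OF l l r(1)])
    then have ph: "?p = poly_mult ?l h" "h = poly_mult ?l r"
      unfolding h_def by (simp_all only: univ_poly_mult)
    have pol: "polynomial (carrier R) ?l" "polynomial (carrier R) h" "polynomial (carrier R) r"
      using l h r(1) univ_poly_carrier by auto
    have hn: "h \<noteq> []"
      using ph(1) p(2) poly_mult_zero(2)[of ?l] a by auto
    then have rn: "r \<noteq> []" using ph(2) poly_mult_zero(2)[of ?l] a by auto
    have dp: "degree ?p = 1 + degree h" "degree h = 1 + degree r"
      using poly_mult_degree_eq[OF carrier_is_subring pol(1,2)] poly_mult_degree_eq[OF carrier_is_subring pol(1,3)]
        hn rn ph by simp_all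
    show False
    proof (cases "x \<in> K")
      case True
      have q: "[\<one>, \<ominus> x] \<in> carrier (K[X])" using True kc(2,6) unfolding univ_poly_def polynomial_def by auto
      have "eval [\<one>, \<ominus> x] x = \<zero>" using xc by (simp add: r_neg)
      then have "?p pdivides [\<one>, \<ominus> x]" using Irr_minimal[OF sf(1) xc alg q] by blast
      then have "degree ?p \<le> 1"
        using pdivides_imp_degree_le[OF subfieldE(1)[OF sf(1)] I(1) q] by simp
      then show False using dp by simp
    next
      case False
      have d3: "degree ?p = 3" using dimension_3_basis(3)[OF sf assms(2) x False] .
      then have "length r = 2" "length h = 3" using dp rn hn by auto
      then obtain r1 r0 h2 h1 h0 where rh: "r = [r1, r0]" "h = [h2, h1, h0]"
        by (auto simp: length_Suc_conv eval_nat_numeral)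
      have "length ?p = 4" using d3 p(2) by simp
      then obtain d c2 c1 c0 where pe: "?p = [d, c2, c1, c0]"
        by (auto simp: length_Suc_conv eval_nat_numeral)
      have cK: "d \<in> K" "c2 \<in> K" "c1 \<in> K" "c0 \<in> K" "d = \<one>"
        using I(1,3) unfolding pe univ_poly_def polynomial_def by auto
      have cr: "c2 \<in> carrier R" "c1 \<in> carrier R" "c0 \<in> carrier R"
        "r1 \<in> carrier R" "r0 \<in> carrier R" "h2 \<in> carrier R" "h1 \<in> carrier R" "h0 \<in> carrier R"
        using cK kc(10) pol unfolding rh polynomial_def by auto
      have "coeff ?p = (\<lambda>i. coeff [h2, h1, h0, \<zero>] i \<oplus> coeff [\<ominus> a \<otimes> h2, \<ominus> a \<otimes> h1, \<ominus> a \<otimes> h0] i)"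
        using ph(1) coeff_mult_root_factor[OF a cr(6-8)] unfolding rh by simp
      from fun_cong[OF this, of 3] fun_cong[OF this, of 2] fun_cong[OF this, of 1] fun_cong[OF this, of 0]
      have e1: "\<one> = h2" "c2 = h1 \<oplus> \<ominus> a \<otimes> h2" "c1 = h0 \<oplus> \<ominus> a \<otimes> h1" "c0 = \<zero> \<oplus> \<ominus> a \<otimes> h0"
        unfolding pe using cr a cK(5) by simp_all
      have "coeff h = (\<lambda>i. coeff [r1, r0, \<zero>] i \<oplus> coeff [\<ominus> a \<otimes> r1, \<ominus> a \<otimes> r0] i)"
        using ph(2) coeff_mult_root_factor'[OF a cr(4,5)] unfolding rh by simp
      from fun_cong[OF this, of 2] fun_cong[OF this, of 1] fun_cong[OF this, of 0]
      have e2: "h2 = r1" "h1 = r0 \<oplus> \<ominus> a \<otimes> r1" "h0 = \<zero> \<oplus> \<ominus> a \<otimes> r0"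
        unfolding rh using cr a by simp_all
      have r1: "r1 = \<one>" using e1(1) e2(1) by simp
      have root: "a \<otimes> a \<otimes> a \<oplus> c2 \<otimes> (a \<otimes> a) \<oplus> c1 \<otimes> a \<oplus> c0 = \<zero>"
        unfolding e1(2-4) e2 r1 using a cr(5) by (simp add: ring_norm)
      \<comment> \<open>The derivative at \<open>a\<close>, obtained from the coefficients of a
        double factor \<open>X - a\<close> times a linear factor.\<close>
      have der: "c1 \<oplus> (c2 \<oplus> c2) \<otimes> a \<oplus> \<guillemotleft>3\<guillemotright> \<otimes> (a \<otimes> a) = \<zero>"
        unfolding e1(2-4) e2 r1 using a cr(5) by (simp add: ring_norm)
      have ev: "eval ?p a = \<zero>" unfolding pe cK(5) using eval_monic_3[OF a cr(3,2,1)] root by simp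
      have alga: "(algebraic over K) a" using algebraicI[OF I(1) p(2) ev] .
      \<comment> \<open>Being irreducible, the polynomial is also the minimal polynomial of its root
        \<open>a\<close>, so that \<open>a\<close> has degree three.\<close>
      have "Irr K a = ?p"
        using minimal_polynomial_is_unique[OF sf(1) a alga] I(1-3) ev IrrE[OF sf(1) a alga] by blast
      then have "independent K (exp_base a 3)" using exp_base_independent[OF sf(1) a alga] d3 by simp
      then have "indep3 K a" using independent_exp_base_3_iff[OF sf(1) a] by blast
      from indep3D(3)[OF this cK(3) kc(3)[OF cK(2,2)] three_in_subfield[OF sf(1)] der] assms(3)
      show False by blast
    qed
  qed
qed

lemma composite_base: "field_extension K L \<Longrightarrow> composite L K = L"
  unfolding composite_def field_extension_def
  using generate_fieldI[of "L \<union> K" L] subfieldE(3)[of L R] by blast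

text \<open>Ramification supplies geometricity: if \<open>L\<close> came from a degree-three
  extension of the constants \<kappa>, \<open>constant_extension_unramified\<close> would place that
  extension inside \<open>K\<close>. Leaving \<kappa> open allows the use over the full constant
  field as well.\<close>

lemma cubic_extension_of_ramified:
  assumes "field_extension K L" "dimension 3 K L" "\<guillemotleft>3\<guillemotright> \<noteq> \<zero>"
    and "dval L W w" "\<And>x. x \<in> K \<Longrightarrow> x \<noteq> \<zero> \<Longrightarrow> 3 dvd w x"
    and "\<kappa> \<subseteq> K" "\<kappa> \<subseteq> W"
  shows "cubic_extension \<kappa> K L"
  unfolding cubic_extension_def
proof (intro conjI separable_extension_degree_3 assms(1-3) notI)
  have sf: "subfield K R" "subfield L R" "K \<subseteq> L" using assms(1) unfolding field_extension_def by auto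
  assume "\<exists>l. field_extension \<kappa> l \<and> dimension 3 \<kappa> l \<and> L = composite K l"
  then obtain l where l: "subfield \<kappa> R" "subfield l R" "\<kappa> \<subseteq> l" "dimension 3 \<kappa> l" "L = generate_field R (K \<union> l)"
    unfolding field_extension_def composite_def by blast
  have "l \<subseteq> L" unfolding l(5) by (auto intro: generate_field.incl)
  from constant_extension_unramified[OF assms(4) sf(1,3) assms(2,5) l(1) assms(6,7) l(2,3) this l(4) assms(3)]
  have "l \<subseteq> K" .
  then have "K \<union> l = K" by blast
  then have "L = K" using l(5) generate_fieldI[OF subfieldE(3)[OF sf(1)] sf(1)] by simp
  then have "dimension 1 K L" using dimension_one[OF sf(1)] by simp
  then show False using dimension_is_inj[OF sf(1) assms(2)] by fastforce
qed

text \<open>As 3 is prime, being outside \<open>K\<close> already makes \<open>y\<close> a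
  generator, and its cube lying in \<open>K\<close> determines the minimal polynomial.\<close>

lemma purely_cubicI:
  assumes "cubic_extension \<kappa> K L" "y \<in> L" "y \<notin> K" "y \<otimes> y \<otimes> y \<in> K"
  shows "purely_cubic \<kappa> K L"
proof -
  have d: "subfield K R" "subfield L R" "K \<subseteq> L" "dimension 3 K L"
    using assms(1) unfolding cubic_extension_def separable_extension_def field_extension_def by auto
  show ?thesis
    unfolding purely_cubic_def
    using assms dimension_3_basis(4)[OF d assms(2,3)] Irr_pure_cubic[OF d assms(2,3) refl assms(4)] by blast
qed

lemma purely_cubicE:
  assumes "purely_cubic \<kappa> K L"
  obtains y where "subfield K R" "subfield L R" "K \<subseteq> L" "dimension 3 K L"
    "y \<in> L" "y \<notin> K" "y \<otimes> y \<otimes> y \<in> K" "y \<in> carrier R"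
proof -
  have d: "subfield K R" "subfield L R" "K \<subseteq> L" "dimension 3 K L"
    using assms unfolding purely_cubic_def cubic_extension_def separable_extension_def field_extension_def by auto
  obtain y \<beta> where y: "y \<in> L" "\<beta> \<in> K" "L = generate_field R (insert y K)" "Irr K y = [\<one>, \<zero>, \<zero>, \<ominus> \<beta>]"
    using assms unfolding purely_cubic_def by blast
  have yc: "y \<in> carrier R" using y(1) subfield_closed(10)[OF d(2)] by blast
  have bc: "\<beta> \<in> carrier R" using y(2) subfield_closed(10)[OF d(1)] by blast
  have yK: "y \<notin> K"
  proof
    assume "y \<in> K"
    then have "L = K" using y(3) generate_fieldI[of K K] d(1) subfieldE(3)[OF d(1)] by (metis insert_absorb subset_refl)
    then have "dimension 1 K L" using dimension_one[OF d(1)] by simp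
    then show False using dimension_is_inj[OF d(1,4)] by fastforce
  qed
  have alg: "(algebraic over K) y" using dimension_3_basis(5)[OF d y(1) yK] .
  have "y \<otimes> y \<otimes> y \<oplus> \<zero> \<otimes> (y \<otimes> y) \<oplus> \<zero> \<otimes> y \<oplus> \<ominus> \<beta> = \<zero>"
    using IrrE(4)[OF d(1) yc alg] eval_monic_3[OF yc, of "\<ominus> \<beta>" \<zero> \<zero>] bc unfolding y(4) by simp
  then have "y \<otimes> y \<otimes> y = \<beta>" using yc bc eq_neg_iff_add_eq_0[of "y \<otimes> y \<otimes> y" "\<ominus> \<beta>"] by simp
  then show thesis using that[OF d y(1) yK _ yc] y(2) by simp
qed

subsection \<open>Places above a place\<close>

lemma function_field_finite_extension:
  assumes "function_field k F" "field_extension F E" "finite_dimension F E"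
  shows "function_field k E"
proof -
  obtain x where x: "subfield k R" "subfield F R" "k \<subseteq> F" "x \<in> F" "(transcendental over k) x"
    "finite_dimension (generate_field R (insert x k)) F"
    using function_fieldE[OF assms(1)] .
  have E: "subfield E R" "F \<subseteq> E" using assms(2) unfolding field_extension_def by auto
  have "insert x k \<subseteq> carrier R" using x(1,2,4) subfield_closed(10) by blast
  then have "finite_dimension (generate_field R (insert x k)) E"
    using telescopic_base_dim(1)[OF generate_field_is_subfield x(2,6) assms(3)] by blast
  then show ?thesis
    unfolding function_field_def field_extension_def using x E by blast
qed

lemma place_facts:
  assumes "function_field k F" "P \<in> places k F"
  shows "dval F (place_ring F P) (place_val F P)" "P = vmax (place_ring F P)"
    "k \<subseteq> place_ring F P" "P \<subseteq> F" "\<exists>t\<in>P. t \<noteq> \<zero>"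
proof -
  have F: "subfield F R" using assms(1) by (auto elim: function_fieldE)
  note pl = placesE[OF assms(2) F]
  show D: "dval F (place_ring F P) (place_val F P)" using dval_place_val[OF assms] .
  show P: "P = vmax (place_ring F P)" "k \<subseteq> place_ring F P" using pl by auto
  show "P \<subseteq> F" using P(1) vmax_subset[OF pl(1)] pl(4) by blast
  obtain t where t: "t \<in> F" "t \<noteq> \<zero>" "place_val F P t = 1" using dval_uniformizer[OF D] .
  then have "t \<in> P" using dval_vmax_iff[OF D t(1,2)] P(1) by simp
  then show "\<exists>t\<in>P. t \<noteq> \<zero>" using t by blast
qed

lemma place_mem_iff:
  assumes "function_field k F" "P \<in> places k F" "x \<in> F" "x \<noteq> \<zero>"
  shows "x \<in> P \<longleftrightarrow> 0 < place_val F P x"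
  using dval_vmax_iff[OF place_facts(1)[OF assms(1,2)] assms(3,4)] place_facts(2)[OF assms(1,2)] by simp

lemma places_subset_imp_eq:
  assumes "function_field k F" "P \<in> places k F" "Q \<in> places k F" "P \<subseteq> Q"
  shows "P = Q"
  using dval_vmax_eq[OF place_facts(1)[OF assms(1,2)] place_facts(1)[OF assms(1,3)]]
    place_facts(2)[OF assms(1,2)] place_facts(2)[OF assms(1,3)] assms(4) by simp

text \<open>The nonzero \<open>t\<close> in both \<open>Q\<close> and \<open>F\<close> guarantees
  that the valuation does not become trivial on \<open>F\<close>.\<close>

lemma restrict_place:
  assumes "function_field k F" "function_field k E" "F \<subseteq> E" "Q \<in> places k E" "t \<in> Q" "t \<in> F" "t \<noteq> \<zero>"
  shows "Q \<inter> F \<in> places k F"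
proof -
  have F: "subfield F R" and k: "subfield k R" "k \<subseteq> F" using assms(1) by (auto elim: function_fieldE)
  have E: "subfield E R" using assms(2) by (auto elim: function_fieldE)
  note fc = subfield_closed[OF F]
  define W where "W = place_ring E Q"
  have W: "vring E W" "Q = vmax W" "k \<subseteq> W" using placesE[OF assms(4) E] unfolding W_def by auto
  define V where "V = W \<inter> F"
  have "subring V R" unfolding V_def using subring_inter[OF vringD(2)[OF W(1)] subfieldE(1)[OF F]] .
  then have V: "vring F V"
    unfolding vring_def V_def using F vringD(11)[OF W(1)] assms(3) fc(8) by blast
  have mV: "vmax V = Q \<inter> F"
    unfolding W(2) vmax_def V_def using fc(8) by blast
  have "k \<subseteq> V" unfolding V_def using W(3) k(2) by blast
  moreover have "V \<noteq> F"
  proof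
    assume "V = F"
    then have "inv t \<in> W" using fc(8)[OF assms(6,7)] unfolding V_def by blast
    then show False using assms(5,7) unfolding W(2) vmax_def by blast
  qed
  moreover have "k \<noteq> V"
  proof
    assume e: "k = V"
    have "t \<in> V" using mV assms(5,6) unfolding vmax_def by blast
    then have "inv t \<in> W" using subfield_closed(8)[OF k(1), of t] e assms(7) W(3) by blast
    then show False using assms(5,7) unfolding W(2) vmax_def by blast
  qed
  ultimately show ?thesis using placesI[OF V] mV by simp
qed

text \<open>Apply \<open>exists_valuation_ring\<close> to the valuation ring of \<open>P\<close>
  with the ideal \<open>P\<close>. A nonzero element of \<open>P\<close> shows that the ring
  obtained is neither the whole field nor \<open>k\<close>.\<close>

lemma extend_place:
  assumes "function_field k F" "function_field k E" "F \<subseteq> E" "P \<in> places k F"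
  obtains Q where "Q \<in> places k E" "P \<subseteq> Q"
proof -
  have F: "subfield F R" and k: "subfield k R" "k \<subseteq> F" using assms(1) by (auto elim: function_fieldE)
  have E: "subfield E R" using assms(2) by (auto elim: function_fieldE)
  note pl = placesE[OF assms(4) F]
  note vr = vringD[OF pl(1)]
  define A where "A = place_ring F P"
  have sub: "x \<ominus> y \<in> P" if "x \<in> P" "y \<in> P" for x y
    using vmax_add[OF pl(1)] vmax_uminus[OF pl(1)] that pl(2) unfolding a_minus_def by metis
  have mul: "a \<otimes> x \<in> P" if "a \<in> A" "x \<in> P" for a x
    using vmax_mult_right[OF pl(1)] that pl(2) unfolding A_def by metis
  have PA: "P \<subseteq> A" using vmax_subset[OF pl(1)] pl(2) unfolding A_def by blast
  have 01: "\<zero> \<in> P" "\<one> \<notin> P" using zero_in_vmax[OF pl(1)] one_notin_vmax[OF pl(1)] pl(2) by auto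
  have "subring A R" "A \<subseteq> E" unfolding A_def using vr(2,3) assms(3) by auto
  from exists_valuation_ring[OF E this PA 01 sub mul]
  obtain W where W: "vring E W" "A \<subseteq> W" "P \<subseteq> vmax W" by blast
  obtain t where t: "t \<in> P" "t \<noteq> \<zero>" using place_facts(5)[OF assms(1,4)] by blast
  then have tW: "t \<in> W" "inv t \<notin> W" using W(3) unfolding vmax_def by auto
  have tE: "t \<in> E" using t place_facts(4)[OF assms(1,4)] assms(3) by blast
  have "k \<subseteq> W" using W(2) pl(3) unfolding A_def by blast
  moreover have "W \<noteq> E" using tW(2) subfield_closed(8)[OF E tE t(2)] by blast
  moreover have "k \<noteq> W" using tW subfield_closed(8)[OF k(1) _ t(2)] by blast
  ultimately have "vmax W \<in> places k E" using placesI[OF W(1)] by blast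
  then show thesis using that W(3) by blast
qed

text \<open>The factor in \<open>ramification_index\<close> is unique because a uniformizer of
  \<open>P\<close> has value 1; existence is \<open>dval_extension\<close>.\<close>

lemma place_above:
  assumes "function_field k F" "function_field k E" "F \<subseteq> E" "P \<in> places k F" "Q \<in> places k E" "P \<subseteq> Q"
  obtains e :: nat where "e > 0" "\<And>x. x \<in> F \<Longrightarrow> x \<noteq> \<zero> \<Longrightarrow> place_val E Q x = int e * place_val F P x"
    "ramification_index F E P Q = e"
proof -
  note p = place_facts[OF assms(1,4)] and q = place_facts[OF assms(2,5)]
  have "vmax (place_ring F P) \<subseteq> vmax (place_ring E Q)" using p(2) q(2) assms(6) by simp
  from dval_extension[OF p(1) q(1) assms(3) this]
  obtain e :: nat where e: "e > 0" "\<And>x. x \<in> F \<Longrightarrow> x \<noteq> \<zero> \<Longrightarrow> place_val E Q x = int e * place_val F P x"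
    by blast
  have "ramification_index F E P Q = e"
    unfolding ramification_index_def
  proof (rule the_equality)
    show "\<forall>x\<in>F - {\<zero>}. place_val E Q x = int e * place_val F P x" using e(2) by blast
    fix e' assume e': "\<forall>x\<in>F - {\<zero>}. place_val E Q x = int e' * place_val F P x"
    obtain t where "t \<in> F" "t \<noteq> \<zero>" "place_val F P t = 1" using dval_uniformizer[OF p(1)] .
    then show "e' = e" using e(2)[of t] e' by simp
  qed
  then show thesis using that e by blast
qed

lemma place_inter:
  assumes "function_field k F" "function_field k E" "F \<subseteq> E" "P \<in> places k F" "Q \<in> places k E" "P \<subseteq> Q"
  shows "Q \<inter> F = P"
proof -
  obtain t where t: "t \<in> P" "t \<noteq> \<zero>" using place_facts(5)[OF assms(1,4)] by blast
  have PF: "P \<subseteq> F" using place_facts(4)[OF assms(1,4)] .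
  have "Q \<inter> F \<in> places k F" using restrict_place[OF assms(1-3,5)] t assms(6) PF by blast
  then show ?thesis using places_subset_imp_eq[OF assms(1,4)] assms(6) PF by blast
qed

end

subsection \<open>Conjugate places\<close>

context quadratic_extension
begin

abbreviation E where "E \<equiv> qspan F c"

lemmas ecl = subfield_closed[OF qspan_subfield]

lemma conjugate_image_iff:
  assumes "S \<subseteq> E" "x \<in> E" shows "x \<in> conjugate ` S \<longleftrightarrow> conjugate x \<in> S"
proof
  assume "x \<in> conjugate ` S"
  then obtain y where "y \<in> S" "x = conjugate y" by blast
  then show "conjugate x \<in> S" using conjugate_conjugate assms(1) by auto
next
  assume "conjugate x \<in> S"
  then have "conjugate (conjugate x) \<in> conjugate ` S" by blast
  then show "x \<in> conjugate ` S" using conjugate_conjugate[OF assms(2)] by simp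
qed

lemma conjugate_image_subset: "S \<subseteq> E \<Longrightarrow> conjugate ` S \<subseteq> E"
  using conjugate_closed by blast

lemma conjugate_image_image: "S \<subseteq> E \<Longrightarrow> conjugate ` conjugate ` S = S"
  using conjugate_conjugate by (force simp: image_image subset_iff)

lemma conjugate_vring:
  assumes "vring E V" shows "vring E (conjugate ` V)" "vmax (conjugate ` V) = conjugate ` vmax V"
proof -
  note vr = vringD[OF assms]
  note iff = conjugate_image_iff[OF vr(3)]
  have sE: "conjugate ` V \<subseteq> E" using conjugate_image_subset[OF vr(3)] .
  have sr: "subring (conjugate ` V) R"
  proof (rule subringI)
    show "conjugate ` V \<subseteq> carrier R" using sE qspan_carrier by blast
    show "\<one> \<in> conjugate ` V" using iff[of \<one>] ecl(2) vr(5) by simp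
    fix h assume h: "h \<in> conjugate ` V"
    have hE: "h \<in> E" "conjugate h \<in> V" using h sE iff by auto
    show "\<ominus> h \<in> conjugate ` V" using iff[of "\<ominus> h"] hE ecl(6) vr(8) conjugate_minus by simp
    fix g assume g: "g \<in> conjugate ` V"
    have gE: "g \<in> E" "conjugate g \<in> V" using g sE iff by auto
    show "h \<otimes> g \<in> conjugate ` V" using iff[of "h \<otimes> g"] hE gE ecl(4) vr(7) conjugate_mult by simp
    show "h \<oplus> g \<in> conjugate ` V" using iff[of "h \<oplus> g"] hE gE ecl(3) vr(6) conjugate_add by simp
  qed
  have inv': "inv x \<in> conjugate ` V \<longleftrightarrow> inv (conjugate x) \<in> V" if "x \<in> E" "x \<noteq> \<zero>" for x
    using iff[of "inv x"] conjugate_inv[OF that] ecl(8)[OF that] by simp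
  show "vring E (conjugate ` V)"
    unfolding vring_def
    using qspan_subfield sr sE iff inv' vr(11) conjugate_closed conjugate_zero_iff by auto
  have mE: "vmax V \<subseteq> E" using vr(3) unfolding vmax_def by blast
  have "x \<in> vmax (conjugate ` V) \<longleftrightarrow> x \<in> conjugate ` vmax V" if x: "x \<in> E" for x
    using conjugate_image_iff[OF mE x] iff[OF x] inv'[OF x] conjugate_zero_iff[OF x]
    unfolding vmax_def by auto
  moreover have "vmax (conjugate ` V) \<subseteq> E" "conjugate ` vmax V \<subseteq> E"
    using sE conjugate_image_subset[OF mE] unfolding vmax_def by auto
  ultimately show "vmax (conjugate ` V) = conjugate ` vmax V" by blast
qed

context
  fixes k
  assumes ffF: "function_field k F" and ffE: "function_field k E"
begin

lemma k_facts: "subfield k R" "k \<subseteq> F" "k \<subseteq> E"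
  using function_fieldE[OF ffF] base_subset_qspan by blast+

text \<open>Composing the valuation of \<open>Q\<close> with conjugation gives a normalised
  valuation for the conjugate ring, and \<open>dval_unique\<close> identifies it with the valuation
  of the conjugate place.\<close>

lemma conjugate_place:
  assumes "Q \<in> places k E"
  shows "conjugate ` Q \<in> places k E" "place_ring E (conjugate ` Q) = conjugate ` place_ring E Q"
    and "x \<in> E \<Longrightarrow> x \<noteq> \<zero> \<Longrightarrow> place_val E (conjugate ` Q) x = place_val E Q (conjugate x)"
proof -
  define V where "V = place_ring E Q"
  note pl = placesE[OF assms qspan_subfield, folded V_def]
  note cv = conjugate_vring[OF pl(1)]
  have Q: "conjugate ` Q = vmax (conjugate ` V)" using pl(2) cv(2) by simp
  have kfix: "conjugate ` k = k" using conjugate_base k_facts(2) by (force simp: subset_iff)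
  have VE: "V \<subseteq> E" using pl(4) by blast
  show pq: "conjugate ` Q \<in> places k E"
    unfolding Q
  proof (rule placesI[OF cv(1)])
    show "k \<subseteq> conjugate ` V" using kfix pl(3) by blast
    show "k \<noteq> conjugate ` V"
      using conjugate_image_image[OF VE] kfix pl(3) by (metis psubset_eq)
    show "conjugate ` V \<noteq> E"
    proof
      assume "conjugate ` V = E"
      then have "V = conjugate ` E" using conjugate_image_image[OF VE] by simp
      moreover have "E \<subseteq> conjugate ` E"
        using conjugate_image_iff[OF subset_refl] conjugate_closed by blast
      ultimately show False using pl(4) by blast
    qed
  qed
  show pr: "place_ring E (conjugate ` Q) = conjugate ` place_ring E Q"
    unfolding Q V_def[symmetric] by (rule place_ring_vmax[OF cv(1)])
  have D: "dval E V (place_val E Q)" using place_facts(1)[OF ffE assms] unfolding V_def .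
  have "dval E (conjugate ` V) (\<lambda>x. place_val E Q (conjugate x))"
    unfolding dval_def
  proof (intro conjI ballI cv(1))
    fix x y assume "x \<in> E - {\<zero>}" "y \<in> E - {\<zero>}"
    then show "place_val E Q (conjugate (x \<otimes> y)) = place_val E Q (conjugate x) + place_val E Q (conjugate y)"
      using dval_mult[OF D, of "conjugate x" "conjugate y"] conjugate_mult conjugate_closed conjugate_zero_iff by simp
  next
    fix x assume "x \<in> E - {\<zero>}"
    then show "(x \<in> conjugate ` V) = (0 \<le> place_val E Q (conjugate x))"
      using conjugate_image_iff[OF VE] dval_in_iff[OF D, of "conjugate x"] conjugate_closed conjugate_zero_iff by simp
  next
    obtain t where t: "t \<in> E" "t \<noteq> \<zero>" "place_val E Q t = 1" using dval_uniformizer[OF D] .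
    then have "place_val E Q (conjugate (conjugate t)) = 1" using conjugate_conjugate by simp
    then show "\<exists>t\<in>E - {\<zero>}. place_val E Q (conjugate t) = 1"
      using t conjugate_closed conjugate_zero_iff by blast
  qed
  moreover have "dval E (conjugate ` V) (place_val E (conjugate ` Q))"
    using place_facts(1)[OF ffE pq] unfolding pr V_def .
  ultimately show "x \<in> E \<Longrightarrow> x \<noteq> \<zero> \<Longrightarrow> place_val E (conjugate ` Q) x = place_val E Q (conjugate x)"
    using dval_unique[of E "conjugate ` V" "\<lambda>x. place_val E Q (conjugate x)" "conjugate ` V"] by blast
qed

lemma conjugate_place_conjugate:
  "Q \<in> places k E \<Longrightarrow> conjugate ` conjugate ` Q = Q"
  using conjugate_image_image place_facts(4)[OF ffE] by blast

lemma conjugate_place_above: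
  assumes "P \<in> places k F" "Q \<in> places k E" "P \<subseteq> Q" shows "P \<subseteq> conjugate ` Q"
proof
  fix x assume x: "x \<in> P"
  then have "conjugate x = x" using conjugate_base place_facts(4)[OF ffF assms(1)] by blast
  then show "x \<in> conjugate ` Q" using x assms(3) by (metis imageI subsetD)
qed

text \<open>The element \<open>x / (1 + x)\<close> below still lies in \<open>Q\<close> but not in \<open>Q1\<close>, and is moreover integral at
  every place at which \<open>x\<close> has a pole.\<close>

lemma separating_element:
  assumes "Q \<in> places k E" "Q' \<in> places k E" "Q1 \<in> places k E" "Q1 \<noteq> Q"
  obtains x where "x \<in> Q" "x \<in> place_ring E Q'" "x \<notin> Q1" "x \<in> E"
proof -
  note p = placesE[OF assms(1) qspan_subfield] and p' = placesE[OF assms(2) qspan_subfield]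
    and p1 = placesE[OF assms(3) qspan_subfield]
  obtain x where x: "x \<in> Q" "x \<notin> Q1"
    using places_subset_imp_eq[OF ffE assms(1,3)] assms(4) by blast
  have xE: "x \<in> E" using x(1) place_facts(4)[OF ffE assms(1)] by blast
  show thesis
  proof (cases "x \<in> place_ring E Q'")
    case True then show ?thesis using that x xE by blast
  next
    case False
    have xc: "x \<in> carrier R" using xE ecl(10) by blast
    have u: "\<one> \<oplus> x \<in> vunits (place_ring E Q)" using one_plus_vmax[OF p(1)] x(1) p(2) by blast
    define w where "w = \<one> \<oplus> x"
    have w: "w \<noteq> \<zero>" "w \<in> carrier R" "inv w \<in> place_ring E Q" "w \<in> E"
      using vunits_carrier[OF p(1) u] vunits_subset[OF p(1) vunits_inv[OF p(1) u]] ecl(2,3) xE unfolding w_def by auto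
    define z where "z = x \<oslash> w"
    have z: "z = x \<otimes> inv w" unfolding z_def using w by (simp add: m_div_def)
    have zE: "z \<in> E" unfolding z_def using ecl(7) xE w by blast
    have "z \<in> Q" unfolding z using vmax_mult[OF p(1)] x(1) p(2) w(3) by blast
    moreover have "z \<in> place_ring E Q'"
    proof -
      have x0: "x \<noteq> \<zero>" "inv x \<in> vmax (place_ring E Q')" using not_in_vring_inv[OF p'(1) xE False] by auto
      have u': "\<one> \<oplus> inv x \<in> vunits (place_ring E Q')" using one_plus_vmax[OF p'(1) x0(2)] .
      have "z = inv (\<one> \<oplus> inv x)"
      proof -
        have "\<one> \<oplus> inv x = w \<oslash> x" unfolding w_def using xc x0 by (simp add: m_div_def l_distr a_comm)
        then show ?thesis unfolding z_def using inv_div[of w x] w xc x0 by simp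
      qed
      then show ?thesis using vunits_subset[OF p'(1) vunits_inv[OF p'(1) u']] by simp
    qed
    moreover have "z \<notin> Q1"
    proof (cases "x \<in> place_ring E Q1")
      case True
      then have wV: "w \<in> place_ring E Q1" unfolding w_def using vringD(5,6)[OF p1(1)] by blast
      show ?thesis
      proof
        assume "z \<in> Q1"
        then have "z \<otimes> w \<in> Q1" using vmax_mult[OF p1(1) _ wV] p1(2) by blast
        also have "z \<otimes> w = x" unfolding z using xc w by (simp add: m_assoc)
        finally show False using x(2) by blast
      qed
    next
      case False
      have x0: "x \<noteq> \<zero>" "inv x \<in> vmax (place_ring E Q1)" using not_in_vring_inv[OF p1(1) xE False] by auto
      have u': "\<one> \<oplus> inv x \<in> vunits (place_ring E Q1)" using one_plus_vmax[OF p1(1) x0(2)] .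
      have "z = inv (\<one> \<oplus> inv x)"
      proof -
        have "\<one> \<oplus> inv x = w \<oslash> x" unfolding w_def using xc x0 by (simp add: m_div_def l_distr a_comm)
        then show ?thesis unfolding z_def using inv_div[of w x] w xc x0 by simp
      qed
      then have "z \<in> vunits (place_ring E Q1)" using vunits_inv[OF p1(1) u'] by simp
      then show ?thesis using p1(2) vunits_iff by blast
    qed
    ultimately show ?thesis using that zE by blast
  qed
qed

text \<open>For a third place \<open>Q1\<close>, a product \<open>z\<close> of two separating
  elements lies in \<open>Q\<close> and in its conjugate but not in \<open>Q1\<close>. Trace and
  norm of \<open>z\<close> then lie in \<open>P\<close>, hence in \<open>Q1\<close>, and the
  quadratic equation of \<open>z\<close> forces \<open>z\<close> into \<open>Q1\<close>.\<close>

lemma places_above_conjugate: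
  assumes "P \<in> places k F" "Q \<in> places k E" "P \<subseteq> Q" "Q1 \<in> places k E" "P \<subseteq> Q1"
  shows "Q1 = Q \<or> Q1 = conjugate ` Q"
proof (rule ccontr)
  assume ne: "\<not> ?thesis"
  define Q' where "Q' = conjugate ` Q"
  have Q': "Q' \<in> places k E" "conjugate ` Q' = Q" "P \<subseteq> Q'"
    using conjugate_place(1) conjugate_place_conjugate conjugate_place_above assms unfolding Q'_def by auto
  note p = placesE[OF assms(2) qspan_subfield] and p' = placesE[OF Q'(1) qspan_subfield]
    and p1 = placesE[OF assms(4) qspan_subfield]
  obtain x where x: "x \<in> Q" "x \<in> place_ring E Q'" "x \<notin> Q1" "x \<in> E"
    using separating_element[OF assms(2) Q'(1) assms(4)] ne by blast
  obtain y where y: "y \<in> Q'" "y \<in> place_ring E Q" "y \<notin> Q1" "y \<in> E"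
    using separating_element[OF Q'(1) assms(2) assms(4)] ne unfolding Q'_def by blast
  define z where "z = x \<otimes> y"
  have zE: "z \<in> E" "z \<in> carrier R" unfolding z_def using x y ecl(4,10) by auto
  have zQ: "z \<in> Q" unfolding z_def using vmax_mult[OF p(1)] x(1) y(2) p(2) by blast
  have "x \<otimes> y \<in> vmax (place_ring E Q')" using vmax_mult_right[OF p'(1) x(2)] y(1) p'(2) by blast
  then have zQ': "z \<in> Q'" unfolding z_def using p'(2) by blast
  have z1: "z \<notin> Q1" unfolding z_def using vmax_prime[OF p1(1) x(4) y(4)] x(3) y(3) p1(2) by blast
  have "Q' \<subseteq> E" using place_facts(4)[OF ffE Q'(1)] .
  then have czQ: "conjugate z \<in> Q" using zQ' Q'(2) by blast
  define t n where "t = z \<oplus> conjugate z" and "n = z \<otimes> conjugate z"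
  have inP: "u \<in> P" if "u \<in> Q" "u \<in> F" for u
    using place_inter[OF ffF ffE base_subset_qspan assms(1,2,3)] that by blast
  have "t \<in> Q" unfolding t_def using vmax_add[OF p(1)] zQ czQ p(2) by blast
  then have t: "t \<in> Q1" using inP trace_in_base[OF zE(1)] assms(5) unfolding t_def by blast
  have "conjugate z \<in> place_ring E Q" using czQ vmax_subset[OF p(1)] p(2) by blast
  then have "n \<in> Q" unfolding n_def using vmax_mult[OF p(1)] zQ p(2) by blast
  then have n: "n \<in> Q1" using inP norm_in_base[OF zE(1)] assms(5) unfolding n_def by blast
  have sq: "z \<otimes> z = t \<otimes> z \<ominus> n" unfolding t_def n_def using square_eq_trace_norm[OF zE(1)] .
  have tc: "t \<in> carrier R" "n \<in> carrier R" using t n place_facts(4)[OF ffE assms(4)] ecl(10) by auto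
  have tn: "t \<in> vmax (place_ring E Q1)" "n \<in> vmax (place_ring E Q1)" using t n p1(2) by auto
  show False
  proof (cases "z \<in> place_ring E Q1")
    case True
    then have "t \<otimes> z \<in> vmax (place_ring E Q1)" using vmax_mult[OF p1(1) tn(1)] by blast
    then have "z \<otimes> z \<in> vmax (place_ring E Q1)"
      unfolding sq a_minus_def using vmax_add[OF p1(1)] vmax_uminus[OF p1(1) tn(2)] by blast
    then show False using vmax_prime[OF p1(1) zE(1) zE(1)] z1 p1(2) by blast
  next
    case False
    have z0: "z \<noteq> \<zero>" and iz: "inv z \<in> vmax (place_ring E Q1)" using not_in_vring_inv[OF p1(1) zE(1) False] by auto
    have izV: "inv z \<in> place_ring E Q1" using vmax_subset[OF p1(1) iz] .
    \<comment> \<open>If \<open>z\<close> has a pole at \<open>Q1\<close>, the quadratic equation is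
      divided by the square of \<open>z\<close>; it then writes 1 as an element of
      \<open>Q1\<close>.\<close>
    have "t \<otimes> inv z \<oplus> (\<ominus> n) \<otimes> (inv z \<otimes> inv z) \<in> vmax (place_ring E Q1)"
      using vmax_add[OF p1(1) vmax_mult[OF p1(1) tn(1) izV]
        vmax_mult[OF p1(1) vmax_uminus[OF p1(1) tn(2)] vringD(7)[OF p1(1) izV izV]]] .
    moreover have "t \<otimes> inv z \<oplus> (\<ominus> n) \<otimes> (inv z \<otimes> inv z) = \<one>"
    proof -
      have "t \<oslash> z \<ominus> n \<oslash> (z \<otimes> z) = (t \<otimes> z \<ominus> n) \<oslash> (z \<otimes> z)"
        using tc zE z0 by (simp add: field_norm)
      also have "\<dots> = \<one>" unfolding sq[symmetric] using zE z0 integral_iff by (simp add: m_div_def)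
      finally show ?thesis
        using tc zE z0 integral_iff by (simp add: m_div_def nonzero_inverse_mult_distrib a_minus_def l_minus)
    qed
    ultimately show False using one_notin_vmax[OF p1(1)] by simp
  qed
qed

lemma places_over_eq:
  assumes "P \<in> places k F" "Q \<in> places k E" "P \<subseteq> Q"
  shows "places_over k E P = {Q, conjugate ` Q}"
  unfolding places_over_def
  using places_above_conjugate[OF assms] assms(2,3) conjugate_place(1)[OF assms(2)] conjugate_place_above[OF assms]
  by blast

lemma splits_iff:
  assumes "P \<in> places k F" "Q \<in> places k E" "P \<subseteq> Q"
  shows "splits k F E P \<longleftrightarrow> conjugate ` Q \<noteq> Q"
proof -
  have "(dim over F) E = 2" using dimI[OF base dimension_2_qspan] .
  then show ?thesis
    unfolding splits_def places_over_eq[OF assms] by (cases "conjugate ` Q = Q") auto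
qed

section \<open>Residue degrees of conjugate places\<close>

lemma conjugate_constant_field: "conjugate ` constant_field k E = constant_field k E"
proof -
  have ev: "eval p (conjugate x) = conjugate (eval p x) \<and> eval p x \<in> E" if "set p \<subseteq> F" "x \<in> E" for p x
    using that(1)
  proof (induction p)
    case Nil then show ?case using ecl(1) by simp
  next
    case (Cons a p)
    have aE: "a \<in> E" "conjugate a = a" using Cons.prems conjugate_base base_subset_qspan by auto
    have pw: "x [^] n \<in> E" "conjugate (x [^] n) = conjugate x [^] n" for n :: nat
      using that(2) ecl(9) by (simp, induction n) (auto simp: conjugate_mult ecl(9))
    show ?case using Cons aE pw ecl(3,4) conjugate_add conjugate_mult by simp
  qed
  have sub: "conjugate x \<in> constant_field k E" if x: "x \<in> constant_field k E" for x
  proof -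
    have xE: "x \<in> E" "(algebraic over k) x" using x unfolding constant_field_def by auto
    obtain p where p: "p \<in> carrier (k[X])" "p \<noteq> []" "eval p x = \<zero>"
      using algebraicE[OF subfieldE(1)[OF k_facts(1)] _ xE(2)] xE(1) ecl(10) by blast
    have "set p \<subseteq> F" using p(1) k_facts(2) unfolding univ_poly_def polynomial_def by auto
    then have "eval p (conjugate x) = \<zero>" using ev[OF _ xE(1)] p(3) by simp
    then have "(algebraic over k) (conjugate x)" using algebraicI[OF p(1,2)] by blast
    then show ?thesis unfolding constant_field_def using conjugate_closed[OF xE(1)] by simp
  qed
  have "constant_field k E \<subseteq> E" unfolding constant_field_def by blast
  then show ?thesis using sub conjugate_image_image by (metis image_subsetI image_mono subset_antisym)
qed

text \<open>The relation behind \<open>place_degree\<close>, which is the unique such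
  \<open>n\<close> if there is one. Transporting the relation instead of the number yields equality
  of degrees without first proving the residue field finite over the constants.\<close>

definition residue_degree_is :: "'a set \<Rightarrow> nat \<Rightarrow> bool" where
  "residue_degree_is Q n \<longleftrightarrow> (let V = R\<lparr>carrier := place_ring E Q\<rparr> in
     ring.dimension (V Quot Q) n ((\<lambda>c. Q +>\<^bsub>V\<^esub> c) ` constant_field k E) (carrier (V Quot Q)))"

lemma place_ideal:
  assumes "Q \<in> places k E" shows "ideal Q (R\<lparr>carrier := place_ring E Q\<rparr>)"
proof -
  note p = placesE[OF assms qspan_subfield]
  note vr = vringD[OF p(1)]
  let ?A = "R\<lparr>carrier := place_ring E Q\<rparr>"
  interpret A: ring ?A using subring_is_ring[OF vr(2)] .
  have QV: "Q \<subseteq> place_ring E Q" using vmax_subset[OF p(1)] p(2) by blast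
  have mi: "\<ominus>\<^bsub>?A\<^esub> x = \<ominus> x" if "x \<in> Q" for x
  proof (rule A.minus_equality)
    have "x \<in> carrier R" using that QV vr(9) by blast
    then show "\<ominus> x \<oplus>\<^bsub>?A\<^esub> x = \<zero>\<^bsub>?A\<^esub>" by (simp add: l_neg)
    show "x \<in> carrier ?A" "\<ominus> x \<in> carrier ?A" using that QV vr(8) by auto
  qed
  show ?thesis
  proof (rule idealI)
    show "ring ?A" by (rule A.ring_axioms)
    show "subgroup Q (add_monoid ?A)"
    proof (rule subgroup.intro)
      show "Q \<subseteq> carrier (add_monoid ?A)" using QV by simp
      show "x \<otimes>\<^bsub>add_monoid ?A\<^esub> y \<in> Q" if "x \<in> Q" "y \<in> Q" for x y
        using vmax_add[OF p(1)] that p(2) by simp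
      show "\<one>\<^bsub>add_monoid ?A\<^esub> \<in> Q" using zero_in_vmax[OF p(1)] p(2) by simp
      show "inv\<^bsub>add_monoid ?A\<^esub> x \<in> Q" if "x \<in> Q" for x
        using mi[OF that] vmax_uminus[OF p(1)] that p(2) unfolding a_inv_def by metis
    qed
    fix a x assume "a \<in> Q" "x \<in> carrier ?A"
    then show "x \<otimes>\<^bsub>?A\<^esub> a \<in> Q" "a \<otimes>\<^bsub>?A\<^esub> x \<in> Q"
      using vmax_mult[OF p(1)] vmax_mult_right[OF p(1)] p(2) by auto
  qed
qed

text \<open>Conjugation induces an isomorphism of the residue fields. It may move individual
  constants, but it maps the constant field onto itself, so dimensions over the constants are
  preserved.\<close>

lemma residue_degree_conjugate:
  assumes "Q \<in> places k E" "residue_degree_is Q n"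
  shows "residue_degree_is (conjugate ` Q) n"
proof -
  define Q' where "Q' = conjugate ` Q"
  note cp = conjugate_place(1,2)[OF assms(1), folded Q'_def]
  note p = placesE[OF assms(1) qspan_subfield] and p' = placesE[OF cp(1) qspan_subfield]
  define V where "V = place_ring E Q"
  have V': "place_ring E Q' = conjugate ` V" using cp(2) unfolding V_def .
  note vr = vringD[OF p(1), folded V_def] and vr' = vringD[OF p'(1), unfolded V']
  let ?A = "R\<lparr>carrier := V\<rparr>" and ?B = "R\<lparr>carrier := conjugate ` V\<rparr>"
  interpret A: ideal Q ?A using place_ideal[OF assms(1)] unfolding V_def .
  interpret B: ideal Q' ?B using place_ideal[OF cp(1)] unfolding V' .
  have QE: "Q \<subseteq> E" using place_facts(4)[OF ffE assms(1)] .
  let ?h = "(`) conjugate"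
  have coset: "?h (Q +>\<^bsub>?A\<^esub> v) = Q' +>\<^bsub>?B\<^esub> conjugate v" if "v \<in> V" for v
  proof -
    have "conjugate (q \<oplus> v) = conjugate q \<oplus> conjugate v" if "q \<in> Q" for q
      using conjugate_add that \<open>v \<in> V\<close> QE vr(3) by blast
    then have "(\<lambda>q. conjugate (q \<oplus> v)) ` Q = (\<lambda>q. conjugate q \<oplus> conjugate v) ` Q"
      by (intro image_cong) auto
    moreover have "?h (Q +>\<^bsub>?A\<^esub> v) = (\<lambda>q. conjugate (q \<oplus> v)) ` Q"
      unfolding a_r_coset_def' by auto
    moreover have "Q' +>\<^bsub>?B\<^esub> conjugate v = (\<lambda>q. conjugate q \<oplus> conjugate v) ` Q"
      unfolding a_r_coset_def' Q'_def by auto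
    ultimately show ?thesis by simp
  qed
  have car: "carrier (?A Quot Q) = {Q +>\<^bsub>?A\<^esub> v | v. v \<in> V}" "carrier (?B Quot Q') = {Q' +>\<^bsub>?B\<^esub> v | v. v \<in> conjugate ` V}"
    unfolding FactRing_def by (auto simp: A_RCOSETS_def')
  note Ah = A.rcos_ring_hom and Bh = B.rcos_ring_hom
  have "?h \<in> ring_hom (?A Quot Q) (?B Quot Q')"
  proof (rule ring_hom_memI)
    fix x assume "x \<in> carrier (?A Quot Q)"
    then obtain v where v: "v \<in> V" "x = Q +>\<^bsub>?A\<^esub> v" unfolding car by blast
    then show "?h x \<in> carrier (?B Quot Q')" unfolding car using coset by blast
    fix y assume "y \<in> carrier (?A Quot Q)"
    then obtain w where w: "w \<in> V" "y = Q +>\<^bsub>?A\<^esub> w" unfolding car by blast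
    have vw: "v \<otimes> w \<in> V" "v \<oplus> w \<in> V" using v(1) w(1) vr(6,7) by auto
    have E: "v \<in> E" "w \<in> E" using v w vr(12) by auto
    have "x \<otimes>\<^bsub>?A Quot Q\<^esub> y = Q +>\<^bsub>?A\<^esub> (v \<otimes> w)"
      using ring_hom_mult[OF Ah, of v w] v w by simp
    moreover have "?h x \<otimes>\<^bsub>?B Quot Q'\<^esub> ?h y = Q' +>\<^bsub>?B\<^esub> (conjugate v \<otimes> conjugate w)"
      using ring_hom_mult[OF Bh, of "conjugate v" "conjugate w"] v w coset by simp
    ultimately show "?h (x \<otimes>\<^bsub>?A Quot Q\<^esub> y) = ?h x \<otimes>\<^bsub>?B Quot Q'\<^esub> ?h y"
      using coset[OF vw(1)] conjugate_mult[OF E] by simp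
    have "x \<oplus>\<^bsub>?A Quot Q\<^esub> y = Q +>\<^bsub>?A\<^esub> (v \<oplus> w)"
      using ring_hom_add[OF Ah, of v w] v w by simp
    moreover have "?h x \<oplus>\<^bsub>?B Quot Q'\<^esub> ?h y = Q' +>\<^bsub>?B\<^esub> (conjugate v \<oplus> conjugate w)"
      using ring_hom_add[OF Bh, of "conjugate v" "conjugate w"] v w coset by simp
    ultimately show "?h (x \<oplus>\<^bsub>?A Quot Q\<^esub> y) = ?h x \<oplus>\<^bsub>?B Quot Q'\<^esub> ?h y"
      using coset[OF vw(2)] conjugate_add[OF E] by simp
  next
    show "?h \<one>\<^bsub>?A Quot Q\<^esub> = \<one>\<^bsub>?B Quot Q'\<^esub>"
      using coset[OF vr(5)] unfolding FactRing_def by simp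
  qed
  then interpret h: ring_hom_ring "?A Quot Q" "?B Quot Q'" ?h
    using ring_hom_ringI2[OF A.quotient_is_ring B.quotient_is_ring] by blast
  interpret pA: ring_hom_ring ?A "?A Quot Q" "\<lambda>c. Q +>\<^bsub>?A\<^esub> c"
    using A.rcos_ring_hom_ring .
  let ?C = "constant_field k E"
  have CV: "?C \<subseteq> V"
    using constant_field_in_vring[OF p(1) k_facts(1)] p(3) unfolding V_def by blast
  have C: "subfield ?C R" using constant_field_subfield(1)[OF k_facts(1) qspan_subfield k_facts(3)] .
  have "subfield ?C ?A"
    using ring.subfield_iff(1)[OF subring_is_ring[OF vr(2)], of ?C] subfield_iff(2)[OF C] CV by simp
  moreover have one: "\<one>\<^bsub>?A Quot Q\<^esub> \<noteq> \<zero>\<^bsub>?A Quot Q\<^esub>"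
  proof
    assume "\<one>\<^bsub>?A Quot Q\<^esub> = \<zero>\<^bsub>?A Quot Q\<^esub>"
    then have "Q +>\<^bsub>?A\<^esub> \<one> = Q" unfolding FactRing_def by simp
    moreover have "\<zero> \<in> Q" using zero_in_vmax[OF p(1)] p(2) by blast
    then have "\<zero> \<oplus> \<one> \<in> Q +>\<^bsub>?A\<^esub> \<one>" unfolding a_r_coset_def' by (rule UN_I) simp
    ultimately show False using one_notin_vmax[OF p(1)] p(2) by simp
  qed
  ultimately have sC: "subfield ((\<lambda>c. Q +>\<^bsub>?A\<^esub> c) ` ?C) (?A Quot Q)"
    using pA.img_is_subfield(2) by blast
  have one': "\<one>\<^bsub>?B Quot Q'\<^esub> \<noteq> \<zero>\<^bsub>?B Quot Q'\<^esub>"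
  proof
    assume "\<one>\<^bsub>?B Quot Q'\<^esub> = \<zero>\<^bsub>?B Quot Q'\<^esub>"
    then have "Q' +>\<^bsub>?B\<^esub> \<one> = Q'" unfolding FactRing_def by simp
    moreover have "\<zero> \<in> Q'" using zero_in_vmax[OF p'(1)] p'(2) by blast
    then have "\<zero> \<oplus> \<one> \<in> Q' +>\<^bsub>?B\<^esub> \<one>" unfolding a_r_coset_def' by (rule UN_I) simp
    ultimately show False using one_notin_vmax[OF p'(1)] p'(2) by simp
  qed
  have inj: "inj_on ?h (carrier (?A Quot Q))"
  proof (rule inj_onI)
    have sE: "x \<subseteq> E" if "x \<in> carrier (?A Quot Q)" for x
    proof -
      obtain v where "v \<in> V" "x = Q +>\<^bsub>?A\<^esub> v" using \<open>x \<in> carrier (?A Quot Q)\<close> unfolding car by blast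
      then show ?thesis unfolding a_r_coset_def' using QE vr(3) ecl(3) by auto
    qed
    fix x y assume "x \<in> carrier (?A Quot Q)" "y \<in> carrier (?A Quot Q)" "?h x = ?h y"
    then show "x = y" using conjugate_image_image sE by metis
  qed
  have "ring.dimension (?A Quot Q) n ((\<lambda>c. Q +>\<^bsub>?A\<^esub> c) ` ?C) (carrier (?A Quot Q))"
    using assms(2) unfolding residue_degree_is_def V_def[symmetric] Let_def .
  from h.inj_hom_dimension[OF sC one' inj this]
  have "ring.dimension (?B Quot Q') n (?h ` (\<lambda>c. Q +>\<^bsub>?A\<^esub> c) ` ?C) (?h ` carrier (?A Quot Q))" .
  moreover have "?h ` carrier (?A Quot Q) = carrier (?B Quot Q')"
    unfolding car using coset by (auto simp: image_iff)
  moreover have "?h ` (\<lambda>c. Q +>\<^bsub>?A\<^esub> c) ` ?C = (\<lambda>c. Q' +>\<^bsub>?B\<^esub> c) ` ?C"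
  proof -
    have "?h ` (\<lambda>c. Q +>\<^bsub>?A\<^esub> c) ` ?C = (\<lambda>c. Q' +>\<^bsub>?B\<^esub> c) ` conjugate ` ?C"
      unfolding image_image using coset CV by (intro image_cong) auto
    then show ?thesis unfolding conjugate_constant_field .
  qed
  ultimately show ?thesis
    unfolding residue_degree_is_def Q'_def[symmetric] V' Let_def by simp
qed

lemma place_degree_conjugate:
  assumes "Q \<in> places k E"
  shows "place_degree k E (conjugate ` Q) = place_degree k E Q"
proof -
  have deg: "place_degree k E Q = (THE n. residue_degree_is Q n)" if "Q \<in> places k E" for Q
    using ring.dim_def[OF ideal.quotient_is_ring[OF place_ideal[OF that]]]
    unfolding place_degree_def residue_degree_is_def Let_def over_def by simp
  have "residue_degree_is (conjugate ` Q) n \<longleftrightarrow> residue_degree_is Q n" for n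
    using residue_degree_conjugate[OF assms] residue_degree_conjugate[OF conjugate_place(1)[OF assms]]
      conjugate_place_conjugate[OF assms] by metis
  then show ?thesis using deg[OF assms] deg[OF conjugate_place(1)[OF assms]] by simp
qed

end

end

context field
begin

subsection \<open>Functions with prescribed divisor in genus zero\<close>

text \<open>If \<open>x\<close> is not algebraic, neither is its inverse \<open>y\<close>, so the
  multiples of \<open>y\<close> in \<open>k[y]\<close> form a proper ideal. A valuation ring
  dominating this ideal defines a place at which \<open>x\<close> has a pole.\<close>

lemma no_poles_imp_algebraic:
  assumes "function_field k E" "x \<in> E" "x \<noteq> \<zero>" "\<And>Q. Q \<in> places k E \<Longrightarrow> place_val E Q x \<ge> 0"
  shows "(algebraic over k) x"
proof (rule ccontr)
  assume na: "\<not> ?thesis"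
  have k: "subfield k R" "k \<subseteq> E" and E: "subfield E R" using function_fieldE[OF assms(1)] by blast+
  note ec = subfield_closed[OF E]
  define y where "y = inv x"
  have xc: "x \<in> carrier R" using assms ec by auto
  have y: "y \<in> E" "y \<noteq> \<zero>" "y \<in> carrier R" "inv y = x"
    unfolding y_def using assms ec(8,10) nonzero_imp_inverse_nonzero nonzero_inverse_inverse_eq by auto
  have nay: "\<not> (algebraic over k) y"
  proof
    assume "(algebraic over k) y"
    then have "inv y \<in> {x \<in> carrier R. (algebraic over k) x}"
      using subfield_closed(8)[OF subfield_of_algebraics[OF k(1)], of y] y by blast
    then show False using na y(4) by simp
  qed
  define A where "A = simple_extension k y"
  have A: "subring A R" unfolding A_def using simple_extension_is_subring[OF subfieldE(1)[OF k(1)] y(3)] .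
  have kA: "k \<subseteq> A" "y \<in> A"
    unfolding A_def using simple_extension_incl[OF subfieldE(3)[OF k(1)] y(3)]
      simple_extension_mem[OF subfieldE(1)[OF k(1)] y(3)] by auto
  have AE: "A \<subseteq> E"
    unfolding A_def using simple_extension_minimal[OF subfieldE(1)[OF k(1)] y(3)] subfieldE(1)[OF E] k(2) y(1) by blast
  note ac = subringE[OF A]
  have Ac: "a \<in> carrier R" if "a \<in> A" for a using ac(1) that by blast
  define I where "I = {p \<otimes> y | p. p \<in> A}"
  have IA: "I \<subseteq> A" unfolding I_def using ac(6) kA(2) by auto
  have I0: "\<zero> \<in> I"
  proof -
    have "\<zero> = \<zero> \<otimes> y" using y by simp
    then show ?thesis unfolding I_def using ac(2) by blast
  qed
  have I1: "\<one> \<notin> I"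
  proof
    assume "\<one> \<in> I"
    then obtain p where p: "p \<in> A" "\<one> = p \<otimes> y" unfolding I_def by blast
    obtain q where q: "q \<in> carrier (k[X])" "p = eval q y"
      using p(1) simple_extension_as_eval_img[OF subfieldE(3)[OF k(1)] y(3)] unfolding A_def by auto
    have qn: "q \<noteq> []" using p(2) q(2) y by auto
    have qk: "set q \<subseteq> k" "lead_coeff q \<noteq> \<zero>" using q(1) qn unfolding univ_poly_def polynomial_def by auto
    have m1: "\<ominus> \<one> \<in> k" using subfield_closed(2,6)[OF k(1)] by blast
    \<comment> \<open>Coefficients are listed from the highest degree down, so appending -1
      multiplies \<open>q\<close> by \<open>X\<close> and subtracts 1.\<close>
    have pol: "q @ [\<ominus> \<one>] \<in> carrier (k[X])"
      using qk qn m1 unfolding univ_poly_def polynomial_def by (auto simp: hd_append)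
    have "eval (q @ [\<ominus> \<one>]) y = p \<otimes> y \<oplus> \<ominus> \<one>"
      using eval_append_aux[of q "\<ominus> \<one>" y] qk(1) subfieldE(3)[OF k(1)] y q(2) by auto
    also have "\<dots> = \<zero>" unfolding p(2)[symmetric] by (simp add: r_neg)
    finally show False using algebraicI[OF pol] nay by blast
  qed
  have Isub: "a \<ominus> b \<in> I" if ab: "a \<in> I" "b \<in> I" for a b
  proof -
    obtain p q where pq: "p \<in> A" "q \<in> A" "a = p \<otimes> y" "b = q \<otimes> y" using ab unfolding I_def by blast
    have "p \<ominus> q \<in> A" using ac(5,7) pq unfolding a_minus_def by blast
    moreover have "a \<ominus> b = (p \<ominus> q) \<otimes> y"
      unfolding pq using Ac pq(1,2) y(3) by (simp add: a_minus_def l_distr l_minus)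
    ultimately show ?thesis unfolding I_def by blast
  qed
  have Imul: "a \<otimes> b \<in> I" if ab: "a \<in> A" "b \<in> I" for a b
  proof -
    obtain p where p: "p \<in> A" "b = p \<otimes> y" using ab unfolding I_def by blast
    have "a \<otimes> b = (a \<otimes> p) \<otimes> y" unfolding p using Ac ab p y(3) by (simp add: m_assoc)
    then show ?thesis unfolding I_def using ac(6) ab p by blast
  qed
  obtain V where V: "vring E V" "A \<subseteq> V" "I \<subseteq> vmax V"
    using exists_valuation_ring[OF E A AE IA I0 I1 Isub Imul] by blast
  have "\<one> \<otimes> y \<in> I" unfolding I_def using ac(3) by blast
  then have ym: "y \<in> vmax V" using V(3) y by auto
  then have yV: "inv y \<notin> V" "y \<in> V" using y(2) unfolding vmax_def by auto
  have "k \<subseteq> V" using kA V(2) by blast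
  moreover have "k \<noteq> V" using subfield_closed(8)[OF k(1) _ y(2)] yV by blast
  moreover have "V \<noteq> E" using yV(1) ec(8)[OF y(1,2)] by blast
  ultimately have pl: "vmax V \<in> places k E" using placesI[OF V(1)] by blast
  have "0 < place_val E (vmax V) y" using place_mem_iff[OF assms(1) pl y(1,2)] ym by blast
  moreover have "place_val E (vmax V) x = - place_val E (vmax V) y"
    using dval_inv[OF place_facts(1)[OF assms(1) pl] y(1,2)] y(4) by simp
  ultimately show False using assms(4)[OF pl] by simp
qed

lemma algebraic_place_val_zero:
  assumes "function_field k E" "x \<in> E" "x \<noteq> \<zero>" "(algebraic over k) x" "Q \<in> places k E"
  shows "place_val E Q x = 0"
proof -
  have k: "subfield k R" "k \<subseteq> E" and E: "subfield E R" using function_fieldE[OF assms(1)] by blast+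
  note p = placesE[OF assms(5) E]
  have C: "subfield (constant_field k E) R" using constant_field_subfield(1)[OF k(1) E k(2)] .
  have "constant_field k E \<subseteq> place_ring E Q"
    using constant_field_in_vring[OF p(1) k(1)] p(3) by blast
  then have "x \<in> vunits (place_ring E Q)"
    using subfield_units[OF C] assms(2-4) unfolding constant_field_def by blast
  then show ?thesis using dval_vunits_iff[OF place_facts(1)[OF assms(1,5)] assms(2,3)] by blast
qed

end

text \<open>The divisor \<open>A\<close> is 1 on \<open>S\<close> and -1 on the conjugates, so its
  degree is zero because conjugate places have equal degree. Genus zero provides \<open>f\<close>
  with values at least \<open>- A\<close>, and the norm of \<open>f\<close> shows that equality
  holds everywhere.\<close>

lemma (in quadratic_extension) genus_zero_divisor:
  assumes "function_field k F" "function_field k (qspan F c)" "has_genus k (qspan F c) 0"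
    and "finite S" "S \<subseteq> places k (qspan F c)" "S \<inter> ((`) conjugate) ` S = {}"
  obtains f where "f \<in> qspan F c" "f \<noteq> \<zero>"
    "\<And>Q. Q \<in> S \<Longrightarrow> place_val (qspan F c) Q f = - 1"
    "\<And>Q. Q \<in> S \<Longrightarrow> place_val (qspan F c) (conjugate ` Q) f = 1"
    "\<And>Q. Q \<in> places k (qspan F c) \<Longrightarrow> Q \<notin> S \<Longrightarrow> conjugate ` Q \<notin> S \<Longrightarrow> place_val (qspan F c) Q f = 0"
proof -
  note ff = assms(1,2)
  define S' where "S' = ((`) conjugate) ` S"
  have S'p: "S' \<subseteq> places k E" "finite S'"
    unfolding S'_def using conjugate_place(1)[OF ff] assms(4,5) by auto
  have mem': "Q \<in> S' \<longleftrightarrow> conjugate ` Q \<in> S" if "Q \<in> places k E" for Q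
  proof
    assume "Q \<in> S'"
    then obtain Q0 where Q0: "Q0 \<in> S" "Q = conjugate ` Q0" unfolding S'_def by blast
    then have "conjugate ` Q = Q0" using conjugate_place_conjugate[OF ff] assms(5) by blast
    then show "conjugate ` Q \<in> S" using Q0 by simp
  next
    assume "conjugate ` Q \<in> S"
    then have "conjugate ` conjugate ` Q \<in> S'" unfolding S'_def by (rule imageI)
    then show "Q \<in> S'" using conjugate_place_conjugate[OF ff that] by simp
  qed
  have disj: "S \<inter> S' = {}" using assms(6) unfolding S'_def .
  define A where "A Q = (if Q \<in> S then 1 else if Q \<in> S' then - 1 else (0::int))" for Q
  have supp: "{P. A P \<noteq> 0} = S \<union> S'" unfolding A_def by auto
  have Adiv: "A \<in> divisors k E"
    unfolding divisors_def using supp assms(4,5) S'p by auto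
  have "divisor_degree k E A = (\<Sum>P\<in>S. A P * int (place_degree k E P)) + (\<Sum>P\<in>S'. A P * int (place_degree k E P))"
    unfolding divisor_degree_def supp using assms(4) S'p(2) disj by (rule sum.union_disjoint)
  also have "(\<Sum>P\<in>S'. A P * int (place_degree k E P)) = (\<Sum>P\<in>S'. - int (place_degree k E P))"
    using disj by (intro sum.cong) (auto simp: A_def)
  also have "\<dots> = (\<Sum>P\<in>S. - int (place_degree k E (conjugate ` P)))"
    unfolding S'_def
  proof (rule sum.reindex_cong[OF _ refl refl])
    show "inj_on ((`) conjugate) S"
      by (rule inj_on_inverseI[of _ "(`) conjugate"]) (use conjugate_place_conjugate[OF ff] assms(5) in blast)
  qed
  also have "\<dots> = (\<Sum>P\<in>S. - int (place_degree k E P))"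
    using place_degree_conjugate[OF ff] assms(5) by (intro sum.cong) auto
  also have "(\<Sum>P\<in>S. A P * int (place_degree k E P)) = (\<Sum>P\<in>S. int (place_degree k E P))"
    by (intro sum.cong) (auto simp: A_def)
  finally have "divisor_degree k E A = 0" by (simp add: sum_negf)
  \<comment> \<open>Genus zero bounds this expression by 0; with degree 0 the dimension cannot be
    0.\<close>
  moreover have "divisor_degree k E A - int (divisor_dim k E A) + 1 \<le> 0"
    using assms(3) Adiv unfolding has_genus_def by blast
  ultimately have dim: "divisor_dim k E A \<noteq> 0" by simp
  have C: "subfield (constant_field k E) R"
    using constant_field_subfield(1)[OF k_facts(1)[OF ff] qspan_subfield k_facts(3)[OF ff]] .
  have "riemann_roch_space k E A \<noteq> {\<zero>}"
  proof
    assume "riemann_roch_space k E A = {\<zero>}"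
    then have "divisor_dim k E A = 0" unfolding divisor_dim_def using dimI[OF C zero_dim] by simp
    with dim show False ..
  qed
  moreover have "\<zero> \<in> riemann_roch_space k E A" unfolding riemann_roch_space_def using ecl(1) by simp
  ultimately obtain f where "f \<in> riemann_roch_space k E A" "f \<noteq> \<zero>" by blast
  then have f: "f \<in> E" "f \<noteq> \<zero>" and ge: "\<And>P. P \<in> places k E \<Longrightarrow> place_val E P f \<ge> - A P"
    unfolding riemann_roch_space_def by auto
  \<comment> \<open>The value of the norm at \<open>Q\<close> is the sum of the values of
    \<open>f\<close> at \<open>Q\<close> and at its conjugate. It is at least
    \<open>- A Q - A (conjugate Q)\<close>, which is zero, so the norm has no poles; being algebraic
    it has value 0 everywhere, and both lower bounds are attained.\<close>
  define n where "n = f \<otimes> conjugate f"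
  have cf: "conjugate f \<in> E" "conjugate f \<noteq> \<zero>" using f conjugate_closed conjugate_zero_iff by auto
  have n: "n \<in> E" "n \<noteq> \<zero>" unfolding n_def using f cf ecl(4,10) integral_iff by auto
  have vn: "place_val E Q n = place_val E Q f + place_val E (conjugate ` Q) f" if "Q \<in> places k E" for Q
    unfolding n_def using dval_mult[OF place_facts(1)[OF ff(2) that] f(1) cf(1) f(2) cf(2)]
      conjugate_place(3)[OF ff that f] by simp
  have Asum: "A Q + A (conjugate ` Q) = 0" if Q: "Q \<in> places k E" for Q
    using mem'[OF Q] mem'[OF conjugate_place(1)[OF ff Q]] conjugate_place_conjugate[OF ff Q] disj
    unfolding A_def by auto
  have "place_val E Q n \<ge> 0" if Q: "Q \<in> places k E" for Q
    using vn[OF Q] ge[OF Q] ge[OF conjugate_place(1)[OF ff Q]] Asum[OF Q] by linarith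
  then have alg: "(algebraic over k) n" using no_poles_imp_algebraic[OF ff(2) n] by blast
  have val: "place_val E Q f = - A Q" if Q: "Q \<in> places k E" for Q
    using algebraic_place_val_zero[OF ff(2) n alg Q] vn[OF Q] ge[OF Q] ge[OF conjugate_place(1)[OF ff Q]] Asum[OF Q]
    by linarith
  show thesis
  proof (rule that[OF f])
    show "place_val E Q f = - 1" if "Q \<in> S" for Q using val assms(5) that unfolding A_def by auto
    show "place_val E (conjugate ` Q) f = 1" if "Q \<in> S" for Q
    proof -
      have Q: "conjugate ` Q \<in> places k E" using conjugate_place(1)[OF ff] assms(5) that by blast
      have "conjugate ` Q \<in> S'" unfolding S'_def using that by (rule imageI)
      then have "A (conjugate ` Q) = - 1" using disj unfolding A_def by auto
      then show ?thesis using val[OF Q] by simp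
    qed
    show "place_val E Q f = 0" if "Q \<in> places k E" "Q \<notin> S" "conjugate ` Q \<notin> S" for Q
      using val[OF that(1)] mem'[OF that(1)] that unfolding A_def by auto
  qed
qed

context field
begin

subsection \<open>Ramification in the compositum\<close>

text \<open>The characteristic is the Gcd of all annihilators of 1. If 3 vanished, this set would
  contain 3 and consist of multiples of 3.\<close>

lemma three_nonzero_of_characteristic:
  assumes "subfield k R" "characteristic (R\<lparr>carrier := k\<rparr>) \<noteq> 3"
  shows "\<guillemotleft>3\<guillemotright> \<noteq> \<zero>"
proof
  assume z: "\<guillemotleft>3\<guillemotright> = \<zero>"
  define S where "S = {n::nat. [n] \<cdot> \<one> = \<zero>}"
  have "[n] \<cdot>\<^bsub>R\<lparr>carrier := k\<rparr>\<^esub> \<one>\<^bsub>R\<lparr>carrier := k\<rparr>\<^esub> = [n] \<cdot> \<one>" for n :: nat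
    by (simp add: add_pow_def nat_pow_def)
  then have ch: "characteristic (R\<lparr>carrier := k\<rparr>) = Gcd S" unfolding characteristic_def S_def by simp
  have Suc: "[Suc n] \<cdot> \<one> = [n] \<cdot> \<one> \<oplus> \<one>" for n by simp
  have c: "[n] \<cdot> \<one> \<in> carrier R" for n :: nat by simp
  have 3: "\<one> \<oplus> \<one> \<oplus> \<one> = \<zero>"
    using z by (simp add: of_integer_def eval_nat_numeral a_assoc)
  have step: "[Suc (Suc (Suc n))] \<cdot> \<one> = [n] \<cdot> \<one>" for n
  proof -
    have "[Suc (Suc (Suc n))] \<cdot> \<one> = [n] \<cdot> \<one> \<oplus> (\<one> \<oplus> \<one> \<oplus> \<one>)" using c by (simp add: a_assoc)
    then show ?thesis using 3 c by simp
  qed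
  have two: "\<one> \<oplus> \<one> \<noteq> \<zero>" using 3 by auto
  have dvd3: "[n] \<cdot> \<one> = \<zero> \<Longrightarrow> 3 dvd n" for n :: nat
  proof (induction n rule: less_induct)
    case (less n)
    show ?case
    proof (cases "n < 3")
      case True
      then consider "n = 0" | "n = 1" | "n = 2" by linarith
      then show ?thesis using less.prems two by cases (auto simp: numeral_2_eq_2)
    next
      case False
      then obtain m where m: "n = Suc (Suc (Suc m))" by (metis Suc_diff_Suc linorder_not_less numeral_3_eq_3 add_diff_inverse_nat add_Suc plus_nat.add_0)
      then have "3 dvd m" using less.IH[of m] less.prems step by simp
      then show ?thesis unfolding m by presburger
    qed
  qed
  have "add_pow R (3::nat) \<one> = \<zero>" using step[of 0] by (simp add: numeral_3_eq_3)
  then have "Gcd S dvd 3" unfolding S_def by (intro Gcd_dvd) simp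
  moreover have "3 dvd Gcd S" unfolding S_def using dvd3 by (intro Gcd_greatest) simp
  ultimately have "Gcd S = 3" by (rule dvd_antisym)
  then show False using assms(2) ch by simp
qed

lemma dval_surj:
  assumes "dval F V v" obtains g where "g \<in> F" "g \<noteq> \<zero>" "v g = m"
proof -
  obtain t where t: "t \<in> F" "t \<noteq> \<zero>" "v t = 1" using dval_uniformizer[OF assms] .
  note fc = subfield_closed[OF vringD(1)[OF dval_vring[OF assms]]]
  show thesis
  proof (cases "m \<ge> 0")
    case True
    have "v (t [^] nat m) = int (nat m) * v t" using dval_pow[OF assms t(1,2)] by blast
    then show ?thesis
      using that[of "t [^] nat m"] fc(9)[OF t(1)] pow_nonzero[OF fc(10)[OF t(1)] t(2)] t(3) True
      by (simp del: pow_nat)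
  next
    case False
    define g where "g = t [^] nat (- m)"
    have g: "g \<in> F" "g \<noteq> \<zero>" unfolding g_def using fc(9)[OF t(1)] pow_nonzero[OF fc(10)[OF t(1)] t(2)] by blast+
    have "v g = - m" unfolding g_def using dval_pow[OF assms t(1,2), of "nat (- m)"] t(3) False by (simp del: pow_nat)
    then show ?thesis
      using that[of "inv g"] dval_inv[OF assms g] fc(8)[OF g] nonzero_imp_inverse_nonzero[OF fc(10)[OF g(1)] g(2)] by simp
  qed
qed

lemma place_val_three:
  assumes "function_field k E" "Q \<in> places k E" "\<guillemotleft>3\<guillemotright> \<noteq> \<zero>"
  shows "place_val E Q \<guillemotleft>3\<guillemotright> = 0"
proof -
  have k: "subfield k R" and E: "subfield E R" using function_fieldE[OF assms(1)] by blast+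
  show ?thesis
    using algebraic_place_val_zero[OF assms(1) three_in_subfield[OF E] assms(3) _ assms(2)]
      algebraic_self[OF subfieldE(1)[OF k] three_in_subfield[OF k]] by blast
qed

lemma ramification_le_degree:
  assumes "function_field k F" "function_field k E" "F \<subseteq> E" "Q \<in> places k E" "dimension n F E"
    and "e > 0" "\<And>x. x \<in> F \<Longrightarrow> x \<noteq> \<zero> \<Longrightarrow> place_val E Q x = int e * v x"
  shows "e \<le> n"
proof -
  have F: "subfield F R" using function_fieldE[OF assms(1)] by blast
  show ?thesis
    by (rule ramification_index_le[OF place_facts(1)[OF assms(2,4)] F assms(3,5,6)]) (use assms(7) in simp)
qed

text \<open>Ramification indices in the diamond of \<open>K\<close>, its quadratic extension \<open>K'\<close>, its cubic
  extension \<open>L\<close> and their compositum \<open>L'\<close>: being prime to 2, a factor 3 passes across.\<close>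

lemma ramification_diamond:
  assumes ff: "function_field k K" "function_field k M" "function_field k N" "function_field k E"
    and sub: "K \<subseteq> M" "K \<subseteq> N" "M \<subseteq> E" "N \<subseteq> E"
    and dims: "dimension 2 K N" "dimension 2 M E" "dimension 3 K M" "dimension 3 N E"
    and P: "P \<in> places k K" "W \<in> places k E" "P \<subseteq> W"
  obtains f f' where
    "W \<inter> M \<in> places k M" "P \<subseteq> W \<inter> M" "W \<inter> N \<in> places k N" "P \<subseteq> W \<inter> N"
    "\<And>x. x \<in> K \<Longrightarrow> x \<noteq> \<zero> \<Longrightarrow> place_val M (W \<inter> M) x = int f * place_val K P x"
    "ramification_index K M P (W \<inter> M) = f"
    "\<And>x. x \<in> N \<Longrightarrow> x \<noteq> \<zero> \<Longrightarrow> place_val E W x = int f' * place_val N (W \<inter> N) x"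
    "f = 3 \<longleftrightarrow> f' = 3" "f = 3 \<longleftrightarrow> 3 dvd f" "f' = 3 \<longleftrightarrow> 3 dvd f'"
proof -
  obtain t where t: "t \<in> P" "t \<noteq> \<zero>" using place_facts(5)[OF ff(1) P(1)] by blast
  have PK: "P \<subseteq> K" using place_facts(4)[OF ff(1) P(1)] .
  have tW: "t \<in> W" "t \<in> M" "t \<in> N" using t(1) P(3) PK sub(1,2) by auto
  have WM: "W \<inter> M \<in> places k M" by (rule restrict_place[OF ff(2,4) sub(3) P(2) tW(1,2) t(2)])
  have WN: "W \<inter> N \<in> places k N" by (rule restrict_place[OF ff(3,4) sub(4) P(2) tW(1,3) t(2)])
  have PM: "P \<subseteq> W \<inter> M" and PN: "P \<subseteq> W \<inter> N" using P(3) PK sub(1,2) by auto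
  obtain f where f: "f > 0" "\<And>x. x \<in> K \<Longrightarrow> x \<noteq> \<zero> \<Longrightarrow> place_val M (W \<inter> M) x = int f * place_val K P x"
    "ramification_index K M P (W \<inter> M) = f" using place_above[OF ff(1,2) sub(1) P(1) WM PM] by blast
  obtain e where e: "e > 0" "\<And>x. x \<in> M \<Longrightarrow> x \<noteq> \<zero> \<Longrightarrow> place_val E W x = int e * place_val M (W \<inter> M) x"
    using place_above[OF ff(2,4) sub(3) WM P(2)] by blast
  obtain e' where e': "e' > 0" "\<And>x. x \<in> K \<Longrightarrow> x \<noteq> \<zero> \<Longrightarrow> place_val N (W \<inter> N) x = int e' * place_val K P x"
    using place_above[OF ff(1,3) sub(2) P(1) WN PN] by blast
  obtain f' where f': "f' > 0" "\<And>x. x \<in> N \<Longrightarrow> x \<noteq> \<zero> \<Longrightarrow> place_val E W x = int f' * place_val N (W \<inter> N) x"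
    using place_above[OF ff(3,4) sub(4) WN P(2)] by blast
  have le: "f \<le> 3" "e \<le> 2" "e' \<le> 2" "f' \<le> 3"
    using ramification_le_degree[OF ff(1,2) sub(1) WM dims(3) f(1,2)]
      ramification_le_degree[OF ff(2,4) sub(3) P(2) dims(2) e]
      ramification_le_degree[OF ff(1,3) sub(2) WN dims(1) e']
      ramification_le_degree[OF ff(3,4) sub(4) P(2) dims(4) f'] by blast+
  obtain s where s: "s \<in> K" "s \<noteq> \<zero>" "place_val K P s = 1" using dval_uniformizer[OF place_facts(1)[OF ff(1) P(1)]] .
  \<comment> \<open>Both towers from \<open>K\<close> to \<open>E\<close> multiply the value 1 of
    the uniformizer \<open>s\<close> by the product of their indices.\<close>
  have "int e * int f = int f' * int e'"
    using e(2)[of s] f(2)[of s] f'(2)[of s] e'(2)[of s] s subsetD[OF sub(1) s(1)] subsetD[OF sub(2) s(1)] by simp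
  then have "int (e * f) = int (f' * e')" by (simp only: Nat.of_nat_mult)
  then have ef: "e * f = f' * e'" by (simp only: of_nat_eq_iff)
  have "f \<in> {1,2,3}" "f' \<in> {1,2,3}" "e \<in> {1,2}" "e' \<in> {1,2}" using le f(1) f'(1) e(1) e'(1) by auto
  then have "f = 3 \<longleftrightarrow> f' = 3" "f = 3 \<longleftrightarrow> 3 dvd f" "f' = 3 \<longleftrightarrow> 3 dvd f'" using ef by auto
  then show thesis using that[OF WM PM WN PN f(2,3) f'(2)] by blast
qed

lemma fully_ramified_iff:
  assumes "dimension 3 K L" "subfield K R"
  shows "fully_ramified k K L P \<longleftrightarrow> (\<exists>Q \<in> places k L. P \<subseteq> Q \<and> ramification_index K L P Q = 3)"
  unfolding fully_ramified_def places_over_def dimI[OF assms(2,1)] by blast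

end

text \<open>An element of \<open>L\<close> outside \<open>F\<close> has degree three over
  \<open>F\<close>, whereas \<open>c\<close> satisfies a quadratic equation.\<close>

lemma (in quadratic_extension) generator_notin_cubic:
  assumes "subfield L R" "F \<subseteq> L" "dimension 3 F L" shows "c \<notin> L"
  using dimension_3_basis(1)[OF base assms(1,2,3)] c_notin indep3_not_in_qspan generator_in_qspan by blast

context field
begin

subsection \<open>Fully ramified places split\<close>

lemma fully_ramified_imp_splits:
  assumes ff: "function_field k K" and quad: "quadratic_extension R K c s p" and three: "\<guillemotleft>3\<guillemotright> \<noteq> \<zero>"
    and cubic: "cubic_extension k K L" and closure: "purely_cubic_closure k K L (qspan K c)"
    and P: "P \<in> places k K" "fully_ramified k K L P"
  shows "splits k K (qspan K c) P"
proof (rule ccontr)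
  assume nsplit: "\<not> ?thesis"
  interpret KK: quadratic_extension R K c s p by fact
  have L: "subfield L R" "K \<subseteq> L" "dimension 3 K L" "field_extension K L"
    using cubic unfolding cubic_extension_def separable_extension_def field_extension_def by auto
  have k: "subfield k R" "k \<subseteq> K" using function_fieldE[OF ff] by blast+
  have cL: "c \<notin> L" using KK.generator_notin_cubic[OF L(1-3)] .
  interpret LL: quadratic_extension R L c s p using quadratic_extension_over[OF quad L(1,2) cL] .
  define K' where "K' = qspan K c"
  define L' where "L' = qspan L c"
  have comp: "composite L K' = L'"
    unfolding K'_def L'_def using composite_qspan[OF quad LL.quadratic_extension_axioms L(2)] .
  have sf: "subfield K' R" "subfield L' R" "K \<subseteq> K'" "L \<subseteq> L'" "K' \<subseteq> L'"
    unfolding K'_def L'_def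
    using KK.qspan_subfield LL.qspan_subfield KK.base_subset_qspan LL.base_subset_qspan qspan_mono[OF L(2)] by auto
  note kc = subfield_closed[OF KK.base] and k'c = subfield_closed[OF sf(1)] and l'c = subfield_closed[OF sf(2)]
  have d2: "dimension 2 K K'" "dimension 2 L L'"
    unfolding K'_def L'_def using KK.dimension_2_qspan LL.dimension_2_qspan by auto
  have ff': "function_field k K'" "function_field k L" "function_field k L'"
  proof -
    show "function_field k K'"
      using function_field_finite_extension[OF ff _ finite_dimensionI[OF d2(1)]] KK.base sf unfolding field_extension_def by blast
    show l: "function_field k L" using function_field_finite_extension[OF ff L(4) finite_dimensionI[OF L(3)]] .
    show "function_field k L'"
      using function_field_finite_extension[OF l _ finite_dimensionI[OF d2(2)]] L(1) sf unfolding field_extension_def by blast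
  qed
  have conj_eq: "LL.conjugate x = KK.conjugate x" if "x \<in> K'" for x
    using conjugate_restrict[OF quad LL.quadratic_extension_axioms L(2)] that unfolding K'_def by blast
  have conj_in: "LL.conjugate x \<in> K'" if "x \<in> K'" for x
    using conj_eq[OF that] KK.conjugate_closed that unfolding K'_def by simp
  have "makes_purely_cubic k K L K'" using closure unfolding purely_cubic_closure_def K'_def by blast
  then have "purely_cubic (constant_field k K') K' L'" unfolding makes_purely_cubic_def comp by blast
  then obtain w where w: "dimension 3 K' L'" "w \<in> L'" "w \<notin> K'" "w \<otimes> w \<otimes> w \<in> K'" "w \<in> carrier R"
    using purely_cubicE by metis
  define \<beta> where "\<beta> = w \<otimes> w \<otimes> w"
  have b: "\<beta> \<in> K'" "\<beta> \<in> carrier R" using w k'c(10) unfolding \<beta>_def by auto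
  note basis = dimension_3_basis[OF sf(1,2,5) w(1,2,3)]
  have w0: "w \<noteq> \<zero>" using w(3) k'c(1) by auto
  have b0: "\<beta> \<noteq> \<zero>" unfolding \<beta>_def using w0 w(5) integral_iff by simp
  obtain QL where QL: "QL \<in> places k L" "P \<subseteq> QL" "ramification_index K L P QL = 3"
    using P(2) fully_ramified_iff[OF L(3) KK.base] by blast
  obtain e where e: "e > 0" "\<And>x. x \<in> K \<Longrightarrow> x \<noteq> \<zero> \<Longrightarrow> place_val L QL x = int e * place_val K P x"
    "ramification_index K L P QL = e" using place_above[OF ff ff'(2) L(2) P(1) QL(1,2)] by blast
  \<comment> \<open>A pure generator over \<open>K\<close> would make \<open>K\<close> itself
    compete for the closure, forcing \<open>K'\<close> into \<open>K\<close>. The constants of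
    \<open>K\<close> may exceed \<open>k\<close>, so geometricity over them is taken from the
    ramified place.\<close>
  have not_pure: False if y: "y \<in> L" "y \<notin> K" "y \<otimes> y \<otimes> y \<in> K" for y
  proof -
    note pf = place_facts[OF ff'(2) QL(1)]
    let ?C = "constant_field k K"
    have C: "?C \<subseteq> K" unfolding constant_field_def by blast
    moreover have "?C \<subseteq> place_ring L QL"
      using constant_field_in_vring[OF dval_vring[OF pf(1)] k(1) pf(3)] L(2) unfolding constant_field_def by blast
    ultimately have "cubic_extension ?C K L"
      using cubic_extension_of_ramified[OF L(4,3) three pf(1)] e(2,3) QL(3) by simp
    then have "purely_cubic ?C K L" using purely_cubicI y by blast
    then have "makes_purely_cubic k K L K"
      unfolding makes_purely_cubic_def composite_base[OF L(4)] field_extension_def using KK.base by blast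
    then have "K' \<subseteq> K" using closure unfolding purely_cubic_closure_def K'_def by blast
    then show False using KK.generator_in_qspan KK.c_notin unfolding K'_def by blast
  qed
  \<comment> \<open>In the inseparable case conjugation is the identity, so norms are squares:
    \<open>w \<otimes> w\<close> lies in \<open>L\<close>, and its cube, the square of \<beta>, lies
    in \<open>K\<close>. This is a pure generator over \<open>K\<close>.\<close>
  have separable: "s \<noteq> c \<oplus> c"
  proof
    assume s: "s = c \<oplus> c"
    have "s \<ominus> c = c" unfolding s using KK.c_carrier by (simp add: a_minus_def a_assoc r_neg)
    then have Lid: "LL.conjugate x = x" if "x \<in> L'" for x
      using that unfolding L'_def by (elim LL.qspanE) (simp add: LL.conjugate_eq)
    have Kid: "KK.conjugate x = x" if "x \<in> K'" for x
      using Lid[of x] conj_eq[OF that] that sf(5) by auto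
    have y: "w \<otimes> w \<in> L" using LL.norm_in_base[of w] Lid[OF w(2)] w(2) unfolding L'_def by simp
    have ynK: "w \<otimes> w \<notin> K"
    proof
      assume "w \<otimes> w \<in> K"
      then have "\<beta> \<oslash> (w \<otimes> w) \<in> K'" using k'c(7)[OF b(1)] sf(3) by blast
      moreover have "\<beta> \<oslash> (w \<otimes> w) = w" unfolding \<beta>_def using w(5) w0 by (simp add: field_norm)
      ultimately show False using w(3) by simp
    qed
    have "\<beta> \<otimes> \<beta> \<in> K" using KK.norm_in_base[of \<beta>] Kid[OF b(1)] b(1) unfolding K'_def by simp
    moreover have "\<beta> \<otimes> \<beta> = (w \<otimes> w) \<otimes> (w \<otimes> w) \<otimes> (w \<otimes> w)" unfolding \<beta>_def using w(5) by (simp add: ring_norm)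
    ultimately show False using not_pure[OF y ynK] by simp
  qed
  \<comment> \<open>Going up to \<open>L'\<close> and down to \<open>K'\<close>, the index 3 of
    \<open>QL\<close> over \<open>P\<close> reappears as the index of \<open>W\<close> over
    \<open>Q\<close>.\<close>
  obtain W where W: "W \<in> places k L'" "QL \<subseteq> W" using extend_place[OF ff'(2,3) sf(4) QL(1)] .
  have PW: "P \<subseteq> W" using QL(2) W(2) by blast
  have WL: "W \<inter> L = QL" using place_inter[OF ff'(2,3) sf(4) QL(1) W] .
  define Q where "Q = W \<inter> K'"
  obtain f f' where diamond: "Q \<in> places k K'" "P \<subseteq> Q" "ramification_index K L P (W \<inter> L) = f"
    "\<And>x. x \<in> K' \<Longrightarrow> x \<noteq> \<zero> \<Longrightarrow> place_val L' W x = int f' * place_val K' Q x"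
    "f = 3 \<longleftrightarrow> f' = 3"
    unfolding Q_def
    using ramification_diamond[OF ff ff'(2,1,3) L(2) sf(3,4,5) d2 L(3) w(1) P(1) W(1) PW] by metis
  have f3: "f' = 3" using diamond(3,5) WL QL(3) by simp
  have vW: "place_val L' W x = 3 * place_val K' Q x" if "x \<in> K'" "x \<noteq> \<zero>" for x
    using diamond(4)[OF that] f3 by simp
  \<comment> \<open>Without splitting, \<open>Q\<close> is the only place of \<open>K'\<close> above
    \<open>P\<close>, so conjugation preserves it together with its valuation.\<close>
  have stable: "KK.conjugate ` Q = Q"
    using nsplit KK.splits_iff[OF ff ff'(1)[unfolded K'_def] P(1) diamond(1,2)[unfolded K'_def]] by blast
  define v where "v = place_val K' Q"
  have D: "dval K' (place_ring K' Q) v" unfolding v_def using place_facts(1)[OF ff'(1) diamond(1)] .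
  have vconj: "v (KK.conjugate x) = v x" if "x \<in> K'" "x \<noteq> \<zero>" for x
    using KK.conjugate_place(3)[OF ff ff'(1)[unfolded K'_def] diamond(1)[unfolded K'_def], of x] stable that
    unfolding v_def K'_def by simp
  \<comment> \<open>The conjugate \<open>u\<close> of \<open>w\<close> lies in \<open>K'(w)\<close>,
    and its cube is the conjugate of \<beta>; \<open>cube_root_combination\<close> therefore leaves
    three forms for \<open>u\<close>. The first would put \<open>w\<close> into \<open>K'\<close>,
    the second would make \<open>L\<close> pure over \<open>K\<close>, and the third gives the
    divisibility.\<close>
  have "3 dvd v \<beta>"
  proof -
    define u where "u = LL.conjugate w"
    have u: "u \<in> L'" "u \<in> carrier R" unfolding u_def using LL.conjugate_closed w(2) l'c(10) unfolding L'_def by auto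
    have cw: "LL.conjugate u = w" unfolding u_def using LL.conjugate_conjugate w(2) unfolding L'_def by blast
    define \<gamma> where "\<gamma> = KK.conjugate \<beta>"
    have "w \<otimes> w \<in> qspan L c" using w(2) l'c(4) unfolding L'_def by blast
    then have u3: "u \<otimes> u \<otimes> u = \<gamma>"
      using LL.conjugate_mult[of "w \<otimes> w" w] LL.conjugate_mult[of w w] w(2) conj_eq[OF b(1)]
      unfolding u_def \<gamma>_def \<beta>_def L'_def by simp
    have g: "\<gamma> \<in> K'" "\<gamma> \<noteq> \<zero>" "\<gamma> \<in> carrier R"
      unfolding \<gamma>_def using KK.conjugate_closed KK.conjugate_zero_iff b b0 k'c(10) unfolding K'_def by auto
    obtain a1 a2 a3 where a: "a1 \<in> K'" "a2 \<in> K'" "a3 \<in> K'" "u = a1 \<oplus> a2 \<otimes> w \<oplus> a3 \<otimes> (w \<otimes> w)"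
      using basis(2)[OF u(1)] by blast
    have "u \<otimes> u \<otimes> u \<in> K'" using u3 g by simp
    from cube_root_combination[OF sf(1) basis(1) w(5) \<beta>_def[symmetric] b(1) three a this]
    consider "u = a1" | "u = a2 \<otimes> w" | "u = a3 \<otimes> (w \<otimes> w)" by blast
    then show ?thesis
    proof cases
      case 1
      then have "w \<in> K'" using conj_in[OF a(1)] cw by simp
      then show ?thesis using w(3) by blast
    next
      case 3
      have ac: "a3 \<in> carrier R" using a(3) k'c(10) by blast
      \<comment> \<open>This is the product of \<open>w\<close> with its conjugate. Its cube is
        \<beta> times the conjugate of \<beta>, and that product has value
        \<open>2 * v \<beta>\<close>.\<close>
      define h where "h = a3 \<otimes> \<beta>"
      have h: "h \<in> K'" "h \<in> carrier R" unfolding h_def using a(3) b k'c(4,10) by auto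
      have "\<beta> \<otimes> \<gamma> = h \<otimes> h \<otimes> h"
        unfolding u3[symmetric] 3 h_def \<beta>_def using w(5) ac by (simp add: ring_norm)
      moreover have "h \<noteq> \<zero>"
      proof
        assume "h = \<zero>"
        then have "\<beta> \<otimes> \<gamma> = \<zero>" using calculation by simp
        then show False using b b0 g integral_iff by simp
      qed
      ultimately have "v \<beta> + v \<gamma> = 3 * v h"
        using dval_mult[OF D b(1) g(1) b0 g(2)] dval_cube[OF D h(1)] by simp
      then show ?thesis using vconj[OF b(1) b0] unfolding \<gamma>_def by presburger
    next
      case 2
      note cjE = LL.conjugate_mult[folded L'_def] LL.conjugate_add[folded L'_def]
      have aL: "a2 \<in> L'" "a2 \<in> carrier R" using a(2) sf(5) k'c(10) by auto
      define b2 where "b2 = LL.conjugate a2"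
      have b2: "b2 \<in> K'" "b2 \<in> carrier R" unfolding b2_def using conj_in[OF a(2)] k'c(10) by auto
      have "w = b2 \<otimes> (a2 \<otimes> w)"
        using cw cjE(1)[OF aL(1) w(2)] unfolding 2 b2_def using 2 unfolding u_def by simp
      then have "(b2 \<otimes> a2) \<otimes> w = \<one> \<otimes> w" using b2 aL w(5) by (simp add: m_assoc)
      then have norm1: "b2 \<otimes> a2 = \<one>" using m_rcancel[OF w0 w(5)] b2 aL by simp
      \<comment> \<open>Hilbert 90 for the norm-one element \<open>a2\<close>: the choice
        \<open>d = \<one> \<oplus> a2\<close> works unless it is zero.\<close>
      have "\<exists>d\<in>K'. d \<noteq> \<zero> \<and> a2 \<otimes> LL.conjugate d = d"
      proof (cases "a2 = \<ominus> \<one>")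
        case False
        define d where "d = \<one> \<oplus> a2"
        have dK: "d \<in> K'" unfolding d_def using a(2) k'c(2,3) by blast
        have "d \<noteq> \<zero>" unfolding d_def using False aL(2) eq_neg_iff_add_eq_0[of a2 \<one>] by (simp add: a_comm)
        moreover have "LL.conjugate d = \<one> \<oplus> b2"
          unfolding d_def b2_def using cjE(2)[OF l'c(2) aL(1)] by simp
        then have "a2 \<otimes> LL.conjugate d = a2 \<oplus> b2 \<otimes> a2" using b2 aL by (simp add: r_distr m_comm)
        then have "a2 \<otimes> LL.conjugate d = d" unfolding norm1 d_def using aL by (simp add: a_comm)
        ultimately show ?thesis using dK by blast
      next
        case True
        \<comment> \<open>For \<open>a2 = \<ominus> \<one>\<close> an element negated by conjugation
          is needed; the difference of the two roots is one, and it is nonzero by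
          separability.\<close>
        define d where "d = c \<ominus> (s \<ominus> c)"
        have cK: "c \<in> K'" "s \<in> K'" unfolding K'_def using KK.generator_in_qspan KK.base_subset_qspan KK.s_in by auto
        have dK: "d \<in> K'" unfolding d_def using cK k'c(5) by blast
        have cr: "c \<in> carrier R" "s \<in> carrier R" using KK.c_carrier KK.sp_carrier by auto
        have dn: "d \<noteq> \<zero>"
        proof
          assume "d = \<zero>"
          then have "c = s \<ominus> c" unfolding d_def using cr by simp
          moreover have "s \<ominus> c \<oplus> c = s" using cr by (simp add: ring_norm)
          ultimately have "s = c \<oplus> c" by metis
          then show False using separable by blast
        qed
        have "d = (\<ominus> s) \<oplus> (\<one> \<oplus> \<one>) \<otimes> c" unfolding d_def using cr by (simp add: ring_norm)
        moreover have "\<ominus> s \<in> L" "\<one> \<oplus> \<one> \<in> L" using LL.s_in LL.cl(2,3,6) by auto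
        ultimately have "LL.conjugate d = (\<ominus> s) \<oplus> (\<one> \<oplus> \<one>) \<otimes> (s \<ominus> c)" using LL.conjugate_eq by simp
        also have "\<dots> = \<ominus> d" unfolding d_def using cr by (simp add: ring_norm)
        finally have "a2 \<otimes> LL.conjugate d = d" unfolding True using dK k'c(10) by (simp add: l_minus r_minus)
        then show ?thesis using dK dn by blast
      qed
      then obtain d where d: "d \<in> K'" "d \<noteq> \<zero>" "a2 \<otimes> LL.conjugate d = d" by blast
      have dc: "d \<in> L'" "d \<in> carrier R" "LL.conjugate d \<in> carrier R"
        using d sf(5) k'c(10) conj_in by auto
      \<comment> \<open>The factor \<open>d\<close> corrects \<open>w\<close> so that the product is
        fixed by conjugation; hence \<open>y\<close> lies in \<open>L\<close> and its cube in
        \<open>K\<close>.\<close>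
      define y where "y = w \<otimes> d"
      have yL': "y \<in> L'" unfolding y_def using w(2) dc(1) l'c(4) by blast
      have "LL.conjugate y = (a2 \<otimes> w) \<otimes> LL.conjugate d"
        unfolding y_def using cjE(1)[OF w(2) dc(1)] 2 unfolding u_def by simp
      also have "\<dots> = w \<otimes> (a2 \<otimes> LL.conjugate d)" using aL w(5) dc by (simp add: m_ac)
      finally have yfix: "LL.conjugate y = y" unfolding d(3) y_def .
      have yL: "y \<in> L" using LL.fixed_imp_base[OF separable] yL' yfix unfolding L'_def by blast
      have yK: "y \<notin> K'"
      proof
        assume "y \<in> K'"
        then have "y \<oslash> d \<in> K'" using d(1) k'c(7) by blast
        moreover have "y \<oslash> d = w" unfolding y_def using w(5) dc d(2) by (simp add: field_norm)
        ultimately show False using w(3) by simp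
      qed
      have "y \<otimes> y \<otimes> y = \<beta> \<otimes> (d \<otimes> d \<otimes> d)" unfolding y_def \<beta>_def using w(5) dc(2) by (simp add: ring_norm)
      then have y3: "y \<otimes> y \<otimes> y \<in> K'" using b(1) d(1) k'c(4) by simp
      have "KK.conjugate (y \<otimes> y \<otimes> y) = LL.conjugate (y \<otimes> y \<otimes> y)" using conj_eq[OF y3] by simp
      also have "\<dots> = y \<otimes> y \<otimes> y" by (rule LL.conjugate_base) (use yL LL.cl(4) in blast)
      finally have "y \<otimes> y \<otimes> y \<in> K" using KK.fixed_imp_base[OF separable] y3 unfolding K'_def by blast
      then show ?thesis using not_pure[OF yL] yK sf(3) by blast
    qed
  qed
  \<comment> \<open>Dividing \<open>w\<close> by an element of value \<open>m\<close> makes it a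
    unit at \<open>W\<close> without leaving the cube roots over \<open>K'\<close>; such a generator
    cannot ramify.\<close>
  then obtain m where m: "v \<beta> = 3 * m" by blast
  obtain g where g: "g \<in> K'" "g \<noteq> \<zero>" "v g = m" using dval_surj[OF D] .
  have gc: "g \<in> carrier R" "g \<in> L'" using g k'c(10) sf(5) by auto
  define z where "z = w \<oslash> g"
  have z: "z \<in> L'" "z \<noteq> \<zero>" unfolding z_def using l'c(7)[OF w(2) gc(2)] div_nonzero[OF w(5) gc(1) w0 g(2)] by auto
  have zK: "z \<notin> K'"
  proof
    assume "z \<in> K'"
    then have "z \<otimes> g \<in> K'" using g(1) k'c(4) by blast
    moreover have "z \<otimes> g = w" unfolding z_def using w(5) gc(1) g(2) by (simp add: field_norm)
    ultimately show False using w(3) by simp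
  qed
  have ggg: "g \<otimes> g \<otimes> g \<in> K'" "g \<otimes> g \<otimes> g \<noteq> \<zero>" using g(1,2) gc(1) k'c(4) integral_iff by auto
  have z3: "z \<otimes> z \<otimes> z = \<beta> \<oslash> (g \<otimes> g \<otimes> g)"
    unfolding z_def \<beta>_def using w(5) gc(1) g(2) by (simp add: field_norm)
  have z3K: "z \<otimes> z \<otimes> z \<in> K'" "z \<otimes> z \<otimes> z \<noteq> \<zero>"
    unfolding z3 using k'c(7)[OF b(1) ggg(1)] div_nonzero[OF b(2) _ b0 ggg(2)] ggg(1) k'c(10) by auto
  have "v (z \<otimes> z \<otimes> z) = 0"
    unfolding z3 using dval_div[OF D b(1) ggg(1) b0 ggg(2)] dval_cube[OF D g(1,2)] m g(3) by simp
  note DW = place_facts(1)[OF ff'(3) W(1)]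
  have "3 * place_val L' W z = 3 * v (z \<otimes> z \<otimes> z)"
    using vW[OF z3K] dval_cube[OF DW z] unfolding v_def by simp
  then have wz: "place_val L' W z = 0" using \<open>v (z \<otimes> z \<otimes> z) = 0\<close> by simp
  show False
    by (rule unit_cube_root_unramified[OF DW sf(1,5) w(1) _ z(1) zK wz z3K(1) three place_val_three[OF ff'(3) W(1) three]])
      (simp add: vW)
qed

subsection \<open>Construction of the cubic extension\<close>

text \<open>\<open>u + 1/u\<close> is the trace of \<open>u\<close> under the extension of conjugation that sends \<open>u\<close> to \<open>1/u\<close>.\<close>

lemma cube_root_trace_generates:
  assumes "quadratic_extension R K c s p" "\<guillemotleft>3\<guillemotright> \<noteq> \<zero>"
    and r: "r \<in> qspan K c" "r \<otimes> quadratic_extension.conjugate R K c s r = \<one>"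
    and u: "u \<in> carrier R" "u \<otimes> u \<otimes> u = r" "indep3 (qspan K c) u"
  defines "y \<equiv> u \<oplus> inv u"
  shows "y \<in> carrier R" "indep3 (qspan K c) y"
    "dimension 3 K (generate_field R (insert y K))"
    "dimension 3 (qspan K c) (generate_field R (insert u (qspan K c)))"
    "composite (generate_field R (insert y K)) (qspan K c) = generate_field R (insert u (qspan K c))"
    "(y \<otimes> y \<ominus> \<one>) \<otimes> u = r \<oplus> y"
proof -
  interpret KK: quadratic_extension R K c s p by fact
  define K' where "K' = qspan K c"
  have K': "subfield K' R" "K \<subseteq> K'" unfolding K'_def using KK.qspan_subfield KK.base_subset_qspan by auto
  note kc = subfield_closed[OF KK.base] and k'c = subfield_closed[OF K'(1)]
  have ui: "indep3 K' u" using u(3) unfolding K'_def .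
  have u0: "u \<noteq> \<zero>" using indep3_nonzero[OF K'(1) ui u(1)] by blast
  have rK: "r \<in> K'" "r \<in> carrier R" using r(1) k'c(10) unfolding K'_def by auto
  have r0: "r \<noteq> \<zero>" using u(1,2) u0 integral_iff by auto
  define v where "v = inv u"
  have v: "v \<in> carrier R" "u \<otimes> v = \<one>" "v \<noteq> \<zero>"
    unfolding v_def using u(1) u0 nonzero_imp_inverse_nonzero by auto
  have y: "y = u \<oplus> v" unfolding y_def v_def ..
  show yc: "y \<in> carrier R" unfolding y using u(1) v(1) by simp
  define r' where "r' = KK.conjugate r"
  have r': "r' \<in> carrier R" "r \<otimes> r' = \<one>"
    unfolding r'_def using KK.conjugate_closed[OF r(1)] KK.qspan_carrier r(2) by auto
  have v3: "v \<otimes> v \<otimes> v = r'"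
  proof -
    have "r \<otimes> (v \<otimes> v \<otimes> v) = (u \<otimes> v) \<otimes> (u \<otimes> v) \<otimes> (u \<otimes> v)"
      unfolding u(2)[symmetric] using u(1) v(1) by (simp add: ring_norm)
    then have "r \<otimes> (v \<otimes> v \<otimes> v) = r \<otimes> r'" unfolding v(2) r'(2) by simp
    then show ?thesis using m_lcancel[OF r0 rK(2)] v(1) r'(1) by simp
  qed
  define \<alpha> where "\<alpha> = r \<oplus> r'"
  have a: "\<alpha> \<in> K" "\<alpha> \<in> carrier R" unfolding \<alpha>_def r'_def using KK.trace_in_base[OF r(1)] kc(10) by auto
  have three: "\<guillemotleft>3\<guillemotright> \<in> K" using three_in_subfield[OF KK.base] .
  \<comment> \<open>As \<open>u\<close> and \<open>v\<close> have product 1, the binomial formula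
    makes \<open>y\<close> a root of \<open>X^3 - 3 X - \<alpha>\<close>, where \<alpha> is the
    trace of \<open>r\<close> and so lies in \<open>K\<close>.\<close>
  have y3: "y \<otimes> y \<otimes> y = \<alpha> \<oplus> \<guillemotleft>3\<guillemotright> \<otimes> y \<oplus> \<zero> \<otimes> (y \<otimes> y)"
  proof -
    have "y \<otimes> y \<otimes> y = u \<otimes> u \<otimes> u \<oplus> v \<otimes> v \<otimes> v \<oplus> \<guillemotleft>3\<guillemotright> \<otimes> (u \<otimes> v) \<otimes> (u \<oplus> v)"
      unfolding y using u(1) v(1) by (simp add: ring_norm)
    then show ?thesis unfolding u(2) v3 v(2) \<alpha>_def y using u(1) v(1) rK r' three kc(10) by simp
  qed
  have uy: "u \<otimes> u = y \<otimes> u \<ominus> \<one>"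
  proof -
    have "y \<otimes> u \<ominus> u \<otimes> v = u \<otimes> u" unfolding y using u(1) v(1) by (simp add: ring_norm)
    then show ?thesis unfolding v(2) by simp
  qed
  \<comment> \<open>The quadratic equation of \<open>u\<close> over the field of \<open>y\<close>
    reduces \<open>u^3 = r\<close> to an equation linear in \<open>u\<close>. This is what recovers
    \<open>u\<close> from \<open>y\<close> when minimality of \<open>K'\<close> is proved.\<close>
  have "(y \<otimes> y \<ominus> \<one>) \<otimes> u = y \<otimes> (y \<otimes> u \<ominus> \<one>) \<ominus> u \<oplus> y"
    using u(1) yc by (simp add: ring_norm)
  also have "\<dots> = u \<otimes> u \<otimes> u \<oplus> y"
  proof -
    have "u \<otimes> u \<otimes> u = u \<otimes> (y \<otimes> u \<ominus> \<one>)" unfolding uy[symmetric] using u(1) by (simp add: m_assoc)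
    also have "\<dots> = y \<otimes> (u \<otimes> u) \<ominus> u" using u(1) yc by (simp add: ring_norm)
    finally have "u \<otimes> u \<otimes> u = y \<otimes> (u \<otimes> u) \<ominus> u" .
    then show ?thesis using uy by simp
  qed
  finally show key: "(y \<otimes> y \<ominus> \<one>) \<otimes> u = r \<oplus> y" unfolding u(2) .
  define L' where "L' = generate_field R (insert u K')"
  have d3': "dimension 3 K' L'"
    unfolding L'_def using dimension_3I[OF K'(1) u(1) ui rK(1) k'c(1) k'c(1)] u rK by simp
  then show "dimension 3 (qspan K c) (generate_field R (insert u (qspan K c)))" unfolding L'_def K'_def .
  have ins: "insert u K' \<subseteq> carrier R" using u(1) k'c(10) by blast
  have L': "subfield L' R" "K' \<subseteq> L'" "u \<in> L'"
    unfolding L'_def using generate_field_is_subfield[OF ins] by (auto intro: generate_field.incl)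
  have yL': "y \<in> L'" unfolding y v_def using subfield_closed(3,8)[OF L'(1)] L'(3) u0 by blast
  have yK': "y \<notin> K'"
  proof
    assume y: "y \<in> K'"
    have "\<one> \<oplus> (\<ominus> y) \<otimes> u \<oplus> \<one> \<otimes> (u \<otimes> u) = \<zero>" using u(1) yc by (simp add: ring_norm uy)
    from indep3D(1)[OF ui _ _ _ this] show False using k'c(2,6) y by simp
  qed
  note bas = dimension_3_basis[OF K'(1) L'(1,2) d3' yL' yK']
  show "indep3 (qspan K c) y" using bas(1) unfolding K'_def .
  have yi: "indep3 K y" using indep3_mono[OF bas(1) K'(2)] .
  define L where "L = generate_field R (insert y K)"
  show "dimension 3 K (generate_field R (insert y K))"
    using dimension_3I[OF KK.base yc yi a(1) three kc(1) y3] .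
  have insK: "insert y K \<subseteq> carrier R" using yc kc(10) by blast
  have L: "K \<subseteq> L" "y \<in> L" unfolding L_def by (auto intro: generate_field.incl)
  have "L \<subseteq> L'"
    unfolding L_def by (rule generate_field_min_subfield1[OF insK L'(1)]) (use yL' K'(2) L'(2) in auto)
  then have LK': "L \<union> K' \<subseteq> L'" using L'(2) by blast
  then have c1: "L \<union> K' \<subseteq> carrier R" using subfield_closed(10)[OF L'(1)] by blast
  have "composite L K' = L'"
  proof
    show "composite L K' \<subseteq> L'"
      unfolding composite_def by (rule generate_field_min_subfield1[OF c1 L'(1) LK'])
    have "insert y K' \<subseteq> L \<union> K'" using L(2) by blast
    then have "generate_field R (insert y K') \<subseteq> composite L K'"
      unfolding composite_def using mono_generate_field c1 by blast
    then show "L' \<subseteq> composite L K'" using bas(4) by simp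
  qed
  then show "composite (generate_field R (insert y K)) (qspan K c) = generate_field R (insert u (qspan K c))"
    unfolding L_def L'_def K'_def .
qed

text \<open>Suppose \<open>L\<close> becomes pure over \<open>F\<close>, generated by a cube root
  \<open>w\<close> of \<beta>, and \<open>c\<close> is not in \<open>F\<close>. Over
  \<open>M = F(c)\<close> both \<open>u\<close> and \<open>w\<close> are cube roots generating the
  same field, so \<open>r\<close> is \<beta> or its square up to a cube in \<open>M\<close>. Taking
  norms to \<open>F\<close>, where \<open>r\<close> has norm 1, turns \<beta> into a cube in
  \<open>F\<close>.\<close>

lemma cube_root_trace_closure_minimal:
  assumes quad: "quadratic_extension R K c s p" and three: "\<guillemotleft>3\<guillemotright> \<noteq> \<zero>"
    and r: "r \<in> qspan K c" "r \<otimes> quadratic_extension.conjugate R K c s r = \<one>"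
    and u: "u \<in> carrier R" "u \<otimes> u \<otimes> u = r" "indep3 (qspan K c) u"
    and L: "L = generate_field R (insert (u \<oplus> inv u) K)"
    and F: "makes_purely_cubic k K L F"
  shows "qspan K c \<subseteq> F"
proof (rule ccontr)
  assume nsub: "\<not> ?thesis"
  interpret KK: quadratic_extension R K c s p by fact
  define y where "y = u \<oplus> inv u"
  note cr = cube_root_trace_generates[OF quad three r u, folded y_def]
  have sF: "subfield F R" "K \<subseteq> F"
    using F unfolding makes_purely_cubic_def field_extension_def by auto
  note fc = subfield_closed[OF sF(1)]
  have cF: "c \<notin> F"
  proof
    assume c: "c \<in> F"
    have "qspan K c \<subseteq> F"
    proof
      fix x assume "x \<in> qspan K c"
      then obtain a b where ab: "a \<in> K" "b \<in> K" "x = a \<oplus> b \<otimes> c" by (rule KK.qspanE)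
      then have "a \<in> F" "b \<in> F" using sF(2) by auto
      then show "x \<in> F" unfolding ab(3) using c fc(3,4) by simp
    qed
    with nsub show False ..
  qed
  interpret FF: quadratic_extension R F c s p using quadratic_extension_over[OF quad sF cF] .
  define M where "M = qspan F c"
  have M: "subfield M R" "F \<subseteq> M" unfolding M_def using FF.qspan_subfield FF.base_subset_qspan by auto
  note mc = subfield_closed[OF M(1)]
  define LF where "LF = composite L F"
  have "purely_cubic (constant_field k F) F LF" using F unfolding makes_purely_cubic_def LF_def by blast
  then obtain w where w: "subfield LF R" "F \<subseteq> LF" "dimension 3 F LF" "w \<in> LF" "w \<notin> F" "w \<otimes> w \<otimes> w \<in> F" "w \<in> carrier R"
    using purely_cubicE by metis
  define \<beta> where "\<beta> = w \<otimes> w \<otimes> w"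
  have b: "\<beta> \<in> F" "\<beta> \<in> carrier R" using w(6) fc(10) unfolding \<beta>_def by auto
  note basF = dimension_3_basis[OF sF(1) w(1-5)]
  have insK: "insert y K \<subseteq> carrier R" using cr(1) KK.cl(10) by blast
  have yL: "y \<in> L" unfolding L y_def by (auto intro: generate_field.incl)
  then have yLF: "y \<in> LF" unfolding LF_def composite_def by (auto intro: generate_field.incl)
  have yF: "y \<notin> F"
  proof
    assume "y \<in> F"
    then have "L \<subseteq> F" unfolding L y_def[symmetric] using generate_field_min_subfield1[OF insK sF(1)] sF(2) by blast
    then have "L \<union> F = F" by blast
    then have "LF = F"
      unfolding LF_def composite_def using generate_fieldI[OF subfieldE(3)[OF sF(1)] sF(1)] by simp
    then show False using w(4,5) by blast
  qed
  have yi: "indep3 F y" using dimension_3_basis(1)[OF sF(1) w(1-3) yLF yF] .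
  have yM: "y \<notin> M" unfolding M_def using FF.indep3_not_in_qspan[OF yi] .
  have wi: "indep3 M w" unfolding M_def using FF.indep3_qspan[OF basF(1) w(7,6)] .
  define N where "N = generate_field R (insert w M)"
  have insM: "insert w M \<subseteq> carrier R" using w(7) mc(10) by blast
  have N: "subfield N R" "M \<subseteq> N" "w \<in> N"
    unfolding N_def using generate_field_is_subfield[OF insM] by (auto intro: generate_field.incl)
  note nc = subfield_closed[OF N(1)]
  have bM: "\<beta> \<in> M" using b(1) M(2) by blast
  have d3: "dimension 3 M N"
    unfolding N_def
    using dimension_3I[OF M(1) w(7) wi bM mc(1) mc(1)] w(7) b(2) unfolding \<beta>_def by simp
  have "LF = generate_field R (insert w F)" using basF(4) .
  also have "\<dots> \<subseteq> N"
    unfolding N_def using M(2) insM by (intro mono_generate_field) auto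
  finally have yN: "y \<in> N" using yLF by blast
  have rM: "r \<in> M" unfolding M_def using r(1) qspan_mono[OF sF(2)] by blast
  have y21: "y \<otimes> y \<ominus> \<one> \<noteq> \<zero>"
  proof
    assume e: "y \<otimes> y \<ominus> \<one> = \<zero>"
    have "(\<ominus> \<one>) \<oplus> \<zero> \<otimes> y \<oplus> \<one> \<otimes> (y \<otimes> y) = y \<otimes> y \<ominus> \<one>" using cr(1) by (simp add: ring_norm)
    then have "(\<ominus> \<one>) \<oplus> \<zero> \<otimes> y \<oplus> \<one> \<otimes> (y \<otimes> y) = \<zero>" using e by simp
    from indep3D(3)[OF yi _ _ _ this] fc(1,2,6) show False by simp
  qed
  have y2N: "y \<otimes> y \<ominus> \<one> \<in> N" "r \<oplus> y \<in> N" using yN rM N(2) nc(2,3,4,5) by blast+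
  have uN: "u \<in> N"
  proof -
    define q where "q = y \<otimes> y \<ominus> \<one>"
    have q: "q \<in> N" "q \<noteq> \<zero>" "q \<in> carrier R" unfolding q_def using y2N y21 nc(10) by auto
    have "(q \<otimes> u) \<oslash> q \<in> N" using cr(6) y2N(2) q(1) nc(7) unfolding q_def by simp
    moreover have "(q \<otimes> u) \<oslash> q = u" using q u(1) by (simp add: field_norm)
    ultimately show ?thesis by simp
  qed
  have "u \<noteq> \<zero>" using indep3_nonzero[OF KK.qspan_subfield u(3,1)] by blast
  have uM: "u \<notin> M"
  proof
    assume "u \<in> M"
    then have "y \<in> M" unfolding y_def using mc(3)[OF _ mc(8)] \<open>u \<noteq> \<zero>\<close> by blast
    with yM show False ..
  qed
  have wM: "w \<notin> M" using indep3_nonzero[OF M(1) wi w(7)] by blast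
  obtain a1 a2 a3 where a: "a1 \<in> M" "a2 \<in> M" "a3 \<in> M" "u = a1 \<oplus> a2 \<otimes> w \<oplus> a3 \<otimes> (w \<otimes> w)"
    using dimension_3_basis(2)[OF M(1) N(1,2) d3 N(3) wM uN] by blast
  have "u \<otimes> u \<otimes> u \<in> M" using rM u(2) by simp
  from cube_root_combination[OF M(1) wi w(7) \<beta>_def[symmetric] bM three a this]
  consider "u = a1" | "u = a2 \<otimes> w" | "u = a3 \<otimes> (w \<otimes> w)" by blast
  moreover define r' where "r' = FF.conjugate r"
  have rr: "r \<otimes> r' = \<one>" unfolding r'_def
    using conjugate_restrict[OF quad FF.quadratic_extension_axioms sF(2) r(1)] r(2) by simp
  have nocube: False if "d \<in> F" "d \<otimes> d \<otimes> d = \<beta>" for d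
    using indep3_not_cube[OF sF(1) basF(1) w(7) that(1)] that(2) unfolding \<beta>_def by blast
  have cjm: "FF.conjugate (x \<otimes> z) = FF.conjugate x \<otimes> FF.conjugate z" if "x \<in> M" "z \<in> M" for x z
    using FF.conjugate_mult that unfolding M_def by blast
  have bfix: "FF.conjugate \<beta> = \<beta>" using FF.conjugate_base b(1) by blast
  have norm: "d \<otimes> FF.conjugate d \<in> F" "FF.conjugate d \<in> carrier R" if "d \<in> M" for d
    using FF.norm_in_base FF.conjugate_closed FF.qspan_carrier that unfolding M_def by auto
  ultimately show False
  proof cases
    case 1 then show ?thesis using uM a(1) by blast
  next
    case 2
    define e where "e = FF.conjugate a2"
    \<comment> \<open>The norm of \<open>a2\<close>. From \<open>r = a2^3 \<beta>\<close> one gets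
      \<open>n^3 \<beta>^2 = 1\<close>, so \<beta> is the cube of
      \<open>\<beta> \<otimes> n\<close>.\<close>
    define n where "n = a2 \<otimes> e"
    have n: "n \<in> F" "e \<in> carrier R" "a2 \<in> carrier R" unfolding n_def e_def using norm[OF a(2)] a(2) mc(10) by auto
    then have nR: "n \<in> carrier R" using fc(10) by blast
    have req: "r = a2 \<otimes> a2 \<otimes> a2 \<otimes> \<beta>" unfolding u(2)[symmetric] 2 \<beta>_def using n(3) w(7) by (simp add: ring_norm)
    have r'eq: "r' = e \<otimes> e \<otimes> e \<otimes> \<beta>" unfolding r'_def req e_def using cjm a(2) bM mc(4) bfix by simp
    have "(n \<otimes> n \<otimes> n) \<otimes> (\<beta> \<otimes> \<beta>) = r \<otimes> r'" unfolding req r'eq n_def using n b(2) by (simp add: ring_norm)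
    then have one: "(n \<otimes> n \<otimes> n) \<otimes> (\<beta> \<otimes> \<beta>) = \<one>" using rr by simp
    have "(\<beta> \<otimes> n) \<otimes> (\<beta> \<otimes> n) \<otimes> (\<beta> \<otimes> n) = \<beta> \<otimes> ((n \<otimes> n \<otimes> n) \<otimes> (\<beta> \<otimes> \<beta>))"
      using nR b(2) by (simp add: ring_norm)
    also have "\<dots> = \<beta>" unfolding one using b(2) by simp
    finally show ?thesis using nocube[of "\<beta> \<otimes> n"] fc(4)[OF b(1) n(1)] by blast
  next
    case 3
    define e where "e = FF.conjugate a3"
    define n where "n = a3 \<otimes> e"
    have n: "n \<in> F" "e \<in> carrier R" "a3 \<in> carrier R" unfolding n_def e_def using norm[OF a(3)] a(3) mc(10) by auto
    then have nR: "n \<in> carrier R" using fc(10) by blast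
    have req: "r = a3 \<otimes> a3 \<otimes> a3 \<otimes> (\<beta> \<otimes> \<beta>)" unfolding u(2)[symmetric] 3 \<beta>_def using n(3) w(7) by (simp add: ring_norm)
    have r'eq: "r' = e \<otimes> e \<otimes> e \<otimes> (\<beta> \<otimes> \<beta>)" unfolding r'_def req e_def using cjm a(3) bM mc(4) bfix by simp
    have "(n \<otimes> n \<otimes> n) \<otimes> (\<beta> \<otimes> \<beta> \<otimes> \<beta> \<otimes> \<beta>) = r \<otimes> r'" unfolding req r'eq n_def using n b(2) by (simp add: ring_norm)
    then have one: "(n \<otimes> n \<otimes> n) \<otimes> (\<beta> \<otimes> \<beta> \<otimes> \<beta> \<otimes> \<beta>) = \<one>" using rr by simp
    \<comment> \<open>Now \<open>r = a3^3 \<beta>^2\<close> gives \<open>n^3 \<beta>^4 = 1\<close>,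
      that is, \<open>g^3 \<beta> = 1\<close>; the cube root of \<beta> is the inverse of
      \<open>g\<close>.\<close>
    define g where "g = \<beta> \<otimes> n"
    have g: "g \<in> F" "g \<in> carrier R" unfolding g_def using fc(4)[OF b(1) n(1)] fc(10) by auto
    have "(g \<otimes> g \<otimes> g) \<otimes> \<beta> = (n \<otimes> n \<otimes> n) \<otimes> (\<beta> \<otimes> \<beta> \<otimes> \<beta> \<otimes> \<beta>)" unfolding g_def using nR b(2) by (simp add: ring_norm)
    then have g3: "(g \<otimes> g \<otimes> g) \<otimes> \<beta> = \<one>" using one by simp
    then have g0: "g \<noteq> \<zero>" using b(2) by auto
    have "(\<one> \<oslash> g) \<otimes> (\<one> \<oslash> g) \<otimes> (\<one> \<oslash> g) = \<one> \<oslash> (g \<otimes> g \<otimes> g)"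
      using g(2) g0 by (simp add: field_norm)
    also have "\<dots> = ((g \<otimes> g \<otimes> g) \<otimes> \<beta>) \<oslash> (g \<otimes> g \<otimes> g)" unfolding g3 ..
    also have "\<dots> = \<beta>" using g(2) g0 b(2) by (simp add: field_norm)
    finally show ?thesis using nocube[of "\<one> \<oslash> g"] fc(7)[OF fc(2) g(1)] by blast
  qed
qed

end

section \<open>Cube roots in the algebraic closure\<close>

context algebraic_closure
begin

lemma exists_cube_root:
  assumes "r \<in> carrier L" obtains u where "u \<in> carrier L" "u \<otimes> u \<otimes> u = r"
proof -
  let ?p = "[\<one>, \<zero>, \<zero>, \<ominus> r]"
  have p: "?p \<in> carrier (poly_ring L)"
    using assms unfolding univ_poly_def polynomial_def by auto
  then have "size (roots ?p) = 3" using roots_over_carrier[OF p] unfolding splitted_def by simp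
  then obtain u where "u \<in># roots ?p" by (metis multiset_nonemptyE size_empty zero_neq_numeral)
  then have "is_root ?p u" using roots_mem_iff_is_root[OF p] by blast
  then have u: "u \<in> carrier L" "eval ?p u = \<zero>" unfolding is_root_def by auto
  then have "u \<otimes> u \<otimes> u \<oplus> \<ominus> r = \<zero>" using eval_monic_3[OF u(1), of "\<ominus> r" \<zero> \<zero>] assms by simp
  then have "u \<otimes> u \<otimes> u = r" using u(1) assms eq_neg_iff_add_eq_0[of "u \<otimes> u \<otimes> u" "\<ominus> r"] by simp
  then show thesis using that u(1) by blast
qed

end

context field
begin

text \<open>Finiteness of \<open>T\<close> makes the chosen places the support of a divisor. A
  member of \<open>T\<close> is used twice: the value of \<open>r\<close> there shows that
  \<open>r\<close> is not a cube, and ramification there makes the cubic extensions of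
  \<open>K\<close> and of \<open>K'\<close> geometric.\<close>

lemma splits_imp_cubic_extension:
  assumes ff: "function_field k K" and quad: "quadratic_extension R K c s p" and three: "\<guillemotleft>3\<guillemotright> \<noteq> \<zero>"
    and roots: "\<And>r. r \<in> carrier R \<Longrightarrow> \<exists>u\<in>carrier R. u \<otimes> u \<otimes> u = r"
    and genus: "has_genus k (qspan K c) 0"
    and T: "T \<subseteq> places k K" "finite T" "T \<noteq> {}" "\<And>P. P \<in> T \<Longrightarrow> splits k K (qspan K c) P"
  shows "\<exists>L. cubic_extension k K L \<and> purely_cubic_closure k K L (qspan K c) \<and>
    {P \<in> places k K. fully_ramified k K L P} = T"
proof -
  interpret KK: quadratic_extension R K c s p by fact
  define K' where "K' = qspan K c"
  have K': "subfield K' R" "K \<subseteq> K'" unfolding K'_def using KK.qspan_subfield KK.base_subset_qspan by auto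
  note kc = subfield_closed[OF KK.base] and k'c = subfield_closed[OF K'(1)]
  have k: "subfield k R" "k \<subseteq> K" using function_fieldE[OF ff] by blast+
  have d2: "dimension 2 K K'" unfolding K'_def by (rule KK.dimension_2_qspan)
  have ff': "function_field k K'"
    using function_field_finite_extension[OF ff _ finite_dimensionI[OF d2]] KK.base K' unfolding field_extension_def by blast
  have ff'q: "function_field k (qspan K c)" using ff' unfolding K'_def .
  have "\<forall>P\<in>T. \<exists>Q. Q \<in> places k K' \<and> P \<subseteq> Q"
  proof
    fix P assume "P \<in> T"
    then obtain Q where "Q \<in> places k K'" "P \<subseteq> Q" using extend_place[OF ff ff' K'(2)] T(1) by blast
    then show "\<exists>Q. Q \<in> places k K' \<and> P \<subseteq> Q" by blast
  qed
  then have "\<exists>Q. \<forall>P\<in>T. Q P \<in> places k K' \<and> P \<subseteq> Q P" by (rule bchoice)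
  then obtain Q where Q: "\<And>P. P \<in> T \<Longrightarrow> Q P \<in> places k K'" "\<And>P. P \<in> T \<Longrightarrow> P \<subseteq> Q P" by blast
  have QK: "Q P \<inter> K = P" if "P \<in> T" for P
    using place_inter[OF ff ff' K'(2) _ Q(1)[OF that] Q(2)[OF that]] T(1) that by blast
  have cQ: "KK.conjugate ` Q P \<in> places k K'" "P \<subseteq> KK.conjugate ` Q P" "KK.conjugate ` Q P \<noteq> Q P"
    "KK.conjugate ` Q P \<inter> K = P" if P: "P \<in> T" for P
  proof -
    have PK: "P \<in> places k K" using T(1) P by blast
    note q = Q[OF P, unfolded K'_def]
    show "KK.conjugate ` Q P \<in> places k K'" using KK.conjugate_place(1)[OF ff ff'q q(1)] unfolding K'_def .
    moreover show "P \<subseteq> KK.conjugate ` Q P" using KK.conjugate_place_above[OF ff ff'q PK q] .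
    ultimately show "KK.conjugate ` Q P \<inter> K = P" using place_inter[OF ff ff' K'(2) PK] by blast
    show "KK.conjugate ` Q P \<noteq> Q P" using T(4)[OF P] KK.splits_iff[OF ff ff'q PK q] by blast
  qed
  define S where "S = Q ` T"
  have S: "finite S" "S \<subseteq> places k (qspan K c)" unfolding S_def using T(2) Q(1) unfolding K'_def by auto
  \<comment> \<open>A place of \<open>K'\<close> determines the place of \<open>K\<close> below it,
    so an overlap would identify a chosen place with its own conjugate, against splitting.\<close>
  have disj: "S \<inter> (`) KK.conjugate ` S = {}"
  proof (rule ccontr)
    assume "\<not> ?thesis"
    then obtain P P' where PP: "P \<in> T" "P' \<in> T" "Q P = KK.conjugate ` Q P'" unfolding S_def by blast
    have "P = Q P \<inter> K" using QK[OF PP(1)] by (rule sym)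
    also have "\<dots> = P'" unfolding PP(3) by (rule cQ(4)[OF PP(2)])
    finally have "KK.conjugate ` Q P = Q P" using PP(3) by metis
    then show False using cQ(3)[OF PP(1)] by blast
  qed
  obtain f where f: "f \<in> qspan K c" "f \<noteq> \<zero>"
    "\<And>Q. Q \<in> S \<Longrightarrow> place_val K' Q f = - 1"
    "\<And>Q. Q \<in> S \<Longrightarrow> place_val K' (KK.conjugate ` Q) f = 1"
    "\<And>Q. Q \<in> places k K' \<Longrightarrow> Q \<notin> S \<Longrightarrow> KK.conjugate ` Q \<notin> S \<Longrightarrow> place_val K' Q f = 0"
    by (rule KK.genus_zero_divisor[OF ff ff'q genus S disj, folded K'_def])
      (rule that, simp_all add: K'_def)
  define f' where "f' = KK.conjugate f"
  have f': "f' \<in> K'" "f' \<noteq> \<zero>" "f' \<in> carrier R" "f \<in> K'" "f \<in> carrier R"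
    unfolding f'_def K'_def using f KK.conjugate_closed KK.conjugate_zero_iff KK.qspan_carrier by auto
  define r where "r = f \<oslash> f'"
  have r: "r \<in> K'" "r \<noteq> \<zero>" "r \<in> carrier R"
    unfolding r_def using k'c(7)[OF f'(4,1)] div_nonzero[OF f'(5,3) f(2) f'(2)] k'c(10) by auto
  have cr: "r \<otimes> KK.conjugate r = \<one>"
  proof -
    have "r = f \<otimes> inv f'" unfolding r_def using f' by (simp add: m_div_def)
    moreover have "inv f' \<in> qspan K c" using k'c(8)[OF f'(1,2)] unfolding K'_def .
    moreover have "KK.conjugate (inv f') = inv f"
      using KK.conjugate_inv[of f'] KK.conjugate_conjugate[OF f(1)] f' unfolding K'_def f'_def by simp
    ultimately have "KK.conjugate r = f' \<otimes> inv f" using KK.conjugate_mult[of f "inv f'"] f(1) unfolding f'_def by simp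
    then have "KK.conjugate r = f' \<oslash> f" using f(2) by (simp add: m_div_def)
    moreover have "(f \<oslash> f') \<otimes> (f' \<oslash> f) = \<one>" using f' f(2) by (simp add: field_norm)
    ultimately show ?thesis unfolding r_def by simp
  qed
  have vr: "place_val K' Q r = place_val K' Q f - place_val K' (KK.conjugate ` Q) f" if "Q \<in> places k K'" for Q
    unfolding r_def using dval_div[OF place_facts(1)[OF ff' that] f'(4,1) f(2) f'(2)]
      KK.conjugate_place(3)[OF ff ff'q _ f(1,2)] that unfolding f'_def K'_def by simp
  \<comment> \<open>The value of \<open>f\<close> is -1 at \<open>Q P\<close> and 1 at its
    conjugate, and \<open>r\<close> has the difference as its value.\<close>
  have vrT: "place_val K' (Q P) r = - 2" if "P \<in> T" for P
    using vr[OF Q(1)[OF that]] f(3,4)[of "Q P"] that unfolding S_def by simp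
  have vr0: "place_val K' Q1 r = 0" if Q1: "Q1 \<in> places k K'" "Q1 \<inter> K \<notin> T" for Q1
  proof -
    have "Q1 \<notin> S" using Q1(2) QK unfolding S_def by auto
    moreover have cc: "KK.conjugate ` KK.conjugate ` Q1 = Q1"
      using KK.conjugate_place_conjugate[OF ff ff'q] Q1(1) unfolding K'_def by blast
    have "KK.conjugate ` Q1 \<notin> S"
    proof
      assume "KK.conjugate ` Q1 \<in> S"
      then obtain P where P: "P \<in> T" "KK.conjugate ` Q1 = Q P" unfolding S_def by blast
      then have "Q1 \<inter> K = P" using cc cQ(4)[OF P(1)] by simp
      then show False using Q1(2) P(1) by simp
    qed
    moreover have "KK.conjugate ` Q1 \<in> places k K'" using KK.conjugate_place(1)[OF ff ff'q] Q1(1) unfolding K'_def by blast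
    ultimately show ?thesis using vr[OF Q1(1)] f(5)[of Q1] f(5)[of "KK.conjugate ` Q1"] Q1(1) cc by simp
  qed
  obtain u where u: "u \<in> carrier R" "u \<otimes> u \<otimes> u = r" using roots[OF r(3)] by blast
  obtain P0 where P0: "P0 \<in> T" using T(3) by blast
  \<comment> \<open>A cube has values divisible by 3, but \<open>r\<close> has value -2 at the place
    chosen above \<open>P0\<close>.\<close>
  have "d \<otimes> d \<otimes> d \<noteq> r" if d: "d \<in> K'" for d
  proof
    assume e: "d \<otimes> d \<otimes> d = r"
    then have "d \<noteq> \<zero>" using r(2) by auto
    then have "place_val K' (Q P0) r = 3 * place_val K' (Q P0) d"
      using dval_cube[OF place_facts(1)[OF ff' Q(1)[OF P0]] d] e by simp
    then show False using vrT[OF P0] by presburger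
  qed
  then have ui: "indep3 (qspan K c) u" using not_cube_indep3[OF K'(1) u r(1)] unfolding K'_def by blast
  define L where "L = generate_field R (insert (u \<oplus> inv u) K)"
  define L' where "L' = generate_field R (insert u K')"
  note gen = cube_root_trace_generates[OF quad three r(1)[unfolded K'_def] cr u ui, folded K'_def, folded L_def L'_def]
  have insK: "insert (u \<oplus> inv u) K \<subseteq> carrier R" using gen(1) kc(10) by blast
  have L: "subfield L R" "K \<subseteq> L" "dimension 3 K L" "field_extension K L"
    using generate_field_is_subfield[OF insK] gen(3) KK.base
    unfolding L_def field_extension_def by (auto intro: generate_field.incl)
  have cL: "c \<notin> L" using KK.generator_notin_cubic[OF L(1-3)] .
  interpret LL: quadratic_extension R L c s p using quadratic_extension_over[OF quad L(1,2) cL] .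
  have L'q: "L' = qspan L c"
    using gen(5) composite_qspan[OF quad LL.quadratic_extension_axioms L(2)] unfolding K'_def by simp
  have L': "subfield L' R" "L \<subseteq> L'" "K' \<subseteq> L'" "dimension 2 L L'"
    using LL.qspan_subfield LL.base_subset_qspan qspan_mono[OF L(2)] LL.dimension_2_qspan
    unfolding L'q K'_def by auto
  note l'c = subfield_closed[OF L'(1)]
  have uL': "u \<in> L'" "u \<notin> K'" "u \<noteq> \<zero>"
    using indep3_nonzero[OF KK.qspan_subfield ui u(1)] unfolding L'_def K'_def by (auto intro: generate_field.incl)
  have ffL: "function_field k L" using function_field_finite_extension[OF ff L(4) finite_dimensionI[OF L(3)]] .
  have ffL': "function_field k L'"
    using function_field_finite_extension[OF ffL _ finite_dimensionI[OF L'(4)]] L(1) L'(1,2) unfolding field_extension_def by blast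
  note diamond = ramification_diamond[OF ff ffL ff' ffL' L(2) K'(2) L'(2,3) d2 L'(4) L(3) gen(4)]
  have vu: "place_val L' W r = 3 * place_val L' W u" if "W \<in> places k L'" for W
    using dval_cube[OF place_facts(1)[OF ffL' that] uL'(1,3)] u(2) by simp
  \<comment> \<open>A single place \<open>W\<close> of the compositum records ramification index 3
    both in \<open>L/K\<close> and in \<open>L'/K'\<close>; the two statements about values are what
    \<open>cubic_extension_of_ramified\<close> asks for.\<close>
  have ram: "\<exists>W. W \<in> places k L' \<and> W \<inter> L \<in> places k L \<and> P \<subseteq> W \<inter> L \<and> ramification_index K L P (W \<inter> L) = 3 \<and>
      (\<forall>x\<in>K - {\<zero>}. place_val L (W \<inter> L) x = 3 * place_val K P x) \<and>
      (\<forall>x\<in>K' - {\<zero>}. place_val L' W x = 3 * place_val K' (W \<inter> K') x)" if P: "P \<in> T" for P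
  proof -
    have PK: "P \<in> places k K" using P T(1) by blast
    obtain W where W: "W \<in> places k L'" "Q P \<subseteq> W" using extend_place[OF ff' ffL' L'(3) Q(1)[OF P]] .
    have PW: "P \<subseteq> W" using Q(2)[OF P] W(2) by blast
    have WK: "W \<inter> K' = Q P" using place_inter[OF ff' ffL' L'(3) Q(1)[OF P] W] .
    obtain f f' where d: "W \<inter> L \<in> places k L" "P \<subseteq> W \<inter> L"
      "\<And>x. x \<in> K \<Longrightarrow> x \<noteq> \<zero> \<Longrightarrow> place_val L (W \<inter> L) x = int f * place_val K P x"
      "ramification_index K L P (W \<inter> L) = f"
      "\<And>x. x \<in> K' \<Longrightarrow> x \<noteq> \<zero> \<Longrightarrow> place_val L' W x = int f' * place_val K' (W \<inter> K') x"
      "f = 3 \<longleftrightarrow> f' = 3" "f' = 3 \<longleftrightarrow> 3 dvd f'"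
      using diamond[OF PK W(1) PW] by metis
    \<comment> \<open>This is \<open>u^3 = r\<close> evaluated at \<open>W\<close>; as 2 is prime to
      3, the index over \<open>K'\<close> must be divisible by 3.\<close>
    have "3 * place_val L' W u = int f' * (- 2)"
      using vu[OF W(1)] d(5)[OF r(1,2)] vrT[OF P] unfolding WK by simp
    then have "3 dvd f'" by presburger
    then have "f = 3" "f' = 3" using d(6,7) by auto
    then have r3: "ramification_index K L P (W \<inter> L) = 3" using d(4) by simp
    have "\<forall>x\<in>K - {\<zero>}. place_val L (W \<inter> L) x = 3 * place_val K P x"
      using d(3) \<open>f = 3\<close> by simp
    moreover have "\<forall>x\<in>K' - {\<zero>}. place_val L' W x = 3 * place_val K' (W \<inter> K') x"
      using d(5) \<open>f' = 3\<close> by simp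
    ultimately show ?thesis using W(1) d(1,2) r3 by blast
  qed
  have cubic: "cubic_extension k K L" and purely: "purely_cubic (constant_field k K') K' L'"
  proof -
    obtain W where W: "W \<in> places k L'" "W \<inter> L \<in> places k L"
      "\<forall>x\<in>K - {\<zero>}. place_val L (W \<inter> L) x = 3 * place_val K P0 x"
      "\<forall>x\<in>K' - {\<zero>}. place_val L' W x = 3 * place_val K' (W \<inter> K') x"
      using ram[OF P0] by blast
    note pl = place_facts[OF ffL W(2)] and pw = place_facts[OF ffL' W(1)]
    show "cubic_extension k K L"
      using cubic_extension_of_ramified[OF L(4,3) three pl(1) _ k(2) pl(3)] W(3) by simp
    have "constant_field k K' \<subseteq> K'" unfolding constant_field_def by blast
    moreover have "constant_field k K' \<subseteq> place_ring L' W"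
      using constant_field_in_vring[OF dval_vring[OF pw(1)] k(1) pw(3)] L'(3) unfolding constant_field_def by blast
    moreover have "field_extension K' L'" unfolding field_extension_def using K'(1) L' by blast
    ultimately have "cubic_extension (constant_field k K') K' L'"
      using cubic_extension_of_ramified[OF _ gen(4) three pw(1)] W(4) by simp
    then show "purely_cubic (constant_field k K') K' L'" using purely_cubicI uL' u(2) r(1) by blast
  qed
  have "makes_purely_cubic k K L K'"
    unfolding makes_purely_cubic_def gen(5) field_extension_def using purely KK.base K' by blast
  moreover have "K' \<subseteq> F" if "makes_purely_cubic k K L F" for F
    using cube_root_trace_closure_minimal[OF quad three r(1)[unfolded K'_def] cr u ui L_def that] unfolding K'_def .
  ultimately have closure: "purely_cubic_closure k K L (qspan K c)"
    unfolding purely_cubic_closure_def K'_def by blast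
  have "fully_ramified k K L P" if "P \<in> T" for P
    using ram[OF that] fully_ramified_iff[OF L(3) KK.base] by blast
  moreover have "P \<in> T" if P: "P \<in> places k K" "fully_ramified k K L P" for P
  proof (rule ccontr)
    assume nT: "P \<notin> T"
    obtain QL where QL: "QL \<in> places k L" "P \<subseteq> QL" "ramification_index K L P QL = 3"
      using P(2) fully_ramified_iff[OF L(3) KK.base] by blast
    obtain W where W: "W \<in> places k L'" "QL \<subseteq> W" using extend_place[OF ffL ffL' L'(2) QL(1)] .
    have PW: "P \<subseteq> W" using QL(2) W(2) by blast
    have WL: "W \<inter> L = QL" using place_inter[OF ffL ffL' L'(2) QL(1) W] .
    obtain f f' where d: "W \<inter> K' \<in> places k K'" "P \<subseteq> W \<inter> K'"
      "ramification_index K L P (W \<inter> L) = f"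
      "\<And>x. x \<in> K' \<Longrightarrow> x \<noteq> \<zero> \<Longrightarrow> place_val L' W x = int f' * place_val K' (W \<inter> K') x"
      "f = 3 \<longleftrightarrow> f' = 3"
      using diamond[OF P(1) W(1) PW] by metis
    have f3: "f' = 3" using d(3,5) WL QL(3) by simp
    have "(W \<inter> K') \<inter> K = P" using place_inter[OF ff ff' K'(2) P(1) d(1,2)] .
    \<comment> \<open>Outside \<open>T\<close> the value of \<open>r\<close> is zero, so
      \<open>u\<close> is a unit at \<open>W\<close>. With index 3 over \<open>K'\<close> this
      contradicts \<open>unit_cube_root_unramified\<close>.\<close>
    then have "place_val K' (W \<inter> K') r = 0" using vr0[OF d(1)] nT by simp
    then have wu: "place_val L' W u = 0" using vu[OF W(1)] d(4)[OF r(1,2)] by simp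
    have u3: "u \<otimes> u \<otimes> u \<in> K'" using u(2) r(1) by simp
    show False
      by (rule unit_cube_root_unramified[OF place_facts(1)[OF ffL' W(1)] K'(1) L'(3) gen(4) _ uL'(1,2) wu u3 three
            place_val_three[OF ffL' W(1) three]]) (simp add: d(4) f3)
  qed
  ultimately have "{P \<in> places k K. fully_ramified k K L P} = T" using T(1) by blast
  then show ?thesis using cubic closure by blast
qed

end

text \<open>The ambient algebraic closure provides the cube root of \<open>r\<close>, and its
  subfields are the fields among which the purely cubic closure is minimal.\<close>

theorem theorem4p1:
  fixes \<Omega> :: "('a, 'b) ring_scheme" (structure)
    and k K K' :: "'a set" and T :: "'a set set"
  assumes "algebraic_closure \<Omega> K"
    and "perfect_field (\<Omega>\<lparr>carrier := k\<rparr>)"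
    and "characteristic (\<Omega>\<lparr>carrier := k\<rparr>) \<noteq> 3"
    and "ring.function_field \<Omega> k K"
    and "ring.field_extension \<Omega> K K'" and "ring.dimension \<Omega> 2 K K'"
    and "ring.has_genus \<Omega> k K' 0"
    and "T \<subseteq> ring.places \<Omega> k K" and "finite T" and "T \<noteq> {}"
  shows "(\<exists>L. ring.cubic_extension \<Omega> k K L \<and>
              ring.purely_cubic_closure \<Omega> k K L K' \<and>
              {P \<in> ring.places \<Omega> k K. ring.fully_ramified \<Omega> k K L P} = T) \<longleftrightarrow>
         (\<forall>P \<in> T. ring.splits \<Omega> k K K' P)"
proof -
  interpret algebraic_closure \<Omega> K by fact
  have k: "subfield k \<Omega>" using function_fieldE[OF assms(4)] by blast
  have three: "\<guillemotleft>3\<guillemotright> \<noteq> \<zero>" using three_nonzero_of_characteristic[OF k assms(3)] .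
  have sub: "subfield K \<Omega>" "subfield K' \<Omega>" "K \<subseteq> K'" using assms(5) unfolding field_extension_def by auto
  obtain c s p where q: "quadratic_extension \<Omega> K c s p" "K' = qspan K c"
    using dimension_2_quadratic_extension[OF sub assms(6)] .
  have roots: "\<exists>u\<in>carrier \<Omega>. u \<otimes> u \<otimes> u = r" if "r \<in> carrier \<Omega>" for r
    using exists_cube_root[OF that] by blast
  show ?thesis
  proof
    assume "\<exists>L. cubic_extension k K L \<and> purely_cubic_closure k K L K' \<and>
      {P \<in> places k K. fully_ramified k K L P} = T"
    then obtain L where "cubic_extension k K L" "purely_cubic_closure k K L K'"
      "{P \<in> places k K. fully_ramified k K L P} = T" by blast
    then show "\<forall>P\<in>T. splits k K K' P"
      using fully_ramified_imp_splits[OF assms(4) q(1) three] unfolding q(2) by blast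
  next
    assume "\<forall>P\<in>T. splits k K K' P"
    then show "\<exists>L. cubic_extension k K L \<and> purely_cubic_closure k K L K' \<and>
      {P \<in> places k K. fully_ramified k K L P} = T"
      using splits_imp_cubic_extension[OF assms(4) q(1) three roots assms(7)[unfolded q(2)] assms(8-10)]
      unfolding q(2) by blast
  qed
qed

end
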